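(* Let $(A,\mathfrak{m})$ be a Cohen-Macaulay local ring of dimension $d \geq 1$ with infinite residue field. Let $M$ be a maximal Cohen-Macaulay $A$-module. Let $I$ be an ideal of $A$ which is locally a complete intersection, with $r(I) \leq 1$, $\operatorname{ht}(I) = \operatorname{ht}_M(I) = d-1$ and $l(I) = d$. If $\deg t_I^A(M,z) < d-1$, then $F_I(M)$ is a free $F(I)$-module.
   Context: Rings are commutative Noetherian; maximal Cohen-Macaulay modules are finitely generated. $F(I)=\bigoplus_{n\ge 0} I^n/\mathfrak{m}I^n$ is the fiber cone of $I$, $F_I(M)=\bigoplus_{n\ge 0} I^nM/\mathfrak{m}I^nM$ is the fiber module of $M$ with respect to $I$ (a graded $F(I)$-module), and $l(I)=\dim F(I)$ is the analytic spread of $I$. $\operatorname{ht}_M(I)$ is the height of the image of $I$ in $A/\operatorname{ann}_A(M)$. "$I$ is locally a complete intersection" means that for every minimal prime $P$ of $I$ the ideal $I_P$ of $A_P$ is generated by an $A_P$-regular sequence (of length $\operatorname{ht} P$; in particular $I_P=0$ if $\operatorname{ht}P=0$). An ideal $J\subseteq I$ is a reduction of $I$ if $JI^n=I^{n+1}$ for all $n\gg 0$; it is a minimal reduction if it is minimal with respect to inclusion among reductions of $I$. For a reduction $J$, $r_J(I)$ is the least $m\ge 0$ such that $JI^n=I^{n+1}$ for all $n\ge m$, and $r(I)=\min\{r_J(I) : J \text{ a minimal reduction of } I\}$. Let $\ell$ denote length. Under the stated hypotheses $\ell(\operatorname{Tor}_1^A(M,A/I^{n+1}))<\infty$ for $n\gg0$,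 and (Kodiyalam) there is a polynomial $t_I^A(M,z)\in\mathbb{Q}[z]$ of degree at most $l(I)-1$ with $t_I^A(M,n)=\ell(\operatorname{Tor}_1^A(M,A/I^{n+1}))$ for all $n\gg 0$. The degree of the zero polynomial is $-\infty$. *)

theory Defs
  imports
    "HOL-Computational_Algebra.Polynomial"
    "HOL-Library.Extended_Nat"
    "HOL-Algebra.Module"
    "HOL-Algebra.Ideal_Product"
    "HOL-Algebra.QuotRing"
    "HOL-Algebra.Ring_Divisibility"
begin

section \<open>Modules\<close>

text \<open>The record type of modules extends that of rings; the multiplication and the unit of
  a module play no role and are left undefined.\<close>

definition ring_as_module :: "('a, 'r) ring_scheme \<Rightarrow> ('a, 'a) module"
  where "ring_as_module R =
    \<lparr>carrier = carrier R, monoid.mult = monoid.mult R, one = \<one>\<^bsub>R\<^esub>, ring.zero = \<zero>\<^bsub>R\<^esub>,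
     add = ring.add R, smult = monoid.mult R\<rparr>"

definition module_span :: "('a, 'r) ring_scheme \<Rightarrow> ('a, 'b, 's) module_scheme \<Rightarrow> 'b set \<Rightarrow> 'b set"
  where "module_span R M S = \<Inter>{H. submodule H R M \<and> S \<subseteq> H}"

definition finitely_generated_module :: "('a, 'r) ring_scheme \<Rightarrow> ('a, 'b, 's) module_scheme \<Rightarrow> bool"
  where "finitely_generated_module R M \<longleftrightarrow>
    module R M \<and> (\<exists>S. finite S \<and> S \<subseteq> carrier M \<and> module_span R M S = carrier M)"

text \<open>The submodule \<open>J N\<close> of \<open>M\<close>, for an ideal \<open>J\<close> and a submodule \<open>N\<close> of \<open>M\<close>.\<close>

definition ideal_smult ::
    "('a, 'r) ring_scheme \<Rightarrow> ('a, 'b, 's) module_scheme \<Rightarrow> 'a set \<Rightarrow> 'b set \<Rightarrow> 'b set"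
  where "ideal_smult R M J N = module_span R M {a \<odot>\<^bsub>M\<^esub> x | a x. a \<in> J \<and> x \<in> N}"

definition coset_smult :: "('a, 'b, 's) module_scheme \<Rightarrow> 'b set \<Rightarrow> 'a \<Rightarrow> 'b set \<Rightarrow> 'b set"
  where "coset_smult M N a X = (\<Union>x\<in>X. N +>\<^bsub>M\<^esub> (a \<odot>\<^bsub>M\<^esub> x))"

definition quot_module :: "('a, 'b, 's) module_scheme \<Rightarrow> 'b set \<Rightarrow> ('a, 'b set) module"
  where "quot_module M N =
    \<lparr>carrier = a_rcosets\<^bsub>M\<^esub> N, monoid.mult = undefined, one = undefined, ring.zero = N,
     add = set_add M, smult = coset_smult M N\<rparr>"

definition annihilator :: "('a, 'r) ring_scheme \<Rightarrow> ('a, 'b, 's) module_scheme \<Rightarrow> 'a set"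
  where "annihilator R M = {a \<in> carrier R. \<forall>x\<in>carrier M. a \<odot>\<^bsub>M\<^esub> x = \<zero>\<^bsub>M\<^esub>}"

definition module_length :: "('a, 'r) ring_scheme \<Rightarrow> ('a, 'b, 's) module_scheme \<Rightarrow> enat"
  where "module_length R M = Sup {enat n | n.
    \<exists>C :: nat \<Rightarrow> 'b set. (\<forall>i\<le>n. submodule (C i) R M) \<and> (\<forall>i<n. C i \<subset> C (Suc i))}"

text \<open>The free module on a set \<open>X\<close>: finitely supported functions on \<open>X\<close>, extended by zero.\<close>

definition free_on :: "('a, 'r) ring_scheme \<Rightarrow> 'x set \<Rightarrow> ('a, 'x \<Rightarrow> 'a) module"
  where "free_on R X =
    \<lparr>carrier = {f. (\<forall>x\<in>X. f x \<in> carrier R) \<and> (\<forall>x. x \<notin> X \<longrightarrow> f x = \<zero>\<^bsub>R\<^esub>) \<and> finite {x. f x \<noteq> \<zero>\<^bsub>R\<^esub>}},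
     monoid.mult = undefined, one = undefined, ring.zero = (\<lambda>x. \<zero>\<^bsub>R\<^esub>),
     add = (\<lambda>f g x. f x \<oplus>\<^bsub>R\<^esub> g x), smult = (\<lambda>a f x. a \<otimes>\<^bsub>R\<^esub> f x)\<rparr>"

definition free_gen :: "('a, 'r) ring_scheme \<Rightarrow> 'x \<Rightarrow> 'x \<Rightarrow> 'a"
  where "free_gen R x = (\<lambda>y. if y = x then \<one>\<^bsub>R\<^esub> else \<zero>\<^bsub>R\<^esub>)"

definition lincomb :: "('a, 'r) ring_scheme \<Rightarrow> ('a, 'b, 's) module_scheme \<Rightarrow> ('b \<Rightarrow> 'a) \<Rightarrow> 'b"
  where "lincomb R M f = (\<Oplus>\<^bsub>M\<^esub>x\<in>{x. f x \<noteq> \<zero>\<^bsub>R\<^esub>}. f x \<odot>\<^bsub>M\<^esub> x)"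

definition free_module :: "('a, 'r) ring_scheme \<Rightarrow> ('a, 'b, 's) module_scheme \<Rightarrow> bool"
  where "free_module R M \<longleftrightarrow> module R M \<and>
    (\<exists>B \<subseteq> carrier M. bij_betw (lincomb R M) (carrier (free_on R B)) (carrier M))"


section \<open>Tensor products and Tor\<close>

definition tensor_relations ::
    "('a, 'r) ring_scheme \<Rightarrow> ('a, 'b, 's) module_scheme \<Rightarrow> ('a, 'c, 't) module_scheme
      \<Rightarrow> ('b \<times> 'c \<Rightarrow> 'a) set"
  where "tensor_relations R M N =
    (let F = free_on R (carrier M \<times> carrier N); e = (\<lambda>x y. free_gen R (x, y)) in
      {e (x \<oplus>\<^bsub>M\<^esub> x') y \<ominus>\<^bsub>F\<^esub> (e x y \<oplus>\<^bsub>F\<^esub> e x' y) | x x' y.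
         x \<in> carrier M \<and> x' \<in> carrier M \<and> y \<in> carrier N} \<union>
      {e x (y \<oplus>\<^bsub>N\<^esub> y') \<ominus>\<^bsub>F\<^esub> (e x y \<oplus>\<^bsub>F\<^esub> e x y') | x y y'.
         x \<in> carrier M \<and> y \<in> carrier N \<and> y' \<in> carrier N} \<union>
      {e (a \<odot>\<^bsub>M\<^esub> x) y \<ominus>\<^bsub>F\<^esub> (a \<odot>\<^bsub>F\<^esub> e x y) | a x y.
         a \<in> carrier R \<and> x \<in> carrier M \<and> y \<in> carrier N} \<union>
      {e x (a \<odot>\<^bsub>N\<^esub> y) \<ominus>\<^bsub>F\<^esub> (a \<odot>\<^bsub>F\<^esub> e x y) | a x y.
         a \<in> carrier R \<and> x \<in> carrier M \<and> y \<in> carrier N})"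

definition tensor_kernel ::
    "('a, 'r) ring_scheme \<Rightarrow> ('a, 'b, 's) module_scheme \<Rightarrow> ('a, 'c, 't) module_scheme
      \<Rightarrow> ('b \<times> 'c \<Rightarrow> 'a) set"
  where "tensor_kernel R M N =
    module_span R (free_on R (carrier M \<times> carrier N)) (tensor_relations R M N)"

definition tensor ::
    "('a, 'r) ring_scheme \<Rightarrow> ('a, 'b, 's) module_scheme \<Rightarrow> ('a, 'c, 't) module_scheme
      \<Rightarrow> ('a, ('b \<times> 'c \<Rightarrow> 'a) set) module"
  where "tensor R M N = quot_module (free_on R (carrier M \<times> carrier N)) (tensor_kernel R M N)"

definition pure_tensor ::
    "('a, 'r) ring_scheme \<Rightarrow> ('a, 'b, 's) module_scheme \<Rightarrow> ('a, 'c, 't) module_scheme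
      \<Rightarrow> 'b \<Rightarrow> 'c \<Rightarrow> ('b \<times> 'c \<Rightarrow> 'a) set"
  where "pure_tensor R M N x y =
    tensor_kernel R M N +>\<^bsub>free_on R (carrier M \<times> carrier N)\<^esub> free_gen R (x, y)"

text \<open>The map from \<open>tensor R M N\<close> to \<open>tensor R M' N\<close> induced by \<open>h\<close> from \<open>M\<close> to \<open>M'\<close>. All
  representatives \<open>f\<close> of the class \<open>Z\<close> yield the same class, so that the union is that class.\<close>

definition tensor_map ::
    "('a, 'r) ring_scheme \<Rightarrow> ('a, 'b, 's) module_scheme \<Rightarrow> ('a, 'c, 't) module_scheme
      \<Rightarrow> ('d \<Rightarrow> 'b) \<Rightarrow> ('d \<times> 'c \<Rightarrow> 'a) set \<Rightarrow> ('b \<times> 'c \<Rightarrow> 'a) set"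
  where "tensor_map R M' N h Z =
    (\<Union>f\<in>Z. \<Oplus>\<^bsub>tensor R M' N\<^esub>p\<in>{p. f p \<noteq> \<zero>\<^bsub>R\<^esub>}.
      f p \<odot>\<^bsub>tensor R M' N\<^esub> pure_tensor R M' N (h (fst p)) (snd p))"

text \<open>\<open>Tor\<^sub>1(M, N)\<close>, computed from the start \<open>F\<^sub>2 \<rightarrow> F\<^sub>1 \<rightarrow> F\<^sub>0 \<rightarrow> M \<rightarrow> 0\<close> of the standard
  free resolution of \<open>M\<close>: \<open>F\<^sub>0\<close> is free on the elements of \<open>M\<close>, and each further \<open>F\<^sub>i\<close> is free on
  the elements of the kernel of the preceding map. All the maps are \<open>lincomb\<close>.\<close>

definition Tor1 ::
    "('a, 'r) ring_scheme \<Rightarrow> ('a, 'b, 's) module_scheme \<Rightarrow> ('a, 'c, 't) module_scheme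
      \<Rightarrow> ('a, ((('b \<Rightarrow> 'a) \<Rightarrow> 'a) \<times> 'c \<Rightarrow> 'a) set set) module"
  where "Tor1 R M N =
    (let F0 = free_on R (carrier M);
         F1 = free_on R {f \<in> carrier F0. lincomb R M f = \<zero>\<^bsub>M\<^esub>};
         F2 = free_on R {f \<in> carrier F1. lincomb R F0 f = \<zero>\<^bsub>F0\<^esub>};
         Z = {z \<in> carrier (tensor R F1 N).
                tensor_map R F0 N (lincomb R F0) z = \<zero>\<^bsub>tensor R F0 N\<^esub>};
         B = tensor_map R F1 N (lincomb R F1) ` carrier (tensor R F2 N)
     in quot_module ((tensor R F1 N)\<lparr>carrier := Z\<rparr>) B)"


section \<open>Dimension, height and depth\<close>

definition noetherian_local_ring :: "('a, 'r) ring_scheme \<Rightarrow> 'a set \<Rightarrow> bool"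
  where "noetherian_local_ring R \<mm> \<longleftrightarrow>
    cring R \<and> noetherian_ring R \<and> maximalideal \<mm> R \<and> (\<forall>\<nn>. maximalideal \<nn> R \<longrightarrow> \<nn> = \<mm>)"

definition prime_chain :: "('a, 'r) ring_scheme \<Rightarrow> nat \<Rightarrow> (nat \<Rightarrow> 'a set) \<Rightarrow> bool"
  where "prime_chain R n C \<longleftrightarrow> (\<forall>i\<le>n. primeideal (C i) R) \<and> (\<forall>i<n. C i \<subset> C (Suc i))"

definition krull_dim :: "('a, 'r) ring_scheme \<Rightarrow> enat"
  where "krull_dim R = Sup {enat n | n. \<exists>C. prime_chain R n C}"

definition prime_height :: "('a, 'r) ring_scheme \<Rightarrow> 'a set \<Rightarrow> enat"
  where "prime_height R P = Sup {enat n | n. \<exists>C. prime_chain R n C \<and> C n = P}"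

text \<open>The unit ideal has height \<open>\<infinity>\<close>.\<close>

definition ideal_height :: "('a, 'r) ring_scheme \<Rightarrow> 'a set \<Rightarrow> enat"
  where "ideal_height R I = Inf {prime_height R P | P. primeideal P R \<and> I \<subseteq> P}"

definition ideal_height_on ::
    "('a, 'r) ring_scheme \<Rightarrow> ('a, 'b, 's) module_scheme \<Rightarrow> 'a set \<Rightarrow> enat"
  where "ideal_height_on R M I =
    ideal_height (R Quot annihilator R M) ((\<lambda>x. annihilator R M +>\<^bsub>R\<^esub> x) ` I)"

definition module_dim :: "('a, 'r) ring_scheme \<Rightarrow> ('a, 'b, 's) module_scheme \<Rightarrow> enat"
  where "module_dim R M = krull_dim (R Quot annihilator R M)"

definition regular_element :: "('a, 'b, 's) module_scheme \<Rightarrow> 'a \<Rightarrow> bool"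
  where "regular_element M a \<longleftrightarrow> (\<forall>x\<in>carrier M. a \<odot>\<^bsub>M\<^esub> x = \<zero>\<^bsub>M\<^esub> \<longrightarrow> x = \<zero>\<^bsub>M\<^esub>)"

definition regular_sequence ::
    "('a, 'r) ring_scheme \<Rightarrow> ('a, 'b, 's) module_scheme \<Rightarrow> 'a list \<Rightarrow> bool"
  where "regular_sequence R M xs \<longleftrightarrow>
    set xs \<subseteq> carrier R \<and>
    (\<forall>i<length xs. regular_element
       (quot_module M (ideal_smult R M (Idl\<^bsub>R\<^esub> (set (take i xs))) (carrier M))) (xs ! i)) \<and>
    ideal_smult R M (Idl\<^bsub>R\<^esub> (set xs)) (carrier M) \<noteq> carrier M"

definition depth ::
    "('a, 'r) ring_scheme \<Rightarrow> 'a set \<Rightarrow> ('a, 'b, 's) module_scheme \<Rightarrow> enat"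
  where "depth R \<mm> M = Sup {enat (length xs) | xs. set xs \<subseteq> \<mm> \<and> regular_sequence R M xs}"

definition cohen_macaulay_module ::
    "('a, 'r) ring_scheme \<Rightarrow> 'a set \<Rightarrow> ('a, 'b, 's) module_scheme \<Rightarrow> bool"
  where "cohen_macaulay_module R \<mm> M \<longleftrightarrow>
    finitely_generated_module R M \<and> carrier M \<noteq> {\<zero>\<^bsub>M\<^esub>} \<and> depth R \<mm> M = module_dim R M"

definition maximal_cohen_macaulay_module ::
    "('a, 'r) ring_scheme \<Rightarrow> 'a set \<Rightarrow> ('a, 'b, 's) module_scheme \<Rightarrow> bool"
  where "maximal_cohen_macaulay_module R \<mm> M \<longleftrightarrow>
    cohen_macaulay_module R \<mm> M \<and> module_dim R M = krull_dim R"

definition cohen_macaulay_local_ring :: "('a, 'r) ring_scheme \<Rightarrow> 'a set \<Rightarrow> bool"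
  where "cohen_macaulay_local_ring R \<mm> \<longleftrightarrow>
    noetherian_local_ring R \<mm> \<and> cohen_macaulay_module R \<mm> (ring_as_module R)"


section \<open>Localization and local complete intersections\<close>

definition fraction :: "('a, 'r) ring_scheme \<Rightarrow> 'a set \<Rightarrow> 'a \<Rightarrow> 'a \<Rightarrow> ('a \<times> 'a) set"
  where "fraction R S a s = {(b, t). b \<in> carrier R \<and> t \<in> S \<and>
    (\<exists>u\<in>S. u \<otimes>\<^bsub>R\<^esub> (t \<otimes>\<^bsub>R\<^esub> a) = u \<otimes>\<^bsub>R\<^esub> (s \<otimes>\<^bsub>R\<^esub> b))}"

definition localization :: "('a, 'r) ring_scheme \<Rightarrow> 'a set \<Rightarrow> ('a \<times> 'a) set ring"
  where "localization R S =
    \<lparr>carrier = {fraction R S a s | a s. a \<in> carrier R \<and> s \<in> S},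
     monoid.mult = (\<lambda>X Y. \<Union>(a, s)\<in>X. \<Union>(b, t)\<in>Y. fraction R S (a \<otimes>\<^bsub>R\<^esub> b) (s \<otimes>\<^bsub>R\<^esub> t)),
     one = fraction R S \<one>\<^bsub>R\<^esub> \<one>\<^bsub>R\<^esub>,
     ring.zero = fraction R S \<zero>\<^bsub>R\<^esub> \<one>\<^bsub>R\<^esub>,
     add = (\<lambda>X Y. \<Union>(a, s)\<in>X. \<Union>(b, t)\<in>Y.
              fraction R S ((a \<otimes>\<^bsub>R\<^esub> t) \<oplus>\<^bsub>R\<^esub> (b \<otimes>\<^bsub>R\<^esub> s)) (s \<otimes>\<^bsub>R\<^esub> t))\<rparr>"

definition localized_ideal :: "('a, 'r) ring_scheme \<Rightarrow> 'a set \<Rightarrow> 'a set \<Rightarrow> ('a \<times> 'a) set set"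
  where "localized_ideal R S I = {fraction R S a s | a s. a \<in> I \<and> s \<in> S}"

definition minimal_prime_over :: "('a, 'r) ring_scheme \<Rightarrow> 'a set \<Rightarrow> 'a set \<Rightarrow> bool"
  where "minimal_prime_over R I P \<longleftrightarrow> primeideal P R \<and> I \<subseteq> P \<and>
    (\<forall>Q. primeideal Q R \<and> I \<subseteq> Q \<and> Q \<subseteq> P \<longrightarrow> Q = P)"

definition locally_complete_intersection :: "('a, 'r) ring_scheme \<Rightarrow> 'a set \<Rightarrow> bool"
  where "locally_complete_intersection R I \<longleftrightarrow>
    (\<forall>P. minimal_prime_over R I P \<longrightarrow>
      (let S = carrier R - P; RP = localization R S in
        \<exists>xs. regular_sequence RP (ring_as_module RP) xs \<and>
             enat (length xs) = prime_height R P \<and>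
             localized_ideal R S I = Idl\<^bsub>RP\<^esub> (set xs)))"


section \<open>Reductions\<close>

abbreviation ideal_pow :: "('a, 'r) ring_scheme \<Rightarrow> 'a set \<Rightarrow> nat \<Rightarrow> 'a set"
  where "ideal_pow R I n \<equiv> I [^]\<^bsub>ideals_set R\<^esub> n"

definition reduction :: "('a, 'r) ring_scheme \<Rightarrow> 'a set \<Rightarrow> 'a set \<Rightarrow> bool"
  where "reduction R I J \<longleftrightarrow> ideal J R \<and> J \<subseteq> I \<and>
    (\<exists>m. \<forall>n\<ge>m. J \<cdot>\<^bsub>R\<^esub> ideal_pow R I n = ideal_pow R I (n + 1))"

definition minimal_reduction :: "('a, 'r) ring_scheme \<Rightarrow> 'a set \<Rightarrow> 'a set \<Rightarrow> bool"
  where "minimal_reduction R I J \<longleftrightarrow> reduction R I J \<and>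
    (\<forall>K. reduction R I K \<and> K \<subseteq> J \<longrightarrow> K = J)"

definition reduction_number_wrt :: "('a, 'r) ring_scheme \<Rightarrow> 'a set \<Rightarrow> 'a set \<Rightarrow> nat"
  where "reduction_number_wrt R I J =
    (LEAST m. \<forall>n\<ge>m. J \<cdot>\<^bsub>R\<^esub> ideal_pow R I n = ideal_pow R I (n + 1))"

definition reduction_number :: "('a, 'r) ring_scheme \<Rightarrow> 'a set \<Rightarrow> enat"
  where "reduction_number R I =
    Inf {enat (reduction_number_wrt R I J) | J. minimal_reduction R I J}"


section \<open>Fiber cone and fiber module\<close>

text \<open>An element of the fiber cone is the sequence of its homogeneous components, the component of
  degree \<open>n\<close> being a coset of \<open>\<mm>I\<^sup>n\<close> in \<open>I\<^sup>n\<close>. Since \<open>I\<^sup>n/\<mm>I\<^sup>n\<close> is contained in the ring \<open>R/\<mm>I\<^sup>n\<close>, sums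
  in degree \<open>n\<close> are taken there; \<open>rcoset_mult\<close> sends the cosets of \<open>x \<in> I\<^sup>i\<close> and \<open>y \<in> I\<^sup>n\<^sup>-\<^sup>i\<close> to the
  coset of \<open>xy\<close>.\<close>

definition fiber_cone :: "('a, 'r) ring_scheme \<Rightarrow> 'a set \<Rightarrow> 'a set \<Rightarrow> (nat \<Rightarrow> 'a set) ring"
  where "fiber_cone R \<mm> I =
    (let K = (\<lambda>n. \<mm> \<cdot>\<^bsub>R\<^esub> ideal_pow R I n) in
      \<lparr>carrier = {f. (\<forall>n. f n \<in> (\<lambda>x. K n +>\<^bsub>R\<^esub> x) ` ideal_pow R I n) \<and> finite {n. f n \<noteq> K n}},
       monoid.mult =
         (\<lambda>f g n. \<Oplus>\<^bsub>R Quot K n\<^esub>i\<in>{..n}. rcoset_mult R (K n) (f i) (g (n - i))),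
       one = (\<lambda>n. if n = 0 then K 0 +>\<^bsub>R\<^esub> \<one>\<^bsub>R\<^esub> else K n),
       ring.zero = K,
       add = (\<lambda>f g n. f n \<oplus>\<^bsub>R Quot K n\<^esub> g n)\<rparr>)"

definition analytic_spread :: "('a, 'r) ring_scheme \<Rightarrow> 'a set \<Rightarrow> 'a set \<Rightarrow> enat"
  where "analytic_spread R \<mm> I = krull_dim (fiber_cone R \<mm> I)"

definition fiber_module ::
    "('a, 'r) ring_scheme \<Rightarrow> 'a set \<Rightarrow> 'a set \<Rightarrow> ('a, 'b, 's) module_scheme
      \<Rightarrow> (nat \<Rightarrow> 'a set, nat \<Rightarrow> 'b set) module"
  where "fiber_module R \<mm> I M =
    (let L = (\<lambda>n. ideal_smult R M (ideal_pow R I n) (carrier M));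
         K = (\<lambda>n. ideal_smult R M \<mm> (L n)) in
      \<lparr>carrier = {u. (\<forall>n. u n \<in> (\<lambda>x. K n +>\<^bsub>M\<^esub> x) ` L n) \<and> finite {n. u n \<noteq> K n}},
       monoid.mult = undefined, one = undefined,
       ring.zero = K,
       add = (\<lambda>u v n. u n \<oplus>\<^bsub>quot_module M (K n)\<^esub> v n),
       smult = (\<lambda>f u n. \<Oplus>\<^bsub>quot_module M (K n)\<^esub>i\<in>{..n}.
                  \<Union>a\<in>f i. coset_smult M (K n) a (u (n - i)))\<rparr>)"


section \<open>The Tor polynomial\<close>

text \<open>\<open>t(n)\<close> is the length of \<open>Tor\<^sub>1(M, R/I\<^sup>n\<^sup>+\<^sup>1)\<close> for all large \<open>n\<close>; there is at most one such \<open>t\<close>.\<close>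

definition is_tor_polynomial ::
    "('a, 'r) ring_scheme \<Rightarrow> 'a set \<Rightarrow> ('a, 'b, 's) module_scheme \<Rightarrow> rat poly \<Rightarrow> bool"
  where "is_tor_polynomial R I M t \<longleftrightarrow>
    (\<exists>N. \<forall>n\<ge>N. \<exists>k. module_length R
        (Tor1 R M (quot_module (ring_as_module R) (ideal_pow R I (n + 1)))) = enat k \<and>
      poly t (of_nat n) = of_nat k)"

end

theory Submission
 imports Defs "HOL-Algebra.Subrings" "HOL-Algebra.UnivPoly"
begin

text \<open>A minimal reduction \<open>J\<close> of \<open>I\<close> with \<open>I\<^sup>2 = J I\<close> has generic generators \<open>x\<^sub>1, \<dots>, x\<^sub>d\<close> such that
  \<open>x\<^sub>1, \<dots>, x\<^sub>d\<^sub>-\<^sub>1\<close> is a regular sequence generating \<open>I\<close> at its minimal primes and \<open>x\<^sub>d\<close> is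
  regular on \<open>I\<close> modulo it. Quasi-regularity and the analytic independence of \<open>J\<close> then make the
  fiber cone \<open>F(I)\<close> torsion free over the polynomial ring \<open>k[x\<^sub>1, \<dots>, x\<^sub>d]\<close>. Let \<open>m\<^sub>1, \<dots>, m\<^sub>\<mu>\<close> be minimal
  generators of \<open>M\<close>. If every relation \<open>\<Sum> c\<^sub>j m\<^sub>j = 0\<close> with \<open>c\<^sub>j \<in> I\<^sup>n\<close> has its coefficients in \<open>\<mm> I\<^sup>n\<close>, then the
  classes of the \<open>m\<^sub>j\<close> are a basis of \<open>F\<^sub>I(M)\<close>. Otherwise some \<open>c\<^sub>j\<close> is nonzero in \<open>F(I)\<close>; its products with the
  monomials of degree \<open>r\<close> in \<open>x\<close> are linearly independent in \<open>I\<^sup>n\<^sup>+\<^sup>r / \<mm> I\<^sup>n\<^sup>+\<^sup>r\<close> and lie in the image of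
  \<open>Tor\<^sub>1(M, A/I\<^sup>n\<^sup>+\<^sup>r)\<close>, whose length is therefore at least the number of these monomials, a polynomial in \<open>r\<close>
  of degree \<open>d - 1\<close>.\<close>

text \<open>Since \<open>I\<close> has height d - 1 only, the first d - 1 generic elements can be
  regular on \<open>A\<close>, but associated primes of the ideal they generate may contain
  \<open>I\<close>. These primes are minimal over \<open>I\<close>, and there the d - 1 elements
  generate \<open>I\<close> locally; so the last element is regular on \<open>I\<close> modulo the
  others, which suffices because \<open>r(I) <= 1\<close> writes each element of
  \<open>I^(n+1)\<close> as the value of a form of degree n with coefficients in \<open>I\<close>.
  The analytic spread is used from both sides: a chain of d + 1 primes in the fiber cone forces at
  least d generators by counting monomials, and going up over \<open>k[x]\<close> forbids more than
  d independent ones. The length estimate rests on a map from \<open>Tor_1(M, A/I^N)\<close> to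
  \<open>A/m I^N\<close> that reads off one coordinate of a relation; its values lie in
  \<open>m\<close> times the second argument because the generators of \<open>M\<close> are minimal,
  which makes it well defined modulo \<open>m I^N\<close>. Nonvanishing of products of forms is seen
  by evaluating at points: over the infinite residue field a nonzero form has a value outside
  \<open>m\<close>, which is a unit.\<close>

no_notation Sum_Type.Plus (infixr "<+>" 65)

abbreviation (in ring) "RR == carrier R"

section \<open>Ideals of commutative rings\<close>

context cring
begin

lemma id_zero: "ideal I R ==> \<zero> : I"
 by (simp add: additive_subgroup.zero_closed ideal.axioms(1))

lemma id_carr: "ideal I R ==> a : I ==> a : RR"
 by (rule ideal.Icarr)

lemma id_sub: "ideal I R ==> I <= RR"
 using id_carr by blast

lemma id_add: "ideal I R ==> a : I ==> b : I ==> a \<oplus> b : I"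
 by (simp add: additive_subgroup.a_closed ideal.axioms(1))

lemma id_neg: "ideal I R ==> a : I ==> \<ominus> a : I"
 by (simp add: additive_subgroup.a_inv_closed ideal.axioms(1))

lemma id_minus: "ideal I R ==> a : I ==> b : I ==> a \<ominus> b : I"
 unfolding a_minus_def by (simp add: id_add id_neg)

lemma id_mult: "ideal I R ==> a : I ==> c : RR ==> c \<otimes> a : I"
 by (simp add: ideal.I_l_closed)

lemma id_multr: "ideal I R ==> a : I ==> c : RR ==> a \<otimes> c : I"
 by (simp add: ideal.I_r_closed)

lemmas id_simps = id_zero id_add id_neg id_minus id_mult id_multr id_carr

lemma idI:
 assumes "I <= RR" "\<zero> : I" "!!a b. a : I ==> b : I ==> a \<oplus> b : I"
  and m: "!!a c. a : I ==> c : RR ==> c \<otimes> a : I"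
 shows "ideal I R"
proof (rule idealI)
 show "ring R" by (rule ring_axioms)
 show "subgroup I (add_monoid R)"
 proof (rule add.subgroupI)
  fix a assume a: "a : I"
  have "\<ominus> \<one> \<otimes> a : I" using a m by simp
  moreover have "\<ominus> \<one> \<otimes> a = \<ominus> a" using a assms(1) by (auto simp: l_minus)
  ultimately show "\<ominus> a : I" by simp
 qed (use assms in auto)
 fix a x assume "a : I" "x : RR"
 thus "x \<otimes> a : I" "a \<otimes> x : I" using m assms(1) m_comm[of a x] by auto
qed

lemma id_add_cancel:
 assumes "ideal I R" "a : RR" "b : I"
 shows "a \<oplus> b : I \<longleftrightarrow> a : I" "b \<oplus> a : I \<longleftrightarrow> a : I"
proof -
 have b: "b : RR" using assms id_carr by blast
 have 1: "a = (a \<oplus> b) \<ominus> b" using assms(2) b by algebra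
 show "a \<oplus> b : I \<longleftrightarrow> a : I" using 1 id_minus[OF assms(1) _ assms(3)] id_add[OF assms(1) _ assms(3)] by metis
 thus "b \<oplus> a : I \<longleftrightarrow> a : I" using a_comm[OF assms(2) b] by simp
qed

lemma id_minus_cancel:
 assumes "ideal I R" "a : RR" "b : RR" "a \<ominus> b : I"
 shows "a : I \<longleftrightarrow> b : I"
proof -
 have "a = (a \<ominus> b) \<oplus> b" using assms(2,3) by algebra
 thus ?thesis using id_add_cancel[OF assms(1) assms(3) assms(4)] by simp
qed

lemma proper_iff_one: "ideal I R ==> I = RR \<longleftrightarrow> \<one> : I"
 using ideal.one_imp_carrier by fastforce

lemma set_add_iff: "x : I <+> J \<longleftrightarrow> (EX a:I. EX b:J. x = a \<oplus> b)"
 by (auto simp: set_add_def')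

definition addel :: "'a set => 'a => 'a set"
 where "addel q x = {b \<oplus> c \<otimes> x | b c. b : q & c : RR}"

lemma addelI: "b : q ==> c : RR ==> b \<oplus> c \<otimes> x : addel q x"
 unfolding addel_def by blast

lemma addelE:
 assumes "y : addel q x"
 obtains b c where "b : q" "c : RR" "y = b \<oplus> c \<otimes> x"
 using assms unfolding addel_def by blast

lemma addel_ideal:
 assumes q: "ideal q R" and x: "x : RR"
 shows "ideal (addel q x) R"
proof (rule idI)
 note qc = id_carr[OF q]
 show "addel q x <= RR" using q x by (auto simp: addel_def id_carr)
 have "\<zero> = \<zero> \<oplus> \<zero> \<otimes> x" using x by simp
 thus "\<zero> : addel q x" using addelI[OF id_zero[OF q] zero_closed] by metis
next
 fix a b assume "a : addel q x" "b : addel q x"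
 then obtain a1 a2 b1 b2 where *: "a1 : q" "a2 : RR" "a = a1 \<oplus> a2 \<otimes> x"
  "b1 : q" "b2 : RR" "b = b1 \<oplus> b2 \<otimes> x" by (elim addelE)
 note c = id_carr[OF q *(1)] id_carr[OF q *(4)]
 have "a \<oplus> b = (a1 \<oplus> b1) \<oplus> (a2 \<oplus> b2) \<otimes> x" unfolding * using c *(2,5) x by algebra
 thus "a \<oplus> b : addel q x" using addelI[of "a1 \<oplus> b1" q "a2 \<oplus> b2" x] * q by (simp add: id_add)
next
 fix a c assume "a : addel q x" and c: "c : RR"
 then obtain a1 a2 where *: "a1 : q" "a2 : RR" "a = a1 \<oplus> a2 \<otimes> x" by (elim addelE)
 note d = id_carr[OF q *(1)]
 have "c \<otimes> a = c \<otimes> a1 \<oplus> (c \<otimes> a2) \<otimes> x" unfolding * using c d *(2) x by algebra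
 thus "c \<otimes> a : addel q x" using addelI[of "c \<otimes> a1" q "c \<otimes> a2" x] * c q by (simp add: id_mult)
qed

lemma addel_sub: "ideal q R ==> x : RR ==> q <= addel q x"
 using addelI[of _ q \<zero> x] id_carr[of q] by fastforce

lemma addel_mem: "ideal q R ==> x : RR ==> x : addel q x"
 using addelI[of \<zero> q \<one> x] id_zero[of q] by fastforce

lemma addel_least: "ideal L R ==> q <= L ==> x : L ==> addel q x <= L"
 unfolding addel_def using id_add id_mult by blast

lemma addel_commute: "ideal q R ==> x : RR ==> y : RR ==> addel (addel q x) y = addel (addel q y) x"
 by (intro subset_antisym addel_least addel_ideal)
  (meson addel_ideal addel_mem addel_sub subset_iff)+

definition colon :: "'a set => 'a => 'a set"
 where "colon q z = {a : RR. a \<otimes> z : q}"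

lemma colon_iff: "a : colon q z \<longleftrightarrow> a : RR & a \<otimes> z : q"
 unfolding colon_def by simp

lemma colon_ideal:
 assumes "ideal q R" "z : RR" shows "ideal (colon q z) R"
 by (rule idI) (use assms in \<open>auto simp: colon_def l_distr id_simps m_assoc\<close>)

lemma colon_mult:
 assumes "ideal q R" "z : RR" "b : RR"
 shows "colon q z <= colon q (b \<otimes> z)"
proof
 fix a assume a: "a : colon q z"
 hence "a : RR" "b \<otimes> (a \<otimes> z) : q" using assms by (auto simp: colon_def id_mult)
 moreover have "b \<otimes> (a \<otimes> z) = a \<otimes> (b \<otimes> z)" using calculation assms by (simp add: m_lcomm)
 ultimately show "a : colon q (b \<otimes> z)" by (simp add: colon_def)
qed

text \<open>\<open>a\<close> acts injectively on \<open>R/q\<close>. Regular sequences and depth are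
  treated through ideals of \<open>R\<close>, so that no quotient ring has to be formed.\<close>

definition nzd :: "'a set => 'a => bool"
 where "nzd q a \<longleftrightarrow> a : RR & (ALL z:RR. a \<otimes> z : q --> z : q)"

definition assoc_prime :: "'a set => 'a set => bool"
 where "assoc_prime q Q \<longleftrightarrow> primeideal Q R & (EX z:RR. Q = colon q z)"

lemma primeideal_one: "primeideal P R ==> \<one> ~: P"
 using primeideal.axioms(1)[of P R] primeideal.I_notcarr[of P R] ideal.one_imp_carrier by blast

lemma primeideal_mult:
 "primeideal P R ==> a : RR ==> b : RR ==> a \<otimes> b : P \<longleftrightarrow> a : P | b : P"
 using primeideal.I_prime[of P R a b] id_mult[of P b a] id_multr[of P a b] primeideal.axioms(1)[of P R] by blast

lemma assoc_prime_prime: "assoc_prime q Q ==> primeideal Q R"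
 unfolding assoc_prime_def by simp

lemma assoc_prime_ideal: "assoc_prime q Q ==> ideal Q R"
 unfolding assoc_prime_def by (simp add: primeideal.axioms(1))

end

section \<open>Noetherian rings\<close>

locale noeth = cring R for R :: "('a, 'r) ring_scheme" (structure) +
 assumes noetherian: "noetherian_ring R"
begin

lemma max_ideal:
 assumes "S ~= {}" "!!q. q : S ==> ideal q R"
 shows "EX q:S. ALL q':S. q <= q' --> q' = q"
proof -
 have "EX q:S. ALL q':S. q <= q' --> q' = q"
 proof (rule subset_Zorn_nonempty[OF assms(1)])
  fix C assume C: "C ~= {}" "subset.chain S C"
  have "subset.chain {I. ideal I R} C"
   using C(2) assms(2) unfolding subset.chain_def by blast
  hence "\<Union>C : C" using noetherian_ring.ideal_chain_is_trivial[OF noetherian C(1)] by blast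
  thus "\<Union>C : S" using C(2) unfolding subset.chain_def by blast
 qed
 thus ?thesis .
qed

lemma max_ideal_obtain:
 assumes "ideal q R" "P q"
 obtains X where "ideal X R" "P X" "!!Y. ideal Y R ==> X <= Y ==> P Y ==> Y = X"
proof -
 have "EX X:{X. ideal X R & P X}. ALL Y:{X. ideal X R & P X}. X <= Y --> Y = X"
  by (rule max_ideal) (use assms in auto)
 thus ?thesis using that by auto
qed

text \<open>A maximal annihilator is prime. Only annihilators of multiples of \<open>z\<close>
  compete, so that the prime found still contains \<open>colon q z\<close>.\<close>

lemma assoc_prime_exists:
 assumes q: "ideal q R" and z: "z : RR" "z ~: q"
 shows "EX b:RR. b \<otimes> z ~: q & assoc_prime q (colon q (b \<otimes> z)) & colon q z <= colon q (b \<otimes> z)"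
proof -
 let ?S = "{colon q (b \<otimes> z) | b. b : RR & b \<otimes> z ~: q}"
 have "EX P:?S. ALL q':?S. P <= q' --> q' = P"
 proof (rule max_ideal)
  have "\<one> \<otimes> z ~: q" using z by simp
  thus "?S ~= {}" by blast
 qed (use q z in \<open>auto intro!: colon_ideal\<close>)
 then obtain b where b: "b : RR" "b \<otimes> z ~: q"
  and mx: "!!b'. b' : RR ==> b' \<otimes> z ~: q ==> colon q (b \<otimes> z) <= colon q (b' \<otimes> z) ==> colon q (b' \<otimes> z) = colon q (b \<otimes> z)"
  by blast
 let ?P = "colon q (b \<otimes> z)"
 have bz: "b \<otimes> z : RR" using b z by simp
 have "primeideal ?P R"
 proof (rule primeidealI)
  show "ideal ?P R" using q bz by (rule colon_ideal)
  show "cring R" by (rule is_cring)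
  have "\<one> ~: ?P" using b bz by (simp add: colon_iff)
  thus "RR ~= ?P" using one_closed by metis
  fix u v assume uv: "u : RR" "v : RR" "u \<otimes> v : ?P"
  \<comment> \<open>If \<open>v\<close> does not kill \<open>b z\<close>, then
    \<open>(v b) z\<close> is again a competitor; its annihilator contains \<open>?P\<close>, hence
    equals it, and \<open>u\<close> lies in it.\<close>
  show "u : ?P | v : ?P"
  proof (cases "v : ?P")
   case False
   hence v: "(v \<otimes> b) \<otimes> z ~: q" using uv b z by (simp add: colon_def m_assoc)
   have "colon q (b \<otimes> z) <= colon q ((v \<otimes> b) \<otimes> z)"
    using colon_mult[OF q bz uv(2)] uv b z by (simp add: m_assoc)
   hence "colon q ((v \<otimes> b) \<otimes> z) = ?P" using mx[OF _ v] uv b by simp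
   moreover have "u : colon q ((v \<otimes> b) \<otimes> z)" using uv b z by (simp add: colon_def m_assoc)
   ultimately show ?thesis by simp
  qed simp
 qed
 thus ?thesis using b bz colon_mult[OF q z(1) b(1)] unfolding assoc_prime_def by blast
qed

lemma not_nzd_assoc:
 assumes "ideal q R" "a : RR" "~ nzd q a"
 shows "EX Q. assoc_prime q Q & a : Q"
proof -
 obtain z where "z : RR" "a \<otimes> z : q" "z ~: q" using assms unfolding nzd_def by blast
 thus ?thesis using assoc_prime_exists[OF assms(1), of z] assms(2) by (auto simp: colon_iff)
qed

lemma nzd_assoc: "nzd q a ==> assoc_prime q Q ==> ideal q R ==> a ~: Q"
 unfolding nzd_def assoc_prime_def using primeideal_one[of Q] by (auto simp: colon_iff)

text \<open>Noetherian induction: let \<open>q\<close> be maximal among the counterexamples and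
  \<open>Q0\<close> the annihilator of \<open>z\<close> modulo \<open>q\<close>. Every other
  associated prime of \<open>q\<close> is one of \<open>q + (z)\<close>, which has finitely
  many.\<close>

lemma finite_assoc:
 assumes "ideal q R" shows "finite {Q. assoc_prime q Q}"
proof (rule ccontr)
 assume inf: "infinite {Q. assoc_prime q Q}"
 obtain p where p: "ideal p R" "infinite {Q. assoc_prime p Q}"
  and mx: "!!q'. ideal q' R ==> p <= q' ==> infinite {Q. assoc_prime q' Q} ==> q' = p"
  using max_ideal_obtain[where P = "%q. infinite {Q. assoc_prime q Q}", OF assms inf] by blast
 obtain Q0 where "assoc_prime p Q0" using p(2) by (metis (mono_tags, lifting) Collect_empty_eq finite.emptyI)
 then obtain z where z: "z : RR" and Q0: "Q0 = colon p z" "primeideal Q0 R" unfolding assoc_prime_def by blast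
 have zn: "z ~: p" using primeideal_one[OF Q0(2)] z unfolding Q0 by (auto simp: colon_iff)
 let ?p = "addel p z"
 have pi: "ideal ?p R" "p <= ?p" "z : ?p" using p z by (auto simp: addel_ideal addel_sub[THEN subsetD] addel_mem)
 have fin: "finite {Q. assoc_prime ?p Q}" using mx[OF pi(1,2)] pi(3) zn by blast
 have "{Q. assoc_prime p Q} <= insert Q0 {Q. assoc_prime ?p Q}"
 proof
  fix Q assume "Q : {Q. assoc_prime p Q}"
  then obtain w where w: "w : RR" and Q: "Q = colon p w" "primeideal Q R" unfolding assoc_prime_def by blast
  \<comment> \<open>In \<open>R/q\<close> the submodules generated by \<open>w\<close> and
    \<open>z\<close> are copies of \<open>R/Q\<close> and \<open>R/Q0\<close>, so their nonzero
    elements have annihilator \<open>Q\<close> and \<open>Q0\<close>. A common nonzero element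
    forces \<open>Q = Q0\<close>; otherwise \<open>w\<close> keeps its annihilator modulo
    \<open>q + (z)\<close>.\<close>
  show "Q : insert Q0 {Q. assoc_prime ?p Q}"
  proof (cases "EX b:RR. b \<otimes> w : ?p & b \<otimes> w ~: p")
   case True
   then obtain b where b: "b : RR" "b \<otimes> w : ?p" "b \<otimes> w ~: p" by blast
   then obtain e c where ec: "e : p" "c : RR" "b \<otimes> w = e \<oplus> c \<otimes> z" by (elim addelE)
   have e: "e : RR" using ec p id_carr by blast
   have bQ: "b ~: Q" using b by (simp add: Q colon_iff)
   have cQ: "c ~: Q0"
   proof
    assume "c : Q0" hence "c \<otimes> z : p" by (simp add: Q0 colon_iff)
    thus False using ec b p by (simp add: id_add)
   qed
   have "u : Q \<longleftrightarrow> u : Q0" if u: "u : RR" for u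
   proof -
    have "u : Q \<longleftrightarrow> u \<otimes> b : Q" using primeideal_mult[OF Q(2)] u b bQ by blast
    also have "... \<longleftrightarrow> u \<otimes> (b \<otimes> w) : p" using u b w by (simp add: Q colon_iff m_assoc)
    also have "u \<otimes> (b \<otimes> w) = u \<otimes> e \<oplus> (u \<otimes> c) \<otimes> z" unfolding ec using u ec(2) e z by algebra
    also have "... : p \<longleftrightarrow> (u \<otimes> c) \<otimes> z : p"
     using id_add_cancel(2)[OF p(1), of "(u \<otimes> c) \<otimes> z" "u \<otimes> e"] u ec z p by (simp add: id_mult)
    also have "... \<longleftrightarrow> u \<otimes> c : Q0" using u ec by (simp add: Q0 colon_iff)
    also have "... \<longleftrightarrow> u : Q0" using primeideal_mult[OF Q0(2)] u ec cQ by blast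
    finally show ?thesis .
   qed
   hence "Q = Q0" unfolding Q Q0 by (auto simp: colon_iff)
   thus ?thesis by simp
  next
   case False
   have "Q = colon ?p w" using False pi(2) unfolding Q by (auto simp: colon_iff)
   hence "assoc_prime ?p Q" using Q(2) w unfolding assoc_prime_def by blast
   thus ?thesis by simp
  qed
 qed
 thus False using fin p(2) finite_subset by blast
qed

end

section \<open>Noetherian local rings\<close>

locale local_noeth = noeth R for R :: "('a, 'r) ring_scheme" (structure) and mm :: "'a set" +
 assumes local_max: "maximalideal mm R"
  and local_unique: "maximalideal \<nn> R ==> \<nn> = mm"
begin

lemma mm_ideal: "ideal mm R"
 using local_max by (rule maximalideal.axioms(1))

lemma mm_prime: "primeideal mm R"
 using local_max by (rule maximalideal_prime)

lemma mm_one: "\<one> ~: mm"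
 using mm_prime by (rule primeideal_one)

lemma proper_sub_mm:
 assumes q: "ideal q R" "\<one> ~: q" shows "q <= mm"
proof -
 obtain I where I: "ideal I R" "q <= I & \<one> ~: I"
  and mx: "!!q'. ideal q' R ==> I <= q' ==> q <= q' & \<one> ~: q' ==> q' = I"
  using max_ideal_obtain[where P = "%I. q <= I & \<one> ~: I", OF q(1)] q(2) by auto
 have "maximalideal I R"
 proof (rule maximalidealI[OF I(1)])
  show "RR ~= I" using I(2) one_closed by blast
  fix J assume "ideal J R" "I <= J"
  thus "J = I | J = RR" using mx[of J] proper_iff_one[of J] I(2) by blast
 qed
 thus ?thesis using local_unique I(2) by blast
qed

lemma unit_inverse:
 assumes a: "a : RR" "a ~: mm" shows "EX b:RR. b \<otimes> a = \<one>"
proof -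
 have z: "ideal {\<zero>} R" by (rule zeroideal)
 have "a : addel {\<zero>} a" using z a(1) by (rule addel_mem)
 hence "\<one> : addel {\<zero>} a" using proper_sub_mm[OF addel_ideal[OF z a(1)]] a(2) by blast
 then obtain b c where "b : {\<zero>}" "c : RR" "\<one> = b \<oplus> c \<otimes> a" by (elim addelE)
 thus ?thesis using a by auto
qed

lemma unit_cancel:
 assumes "ideal L R" "a : RR" "a ~: mm" "y : RR"
 shows "a \<otimes> y : L \<longleftrightarrow> y : L"
proof
 assume y: "a \<otimes> y : L"
 obtain b where b: "b : RR" "b \<otimes> a = \<one>" using unit_inverse assms by blast
 have "b \<otimes> (a \<otimes> y) = (b \<otimes> a) \<otimes> y" using b(1) assms by (simp add: m_assoc)
 hence "b \<otimes> (a \<otimes> y) = y" using b assms by simp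
 thus "y : L" using id_mult[OF assms(1) y b(1)] by simp
qed (use assms in \<open>auto simp: id_mult\<close>)

lemma one_minus_unit: "p : mm ==> \<one> \<ominus> p ~: mm"
proof -
 assume p: "p : mm"
 hence "p : RR" using mm_ideal id_carr by blast
 hence "(\<one> \<ominus> p) \<oplus> p = \<one>" by algebra
 thus ?thesis using id_add[OF mm_ideal _ p] mm_one by metis
qed

text \<open>Choosing a maximal ideal \<open>X \<supseteq> L\<close> that does not contain \<open>N\<close> forces \<open>N <= X + (y)\<close> for every
  \<open>y \<in> N - X\<close>; this replaces the usual induction on generators.\<close>

lemma nakayama:
 assumes N: "ideal N R" and L: "ideal L R" and le: "N <= L <+> mm \<cdot> N"
 shows "N <= L"
proof (rule ccontr)
 assume "~ N <= L"
 then obtain X where X: "ideal X R" "L <= X & ~ N <= X"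
  and mx: "!!q'. ideal q' R ==> X <= q' ==> L <= q' & ~ N <= q' ==> q' = X"
  using max_ideal_obtain[where P = "%X. L <= X & ~ N <= X", OF L] by auto
 obtain y where y: "y : N" "y ~: X" using X by blast
 have yc: "y : RR" using y N id_carr by blast
 have NX: "N <= addel X y"
  using mx[OF addel_ideal[OF X(1) yc] addel_sub[OF X(1) yc]] y addel_mem[OF X(1) yc] addel_sub[OF X(1) yc] X(2)
  by (metis order_trans)
 have *: "EX p:mm. EX e:X. u = e \<oplus> p \<otimes> y" if "u : mm \<cdot> N" for u
  using that
 proof (induction u rule: ideal_prod.induct)
  case (prod i j)
  then obtain b c where bc: "b : X" "c : RR" "j = b \<oplus> c \<otimes> y" using NX by (blast elim: addelE)
  have i: "i : RR" using prod mm_ideal id_carr by blast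
  have b: "b : RR" using bc X id_carr by blast
  have "i \<otimes> j = i \<otimes> b \<oplus> (i \<otimes> c) \<otimes> y" unfolding bc using i b bc(2) yc by algebra
  thus ?case using prod(1) bc i X mm_ideal by (meson id_mult id_multr)
 next
  case (sum s1 s2)
  then obtain p1 e1 p2 e2 where s: "p1 : mm" "e1 : X" "s1 = e1 \<oplus> p1 \<otimes> y" "p2 : mm" "e2 : X" "s2 = e2 \<oplus> p2 \<otimes> y"
   by blast
  have c: "p1 : RR" "p2 : RR" "e1 : RR" "e2 : RR"
   using s mm_ideal X id_carr by blast+
  have "s1 \<oplus> s2 = (e1 \<oplus> e2) \<oplus> (p1 \<oplus> p2) \<otimes> y" unfolding s using c yc by algebra
  thus ?case using s X mm_ideal id_add by metis
 qed
 obtain l u where lu: "l : L" "u : mm \<cdot> N" "y = l \<oplus> u" using le y(1) unfolding set_add_iff[symmetric] using set_add_iff by blast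
 then obtain p e where pe: "p : mm" "e : X" "u = e \<oplus> p \<otimes> y" using * by blast
 have c: "l : RR" "e : RR" "p : RR" using lu pe L X mm_ideal id_carr by blast+
 have "y \<ominus> p \<otimes> y = (l \<oplus> (e \<oplus> p \<otimes> y)) \<ominus> p \<otimes> y" using lu(3) pe(3) by simp
 also have "... = l \<oplus> e" using c yc by algebra
 finally have "(\<one> \<ominus> p) \<otimes> y = l \<oplus> e" using c yc by (simp add: minus_eq l_distr l_minus)
 hence "(\<one> \<ominus> p) \<otimes> y : X" using id_add[OF X(1) _ pe(2), of l] lu(1) X(2) by auto
 thus False using unit_cancel[OF X(1) _ one_minus_unit[OF pe(1)] yc] c y by simp
qed

end

locale local_inf = local_noeth +
 assumes inf_res: "infinite (carrier (R Quot mm))"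
begin

lemma fresh_residue:
 assumes "finite T" "T <= RR"
 shows "EX t:RR. ALL s:T. t \<ominus> s ~: mm"
proof (rule ccontr)
 assume "~ ?thesis"
 hence *: "EX s:T. t \<ominus> s : mm" if "t : RR" for t using that by blast
 have "carrier (R Quot mm) <= (%s. mm +> s) ` T"
 proof
  fix X assume "X : carrier (R Quot mm)"
  then obtain t where t: "t : RR" "X = mm +> t" by (auto simp: FactRing_def A_RCOSETS_def')
  then obtain s where s: "s : T" "t \<ominus> s : mm" using * by blast
  hence "mm +> t = mm +> s" using quotient_eq_iff_same_a_r_cos[OF mm_ideal t(1), of s] assms by blast
  thus "X : (%s. mm +> s) ` T" using t s by blast
 qed
 thus False using inf_res assms finite_subset by blast
qed

text \<open>The ideals avoided need not be prime, because the residue field is infinite: for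
  \<open>x\<close> outside the earlier ideals but inside the new one, and \<open>y\<close> outside
  the new one, \<open>y + t x\<close> is never in the new ideal and lies in each earlier one for at
  most one residue class of \<open>t\<close>.\<close>

lemma avoid:
 assumes J: "ideal J R" and "finite Ls" "!!L. L : Ls ==> ideal L R" "!!L. L : Ls ==> ~ J <= L"
 shows "EX x:J. ALL L:Ls. x ~: L"
 using assms(2-)
proof (induction Ls rule: finite_induct)
 case empty thus ?case using id_zero[OF J] by blast
next
 case (insert L0 Ls)
 then obtain x where x: "x : J" "!!L. L : Ls ==> x ~: L" by auto
 show ?case
 proof (cases "x : L0")
  case False thus ?thesis using x by blast
 next
  case True
  obtain y where y: "y : J" "y ~: L0" using insert by blast
  have c: "x : RR" "y : RR" using x y J id_carr by blast+
  let ?bad = "%L t. t : RR & y \<oplus> t \<otimes> x : L"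
  \<comment> \<open>One bad scalar per ideal is enough: if \<open>t\<close> is bad for
    \<open>L\<close> and not congruent to \<open>b L\<close>, then the unit \<open>t - b L\<close>
    times \<open>x\<close> lies in \<open>L\<close>, which \<open>x\<close> avoids.\<close>
  define b where "b L = (SOME t. ?bad L t)" for L
  define T where "T = b ` {L : Ls. EX t. ?bad L t}"
  have bb: "?bad L (b L)" if "EX t. ?bad L t" for L unfolding b_def using that by (rule someI_ex)
  have "finite T" "T <= RR" using insert(1) bb unfolding T_def by auto
  from fresh_residue[OF this] obtain t where t: "t : RR" "!!s. s : T ==> t \<ominus> s ~: mm" by blast
  have "y \<oplus> t \<otimes> x ~: L" if L: "L : insert L0 Ls" for L
  proof
   assume bad: "y \<oplus> t \<otimes> x : L"
   have Li: "ideal L R" using insert L by blast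
   show False
   proof (cases "L = L0")
    case True
    thus False using bad id_add_cancel(1)[OF Li c(2), of "t \<otimes> x"] \<open>x : L0\<close> y Li t(1) id_mult by blast
   next
    case False
    hence LL: "L : Ls" using L by blast
    have ex: "EX t. ?bad L t" using bad t by blast
    note s = bb[OF ex]
    have "t \<ominus> b L ~: mm" using t(2)[of "b L"] LL ex unfolding T_def by blast
    have "(y \<oplus> t \<otimes> x) \<ominus> (y \<oplus> b L \<otimes> x) = (t \<ominus> b L) \<otimes> x" using c t(1) s by algebra
    hence "(t \<ominus> b L) \<otimes> x : L" using id_minus[OF Li bad] s by metis
    thus False using unit_cancel[OF Li _ \<open>t \<ominus> b L ~: mm\<close> c(1)] t(1) s x(2)[OF LL] by simp
   qed
  qed
  moreover have "y \<oplus> t \<otimes> x : J" using x y t J by (simp add: id_simps)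
  ultimately show ?thesis by blast
 qed
qed

end

section \<open>Depth of quotients, exchange of regular elements and chains of primes\<close>

context local_noeth
begin

text \<open>Some regular sequence of length \<open>r\<close> on \<open>R/q\<close> has its elements
  in \<open>mm\<close>. That the choice of the first element is immaterial is shown in
  \<open>dep_exchange\<close>.\<close>

fun dep :: "'a set => nat => bool" where
 "dep q 0 = True"
| "dep q (Suc r) = (EX a:mm. nzd q a & dep (addel q a) r)"

lemma mm_not_assoc:
 assumes "ideal q R" "dep q (Suc r)" shows "~ assoc_prime q mm"
proof -
 obtain a where a: "a : mm" "nzd q a" using assms by auto
 thus ?thesis using nzd_assoc assms by blast
qed

text \<open>The sequence \<open>a, y\<close> modulo \<open>q\<close> may be taken in the order
  \<open>y, a\<close>: write \<open>a v = b + w y\<close>, divide \<open>w\<close> by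
  \<open>a\<close> modulo \<open>q\<close>, which regularity of \<open>y\<close> modulo
  \<open>q + (a)\<close> permits, and cancel \<open>a\<close>.\<close>

lemma nzd_swap:
 assumes q: "ideal q R" and y: "nzd q y" and ya: "nzd (addel q a) y" and a: "nzd q a"
 shows "nzd (addel q y) a"
proof -
 have c: "y : RR" "a : RR" using y a unfolding nzd_def by auto
 show ?thesis unfolding nzd_def
 proof (intro conjI ballI impI c)
  fix v assume v: "v : RR" "a \<otimes> v : addel q y"
  then obtain b w where bw: "b : q" "w : RR" "a \<otimes> v = b \<oplus> w \<otimes> y" by (elim addelE)
  have b: "b : RR" using bw q id_carr by blast
  have "y \<otimes> w = (b \<oplus> w \<otimes> y) \<ominus> b" using b bw(2) c by algebra
  also have "... = \<ominus> b \<oplus> v \<otimes> a" unfolding bw(3)[symmetric] using b c v(1) by algebra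
  finally have "y \<otimes> w : addel q a" using bw q v by (simp add: addelI id_neg)
  hence "w : addel q a" using ya bw unfolding nzd_def by blast
  then obtain b' w' where w': "b' : q" "w' : RR" "w = b' \<oplus> w' \<otimes> a" by (elim addelE)
  have b': "b' : RR" using w' q id_carr by blast
  have "a \<otimes> (v \<ominus> w' \<otimes> y) = a \<otimes> v \<ominus> a \<otimes> (w' \<otimes> y)" using c v(1) w'(2) by algebra
  also have "... = b \<oplus> b' \<otimes> y" unfolding bw(3) w'(3) using b b' c w'(2) by algebra
  finally have "a \<otimes> (v \<ominus> w' \<otimes> y) : q" using bw w' q c by (simp add: id_simps)
  hence "v \<ominus> w' \<otimes> y : q" using a v w' c unfolding nzd_def by simp
  moreover have "v = (v \<ominus> w' \<otimes> y) \<oplus> w' \<otimes> y" using v w'(2) c by algebra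
  ultimately show "v : addel q y" using addelI[of "v \<ominus> w' \<otimes> y" q w' y] w'(2) by simp
 qed
qed

text \<open>Both socles are \<open>Ext^1(k, R/q)\<close>. In elementary terms: if
  \<open>mm z\<close> lies in \<open>q + (x)\<close> and \<open>a z = b + w x\<close>, then
  \<open>w\<close> is nonzero modulo \<open>q + (a)\<close> and killed by \<open>mm\<close>
  there.\<close>

lemma mm_assoc_swap:
 assumes q: "ideal q R" and a: "nzd q a" "a : mm" and x: "nzd q x" "x : mm"
  and m: "assoc_prime (addel q x) mm"
 shows "assoc_prime (addel q a) mm"
proof -
 have c: "x : RR" "a : RR" using x a unfolding nzd_def by auto
 note qx = addel_ideal[OF q c(1)] and qa = addel_ideal[OF q c(2)]
 obtain z where z: "z : RR" "mm = colon (addel q x) z" using m unfolding assoc_prime_def by blast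
 have zn: "z ~: addel q x" using mm_one z by (auto simp: colon_iff)
 have "a \<otimes> z : addel q x" using a z by (auto simp: colon_iff)
 then obtain b w where bw: "b : q" "w : RR" "a \<otimes> z = b \<oplus> w \<otimes> x" by (elim addelE)
 have b: "b : RR" using bw q id_carr by blast
 have wn: "w ~: addel q a"
 proof
  assume "w : addel q a"
  then obtain b' w' where w': "b' : q" "w' : RR" "w = b' \<oplus> w' \<otimes> a" by (elim addelE)
  have b': "b' : RR" using w' q id_carr by blast
  have "a \<otimes> (z \<ominus> w' \<otimes> x) = a \<otimes> z \<ominus> a \<otimes> (w' \<otimes> x)" using c z(1) w'(2) by algebra
  also have "... = b \<oplus> b' \<otimes> x" unfolding bw(3) w'(3) using b b' c w'(2) by algebra
  finally have "a \<otimes> (z \<ominus> w' \<otimes> x) : q" using bw w' q c by (simp add: id_simps)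
  hence "z \<ominus> w' \<otimes> x : q" using a z w' c unfolding nzd_def by simp
  moreover have "z = (z \<ominus> w' \<otimes> x) \<oplus> w' \<otimes> x" using z(1) w'(2) c by algebra
  ultimately show False using addelI[of "z \<ominus> w' \<otimes> x" q w' x] w'(2) zn by simp
 qed
 have "mm <= colon (addel q a) w"
 proof
  fix u assume u: "u : mm"
  have uc: "u : RR" using u mm_ideal id_carr by blast
  have "u \<otimes> z : addel q x" using u z by (auto simp: colon_iff)
  then obtain b' v where w': "b' : q" "v : RR" "u \<otimes> z = b' \<oplus> v \<otimes> x" by (elim addelE)
  have b': "b' : RR" using w' q id_carr by blast
  \<comment> \<open>Two expressions for \<open>a (u z)\<close> are compared; what remains is
    \<open>x\<close> times \<open>u w - a v\<close>, and \<open>x\<close> can be cancelled modulo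
    \<open>q\<close>.\<close>
  have "u \<otimes> b \<oplus> (u \<otimes> w) \<otimes> x = u \<otimes> (b \<oplus> w \<otimes> x)" using uc b bw(2) c by algebra
  also have "... = a \<otimes> (u \<otimes> z)" unfolding bw(3)[symmetric] using uc z(1) c by algebra
  also have "... = a \<otimes> b' \<oplus> (a \<otimes> v) \<otimes> x" unfolding w'(3) using w'(2) b' c by algebra
  finally have e: "u \<otimes> b \<oplus> (u \<otimes> w) \<otimes> x = a \<otimes> b' \<oplus> (a \<otimes> v) \<otimes> x" .
  have "x \<otimes> (u \<otimes> w \<ominus> a \<otimes> v) = (u \<otimes> b \<oplus> (u \<otimes> w) \<otimes> x) \<ominus> (u \<otimes> b \<oplus> (a \<otimes> v) \<otimes> x)" using uc b bw(2) w'(2) c by algebra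
  also have "... = a \<otimes> b' \<ominus> u \<otimes> b" unfolding e using uc b b' w'(2) c by algebra
  finally have "x \<otimes> (u \<otimes> w \<ominus> a \<otimes> v) : q" using bw w' uc c q by (simp add: id_simps)
  hence "u \<otimes> w \<ominus> a \<otimes> v : q" using x uc bw(2) w'(2) c unfolding nzd_def by simp
  moreover have "u \<otimes> w = (u \<otimes> w \<ominus> a \<otimes> v) \<oplus> v \<otimes> a" using uc bw(2) w'(2) c by algebra
  ultimately have "u \<otimes> w : addel q a" using addelI[of "u \<otimes> w \<ominus> a \<otimes> v" q v a] w'(2) by simp
  thus "u : colon (addel q a) w" using uc by (simp add: colon_iff)
 qed
 moreover have "colon (addel q a) w <= mm"
  using proper_sub_mm[OF colon_ideal[OF qa bw(2)]] wn bw(2) by (simp add: colon_iff)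
 ultimately show ?thesis unfolding assoc_prime_def using bw(2) mm_prime by blast
qed

end

context local_inf
begin

text \<open>The associated primes of all the given ideals are finitely many proper subideals of
  \<open>mm\<close>, so one element of \<open>mm\<close> avoids them together.\<close>

lemma common_nzd:
 assumes "finite qs" "!!q. q : qs ==> ideal q R" "!!q. q : qs ==> ~ assoc_prime q mm"
 shows "EX y:mm. ALL q:qs. nzd q y"
proof -
 have "EX x:mm. ALL L:(\<Union>q\<in>qs. {Q. assoc_prime q Q}). x ~: L"
 proof (rule avoid[OF mm_ideal])
  show "finite (\<Union>q\<in>qs. {Q. assoc_prime q Q})" using assms finite_assoc by blast
  fix L assume L: "L : (\<Union>q\<in>qs. {Q. assoc_prime q Q})"
  thus "ideal L R" using assoc_prime_ideal by blast
  have "L <= mm" using L assoc_prime_ideal proper_sub_mm primeideal_one unfolding assoc_prime_def by blast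
  thus "~ mm <= L" using L assms(3) by (metis UN_E mem_Collect_eq subset_antisym)
 qed
 thus ?thesis using not_nzd_assoc assms(2) mm_ideal id_carr by (metis UN_iff mem_Collect_eq)
qed

text \<open>A regular \<open>x\<close> can replace the first element \<open>a\<close> of a given
  sequence. An element \<open>y\<close> that is regular modulo \<open>q\<close>,
  \<open>q + (a)\<close> and \<open>q + (x)\<close> mediates: depth is passed from
  \<open>q + (a)\<close> to \<open>q + (a, y)\<close>, then to \<open>q + (y)\<close>,
  \<open>q + (x, y)\<close> and finally \<open>q + (x)\<close>.\<close>

lemma dep_exchange:
 "ideal q R ==> dep q (Suc r) ==> x : mm ==> nzd q x ==> dep (addel q x) r"
proof (induction r arbitrary: q x)
 case (Suc r)
 obtain a where a: "a : mm" "nzd q a" "dep (addel q a) (Suc r)" using Suc.prems(2) by auto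
 have c: "x : RR" "a : RR" using a Suc.prems unfolding nzd_def by auto
 note q = Suc.prems(1)
 note qx = addel_ideal[OF q c(1)] and qa = addel_ideal[OF q c(2)]
 have na: "~ assoc_prime (addel q a) mm" using mm_not_assoc[OF qa a(3)] .
 have nx: "~ assoc_prime (addel q x) mm" using mm_assoc_swap[OF q a(2,1) Suc.prems(4,3)] na by blast
 have nq: "~ assoc_prime q mm" using mm_not_assoc[OF q Suc.prems(2)] .
 obtain y where y: "y : mm" "nzd q y" "nzd (addel q x) y" "nzd (addel q a) y"
  using common_nzd[of "{q, addel q x, addel q a}"] q qx qa na nx nq by auto
 have yc: "y : RR" using y unfolding nzd_def by auto
 note qy = addel_ideal[OF q yc]
 have "dep (addel (addel q a) y) r" using Suc.IH[OF qa a(3) y(1,4)] .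
 hence "dep (addel (addel q y) a) r" using addel_commute[OF q yc c(2)] by simp
 hence "dep (addel q y) (Suc r)" using a(1) nzd_swap[OF q y(2,4) a(2)] by auto
 hence "dep (addel (addel q y) x) r" using Suc.IH[OF qy _ Suc.prems(3) nzd_swap[OF q y(2,3) Suc.prems(4)]] by blast
 hence "dep (addel (addel q x) y) r" using addel_commute[OF q yc c(1)] by simp
 thus ?case using y by auto
qed simp

end

context local_noeth
begin

text \<open>Let \<open>T\<close> consist of the elements killed by \<open>Q\<close> modulo
  \<open>q\<close>. As \<open>a\<close> can be cancelled, an element of \<open>T\<close> that lies
  in \<open>q + (a)\<close> lies in \<open>q + a T\<close>; if all of \<open>T\<close> did, Nakayama
  would give \<open>T <= q\<close>. So some \<open>v\<close> in \<open>T\<close> is nonzero modulo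
  \<open>q + (a)\<close>, and both \<open>Q\<close> and \<open>a\<close> kill it.\<close>

lemma assoc_prime_lift:
 assumes q: "ideal q R" and Q: "assoc_prime q Q" and a: "a : mm" "nzd q a"
 shows "EX Q'. assoc_prime (addel q a) Q' & Q \<subset> Q'"
proof -
 have ac: "a : RR" using a unfolding nzd_def by auto
 note qa = addel_ideal[OF q ac]
 have Qi: "ideal Q R" using Q assoc_prime_ideal by blast
 obtain z where z: "z : RR" "Q = colon q z" using Q unfolding assoc_prime_def by blast
 have "\<one> ~: Q" using Q primeideal_one unfolding assoc_prime_def by blast
 hence zq: "z ~: q" using z by (auto simp: colon_iff)
 define T where "T = {v : RR. ALL u:Q. u \<otimes> v : q}"
 have T: "ideal T R"
 proof (rule idI)
  fix v c assume vc: "v : T" "c : RR"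
  have "u \<otimes> (c \<otimes> v) : q" if u: "u : Q" for u
  proof -
   have "u \<otimes> (c \<otimes> v) = c \<otimes> (u \<otimes> v)" using vc u Qi by (simp add: T_def id_simps m_lcomm)
   thus ?thesis using vc u q by (simp add: T_def id_simps)
  qed
  thus "c \<otimes> v : T" using vc by (simp add: T_def)
 qed (use q Qi in \<open>auto simp: T_def id_simps r_distr\<close>)
 have zT: "z : T" using z by (auto simp: T_def colon_iff)
 have qT: "q <= T" using q Qi by (auto simp: T_def id_simps)
 have "~ T <= addel q a"
 proof
  assume le: "T <= addel q a"
  have "T <= q <+> mm \<cdot> T"
  proof
   fix v assume v: "v : T"
   then obtain b w where bw: "b : q" "w : RR" "v = b \<oplus> w \<otimes> a" using le by (blast elim: addelE)
   have b: "b : RR" using bw q id_carr by blast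
   have "w : T" unfolding T_def
   proof (intro CollectI conjI bw ballI)
    fix u assume u: "u : Q"
    have uc: "u : RR" using u Qi id_carr by blast
    have "u \<otimes> v : q" using u v by (simp add: T_def)
    moreover have "a \<otimes> (u \<otimes> w) = u \<otimes> v \<ominus> u \<otimes> b" unfolding bw using uc b ac bw(2) by algebra
    ultimately have "a \<otimes> (u \<otimes> w) : q" using bw uc q by (simp add: id_simps)
    thus "u \<otimes> w : q" using a uc bw unfolding nzd_def by simp
   qed
   hence "a \<otimes> w : mm \<cdot> T" using a by (blast intro: ideal_prod.prod)
   moreover have "v = b \<oplus> a \<otimes> w" using bw ac by (simp add: m_comm)
   ultimately show "v : q <+> mm \<cdot> T" using bw by (auto simp: set_add_iff)
  qed
  hence "T <= q" using nakayama[OF T q] by blast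
  thus False using zT zq by blast
 qed
 then obtain v where v: "v : T" "v ~: addel q a" by blast
 have vc: "v : RR" using v by (simp add: T_def)
 obtain b where b: "b : RR" "assoc_prime (addel q a) (colon (addel q a) (b \<otimes> v))"
   "colon (addel q a) v <= colon (addel q a) (b \<otimes> v)"
  using assoc_prime_exists[OF qa vc v(2)] by blast
 have "Q <= colon (addel q a) v" using v Qi addel_sub[OF q ac] by (auto simp: T_def colon_iff id_simps)
 moreover have "a : colon (addel q a) v"
  using addel_mem[OF q ac] ac vc qa by (simp add: colon_iff id_multr)
 moreover have "a ~: Q" using nzd_assoc[OF a(2) Q q] .
 ultimately show ?thesis using b by blast
qed

text \<open>The depth of \<open>R/q\<close> is at most the dimension of \<open>R/Q\<close> for each
  associated prime \<open>Q\<close>. This is how the Cohen-Macaulay property will locate associated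
  primes in chains.\<close>

lemma dep_prime_chain:
 "ideal q R ==> assoc_prime q Q ==> dep q r ==> EX C. prime_chain R r C & C 0 = Q"
proof (induction r arbitrary: q Q)
 case 0
 have "primeideal Q R" using 0(2) by (rule assoc_prime_prime)
 hence "prime_chain R 0 (%_. Q)" unfolding prime_chain_def by simp
 thus ?case by blast
next
 case (Suc r)
 obtain a where a: "a : mm" "nzd q a" "dep (addel q a) r" using Suc.prems(3) by auto
 have ac: "a : RR" using a unfolding nzd_def by auto
 obtain Q' where Q': "assoc_prime (addel q a) Q'" "Q \<subset> Q'"
  using assoc_prime_lift[OF Suc.prems(1,2) a(1,2)] by blast
 obtain C where C: "prime_chain R r C" "C 0 = Q'"
  using Suc.IH[OF addel_ideal[OF Suc.prems(1) ac] Q'(1) a(3)] by blast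
 define D where "D i = (case i of 0 => Q | Suc j => C j)" for i
 have Qp: "primeideal Q R" using Suc.prems(2) by (rule assoc_prime_prime)
 have "prime_chain R (Suc r) D"
  unfolding prime_chain_def
 proof (intro conjI allI impI)
  fix i assume "i <= Suc r"
  thus "primeideal (D i) R" using C(1) Qp unfolding D_def prime_chain_def by (cases i) auto
 next
  fix i assume "i < Suc r"
  thus "D i \<subset> D (Suc i)" using C Q'(2) unfolding D_def prime_chain_def by (cases i) auto
 qed
 moreover have "D 0 = Q" by (simp add: D_def)
 ultimately show ?case by blast
qed

end

section \<open>Forms and their values\<close>

text \<open>A form of degree \<open>n\<close> in the variables \<open>0, \<dots>, s - 1\<close> is given by its coefficients, indexed by
  the monomials, which are multisets of size \<open>n\<close>.\<close>

definition Mon :: "nat => nat => nat multiset set"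
 where "Mon s n = {mu. set_mset mu <= {..<s} & size mu = n}"

lemma Mon_0 [simp]: "Mon s 0 = {{#}}"
 unfolding Mon_def by auto

lemma Mon_0_Suc [simp]: "Mon 0 (Suc n) = {}"
 unfolding Mon_def by auto

lemma Mon_mono: "s <= s' ==> Mon s n <= Mon s' n"
 unfolding Mon_def by auto

lemma Mon_add: "nu : Mon s n ==> i < s ==> add_mset i nu : Mon s (Suc n)"
 unfolding Mon_def by auto

lemma Mon_remove: "mu : Mon s (Suc n) ==> i :# mu ==> mu - {#i#} : Mon s n"
 unfolding Mon_def by (auto simp: size_Diff_singleton dest: in_diffD)

lemma Mon_notin: "mu : Mon s n ==> s ~:# mu"
 unfolding Mon_def by auto

lemma Mon_Suc: "Mon (Suc s) (Suc n) = Mon s (Suc n) Un add_mset s ` Mon (Suc s) n"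
proof
 show "Mon (Suc s) (Suc n) <= Mon s (Suc n) Un add_mset s ` Mon (Suc s) n"
 proof
  fix mu assume a: "mu : Mon (Suc s) (Suc n)"
  show "mu : Mon s (Suc n) Un add_mset s ` Mon (Suc s) n"
  proof (cases "s :# mu")
   case True
   hence "mu = add_mset s (mu - {#s#})" by simp
   thus ?thesis using Mon_remove[OF a True] by blast
  next
   case False
   thus ?thesis using a unfolding Mon_def by (force simp: less_Suc_eq)
  qed
 qed
qed (auto simp: Mon_mono[THEN subsetD, of s "Suc s"] Mon_add)

lemma finite_Mon: "finite (Mon s n)"
proof (induction s arbitrary: n)
 case 0 thus ?case by (cases n) auto
next
 case (Suc s)
 note * = this
 show ?case by (induction n) (auto simp: Mon_Suc *)
qed

text \<open>The rule follows the decomposition of a form of degree \<open>n + 1\<close> into the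
  part free of the last variable and the last variable times a form of degree
  \<open>n\<close>.\<close>

lemma two_step_induct [case_names deg0 vars0 step]:
 assumes "!!s. P s 0" "!!n. P 0 (Suc n)" "!!s n. P s (Suc n) ==> P (Suc s) n ==> P (Suc s) (Suc n)"
 shows "P s n"
proof (induction s arbitrary: n)
 case 0 thus ?case using assms by (cases n) auto
next
 case (Suc s)
 note * = this
 show ?case by (induction n) (auto intro: assms *)
qed

context cring
begin

definition point :: "(nat => 'a) => bool"
 where "point x \<longleftrightarrow> (ALL i. x i : RR)"

lemma pointD [simp]: "point x ==> x i : RR"
 unfolding point_def by simp

lemma horner_add:
 "a : RR ==> b : RR ==> c : RR ==> d : RR ==> y : RR ==>
  (a \<oplus> b) \<oplus> y \<otimes> (c \<oplus> d) = (a \<oplus> y \<otimes> c) \<oplus> (b \<oplus> y \<otimes> d)"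
 by algebra

lemma horner_mult:
 "a : RR ==> c : RR ==> e : RR ==> y : RR ==>
  e \<otimes> a \<oplus> y \<otimes> (e \<otimes> c) = e \<otimes> (a \<oplus> y \<otimes> c)"
 by algebra

lemma horner_mult_right:
 "a : RR ==> c : RR ==> e : RR ==> y : RR ==>
  a \<otimes> e \<oplus> y \<otimes> (c \<otimes> e) = (a \<oplus> y \<otimes> c) \<otimes> e"
 by algebra

text \<open>The sum of \<open>c mu\<close> times the monomial \<open>mu\<close> at \<open>x\<close>,
  with the last variable split off in Horner style. Compared with a sum over multisets, this
  recursion makes \<open>two_step_induct\<close> directly applicable.\<close>

fun ev :: "(nat => 'a) => nat => nat => (nat multiset => 'a) => 'a" where
 "ev x s 0 c = c {#}"
| "ev x 0 (Suc n) c = \<zero>"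
| "ev x (Suc s) (Suc n) c = ev x s (Suc n) c \<oplus> x s \<otimes> ev x (Suc s) n (%mu. c (add_mset s mu))"

definition form :: "'a set => nat => nat => (nat multiset => 'a) => bool"
 where "form Q s n c \<longleftrightarrow> (ALL mu:Mon s n. c mu : Q)"

lemma form_Suc: "form Q (Suc s) (Suc n) c \<longleftrightarrow> form Q s (Suc n) c & form Q (Suc s) n (%mu. c (add_mset s mu))"
 unfolding form_def Mon_Suc by auto

lemma form_mono: "form Q s n c ==> Q <= Q' ==> form Q' s n c"
 unfolding form_def by auto

lemma form_carr: "form Q s n c ==> ideal Q R ==> form (RR) s n c"
 using form_mono id_sub by blast

text \<open>\<open>U\<close> is any filtration that multiplication by the \<open>x i\<close> shifts
  by one. Powers of \<open>I\<close>, their products with \<open>mm\<close> and the ideals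
  \<open>vals x s n Q\<close> are the main cases.\<close>

lemma ev_graded:
 assumes U: "!!n. ideal (U n) R" and x: "!!i n u. i < s ==> u : U n ==> x i \<otimes> u : U (Suc n)"
 shows "form (U k) s n c ==> ev x s n c : U (k + n)"
 using x
proof (induction s n arbitrary: c rule: two_step_induct)
 case (vars0 n) thus ?case using U id_zero by simp
next
 case (step s n)
 have "ev x s (Suc n) c : U (k + Suc n)" using step.IH(1)[of c] step.prems by (simp add: form_Suc)
 moreover have "ev x (Suc s) n (%mu. c (add_mset s mu)) : U (k + n)"
  using step.IH(2)[of "%mu. c (add_mset s mu)"] step.prems by (simp add: form_Suc)
 hence "x s \<otimes> ev x (Suc s) n (%mu. c (add_mset s mu)) : U (k + Suc n)" using step.prems(2)[of s] by simp
 ultimately show ?case using id_add[OF U] by simp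
qed (simp add: form_def)

lemma ev_in:
 assumes "ideal Q R" "form Q s n c" "point x" shows "ev x s n c : Q"
proof -
 have "ev x s n c : (%_. Q) (0 + n)"
  by (rule ev_graded[of "%_. Q"]) (use assms id_mult[OF assms(1)] in auto)
 thus ?thesis by simp
qed

lemma ev_closed [simp]: "form (RR) s n c ==> point x ==> ev x s n c : RR"
 by (rule ev_in) (auto simp: oneideal)

lemma ev_cong: "(!!mu. mu : Mon s n ==> c mu = d mu) ==> ev x s n c = ev x s n d"
proof (induction s n arbitrary: c d rule: two_step_induct)
 case (step s n)
 have "ev x s (Suc n) c = ev x s (Suc n) d" by (rule step.IH(1), rule step.prems) (simp add: Mon_Suc)
 moreover have "ev x (Suc s) n (%mu. c (add_mset s mu)) = ev x (Suc s) n (%mu. d (add_mset s mu))"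
  by (rule step.IH(2), rule step.prems) (simp add: Mon_add)
 ultimately show ?case by simp
qed simp_all

lemma ev_point_cong: "(!!i. i < s ==> x i = y i) ==> ev x s n c = ev y s n c"
 by (induction s n arbitrary: c rule: two_step_induct) auto

lemma ev_zero: "point x ==> ev x s n (%_. \<zero>) = \<zero>"
 by (induction s n rule: two_step_induct) auto

lemma ev_add:
 assumes x: "point x"
 shows "form (RR) s n c ==> form (RR) s n d ==>
  ev x s n (%mu. c mu \<oplus> d mu) = ev x s n c \<oplus> ev x s n d"
proof (induction s n arbitrary: c d rule: two_step_induct)
 case (step s n)
 let ?A = "ev x s (Suc n) c" and ?B = "ev x s (Suc n) d" and ?C = "ev x (Suc s) n (%mu. c (add_mset s mu))"
  and ?D = "ev x (Suc s) n (%mu. d (add_mset s mu))"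
 have "?A : RR" "?B : RR" "?C : RR" "?D : RR" using step.prems x by (auto simp: form_Suc)
 hence "(?A \<oplus> ?B) \<oplus> x s \<otimes> (?C \<oplus> ?D) = (?A \<oplus> x s \<otimes> ?C) \<oplus> (?B \<oplus> x s \<otimes> ?D)"
  using x by (intro horner_add) auto
 thus ?case using step by (simp add: form_Suc)
qed (auto simp: form_def)

lemma ev_smult:
 assumes x: "point x" and a: "a : RR"
 shows "form (RR) s n c ==> ev x s n (%mu. a \<otimes> c mu) = a \<otimes> ev x s n c"
proof (induction s n arbitrary: c rule: two_step_induct)
 case (step s n)
 let ?A = "ev x s (Suc n) c" and ?C = "ev x (Suc s) n (%mu. c (add_mset s mu))"
 have "?A : RR" "?C : RR" using step.prems x by (auto simp: form_Suc)
 hence "a \<otimes> ?A \<oplus> x s \<otimes> (a \<otimes> ?C) = a \<otimes> (?A \<oplus> x s \<otimes> ?C)"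
  using x a by (intro horner_mult) auto
 thus ?case using step by (simp add: form_Suc)
qed (auto simp: a form_def)

lemma form_add: "ideal Q R ==> form Q s n c ==> form Q s n d ==> form Q s n (%mu. c mu \<oplus> d mu)"
 unfolding form_def by (simp add: id_add)

lemma form_smult: "ideal Q R ==> form Q s n c ==> a : RR ==> form Q s n (%mu. a \<otimes> c mu)"
 unfolding form_def by (simp add: id_mult)

lemma form_minus: "ideal Q R ==> form Q s n c ==> form Q s n d ==> form Q s n (%mu. c mu \<ominus> d mu)"
 unfolding form_def by (simp add: id_minus)

lemma ev_minus:
 assumes x: "point x" and "form (RR) s n c" "form (RR) s n d"
 shows "ev x s n (%mu. c mu \<ominus> d mu) = ev x s n c \<ominus> ev x s n d"
proof -
 have "ev x s n (%mu. c mu \<ominus> d mu) = ev x s n (%mu. c mu \<oplus> (\<ominus> \<one>) \<otimes> d mu)"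
  by (rule ev_cong) (use assms in \<open>auto simp: form_def minus_eq l_minus\<close>)
 also have "... = ev x s n c \<oplus> (\<ominus> \<one>) \<otimes> ev x s n d"
  using assms by (simp add: ev_add ev_smult form_smult oneideal)
 also have "... = ev x s n c \<ominus> ev x s n d" using assms by (simp add: minus_eq l_minus)
 finally show ?thesis .
qed

text \<open>For an ideal \<open>Q\<close> this is the ideal
  \<open>(x 0, ..., x (s - 1))^n Q\<close>, with membership expressed through coefficients.\<close>

definition vals :: "(nat => 'a) => nat => nat => 'a set => 'a set"
 where "vals x s n Q = {ev x s n c | c. form Q s n c}"

lemma valsI: "form Q s n c ==> ev x s n c : vals x s n Q"
 unfolding vals_def by blast

lemma valsE: assumes "u : vals x s n Q" obtains c where "form Q s n c" "u = ev x s n c"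
 using assms unfolding vals_def by blast

lemma vals_0 [simp]: "vals x s 0 Q = Q"
 unfolding vals_def form_def by auto

lemma vals_mono: "Q <= Q' ==> vals x s n Q <= vals x s n Q'"
 unfolding vals_def using form_mono by blast

lemma vals_ideal:
 assumes Q: "ideal Q R" and x: "point x"
 shows "ideal (vals x s n Q) R"
proof (rule idI)
 show "vals x s n Q <= RR" using x form_carr[OF _ Q] by (auto simp: vals_def)
 have "form Q s n (%_. \<zero>)" using id_zero[OF Q] by (simp add: form_def)
 thus "\<zero> : vals x s n Q" using valsI[of Q s n "%_. \<zero>" x] x by (simp add: ev_zero)
next
 fix a b assume "a : vals x s n Q" "b : vals x s n Q"
 then obtain c d where cd: "form Q s n c" "a = ev x s n c" "form Q s n d" "b = ev x s n d" by (elim valsE)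
 hence "a \<oplus> b = ev x s n (%mu. c mu \<oplus> d mu)" using x Q by (simp add: ev_add form_carr)
 thus "a \<oplus> b : vals x s n Q" using valsI[OF form_add[OF Q cd(1,3)]] by simp
next
 fix a e assume "a : vals x s n Q" and e: "e : RR"
 then obtain c where c: "form Q s n c" "a = ev x s n c" by (elim valsE)
 hence "e \<otimes> a = ev x s n (%mu. e \<otimes> c mu)" using x Q e by (simp add: ev_smult form_carr)
 thus "e \<otimes> a : vals x s n Q" using valsI[OF form_smult[OF Q c(1) e]] by simp
qed

text \<open>The product of the form \<open>c\<close> with the variable \<open>i\<close>.\<close>

definition shift :: "nat => (nat multiset => 'a) => nat multiset => 'a"
 where "shift i c mu = (if i :# mu then c (mu - {#i#}) else \<zero>)"

lemma form_shift: "\<zero> : Q ==> form Q s n c ==> form Q s (Suc n) (shift i c)"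
 unfolding form_def shift_def by (auto dest: Mon_remove)

lemma ev_shift:
 assumes x: "point x"
 shows "i < s ==> form (RR) s n c ==> ev x s (Suc n) (shift i c) = x i \<otimes> ev x s n c"
proof (induction s n arbitrary: c rule: two_step_induct)
 case (deg0 s)
 thus ?case
 proof (induction s)
  case (Suc s)
  have z: "ev x s (Suc 0) (shift s c) = \<zero>"
   using ev_cong[of s "Suc 0" "shift s c" "%_. \<zero>" x] ev_zero[OF x, of s "Suc 0"] Mon_notin by (auto simp: shift_def)
  have c: "c {#} : RR" using Suc.prems by (simp add: form_def)
  show ?case
  proof (cases "i = s")
   case True
   have "shift s c {#s#} = c {#}" by (simp add: shift_def)
   thus ?thesis using True z x c by simp
  next
   case False
   hence "ev x s (Suc 0) (shift i c) = x i \<otimes> c {#}" using Suc by (simp add: form_def)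
   moreover have "shift i c {#s#} = \<zero>" using False by (simp add: shift_def)
   ultimately show ?thesis using x c by simp
  qed
 qed simp
next
 case (step s n)
 have z: "ev x s (Suc (Suc n)) (shift s c) = \<zero>"
  using ev_cong[of s "Suc (Suc n)" "shift s c" "%_. \<zero>" x] ev_zero[OF x, of s "Suc (Suc n)"] Mon_notin by (auto simp: shift_def)
 let ?c = "%mu. c (add_mset s mu)"
 have c: "form (RR) s (Suc n) c" "form (RR) (Suc s) n ?c" using step.prems by (auto simp: form_Suc)
 show ?case
 proof (cases "i = s")
  case True
  have "ev x (Suc s) (Suc n) (%mu. shift s c (add_mset s mu)) = ev x (Suc s) (Suc n) c"
   by (rule ev_cong) (simp add: shift_def)
  hence "ev x (Suc s) (Suc (Suc n)) (shift i c) = x i \<otimes> ev x (Suc s) (Suc n) c"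
   using True z x step.prems(2) by (simp del: ev.simps(3) add: ev.simps(3)[of x s "Suc n"])
  thus ?thesis .
 next
  case False
  have e: "ev x (Suc s) (Suc n) (%mu. shift i c (add_mset s mu)) = ev x (Suc s) (Suc n) (shift i ?c)"
  proof (rule ev_cong)
   fix mu show "shift i c (add_mset s mu) = shift i ?c mu"
    using False by (auto simp: shift_def)
  qed
  have "ev x (Suc s) (Suc (Suc n)) (shift i c) = ev x s (Suc (Suc n)) (shift i c) \<oplus> x s \<otimes> ev x (Suc s) (Suc n) (shift i ?c)"
   by (subst ev.simps(3)) (simp only: e)
  also have "... = x i \<otimes> ev x s (Suc n) c \<oplus> x s \<otimes> (x i \<otimes> ev x (Suc s) n ?c)"
   using step.IH(1)[of c] step.IH(2)[of ?c] step.prems False c by simp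
  also have "... = x i \<otimes> (ev x s (Suc n) c \<oplus> x s \<otimes> ev x (Suc s) n ?c)"
   using ev_closed[OF c(1) x] ev_closed[OF c(2) x] x by (intro horner_mult) auto
  finally show ?thesis by simp
 qed
qed simp

lemma vals_shift:
 assumes "point x" "ideal Q R" "i < s" "u : vals x s n Q"
 shows "x i \<otimes> u : vals x s (Suc n) Q"
proof -
 obtain c where c: "form Q s n c" "u = ev x s n c" using assms(4) by (elim valsE)
 hence "x i \<otimes> u = ev x s (Suc n) (shift i c)" using ev_shift[OF assms(1,3)] form_carr assms(2) by simp
 thus ?thesis using valsI[OF form_shift[OF id_zero[OF assms(2)] c(1)]] by simp
qed

lemma vals_vars_mono:
 assumes "point x" "ideal Q R" "s <= s'"
 shows "vals x s n Q <= vals x s' n Q"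
proof
 fix u assume "u : vals x s n Q"
 then obtain c where "form Q s n c" "u = ev x s n c" by (elim valsE)
 thus "u : vals x s' n Q"
  using ev_graded[of "%n. vals x s' n Q" s x 0 n c] vals_ideal[OF assms(2,1)] vals_shift[OF assms(1,2)] assms(3) by auto
qed

text \<open>The product form does not depend on the point \<open>x\<close>.\<close>

lemma form_product:
 assumes L: "ideal L R" and Q: "Q <= RR" "Q' <= RR" "!!a b. a : Q ==> b : Q' ==> a \<otimes> b : L"
  and w: "form Q' s n w"
 shows "s' <= s ==> form Q s' k f ==> EX h. form L s (k + n) h &
  (ALL x. point x --> ev x s (k + n) h = ev x s' k f \<otimes> ev x s n w)"
proof (induction s' k arbitrary: f rule: two_step_induct)
 case (deg0 s')
 have f: "f {#} : Q" using deg0 by (simp add: form_def)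
 show ?case
  by (intro exI[of _ "%mu. f {#} \<otimes> w mu"] conjI allI impI)
   (use f w Q form_mono[OF w Q(2)] in \<open>auto simp: form_def ev_smult subsetD\<close>)
next
 case (vars0 k)
 show ?case
  by (intro exI[of _ "%mu. \<zero>"] conjI allI impI)
   (use id_zero[OF L] form_mono[OF w Q(2)] in \<open>auto simp: form_def ev_zero\<close>)
next
 case (step s' k)
 let ?f = "%mu. f (add_mset s' mu)"
 have f: "form Q s' (Suc k) f" "form Q (Suc s') k ?f" using step.prems by (auto simp: form_Suc)
 obtain h0 where h0: "form L s (Suc k + n) h0"
  "!!x. point x ==> ev x s (Suc k + n) h0 = ev x s' (Suc k) f \<otimes> ev x s n w"
  using step.IH(1)[OF _ f(1)] step.prems by auto
 obtain h1 where h1: "form L s (k + n) h1"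
  "!!x. point x ==> ev x s (k + n) h1 = ev x (Suc s') k ?f \<otimes> ev x s n w"
  using step.IH(2)[OF _ f(2)] step.prems by auto
 let ?h = "%mu. h0 mu \<oplus> shift s' h1 mu"
 have s: "form L s (Suc k + n) (shift s' h1)" using form_shift[OF id_zero[OF L] h1(1)] by simp
 have "form L s (Suc k + n) ?h" using form_add[OF L h0(1) s] .
 moreover have "ev x s (Suc k + n) ?h = ev x (Suc s') (Suc k) f \<otimes> ev x s n w" if x: "point x" for x
 proof -
  have c: "ev x s' (Suc k) f : RR" "ev x (Suc s') k ?f : RR" "ev x s n w : RR"
   using f x w Q form_mono by (metis ev_closed)+
  have "ev x s (Suc k + n) ?h = ev x s (Suc k + n) h0 \<oplus> ev x s (Suc (k + n)) (shift s' h1)"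
   using ev_add[of x s "Suc k + n" h0 "shift s' h1"] x h0(1) s L form_carr by simp
  also have "... = ev x s' (Suc k) f \<otimes> ev x s n w \<oplus> x s' \<otimes> (ev x (Suc s') k ?f \<otimes> ev x s n w)"
   using ev_shift[of x s' s "k + n" h1] x h0(2) h1 step.prems(1) form_carr[OF h1(1) L] by simp
  also have "... = (ev x s' (Suc k) f \<oplus> x s' \<otimes> ev x (Suc s') k ?f) \<otimes> ev x s n w"
   using c x by (intro horner_mult_right) auto
  finally show ?thesis by simp
 qed
 ultimately show ?case by blast
qed

fun gen :: "(nat => 'a) => nat => 'a set" where
 "gen x 0 = {\<zero>}"
| "gen x (Suc s) = addel (gen x s) (x s)"

lemma gen_ideal: "point x ==> ideal (gen x s) R"
 by (induction s) (auto simp: zeroideal addel_ideal)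

lemma gen_mono: "point x ==> s <= s' ==> gen x s <= gen x s'"
 by (rule lift_Suc_mono_le[of "gen x"]) (use addel_sub gen_ideal in auto)

lemma gen_mem: "point x ==> i < s ==> x i : gen x s"
 using addel_mem[OF gen_ideal, of x "x i" i] gen_mono[of x "Suc i" s] by auto

lemma gen_least: "ideal L R ==> (!!i. i < s ==> x i : L) ==> gen x s <= L"
 proof (induction s)
 case (Suc s)
 thus ?case using addel_least[OF Suc.prems(1), of "gen x s" "x s"] by simp
qed (simp add: id_zero)

lemma gen_eq_vals:
 assumes x: "point x"
 shows "gen x s = vals x s 1 (RR)"
proof
 show "gen x s <= vals x s 1 (RR)"
 proof (rule gen_least[OF vals_ideal[OF oneideal x]])
  fix i assume "i < s"
  thus "x i : vals x s 1 (RR)" using vals_shift[OF x oneideal, of i s \<one> 0] x by simp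
 qed
 show "vals x s 1 (RR) <= gen x s"
 proof
  fix u assume "u : vals x s 1 (RR)"
  then obtain c where c: "form (RR) s 1 c" "u = ev x s 1 c" by (elim valsE)
  let ?U = "%n. case n of 0 => RR | Suc _ => gen x s"
  have "ev x s 1 c : ?U (0 + 1)"
  proof (rule ev_graded)
   show "ideal (?U n) R" for n using gen_ideal[of x s] x by (cases n) (auto simp: oneideal)
   show "form (?U 0) s 1 c" using c by simp
   fix i n u assume *: "i < s" "u : ?U n"
   hence "u : RR" using id_carr[OF gen_ideal[of x s]] x by (cases n) auto
   thus "x i \<otimes> u : ?U (Suc n)" using *(1) gen_mem[of x i s] id_multr[OF gen_ideal[of x s]] x by simp
  qed
  thus "u : gen x s" using c by simp
 qed
qed

text \<open>One variable of each monomial of degree \<open>n + 1\<close> can be absorbed into the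
  coefficient, which then lies in the ideal generated by the \<open>x i\<close>.\<close>

lemma gen_vals:
 assumes x: "point x"
 shows "vals x s n (gen x s) = vals x s (Suc n) (RR)"
proof
 show "vals x s n (gen x s) <= vals x s (Suc n) (RR)"
 proof
  fix u assume "u : vals x s n (gen x s)"
  then obtain c where c: "form (gen x s) s n c" "u = ev x s n c" by (elim valsE)
  have "ev x s n c : vals x s (1 + n) (RR)"
   by (rule ev_graded[where U = "%n. vals x s n (RR)"])
    (use c vals_ideal[OF oneideal x] vals_shift[OF x oneideal] gen_eq_vals[OF x] in auto)
  thus "u : vals x s (Suc n) (RR)" using c by simp
 qed
 show "vals x s (Suc n) (RR) <= vals x s n (gen x s)"
 proof (induction s)
  case 0
  have "u = \<zero>" if "u : vals x 0 (Suc n) (RR)" for u using that by (auto elim: valsE)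
  moreover have "ideal (vals x 0 n (gen x 0)) R" by (rule vals_ideal[OF gen_ideal[OF x] x])
  ultimately show ?case using id_zero by (metis subsetI)
 next
  case (Suc s)
  have gi: "ideal (gen x (Suc s)) R" using gen_ideal x by blast
  show ?case
  proof
   fix u assume "u : vals x (Suc s) (Suc n) (RR)"
   then obtain c where c: "form (RR) (Suc s) (Suc n) c" "u = ev x (Suc s) (Suc n) c" by (elim valsE)
   let ?c = "%mu. c (add_mset s mu)"
   have c': "form (RR) s (Suc n) c" "form (RR) (Suc s) n ?c" using c(1) by (auto simp: form_Suc)
   have "ev x s (Suc n) c : vals x (Suc s) n (gen x (Suc s))"
    using valsI[OF c'(1)] Suc vals_vars_mono[OF x gen_ideal[OF x], of s "Suc s" n s]
     vals_mono[of "gen x s" "gen x (Suc s)" x "Suc s" n] gen_mono[OF x, of s "Suc s"] by auto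
   moreover have "ev x (Suc s) n (%mu. x s \<otimes> ?c mu) : vals x (Suc s) n (gen x (Suc s))"
    by (rule valsI) (use c'(2) gen_mem[OF x, of s "Suc s"] id_multr[OF gi] in \<open>auto simp: form_def\<close>)
   hence "x s \<otimes> ev x (Suc s) n ?c : vals x (Suc s) n (gen x (Suc s))" using ev_smult[OF x pointD[OF x, of s] c'(2)] by simp
   ultimately show "u : vals x (Suc s) n (gen x (Suc s))" using id_add[OF vals_ideal[OF gi x]] c by simp
  qed
 qed
qed

lemma gen_mult_vals:
 assumes x: "point x" and Q: "ideal Q R" and j: "j : gen x s" and u: "u : vals x s n Q"
 shows "j \<otimes> u : vals x s (Suc n) Q"
proof -
 have uc: "u : RR" using u vals_ideal[OF Q x] id_carr by blast
 note V = vals_ideal[OF Q x, of s "Suc n"]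
 have "gen x s <= colon (vals x s (Suc n) Q) u"
  by (rule gen_least[OF colon_ideal[OF V uc]]) (use vals_shift[OF x Q _ u] x in \<open>auto simp: colon_iff\<close>)
 thus ?thesis using j by (auto simp: colon_iff)
qed

end

section \<open>Regular sequences are quasi-regular\<close>

context cring
begin

text \<open>The contraction to \<open>R\<close> of the extension of \<open>Q\<close> to the
  localization at \<open>S\<close>. Local statements are made and proved in \<open>R\<close> through
  it; for \<open>S = {\<one>}\<close> they are the global ones.\<close>

definition sat :: "'a set => 'a set => 'a set"
 where "sat S Q = {a : RR. EX u:S. u \<otimes> a : Q}"

definition mult_set :: "'a set => bool"
 where "mult_set S \<longleftrightarrow> S <= RR & \<one> : S & (ALL a:S. ALL b:S. a \<otimes> b : S)"

lemma mult_setD: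
 assumes "mult_set S"
 shows "a : S ==> a : RR" "\<one> : S" "a : S ==> b : S ==> a \<otimes> b : S"
 using assms unfolding mult_set_def by auto

lemma satI: "a : RR ==> u : S ==> u \<otimes> a : Q ==> a : sat S Q"
 unfolding sat_def by blast

lemma satE: assumes "a : sat S Q" obtains u where "u : S" "u \<otimes> a : Q" "a : RR"
 using assms unfolding sat_def by blast

lemma sat_one: "ideal Q R ==> sat {\<one>} Q = Q"
 unfolding sat_def using id_carr by auto

lemma sat_mono: "Q <= Q' ==> sat S Q <= sat S Q'"
 unfolding sat_def by blast

lemma sat_sub: "mult_set S ==> ideal Q R ==> Q <= sat S Q"
 using satI[of _ \<one> S Q] id_carr[of Q] by (auto simp: mult_setD)

lemma sat_ideal:
 assumes S: "mult_set S" and Q: "ideal Q R" shows "ideal (sat S Q) R"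
proof (rule idI)
 note SD = mult_setD[OF S]
 show "sat S Q <= RR" by (auto simp: sat_def)
 show "\<zero> : sat S Q" using satI[of \<zero> \<one> S Q] SD id_zero[OF Q] by simp
next
 note SD = mult_setD[OF S]
 fix a b assume "a : sat S Q" "b : sat S Q"
 then obtain u v where *: "u : S" "u \<otimes> a : Q" "a : RR" "v : S" "v \<otimes> b : Q" "b : RR" by (elim satE)
 note c = SD(1)[OF *(1)] SD(1)[OF *(4)]
 have "(u \<otimes> v) \<otimes> (a \<oplus> b) = v \<otimes> (u \<otimes> a) \<oplus> u \<otimes> (v \<otimes> b)" using * c by algebra
 also have "... : Q" using * c Q by (simp add: id_add id_mult)
 finally show "a \<oplus> b : sat S Q" using satI[of "a \<oplus> b" "u \<otimes> v" S Q] * SD by simp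
next
 fix a c assume "a : sat S Q" and c: "c : RR"
 then obtain u where *: "u : S" "u \<otimes> a : Q" "a : RR" by (elim satE)
 have uc: "u : RR" using *(1) S by (simp add: mult_setD)
 have "u \<otimes> (c \<otimes> a) = c \<otimes> (u \<otimes> a)" using * uc c by algebra
 thus "c \<otimes> a : sat S Q" using satI[of "c \<otimes> a" u S Q] * c id_mult[OF Q *(2) c] by simp
qed

lemma sat_cancel:
 assumes "mult_set S" "u : S" "a : RR" "u \<otimes> a : sat S Q"
 shows "a : sat S Q"
proof -
 obtain v where v: "v : S" "v \<otimes> (u \<otimes> a) : Q" using assms(4) by (elim satE)
 hence "(v \<otimes> u) \<otimes> a : Q" using assms by (simp add: mult_setD m_assoc)
 thus ?thesis using satI[of a "v \<otimes> u" S Q] assms v by (simp add: mult_setD)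
qed

lemma sat_common:
 assumes S: "mult_set S" and Q: "ideal Q R" and "finite B" "!!b. b : B ==> c b : sat S Q"
 shows "EX u:S. ALL b:B. u \<otimes> c b : Q"
 using assms(3,4)
proof (induction B rule: finite_induct)
 case empty thus ?case using mult_setD[OF S] by auto
next
 case (insert b B)
 then obtain u where u: "u : S" "!!b. b : B ==> u \<otimes> c b : Q" by auto
 have "c b : sat S Q" using insert by simp
 then obtain v where v: "v : S" "v \<otimes> c b : Q" "c b : RR" by (elim satE)
 have uv: "u : RR" "v : RR" using u v S by (auto simp: mult_setD)
 have "(v \<otimes> u) \<otimes> c e : Q" if "e : insert b B" for e
 proof (cases "e = b")
  case True
  hence "(v \<otimes> u) \<otimes> c e = u \<otimes> (v \<otimes> c b)" using uv v(3) by (simp add: m_lcomm m_assoc)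
  thus ?thesis using id_mult[OF Q v(2) uv(1)] by simp
 next
  case False
  hence e: "e : B" using that by simp
  hence "c e : RR" using insert(4)[of e] by (auto simp: sat_def)
  hence "(v \<otimes> u) \<otimes> c e = v \<otimes> (u \<otimes> c e)" using uv by (simp add: m_assoc)
  thus ?thesis using id_mult[OF Q u(2)[OF e] uv(2)] by simp
 qed
 thus ?case using u v mult_setD[OF S] by blast
qed

text \<open>The images of \<open>x 0, ..., x (s - 1)\<close> in the localization at \<open>S\<close>
  are successively regular.\<close>

definition regular_upto :: "'a set => (nat => 'a) => nat => bool"
 where "regular_upto S x s \<longleftrightarrow>
  (ALL i<s. ALL a:RR. x i \<otimes> a : sat S (gen x i) --> a : sat S (gen x i))"

lemma vals_antimono:
 assumes x: "point x" shows "vals x s (Suc n) (RR) <= vals x s n (RR)"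
 unfolding gen_vals[OF x, symmetric] using vals_mono[OF id_sub[OF gen_ideal[OF x]]] .

text \<open>A value in the next power is, up to a denominator, the value of a form with coefficients
  in \<open>gen x s\<close>. Subtracting that form reduces the claim to forms with value
  zero.\<close>

lemma quasi_regular_aux:
 assumes S: "mult_set S" and x: "point x"
  and q: "!!c. form (RR) s n c ==> ev x s n c : sat S {\<zero>} ==> form (sat S (gen x s)) s n c"
  and c: "form (RR) s n c" "ev x s n c : sat S (vals x s (Suc n) (RR))"
 shows "form (sat S (gen x s)) s n c"
proof -
 note gi = gen_ideal[OF x, of s]
 obtain u where u: "u : S" "u \<otimes> ev x s n c : vals x s (Suc n) (RR)" using c(2) by (elim satE)
 have uc: "u : RR" using u S by (simp add: mult_setD)
 obtain e where e: "form (gen x s) s n e" "u \<otimes> ev x s n c = ev x s n e"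
  using u(2) unfolding gen_vals[OF x, symmetric] by (elim valsE)
 note ec = form_carr[OF e(1) gi]
 note uf = form_smult[OF oneideal c(1) uc]
 have ze: "ev x s n (%mu. u \<otimes> c mu \<ominus> e mu) = \<zero>"
  using ev_minus[OF x uf ec] ev_smult[OF x uc c(1)] e(2) ev_closed[OF ec x] by (simp add: minus_eq r_neg)
 have zs: "\<zero> : sat S {\<zero>}" using id_zero[OF sat_ideal[OF S zeroideal]] .
 have f: "form (sat S (gen x s)) s n (%mu. u \<otimes> c mu \<ominus> e mu)"
  by (rule q[OF form_minus[OF oneideal uf ec]]) (simp add: ze zs)
 show ?thesis unfolding form_def
 proof
  fix mu assume a: "mu : Mon s n"
  have "u \<otimes> c mu \<ominus> e mu : sat S (gen x s)" "e mu : sat S (gen x s)" "c mu : RR" "e mu : RR"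
   using f e(1) a sat_sub[OF S gi] c(1) ec by (auto simp: form_def)
  hence "u \<otimes> c mu : sat S (gen x s)"
   using id_minus_cancel[OF sat_ideal[OF S gi], of "u \<otimes> c mu" "e mu"] uc by simp
  thus "c mu : sat S (gen x s)" using sat_cancel[OF S u(1)] \<open>c mu : RR\<close> by blast
 qed
qed

text \<open>Represent \<open>u a\<close> by a form. By quasi-regularity the coefficients of
  \<open>y\<close> times this form lie in the saturated ideal, where \<open>y\<close> cancels
  coefficient by coefficient; this moves \<open>a\<close> from one power into the next.\<close>

lemma regular_mod_power:
 assumes S: "mult_set S" and x: "point x" and y: "y : RR"
  and reg: "!!a. a : RR ==> y \<otimes> a : sat S (gen x s) ==> a : sat S (gen x s)"
  and q: "!!n c. form (RR) s n c ==> ev x s n c : sat S {\<zero>} ==> form (sat S (gen x s)) s n c"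
  and a: "a : RR"
 shows "y \<otimes> a : sat S (vals x s n (RR)) ==> a : sat S (vals x s n (RR))"
proof (induction n)
 case 0
 thus ?case using a sat_sub[OF S oneideal] by auto
next
 case (Suc n)
 have "a : sat S (vals x s n (RR))"
  using Suc sat_mono[OF vals_antimono[OF x]] by blast
 then obtain u where u: "u : S" "u \<otimes> a : vals x s n (RR)" by (elim satE)
 have uc: "u : RR" using u S by (simp add: mult_setD)
 obtain c where c: "form (RR) s n c" "u \<otimes> a = ev x s n c" using u(2) by (elim valsE)
 have "ev x s n (%mu. y \<otimes> c mu) = u \<otimes> (y \<otimes> a)" using ev_smult[OF x y c(1)] m_lcomm[OF y uc a] by (simp add: c(2))
 also have "... : sat S (vals x s (Suc n) (RR))"
  using id_mult[OF sat_ideal[OF S vals_ideal[OF oneideal x]] Suc.prems uc] .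
 finally have "form (sat S (gen x s)) s n (%mu. y \<otimes> c mu)"
  using quasi_regular_aux[OF S x q form_smult[OF oneideal c(1) y]] by blast
 hence "!!mu. mu : Mon s n ==> c mu : sat S (gen x s)" using reg c(1) unfolding form_def by blast
 then obtain v where v: "v : S" "!!mu. mu : Mon s n ==> v \<otimes> c mu : gen x s"
  using sat_common[OF S gen_ideal[OF x] finite_Mon] by metis
 have vc: "v : RR" using v S by (simp add: mult_setD)
 have "ev x s n (%mu. v \<otimes> c mu) : vals x s n (gen x s)" by (rule valsI) (use v in \<open>simp add: form_def\<close>)
 hence "(v \<otimes> u) \<otimes> a : vals x s (Suc n) (RR)"
  using ev_smult[OF x vc c(1)] c(2) vc uc a gen_vals[OF x] by (simp add: m_assoc)
 thus ?case using satI[OF a, of "v \<otimes> u"] u v S by (simp add: mult_setD)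
qed

text \<open>Induction on the number of variables, then on the degree. In a relation
  \<open>C + x s E = 0\<close> the element \<open>x s\<close> cancels modulo the power generated by
  the others, so \<open>E\<close> is, up to a denominator, the value of a form \<open>h\<close> in
  the first \<open>s\<close> variables, and \<open>c + x s h\<close> is a relation in fewer
  variables.\<close>

lemma quasi_regular_zero:
 assumes S: "mult_set S" and x: "point x"
 shows "regular_upto S x s ==> form (RR) s n c ==> ev x s n c : sat S {\<zero>} ==> form (sat S (gen x s)) s n c"
proof (induction s arbitrary: n c)
 case 0
 thus ?case
  by (cases n) (auto simp: form_def)
next
 case (Suc s)
 have rs: "regular_upto S x s" using Suc.prems(1) by (simp add: regular_upto_def)
 note IH = Suc.IH[OF rs]
 have reg: "!!a. a : RR ==> x s \<otimes> a : sat S (gen x s) ==> a : sat S (gen x s)"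
  using Suc.prems(1) by (simp add: regular_upto_def)
 have gm: "sat S (gen x s) <= sat S (gen x (Suc s))" by (rule sat_mono[OF gen_mono[OF x]]) simp
 have si: "ideal (sat S (gen x (Suc s))) R" by (rule sat_ideal[OF S gen_ideal[OF x]])
 show ?case using Suc.prems(2,3)
 proof (induction n arbitrary: c)
  case 0
  thus ?case using sat_mono[of "{\<zero>}" "gen x (Suc s)"] id_zero[OF gen_ideal[OF x, of "Suc s"]]
   by (auto simp: form_def)
 next
  case (Suc n)
  let ?c = "%mu. c (add_mset s mu)"
  let ?E = "ev x (Suc s) n ?c"
  have c: "form (RR) s (Suc n) c" "form (RR) (Suc s) n ?c" using Suc.prems by (auto simp: form_Suc)
  have E: "?E : RR" and C: "ev x s (Suc n) c : RR" using c x by simp_all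
  have "ev x s (Suc n) c \<oplus> x s \<otimes> ?E : sat S (vals x s (Suc n) (RR))"
   using Suc.prems(2) sat_mono[of "{\<zero>}" "vals x s (Suc n) (RR)" S] id_zero[OF vals_ideal[OF oneideal x, of s "Suc n"]] by auto
  moreover have "ev x s (Suc n) c : sat S (vals x s (Suc n) (RR))"
   using valsI[OF c(1)] sat_sub[OF S vals_ideal[OF oneideal x]] by blast
  ultimately have "x s \<otimes> ?E : sat S (vals x s (Suc n) (RR))"
   using id_add_cancel(2)[OF sat_ideal[OF S vals_ideal[OF oneideal x]]] E x by simp
  hence E2: "?E : sat S (vals x s (Suc n) (RR))"
   using regular_mod_power[OF S x pointD[OF x] reg IH E] by blast
  \<comment> \<open>\<open>?E\<close> comes from a form of degree \<open>n\<close> but lies in the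
    power \<open>n + 1\<close>; the induction on the degree puts the coefficients of that form into
    the ideal.\<close>
  hence "?E : sat S (vals x (Suc s) (Suc n) (RR))"
   using sat_mono[OF vals_vars_mono[OF x oneideal, of s "Suc s" "Suc n"]] by auto
  hence f1: "form (sat S (gen x (Suc s))) (Suc s) n ?c"
   using quasi_regular_aux[OF S x Suc.IH c(2)] by blast
  obtain u where u: "u : S" "u \<otimes> ?E : vals x s (Suc n) (RR)" using E2 by (elim satE)
  have uc: "u : RR" using u S by (simp add: mult_setD)
  obtain h where h: "form (RR) s (Suc n) h" "u \<otimes> ?E = ev x s (Suc n) h" using u(2) by (elim valsE)
  note uf = form_smult[OF oneideal c(1) uc] and xf = form_smult[OF oneideal h(1) pointD[OF x, of s]]
  have "ev x s (Suc n) (%mu. u \<otimes> c mu \<oplus> x s \<otimes> h mu) = u \<otimes> ev x s (Suc n) c \<oplus> x s \<otimes> (u \<otimes> ?E)"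
   using ev_add[OF x uf xf] ev_smult[OF x uc c(1)] ev_smult[OF x pointD[OF x] h(1)] h(2) by simp
  also have "... = u \<otimes> ev x (Suc s) (Suc n) c" using horner_mult[OF C E uc pointD[OF x, of s]] by simp
  also have "... : sat S {\<zero>}" using id_mult[OF sat_ideal[OF S zeroideal] Suc.prems(2) uc] .
  finally have f0: "form (sat S (gen x s)) s (Suc n) (%mu. u \<otimes> c mu \<oplus> x s \<otimes> h mu)"
   using IH[OF form_add[OF oneideal uf xf]] by blast
  have "c mu : sat S (gen x (Suc s))" if a: "mu : Mon s (Suc n)" for mu
  proof -
   have cc: "c mu : RR" "h mu : RR" using a c h by (auto simp: form_def)
   have "x s \<otimes> h mu : gen x (Suc s)" using gen_mem[OF x, of s "Suc s"] id_multr[OF gen_ideal[OF x]] cc by blast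
   hence "x s \<otimes> h mu : sat S (gen x (Suc s))" using sat_sub[OF S gen_ideal[OF x]] by blast
   moreover have "u \<otimes> c mu \<oplus> x s \<otimes> h mu : sat S (gen x (Suc s))" using f0 a gm by (auto simp: form_def)
   ultimately have "u \<otimes> c mu : sat S (gen x (Suc s))" using id_add_cancel(1)[OF si] uc cc by simp
   thus ?thesis using sat_cancel[OF S u(1) cc(1)] by blast
  qed
  thus ?case using f1 unfolding form_Suc by (simp add: form_def)
 qed
qed

theorem quasi_regular:
 assumes "mult_set S" "point x" "regular_upto S x s" "form (RR) s n c"
  "ev x s n c : sat S (vals x s (Suc n) (RR))"
 shows "form (sat S (gen x s)) s n c"
 using quasi_regular_aux[OF assms(1,2) quasi_regular_zero[OF assms(1-3)] assms(4,5)] by blast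

lemma mult_set_one: "mult_set {\<one>}"
 by (auto simp: mult_set_def)

text \<open>The case \<open>j = 0\<close> with value zero is the aim: relations among
  \<open>x 0, ..., x r\<close> over \<open>I\<close> have coefficients in the ideal these elements
  generate, although \<open>x r\<close> is regular on \<open>I\<close> only. The power of
  \<open>x r\<close> makes the induction on the degree run, since splitting off the terms divisible
  by \<open>x r\<close> raises it by one.\<close>

lemma relation_coeffs:
 assumes x: "point x" and reg: "!!i. i < r ==> nzd (gen x i) (x i)"
  and I: "ideal I R" "gen x (Suc r) <= I"
  and last: "!!w. w : I ==> x r \<otimes> w : gen x r ==> w : gen x r"
 shows "form I (Suc r) n h ==> x r [^] (j::nat) \<otimes> ev x (Suc r) n h : vals x r (Suc n) (RR) ==>
  ev x (Suc r) n h : vals x r (Suc n) (RR) & form (gen x (Suc r)) (Suc r) n h"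
proof -
 have gI: "gen x r <= I" using gen_mono[OF x, of r "Suc r"] I(2) by simp
 have reg': "regular_upto {\<one>} x r"
  unfolding regular_upto_def using reg by (simp add: sat_one gen_ideal[OF x] nzd_def)
 have lastp: "w : gen x r" if "w : I" "x r [^] k \<otimes> w : gen x r" for w and k :: nat
  using that
 proof (induction k arbitrary: w)
  case 0 thus ?case using id_carr[OF I(1)] by simp
 next
  case (Suc k)
  have wc: "w : RR" using Suc.prems id_carr[OF I(1)] by blast
  have "x r [^] k \<otimes> (x r \<otimes> w) : gen x r" using Suc.prems(2) x wc by (simp add: m_assoc)
  thus ?case using Suc.IH[of "x r \<otimes> w"] last[OF Suc.prems(1)] id_mult[OF I(1) Suc.prems(1)] x by simp
 qed
 show "form I (Suc r) n h ==> x r [^] (j::nat) \<otimes> ev x (Suc r) n h : vals x r (Suc n) (RR) ==>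
  ev x (Suc r) n h : vals x r (Suc n) (RR) & form (gen x (Suc r)) (Suc r) n h"
 proof (induction n arbitrary: h j)
  case 0
  have w: "h {#} : I" using 0 by (simp add: form_def)
  have "x r [^] j \<otimes> h {#} : gen x r" using 0(2) gen_eq_vals[OF x] by simp
  hence "h {#} : gen x r" using lastp w by blast
  thus ?case using gen_mono[OF x, of r "Suc r"] gen_eq_vals[OF x, of r] by (auto simp: form_def)
 next
  case (Suc n)
  let ?h = "%mu. h (add_mset r mu)"
  let ?E = "ev x (Suc r) n ?h" and ?X = "x r [^] j"
  have h: "form I r (Suc n) h" "form I (Suc r) n ?h" using Suc.prems(1) by (auto simp: form_Suc)
  note hc = form_carr[OF h(1) I(1)] form_carr[OF h(2) I(1)]
  have X: "?X : RR" using x by simp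
  have E: "?E : RR" and C: "ev x r (Suc n) h : RR" using ev_closed[OF hc(1) x] ev_closed[OF hc(2) x] by auto
  note V = vals_ideal[OF oneideal x, of r "Suc n"]
  have "?X \<otimes> ev x r (Suc n) h \<oplus> x r [^] Suc j \<otimes> ?E = ?X \<otimes> ev x (Suc r) (Suc n) h"
   using X E C pointD[OF x, of r] by (simp add: r_distr m_assoc)
  also have "... : vals x r (Suc n) (RR)" using Suc.prems(2) vals_antimono[OF x] by blast
  finally have "x r [^] Suc j \<otimes> ?E : vals x r (Suc n) (RR)"
   using id_add_cancel(2)[OF V, of "x r [^] Suc j \<otimes> ?E" "?X \<otimes> ev x r (Suc n) h"] id_mult[OF V valsI[OF hc(1)] X] E x by simp
  hence E2: "?E : vals x r (Suc n) (RR)" and f1: "form (gen x (Suc r)) (Suc r) n ?h"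
   using Suc.IH[OF h(2)] by blast+
  obtain e where e: "form (RR) r (Suc n) e" "?E = ev x r (Suc n) e" using E2 by (elim valsE)
  note xf = form_smult[OF oneideal e(1) pointD[OF x, of r]]
  \<comment> \<open>As \<open>?E\<close> is the value of a form \<open>e\<close> of degree
    \<open>n + 1\<close> in the first \<open>r\<close> variables, \<open>x r\<close> can be treated
    as a coefficient: \<open>?g\<close> has the value of \<open>h\<close> without involving the last
    variable, and quasi-regularity applies to it.\<close>
  let ?g = "%mu. h mu \<oplus> x r \<otimes> e mu"
  have gc: "form (RR) r (Suc n) ?g" using form_add[OF oneideal hc(1) xf] .
  have evg: "ev x r (Suc n) ?g = ev x (Suc r) (Suc n) h"
   using ev_add[OF x hc(1) xf] ev_smult[OF x pointD[OF x] e(1)] e(2) by simp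
  have "ev x r (Suc n) (%mu. ?X \<otimes> ?g mu) : sat {\<one>} (vals x r (Suc (Suc n)) (RR))"
   using ev_smult[OF x X gc] evg Suc.prems(2) by (simp add: sat_one vals_ideal[OF oneideal x])
  hence "form (sat {\<one>} (gen x r)) r (Suc n) (%mu. ?X \<otimes> ?g mu)"
   by (rule quasi_regular[OF mult_set_one x reg' form_smult[OF oneideal gc X]])
  hence f2: "form (gen x r) r (Suc n) (%mu. ?X \<otimes> ?g mu)" by (simp add: sat_one gen_ideal[OF x])
  have xI: "x r : I" using I(2) gen_mem[OF x, of r "Suc r"] by auto
  have f3: "?g mu : gen x r" if a: "mu : Mon r (Suc n)" for mu
  proof (rule lastp)
   show "?X \<otimes> ?g mu : gen x r" using f2 a by (simp add: form_def)
   show "?g mu : I" using h(1) e(1) a I(1) xI by (simp add: form_def id_add id_multr)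
  qed
  hence "ev x (Suc r) (Suc n) h : vals x r (Suc (Suc n)) (RR)"
   unfolding evg[symmetric] gen_vals[OF x, symmetric] by (intro valsI) (simp add: form_def)
  moreover have "h mu : gen x (Suc r)" if a: "mu : Mon r (Suc n)" for mu
  proof -
   have "?g mu : gen x (Suc r)" using f3[OF a] gen_mono[OF x, of r "Suc r"] by auto
   moreover have "x r \<otimes> e mu : gen x (Suc r)"
    using gen_mem[OF x, of r "Suc r"] id_multr[OF gen_ideal[OF x]] e(1) a by (simp add: form_def del: gen.simps)
   ultimately show ?thesis using id_add_cancel(1)[OF gen_ideal[OF x], of "h mu" "x r \<otimes> e mu" "Suc r"] hc(1) a by (simp add: form_def)
  qed
  ultimately show ?case using f1 unfolding form_Suc by (simp add: form_def)
 qed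
qed

end

context local_noeth
begin

lemma vals_mm_prod:
 assumes x: "point x" and I: "ideal I R"
 shows "vals x s n (mm \<cdot> I) = mm \<cdot> vals x s n I"
proof
 have mI: "ideal (mm \<cdot> I) R" using ideal_prod_is_ideal[OF mm_ideal I] .
 show "mm \<cdot> vals x s n I <= vals x s n (mm \<cdot> I)"
 proof
  fix u assume "u : mm \<cdot> vals x s n I"
  thus "u : vals x s n (mm \<cdot> I)"
  proof (induction u rule: ideal_prod.induct)
   case (prod a v)
   obtain c where c: "form I s n c" "v = ev x s n c" using prod(2) by (elim valsE)
   have "a \<otimes> v = ev x s n (%mu. a \<otimes> c mu)"
    using ev_smult[OF x _ form_carr[OF c(1) I]] c(2) id_carr[OF mm_ideal prod(1)] by simp
   moreover have "form (mm \<cdot> I) s n (%mu. a \<otimes> c mu)"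
    using c(1) prod(1) by (auto simp: form_def intro: ideal_prod.prod)
   ultimately show ?case using valsI by simp
  next
   case (sum s1 s2) thus ?case using id_add[OF vals_ideal[OF mI x]] by blast
  qed
 qed
 show "vals x s n (mm \<cdot> I) <= mm \<cdot> vals x s n I"
 proof
  fix u assume "u : vals x s n (mm \<cdot> I)"
  then obtain c where c: "form (mm \<cdot> I) s n c" "u = ev x s n c" by (elim valsE)
  have "ev x s n c : mm \<cdot> vals x s (0 + n) I"
  proof (rule ev_graded[where U = "%n. mm \<cdot> vals x s n I"])
   show "ideal (mm \<cdot> vals x s n I) R" for n using ideal_prod_is_ideal[OF mm_ideal vals_ideal[OF I x]] .
   show "form (mm \<cdot> vals x s 0 I) s n c" using c by simp
   fix i n u assume i: "i < s" and u: "u : mm \<cdot> vals x s n I"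
   note mv = ideal_prod_is_ideal[OF mm_ideal vals_ideal[OF I x]]
   from u show "x i \<otimes> u : mm \<cdot> vals x s (Suc n) I"
   proof (induction u rule: ideal_prod.induct)
    case (prod a v)
    have "a : RR" "v : RR" using prod id_carr[OF mm_ideal] id_carr[OF vals_ideal[OF I x]] by blast+
    hence "x i \<otimes> (a \<otimes> v) = a \<otimes> (x i \<otimes> v)" using x by (simp add: m_lcomm)
    thus ?case using ideal_prod.prod[OF prod(1) vals_shift[OF x I i prod(2)]] by simp
   next
    case (sum s1 s2)
    have "s1 : RR" "s2 : RR" using sum(1,2) id_carr[OF mv] by blast+
    thus ?case using sum x id_add[OF mv] by (simp add: r_distr)
   qed
  qed
  thus "u : mm \<cdot> vals x s n I" using c by simp
 qed
qed

end

section \<open>Values of forms over an infinite residue field\<close>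

context cring
begin

fun horner :: "nat => (nat => 'a) => 'a => 'a" where
 "horner 0 b t = b 0"
| "horner (Suc n) b t = b 0 \<oplus> t \<otimes> horner n (%k. b (Suc k)) t"

lemma horner_closed [simp]: "point b ==> t : RR ==> horner n b t : RR"
 by (induction n arbitrary: b) (auto simp: point_def)

lemma horner_cong: "(!!j. j <= n ==> b j = c j) ==> horner n b t = horner n c t"
proof (induction n arbitrary: b c)
 case (Suc n)
 have "horner n (%k. b (Suc k)) t = horner n (%k. c (Suc k)) t" by (rule Suc.IH) (simp add: Suc.prems)
 thus ?case using Suc.prems[of 0] by simp
qed simp

text \<open>Division by \<open>t - s\<close>, the remainder being the value at \<open>s\<close>. The
  last clause is used in contraposition: a coefficient outside \<open>I\<close> survives in the
  quotient if the value at \<open>s\<close> lies in \<open>I\<close>.\<close>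

lemma horner_divide:
 assumes I: "ideal I R" and s: "s : RR"
 shows "point b ==> EX q. point q & (ALL t:RR. horner (Suc n) b t = horner (Suc n) b s \<oplus> (t \<ominus> s) \<otimes> horner n q t)
  & (horner (Suc n) b s : I --> (ALL k<=n. q k : I) --> (ALL k<=Suc n. b k : I))"
proof (induction n arbitrary: b)
 case 0
 have c: "b 0 : RR" "b (Suc 0) : RR" using 0 by auto
 have e: "b 0 \<oplus> t \<otimes> b (Suc 0) = (b 0 \<oplus> s \<otimes> b (Suc 0)) \<oplus> (t \<ominus> s) \<otimes> b (Suc 0)" if "t : RR" for t
  using that c s by algebra
 have z: "ALL k<=Suc 0. b k : I" if "b 0 \<oplus> s \<otimes> b (Suc 0) : I" "b (Suc 0) : I"
  using that id_add_cancel(1)[OF I c(1) id_mult[OF I that(2) s]] by (simp add: le_Suc_eq)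
 show ?case
 proof (intro exI[of _ "%_. b (Suc 0)"] conjI ballI impI)
  show "point (%_. b (Suc 0))" using c by (simp add: point_def)
  show "horner (Suc 0) b t = horner (Suc 0) b s \<oplus> (t \<ominus> s) \<otimes> horner 0 (%_. b (Suc 0)) t" if "t : RR" for t
   unfolding horner.simps by (rule e[OF that])
  assume a: "horner (Suc 0) b s : I" "ALL k<=(0::nat). b (Suc 0) : I"
  have "b 0 \<oplus> s \<otimes> b (Suc 0) : I" using a(1) by simp
  moreover have "b (Suc 0) : I" using a(2) by blast
  ultimately show "ALL k<=Suc 0. b k : I" by (rule z)
 qed
next
 case (Suc n)
 let ?b = "%k. b (Suc k)"
 have b: "point ?b" using Suc.prems by (simp add: point_def)
 obtain q where q: "point q" "!!t. t : RR ==> horner (Suc n) ?b t = horner (Suc n) ?b s \<oplus> (t \<ominus> s) \<otimes> horner n q t"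
  "horner (Suc n) ?b s : I ==> ALL k<=n. q k : I ==> ALL k<=Suc n. ?b k : I" using Suc.IH[OF b] by blast
 define p where "p = (%k. case k of 0 => horner (Suc n) ?b s | Suc k => q k)"
 have p: "point p" "p 0 = horner (Suc n) ?b s" "!!k. p (Suc k) = q k"
  using q(1) b s unfolding p_def by (auto simp: point_def split: nat.split simp del: horner.simps)
 have h: "horner (Suc n) p t = horner (Suc n) ?b s \<oplus> t \<otimes> horner n q t" for t
  using p by simp
 have 1: "horner (Suc (Suc n)) b t = horner (Suc (Suc n)) b s \<oplus> (t \<ominus> s) \<otimes> horner (Suc n) p t" if t: "t : RR" for t
 proof -
  have gen: "B0 \<oplus> t \<otimes> (H \<oplus> (t \<ominus> s) \<otimes> Q) = (B0 \<oplus> s \<otimes> H) \<oplus> (t \<ominus> s) \<otimes> (H \<oplus> t \<otimes> Q)"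
   if "B0 : RR" "H : RR" "Q : RR" for B0 H Q using that t s by algebra
  have "horner (Suc (Suc n)) b t = b 0 \<oplus> t \<otimes> (horner (Suc n) ?b s \<oplus> (t \<ominus> s) \<otimes> horner n q t)"
   unfolding horner.simps(2)[of "Suc n"] q(2)[OF t] ..
  also have "... = (b 0 \<oplus> s \<otimes> horner (Suc n) ?b s) \<oplus> (t \<ominus> s) \<otimes> (horner (Suc n) ?b s \<oplus> t \<otimes> horner n q t)"
   by (rule gen) (use Suc.prems b q(1) s t in \<open>auto simp del: horner.simps\<close>)
  finally show ?thesis unfolding h horner.simps(2)[of "Suc n"] .
 qed
 have 2: "ALL k<=Suc (Suc n). b k : I" if *: "horner (Suc (Suc n)) b s : I" "ALL k<=Suc n. p k : I"
 proof -
  have p0: "horner (Suc n) ?b s : I" using *(2)[rule_format, of 0] unfolding p(2) by (simp only: le0)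
  have "q k : I" if "k <= n" for k using *(2)[rule_format, of "Suc k"] that unfolding p(3) by (simp only: Suc_le_mono)
  hence bs: "ALL k<=Suc n. ?b k : I" by (intro q(3)[OF p0] allI impI)
  have "b 0 \<oplus> s \<otimes> horner (Suc n) ?b s : I" using *(1) by (simp only: horner.simps(2)[of "Suc n"])
  hence "b 0 : I" using id_add_cancel(1)[OF I pointD[OF Suc.prems] id_mult[OF I p0 s]] by blast
  show ?thesis
  proof (intro allI impI)
   fix k assume "k <= Suc (Suc n)"
   thus "b k : I" using bs \<open>b 0 : I\<close> by (cases k) auto
  qed
 qed
 show ?case using p(1) 1 2 by blast
qed

end

context local_inf
begin

text \<open>The bound on the number of roots, counted in residue classes: a root \<open>s\<close>
  costs one class, because elsewhere \<open>t - s\<close> is a unit, and the quotient has smaller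
  degree and still a coefficient outside \<open>L\<close>.\<close>

lemma horner_bad:
 assumes L: "ideal L R"
 shows "point b ==> EX k<=n. b k ~: L ==>
  EX T. finite T & T <= RR & (ALL t:RR. (ALL s:T. t \<ominus> s ~: mm) --> horner n b t ~: L)"
proof (induction n arbitrary: b)
 case 0 thus ?case by (intro exI[of _ "{}"]) auto
next
 case (Suc n)
 show ?case
 proof (cases "EX s:RR. horner (Suc n) b s : L")
  case False thus ?thesis by (intro exI[of _ "{}"]) auto
 next
  case True
  then obtain s where s: "s : RR" "horner (Suc n) b s : L" by blast
  obtain q where q: "point q" "!!t. t : RR ==> horner (Suc n) b t = horner (Suc n) b s \<oplus> (t \<ominus> s) \<otimes> horner n q t"
   "ALL k<=n. q k : L ==> ALL k<=Suc n. b k : L" using horner_divide[OF L s(1) Suc.prems(1), of n] s(2) by blast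
  then obtain T where T: "finite T" "T <= RR" "!!t. t : RR ==> (ALL s:T. t \<ominus> s ~: mm) ==> horner n q t ~: L"
   using Suc.IH[OF q(1)] Suc.prems(2) by blast
  have "horner (Suc n) b t ~: L" if t: "t : RR" "ALL s':insert s T. t \<ominus> s' ~: mm" for t
  proof
   assume a: "horner (Suc n) b t : L"
   have c: "(t \<ominus> s) \<otimes> horner n q t : RR" "horner n q t : RR" "t \<ominus> s : RR" using t s q(1) by auto
   have "(t \<ominus> s) \<otimes> horner n q t : L" using a id_add_cancel(2)[OF L c(1) s(2)] q(2)[OF t(1)] by simp
   thus False using unit_cancel[OF L c(3) _ c(2)] T(3) t by blast
  qed
  thus ?thesis using T(1,2) s(1) by (intro exI[of _ "insert s T"]) auto
 qed
qed

lemma ev_last_var: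
 "ev (x(s := t)) (Suc s) n f = horner n (%k. ev x s (n - k) (%mu. f (mu + replicate_mset k s))) t"
proof (induction n arbitrary: f)
 case (Suc n)
 have "ev (x(s := t)) s (Suc n) f = ev x s (Suc n) f" by (rule ev_point_cong) simp
 moreover have "ev (x(s := t)) (Suc s) n (%mu. f (add_mset s mu)) =
   horner n (%k. ev x s (n - k) (%mu. f (mu + replicate_mset (Suc k) s))) t"
  unfolding Suc by simp
 ultimately show ?case by (simp del: fun_upd_apply add: fun_upd_same)
qed simp

lemma form_last_var:
 "~ form Q (Suc s) n f ==> EX k<=n. ~ form Q s (n - k) (%mu. f (mu + replicate_mset k s))"
proof (induction n arbitrary: f)
 case 0 thus ?case by (simp add: form_def)
next
 case (Suc n)
 show ?case
 proof (cases "form Q s (Suc n) f")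
  case False thus ?thesis by (intro exI[of _ 0]) simp
 next
  case True
  hence "~ form Q (Suc s) n (%mu. f (add_mset s mu))" using Suc.prems by (simp add: form_Suc)
  then obtain k where "k <= n" "~ form Q s (n - k) (%mu. f (add_mset s (mu + replicate_mset k s)))" using Suc.IH by blast
  thus ?thesis by (intro exI[of _ "Suc k"]) simp
 qed
qed

lemma form_last_var_carrier:
 assumes "form Q (Suc s) n f" "k <= n" shows "form Q s (n - k) (%mu. f (mu + replicate_mset k s))"
 unfolding form_def
proof
 fix mu assume "mu : Mon s (n - k)"
 hence "mu + replicate_mset k s : Mon (Suc s) n" using assms(2) unfolding Mon_def by (auto split: if_splits)
 thus "f (mu + replicate_mset k s) : Q" using assms(1) unfolding form_def by blast
qed

text \<open>\<open>f'\<close> is a coefficient of \<open>f\<close> as a polynomial in the last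
  variable. It is fixed before the point \<open>x\<close>, so that two forms can be handled at a
  common point.\<close>

lemma form_nonvanishing_step:
 assumes L: "ideal L R" and f: "form (RR) (Suc s) n f" "~ form L (Suc s) n f"
 shows "EX k f'. form (RR) s k f' & ~ form L s k f' & (ALL x. point x --> ev x s k f' ~: L -->
  (EX T. finite T & T <= RR & (ALL t:RR. (ALL s:T. t \<ominus> s ~: mm) --> ev (x(s := t)) (Suc s) n f ~: L)))"
proof -
 let ?f = "%k mu. f (mu + replicate_mset k s)"
 obtain k where k: "k <= n" "~ form L s (n - k) (?f k)" using form_last_var[OF f(2)] by blast
 have "EX T. finite T & T <= RR & (ALL t:RR. (ALL s:T. t \<ominus> s ~: mm) --> ev (x(s := t)) (Suc s) n f ~: L)"
  if x: "point x" "ev x s (n - k) (?f k) ~: L" for x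
 proof -
  define b where "b j = (if j <= n then ev x s (n - j) (?f j) else \<zero>)" for j
  have b: "point b" using form_last_var_carrier[OF f(1)] x(1) by (auto simp: point_def b_def)
  have "ev (x(s := t)) (Suc s) n f = horner n b t" for t unfolding ev_last_var by (rule horner_cong) (simp add: b_def)
  moreover have "EX k<=n. b k ~: L" using k(1) x(2) by (auto simp: b_def)
  ultimately show ?thesis using horner_bad[OF L b, of n] by presburger
 qed
 thus ?thesis using form_last_var_carrier[OF f(1) k(1)] k(2) by blast
qed

text \<open>Two forms, modulo two ideals, are treated at once because products of forms will be
  studied through the product of their values at one point. A last coordinate outside the finitely
  many bad classes of both serves.\<close>

lemma form_nonvanishing:
 assumes L: "ideal L R" "ideal L' R"
 shows "form (RR) s n f ==> ~ form L s n f ==> form (RR) s m g ==> ~ form L' s m g ==>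
  EX x. point x & ev x s n f ~: L & ev x s m g ~: L'"
proof (induction s arbitrary: n f m g)
 case 0
 hence "n = 0" "f {#} ~: L" "m = 0" "g {#} ~: L'" by (cases n; cases m; auto simp: form_def)+
 thus ?case by (intro exI[of _ "%_. \<zero>"]) (auto simp: point_def)
next
 case (Suc s)
 from form_nonvanishing_step[OF L(1) Suc.prems(1,2)] obtain k f' where f': "form (RR) s k f'" "~ form L s k f'"
  "!!x. point x ==> ev x s k f' ~: L ==>
   EX T. finite T & T <= RR & (ALL t:RR. (ALL s:T. t \<ominus> s ~: mm) --> ev (x(s := t)) (Suc s) n f ~: L)" by blast
 from form_nonvanishing_step[OF L(2) Suc.prems(3,4)] obtain l g' where g': "form (RR) s l g'" "~ form L' s l g'"
  "!!x. point x ==> ev x s l g' ~: L' ==>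
   EX T. finite T & T <= RR & (ALL t:RR. (ALL s:T. t \<ominus> s ~: mm) --> ev (x(s := t)) (Suc s) m g ~: L')" by blast
 obtain x where x: "point x" "ev x s k f' ~: L" "ev x s l g' ~: L'" using Suc.IH[OF f'(1,2) g'(1,2)] by blast
 obtain T T' where T: "finite (T Un T')" "T Un T' <= RR"
  "!!t. t : RR ==> ALL s:T Un T'. t \<ominus> s ~: mm ==> ev (x(s := t)) (Suc s) n f ~: L & ev (x(s := t)) (Suc s) m g ~: L'"
  using f'(3)[OF x(1,2)] g'(3)[OF x(1,3)] by (metis Un_iff finite_UnI sup.bounded_iff)
 obtain t where t: "t : RR" "ALL s:T Un T'. t \<ominus> s ~: mm" using fresh_residue[OF T(1,2)] by blast
 have "point (x(s := t))" using x(1) t(1) by (auto simp: point_def)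
 thus ?case using T(3)[OF t] by blast
qed

text \<open>At a point where neither factor vanishes, the value of \<open>f\<close> is a unit, so
  the value of the product is outside \<open>L\<close>, and then so is some coefficient. Thus
  multiplication by a nonzero form over the residue field is injective on forms over
  \<open>I\<close> modulo \<open>L\<close>.\<close>

lemma form_product_nonzero:
 assumes I: "ideal I R" and L: "ideal L R"
  and f: "form (RR) s k f" "~ form mm s k f" and w: "form I s n w" "~ form L s n w"
 obtains h where "form I s (k + n) h" "~ form L s (k + n) h" "!!x. point x ==> ev x s (k + n) h = ev x s k f \<otimes> ev x s n w"
proof -
 note wc = form_carr[OF w(1) I]
 obtain x where x: "point x" "ev x s k f ~: mm" "ev x s n w ~: L"
  using form_nonvanishing[OF mm_ideal L f wc w(2)] by blast
 obtain h where h: "form I s (k + n) h" "!!x. point x ==> ev x s (k + n) h = ev x s k f \<otimes> ev x s n w"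
  using form_product[OF I subset_refl id_sub[OF I] id_mult[OF I] w(1) order_refl f(1)] by blast
 have "~ form L s (k + n) h"
  using ev_in[OF L _ x(1)] h(2)[OF x(1)] unit_cancel[OF L ev_closed[OF f(1) x(1)] x(2) ev_closed[OF wc x(1)]] x(3) by metis
 thus ?thesis using that h by blast
qed

end

section \<open>Powers of ideals\<close>

context cring
begin

definition ipow :: "'a set => nat => 'a set"
 where "ipow I n = ideal_pow R I n"

lemma ipow_0 [simp]: "ipow I 0 = RR"
 by (simp add: ipow_def ideals_set_def)

lemma pow_Suc: "ipow I (Suc n) = ipow I n \<cdot> I"
 using monoid.nat_pow_Suc[OF comm_monoid.axioms(1)[OF ideals_set_is_comm_monoid], of I n]
 by (simp add: ipow_def ideals_set_def)

lemma pow_ideal: "ideal I R ==> ideal (ipow I n) R"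
 by (induction n) (simp_all add: pow_Suc oneideal ideal_prod_is_ideal)

lemma pow_Suc2: "ideal I R ==> ipow I (Suc n) = I \<cdot> ipow I n"
 by (simp add: pow_Suc ideal_prod_commute pow_ideal)

lemma pow_1: "ideal I R ==> ipow I (Suc 0) = I"
 using pow_Suc2[of I 0] by (simp add: ideal_prod_one)

lemma pow_add:
 assumes "ideal I R" shows "ipow I (m + n) = ipow I m \<cdot> ipow I n"
proof (induction n)
 case 0 thus ?case using ideal_prod_one[OF pow_ideal[OF assms]] by simp
next
 case (Suc n)
 thus ?case using assms by (simp add: pow_Suc ideal_prod_assoc pow_ideal)
qed

lemma pow_mult: "ideal I R ==> a : ipow I m ==> b : ipow I n ==> a \<otimes> b : ipow I (m + n)"
 unfolding pow_add by (rule ideal_prod.prod)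

lemma prod_mono: "I <= I' ==> J <= J' ==> I \<cdot> J <= I' \<cdot> J'"
proof
 fix u assume "I <= I'" "J <= J'" "u : I \<cdot> J"
 from this(3,1,2) show "u : I' \<cdot> J'" by (induction u rule: ideal_prod.induct) (auto intro: ideal_prod.intros)
qed

lemma pow_mono: "J <= I ==> ipow J n <= ipow I n"
 by (induction n) (simp_all add: pow_Suc prod_mono)

lemma prod_least:
 assumes "ideal L R" "!!a b. a : I ==> b : J ==> a \<otimes> b : L"
 shows "I \<cdot> J <= L"
proof
 fix u assume "u : I \<cdot> J"
 thus "u : L" by (induction u rule: ideal_prod.induct) (use assms(2) id_add[OF assms(1)] in auto)
qed

lemma set_add_least: "ideal L R ==> I <= L ==> J <= L ==> I <+> J <= L"
 by (auto simp: set_add_iff subset_iff id_add)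

lemma set_add_sub1: "ideal I R ==> ideal J R ==> I <= I <+> J"
proof
 fix a assume "ideal I R" "ideal J R" "a : I"
 hence "a = a \<oplus> \<zero>" "\<zero> : J" using id_carr[of I a] id_zero[of J] by simp_all
 thus "a : I <+> J" using \<open>a : I\<close> set_add_iff by blast
qed

lemma set_add_sub2: "ideal I R ==> ideal J R ==> J <= I <+> J"
proof
 fix a assume "ideal I R" "ideal J R" "a : J"
 hence "a = \<zero> \<oplus> a" "\<zero> : I" using id_carr[of J a] id_zero[of I] by simp_all
 thus "a : I <+> J" using \<open>a : J\<close> set_add_iff by blast
qed

lemma prod_sub: "ideal I R ==> ideal J R ==> I \<cdot> J <= J"
 using ideal_prod_inter by blast

lemma ev_scale:
 assumes "point x" "b : RR"
 shows "form (RR) s n f ==> ev (%j. b \<otimes> x j) s n f = b [^] n \<otimes> ev x s n f"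
proof (induction s n arbitrary: f rule: two_step_induct)
 case (step s n)
 let ?f = "%mu. f (add_mset s mu)"
 have f: "form (RR) s (Suc n) f" "form (RR) (Suc s) n ?f" using step.prems by (auto simp: form_Suc)
 have gen: "b [^] n \<otimes> b \<otimes> A \<oplus> (b \<otimes> y) \<otimes> (b [^] n \<otimes> B) = b [^] n \<otimes> b \<otimes> (A \<oplus> y \<otimes> B)"
  if "A : RR" "B : RR" "y : RR" for A B y
 proof -
  obtain B' where B': "B' = b [^] n" "B' : RR" using assms by simp
  show ?thesis unfolding B'(1)[symmetric] using B'(2) assms(2) that by algebra
 qed
 show ?case using step.IH(1)[OF f(1)] step.IH(2)[OF f(2)] gen[OF ev_closed[OF f(1) assms(1)] ev_closed[OF f(2) assms(1)] pointD[OF assms(1)]] by simp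
qed (auto simp: form_def assms)

text \<open>Telescoping: for coordinates in \<open>I\<close> that agree modulo \<open>K\<close>,
  products of \<open>n\<close> of them differ by elements of \<open>K I^(n - 1)\<close>.\<close>

lemma ev_diff:
 assumes I: "ideal I R" and K: "ideal K R" and xz: "!!j. x j : I" "!!j. z j : I" "!!j. x j \<ominus> z j : K"
 shows "form (RR) s n f ==>
  ev x s n f \<ominus> ev z s n f : (case n of 0 => {\<zero>} | Suc k => K \<cdot> ipow I k)"
proof (induction s n arbitrary: f rule: two_step_induct)
 case (deg0 s) thus ?case by (simp add: form_def a_minus_def r_neg)
next
 case (vars0 n)
 thus ?case using id_zero[OF ideal_prod_is_ideal[OF K pow_ideal[OF I]]] by (simp add: a_minus_def)
next
 case (step s n)
 let ?f = "%mu. f (add_mset s mu)"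
 have f: "form (RR) s (Suc n) f" "form (RR) (Suc s) n ?f" using step.prems by (auto simp: form_Suc)
 have px: "point x" "point z" using xz id_carr[OF I] by (auto simp: point_def)
 note c = ev_closed[OF f(1) px(1)] ev_closed[OF f(1) px(2)] ev_closed[OF f(2) px(1)] ev_closed[OF f(2) px(2)]
  pointD[OF px(1), of s] pointD[OF px(2), of s]
 note KI = ideal_prod_is_ideal[OF K pow_ideal[OF I], of n]
 have gen: "(A \<oplus> a \<otimes> B) \<ominus> (A' \<oplus> a' \<otimes> B') = (A \<ominus> A') \<oplus> (a \<otimes> (B \<ominus> B') \<oplus> (a \<ominus> a') \<otimes> B')"
  if "A : RR" "A' : RR" "B : RR" "B' : RR" "a : RR" "a' : RR" for A A' B B' a a'
  using that by algebra
 have "x s \<otimes> (ev x (Suc s) n ?f \<ominus> ev z (Suc s) n ?f) : K \<cdot> ipow I n"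
 proof (cases n)
  case 0
  thus ?thesis using step.IH(2)[OF f(2)] c(5) id_zero[OF KI] by simp
 next
  case (Suc k)
  note KIk = ideal_prod_is_ideal[OF K pow_ideal[OF I], of k]
  have "I \<cdot> (K \<cdot> ipow I k) = K \<cdot> ipow I (Suc k)"
   unfolding pow_Suc2[OF I] using ideal_prod_assoc[OF I K pow_ideal[OF I, of k]] ideal_prod_assoc[OF K I pow_ideal[OF I, of k]]
    ideal_prod_commute[OF I K] by simp
  thus ?thesis using ideal_prod.prod[OF xz(1)[of s], of _ "K \<cdot> ipow I k"] step.IH(2)[OF f(2)] Suc by force
 qed
 moreover have "(x s \<ominus> z s) \<otimes> ev z (Suc s) n ?f : K \<cdot> ipow I n"
 proof (rule ideal_prod.prod[OF xz(3)])
  have "ev z (Suc s) n ?f : ipow I (0 + n)"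
   by (rule ev_graded[where U = "ipow I"])
    (use pow_ideal[OF I] f(2) ideal_prod.prod[OF xz(2)] pow_Suc2[OF I] in auto)
  thus "ev z (Suc s) n ?f : ipow I n" by simp
 qed
 ultimately show ?case using step.IH(1)[OF f(1)] gen[OF c] id_add[OF KI] by simp
qed

lemma finsum_in_ideal:
 assumes "ideal K R" "finite A" "!!i. i : A ==> g i : K" shows "(\<Oplus>i\<in>A. g i) : K"
 using assms(2,3)
proof (induction A rule: finite_induct)
 case (insert i A)
 have "g : A \<rightarrow> RR" "g i : RR" using insert id_carr[OF assms(1)] by auto
 thus ?case using insert id_add[OF assms(1)] by (simp add: finsum_insert)
qed (simp add: id_zero[OF assms(1)])

lemma finsum_swap_linear:
 assumes "finite K" "finite L" "!!k l. w k l : RR" "!!k. rh k : RR" "!!l. l : L ==> u l : RR"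
 shows "(\<Oplus>k\<in>K. rh k \<otimes> (\<Oplus>l\<in>L. w k l \<otimes> u l)) = (\<Oplus>l\<in>L. (\<Oplus>k\<in>K. w k l \<otimes> rh k) \<otimes> u l)"
 using assms(1)
proof (induction K rule: finite_induct)
 case empty thus ?case using assms(5) finsum_zero finsum_cong'[of L L "%_. \<zero>" "%l. \<zero> \<otimes> u l"] by simp
next
 case (insert k K)
 have s: "(\<Oplus>k\<in>K. w k l \<otimes> rh k) : RR" for l by (rule finsum_closed) (use assms in auto)
 have "(\<Oplus>l\<in>L. (\<Oplus>k\<in>insert k K. w k l \<otimes> rh k) \<otimes> u l) = (\<Oplus>l\<in>L. rh k \<otimes> (w k l \<otimes> u l) \<oplus> (\<Oplus>k\<in>K. w k l \<otimes> rh k) \<otimes> u l)"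
 proof (rule finsum_cong')
  fix l assume l: "l : L"
  have "(\<Oplus>k\<in>insert k K. w k l \<otimes> rh k) = w k l \<otimes> rh k \<oplus> (\<Oplus>k\<in>K. w k l \<otimes> rh k)"
   using insert assms(3,4) by (simp add: finsum_insert)
  moreover have "(w k l \<otimes> rh k \<oplus> z) \<otimes> u l = rh k \<otimes> (w k l \<otimes> u l) \<oplus> z \<otimes> u l" if "z : RR" for z
   using assms(3)[of k l] assms(4)[of k] assms(5)[OF l] that by algebra
  ultimately show "(\<Oplus>k\<in>insert k K. w k l \<otimes> rh k) \<otimes> u l = rh k \<otimes> (w k l \<otimes> u l) \<oplus> (\<Oplus>k\<in>K. w k l \<otimes> rh k) \<otimes> u l"
   using s by simp
 qed (use assms s in auto)
 also have "... = (\<Oplus>l\<in>L. rh k \<otimes> (w k l \<otimes> u l)) \<oplus> (\<Oplus>l\<in>L. (\<Oplus>k\<in>K. w k l \<otimes> rh k) \<otimes> u l)"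
  by (rule finsum_addf) (use assms s in auto)
 also have "(\<Oplus>l\<in>L. rh k \<otimes> (w k l \<otimes> u l)) = rh k \<otimes> (\<Oplus>l\<in>L. w k l \<otimes> u l)"
  by (rule finsum_rdistr[symmetric]) (use assms in auto)
 finally have e: "(\<Oplus>l\<in>L. (\<Oplus>k\<in>insert k K. w k l \<otimes> rh k) \<otimes> u l) = rh k \<otimes> (\<Oplus>l\<in>L. w k l \<otimes> u l) \<oplus> (\<Oplus>k\<in>K. rh k \<otimes> (\<Oplus>l\<in>L. w k l \<otimes> u l))"
  using insert.IH by simp
 have "(\<Oplus>l\<in>L. w k l \<otimes> u l) : RR" for k by (rule finsum_closed) (use assms in auto)
 thus ?case unfolding e using insert assms by (intro finsum_insert) auto
qed

text \<open>Determinant trick: the unknowns are eliminated one at a time, and the coefficient of the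
  unknown that is eliminated stays in \<open>G\<close>.\<close>

lemma elimination:
 fixes g :: "nat => 'a"
 assumes Q: "ideal Q R" and GH: "G <= RR" "H <= RR" "\<one> : G"
  and GG: "!!a b. a : G ==> b : G ==> a \<otimes> b : G" and GmH: "!!a b. a : G ==> b : H ==> a \<ominus> b : G"
  and HH: "!!a b. a : H ==> b : H ==> a \<oplus> b : H" "!!a b. a : H ==> b : H ==> a \<otimes> b : H"
  and GHm: "!!a b. a : G ==> b : H ==> a \<otimes> b : H"
  and g: "!!l. g l : RR"
 shows "(!!l. l < n ==> u l : G) ==> (!!l m. l < n ==> m < n ==> h l m : H) ==>
  (!!l. l < n ==> u l \<otimes> g l \<ominus> (\<Oplus>m\<in>{..<n}. h l m \<otimes> g m) : Q) ==> EX v:G. ALL l<n. v \<otimes> g l : Q"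
proof (induction n arbitrary: u h)
 case 0 thus ?case using GH by auto
next
 case (Suc n)
 note u = Suc.prems(1) and h = Suc.prems(2) and rel = Suc.prems(3)
 have c: "!!l. l < Suc n ==> u l : RR" "!!l m. l < Suc n ==> m < Suc n ==> h l m : RR"
  using u h GH by blast+
 define w where "w = u n \<ominus> h n n"
 have w: "w : G" "w : RR" unfolding w_def using GmH[OF u h] GH by auto
 define \<sigma> where "\<sigma> l = (\<Oplus>m\<in>{..<n}. h l m \<otimes> g m)" for l
 have sc: "\<sigma> l : RR" if "l < Suc n" for l unfolding \<sigma>_def by (rule finsum_closed) (use that c g in auto)
 have split: "(\<Oplus>m\<in>{..<Suc n}. h l m \<otimes> g m) = h l n \<otimes> g n \<oplus> \<sigma> l" if "l < Suc n" for l
 proof -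
  have 1: "(%m. h l m \<otimes> g m) : {..<n} \<rightarrow> RR" using that c g by auto
  have 2: "h l n \<otimes> g n : RR" using that c g by auto
  show ?thesis unfolding \<sigma>_def lessThan_Suc using finsum_insert[OF _ _ 1 2] by simp
 qed
 have reln: "w \<otimes> g n \<ominus> \<sigma> n : Q"
 proof -
  have "w \<otimes> g n \<ominus> \<sigma> n = u n \<otimes> g n \<ominus> (h n n \<otimes> g n \<oplus> \<sigma> n)"
   unfolding w_def
   using c(1)[OF lessI] c(2)[OF lessI lessI] g[of n] sc[OF lessI] by algebra
  thus ?thesis using rel[of n] split[of n] by simp
 qed
 \<comment> \<open>Relation \<open>l\<close> times \<open>w\<close>, with \<open>w g n\<close>
   replaced by means of relation \<open>n\<close>, has these coefficients. They stay in
   \<open>H\<close> because products of \<open>G\<close> with \<open>H\<close> and of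
   \<open>H\<close> with \<open>H\<close> do.\<close>
 define h' where "h' l m = w \<otimes> h l m \<oplus> h l n \<otimes> h n m" for l m
 have "EX v:G. ALL l<n. v \<otimes> g l : Q"
 proof (rule Suc.IH[of "%l. w \<otimes> u l" h'])
  show "w \<otimes> u l : G" if "l < n" for l using that u w GG by simp
  show "h' l m : H" if "l < n" "m < n" for l m
   unfolding h'_def by (intro HH GHm w h) (use that in auto)
  fix l assume l: "l < n"
  have "(\<Oplus>m\<in>{..<n}. h' l m \<otimes> g m) = (\<Oplus>m\<in>{..<n}. w \<otimes> (h l m \<otimes> g m) \<oplus> h l n \<otimes> (h n m \<otimes> g m))"
   by (rule finsum_cong')
    (use l c(2)[of l] c(2)[of n] g w(2) in \<open>auto simp: h'_def l_distr m_assoc\<close>)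
  also have "... = (\<Oplus>m\<in>{..<n}. w \<otimes> (h l m \<otimes> g m)) \<oplus> (\<Oplus>m\<in>{..<n}. h l n \<otimes> (h n m \<otimes> g m))"
   by (rule finsum_addf) (use l c g w in auto)
  also have "... = w \<otimes> \<sigma> l \<oplus> h l n \<otimes> \<sigma> n"
  proof -
   have "(%m. h l m \<otimes> g m) : {..<n} \<rightarrow> RR" "(%m. h n m \<otimes> g m) : {..<n} \<rightarrow> RR" "h l n : RR"
    using l c g by auto
   thus ?thesis unfolding \<sigma>_def using w(2) by (simp add: finsum_rdistr)
  qed
  finally have s: "(\<Oplus>m\<in>{..<n}. h' l m \<otimes> g m) = w \<otimes> \<sigma> l \<oplus> h l n \<otimes> \<sigma> n" .
  have "w \<otimes> (u l \<otimes> g l \<ominus> (h l n \<otimes> g n \<oplus> \<sigma> l)) \<oplus> h l n \<otimes> (w \<otimes> g n \<ominus> \<sigma> n) : Q"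
   using rel[of l] split[of l] reln l id_mult[OF Q _ w(2)] id_mult[OF Q _ c(2)[of l n]] id_add[OF Q] by simp
  moreover have "w \<otimes> (u l \<otimes> g l \<ominus> (h l n \<otimes> g n \<oplus> \<sigma> l)) \<oplus> h l n \<otimes> (w \<otimes> g n \<ominus> \<sigma> n)
    = (w \<otimes> u l) \<otimes> g l \<ominus> (w \<otimes> \<sigma> l \<oplus> h l n \<otimes> \<sigma> n)"
   using w(2) c(1)[OF less_SucI[OF l]] c(2)[OF less_SucI[OF l] lessI] g[of l] g[of n]
     sc[OF less_SucI[OF l]] sc[OF lessI] by algebra
  ultimately show "(w \<otimes> u l) \<otimes> g l \<ominus> (\<Oplus>m\<in>{..<n}. h' l m \<otimes> g m) : Q" unfolding s by simp
 qed
 then obtain v where v: "v : G" "!!l. l < n ==> v \<otimes> g l : Q" by blast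
 have vc: "v : RR" using v GH by blast
 \<comment> \<open>\<open>v\<close> kills the unknowns below \<open>n\<close>; relation
   \<open>n\<close> multiplied by \<open>v\<close> then shows that \<open>v w\<close> kills
   \<open>g n\<close> as well.\<close>
 have "v \<otimes> \<sigma> n : Q"
 proof -
  have "v \<otimes> \<sigma> n = (\<Oplus>m\<in>{..<n}. v \<otimes> (h n m \<otimes> g m))" unfolding \<sigma>_def
   by (rule finsum_rdistr) (use vc c g in auto)
  also have "... : Q"
  proof (rule finsum_in_ideal[OF Q])
   fix m assume m: "m : {..<n}"
   have "h n m \<otimes> (v \<otimes> g m) : Q" by (rule id_mult[OF Q v(2)]) (use m c in auto)
   moreover have "h n m \<otimes> (v \<otimes> g m) = v \<otimes> (h n m \<otimes> g m)" using c(2)[of n m] vc g[of m] m m_lcomm by simp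
   ultimately show "v \<otimes> (h n m \<otimes> g m) : Q" by simp
  qed simp
  finally show ?thesis .
 qed
 moreover have "v \<otimes> (w \<otimes> g n \<ominus> \<sigma> n) : Q" using id_mult[OF Q reln vc] .
 ultimately have "v \<otimes> (w \<otimes> g n \<ominus> \<sigma> n) \<oplus> v \<otimes> \<sigma> n : Q" using id_add[OF Q] by blast
 moreover have "v \<otimes> (w \<otimes> g n \<ominus> \<sigma> n) \<oplus> v \<otimes> \<sigma> n = (v \<otimes> w) \<otimes> g n" using vc w(2) g[of n] sc[OF lessI] by algebra
 ultimately have last: "(v \<otimes> w) \<otimes> g n : Q" by simp
 have "(v \<otimes> w) \<otimes> g l : Q" if "l < Suc n" for l
 proof (cases "l = n")
  case False
  hence "w \<otimes> (v \<otimes> g l) : Q" using id_mult[OF Q v(2) w(2)] that by simp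
  thus ?thesis using vc w(2) g[of l] by (simp add: m_ac)
 qed (use last in simp)
 thus ?case using GG[OF v(1) w(1)] by blast
qed

text \<open>Gaussian elimination over the domain \<open>R/P\<close>, with cross multiplication by
  the pivot in place of division, so that the solution stays in \<open>R\<close> and keeps an entry
  outside \<open>P\<close>.\<close>

lemma underdetermined:
 assumes P: "primeideal P R" and "finite E"
 shows "finite K ==> card E < card K ==> ALL e k. v e k : RR ==>
  EX rh. (ALL k. rh k : RR) & (EX k:K. rh k ~: P) & (ALL e:E. (\<Oplus>k\<in>K. v e k \<otimes> rh k) : P)"
 using assms(2)
proof (induction E arbitrary: K v rule: finite_induct)
 case empty
 then obtain k where "k : K" by fastforce
 thus ?case using primeideal_one[OF P] by (intro exI[of _ "%_. \<one>"]) auto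
next
 case (insert e E)
 note Pi = primeideal.axioms(1)[OF P]
 have v: "v e k : RR" for e k using insert.prems(3) by blast
 have sum_in: "(\<Oplus>k\<in>K'. g k) : P" if "finite K'" "!!k. k : K' ==> g k : P" for K' and g :: "_ => 'a"
  using that
 proof (induction K' rule: finite_induct)
  case (insert k K')
  have "g : K' \<rightarrow> RR" "g k : RR" using insert id_carr[OF Pi] by auto
  thus ?case using insert id_add[OF Pi] by (simp add: finsum_insert)
 qed (simp add: id_zero[OF Pi])
 show ?case
 proof (cases "ALL k:K. v e k : P")
  case True
  have "card E < card K" using insert.prems(2) insert.hyps by simp
  then obtain rh where r: "ALL k. rh k : RR" "EX k:K. rh k ~: P" "ALL e:E. (\<Oplus>k\<in>K. v e k \<otimes> rh k) : P"
   using insert.IH[OF insert.prems(1) _ insert.prems(3)] by blast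
  have "(\<Oplus>k\<in>K. v e k \<otimes> rh k) : P" using True r(1) insert.prems(1) id_multr[OF Pi] by (intro sum_in) auto
  thus ?thesis using r by blast
 next
  case False
  then obtain l where l: "l : K" "v e l ~: P" by blast
  define K' where "K' = K - {l}"
  have K': "finite K'" "l ~: K'" "K = insert l K'" "card E < card K'"
   using insert.prems(1,2) insert.hyps l(1) by (auto simp: K'_def card_Diff_singleton)
  define w where "w e' k = v e l \<otimes> v e' k \<ominus> v e' l \<otimes> v e k" for e' k
  have w: "ALL e' k. w e' k : RR" using v by (simp add: w_def)
  obtain rh where r: "!!k. rh k : RR" "EX k:K'. rh k ~: P" "!!e. e : E ==> (\<Oplus>k\<in>K'. w e k \<otimes> rh k) : P"
   using insert.IH[OF K'(1,4) w] by blast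
  define S where "S = (\<Oplus>k\<in>K'. v e k \<otimes> rh k)"
  \<comment> \<open>The pivot unknown gets the negative of the remaining sum and the others are
    scaled by the pivot; the pivot equation then holds exactly.\<close>
  define rh' where "rh' k = (if k = l then \<ominus> S else v e l \<otimes> rh k)" for k
  have S: "S : RR" using v r(1) by (simp add: S_def finsum_closed)
  have r': "rh' k : RR" for k using S v r(1) by (simp add: rh'_def)
  have key: "(\<Oplus>k\<in>K. v e' k \<otimes> rh' k) = (\<Oplus>k\<in>K'. w e' k \<otimes> rh k)" for e'
  proof -
   define T where "T = (\<Oplus>k\<in>K'. v e' k \<otimes> rh k)"
   have T: "T : RR" using v r(1) by (simp add: T_def finsum_closed)
   have "(\<Oplus>k\<in>K'. v e' k \<otimes> rh' k) = (\<Oplus>k\<in>K'. v e l \<otimes> (v e' k \<otimes> rh k))"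
    by (rule finsum_cong') (use v r(1) K'(2) in \<open>auto simp: rh'_def m_lcomm\<close>)
   also have "... = v e l \<otimes> T" unfolding T_def using finsum_rdistr[OF K'(1) v[of e l]] v r(1) by simp
   finally have 1: "(\<Oplus>k\<in>K. v e' k \<otimes> rh' k) = v e' l \<otimes> (\<ominus> S) \<oplus> v e l \<otimes> T"
    unfolding K'(3) using finsum_insert[OF K'(1,2), of "%k. v e' k \<otimes> rh' k"] v r' S by (simp add: rh'_def)
   have "(\<Oplus>k\<in>K'. w e' k \<otimes> rh k) = (\<Oplus>k\<in>K'. v e l \<otimes> (v e' k \<otimes> rh k) \<oplus> (\<ominus> v e' l) \<otimes> (v e k \<otimes> rh k))"
   proof (rule finsum_cong')
    fix k assume "k : K'"
    show "w e' k \<otimes> rh k = v e l \<otimes> (v e' k \<otimes> rh k) \<oplus> (\<ominus> v e' l) \<otimes> (v e k \<otimes> rh k)"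
     unfolding w_def using v[of e l] v[of e' k] v[of e' l] v[of e k] r(1)[of k] by algebra
   qed (use v w r(1) in auto)
   also have "... = v e l \<otimes> T \<oplus> (\<ominus> v e' l) \<otimes> S"
    unfolding T_def S_def using finsum_rdistr[OF K'(1) v[of e l]] finsum_rdistr[OF K'(1) a_inv_closed[OF v[of e' l]]] v r(1)
    by (simp add: finsum_addf)
   finally show ?thesis unfolding 1 using v[of e l] v[of e' l] S T by algebra
  qed
  have "(\<Oplus>k\<in>K'. w e k \<otimes> rh k) : P"
  proof (rule sum_in[OF K'(1)])
   fix k show "w e k \<otimes> rh k : P"
    using v[of e l] v[of e k] r(1)[of k] id_zero[OF Pi] by (simp add: w_def a_minus_def r_neg m_comm)
  qed
  hence "ALL e':insert e E. (\<Oplus>k\<in>K. v e' k \<otimes> rh' k) : P" using key r(3) by auto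
  moreover obtain k where k: "k : K'" "rh k ~: P" using r(2) by blast
  hence "rh' k ~: P" using primeideal_mult[OF P v[of e l] r(1)[of k]] l(2) K'(2) by (auto simp: rh'_def)
  ultimately show ?thesis using r' k K'(3) by blast
 qed
qed

end

section \<open>Minimal reductions are analytically independent\<close>

context local_inf
begin

text \<open>If a coefficient of \<open>f\<close> is a unit, there is a point \<open>a\<close> with
  \<open>f(a)\<close> and some \<open>a l\<close> units. Over the ideal \<open>K\<close> generated
  by the \<open>a l x j - a j x l\<close> the form \<open>f\<close> makes \<open>x l\<close>
  integral, modulo \<open>mm I^n\<close>, so \<open>K\<close> is a reduction and equals
  \<open>J\<close> by minimality. But \<open>K\<close> consists of values of linear forms that
  vanish at \<open>a\<close> modulo \<open>mm\<close>, and independence in degree one keeps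
  \<open>x l\<close> from being such a value.\<close>

lemma analytic_independence:
 assumes I: "ideal I R" and x: "point x" and J: "J = gen x s" "J <= I"
  and red: "!!n. n >= n0 ==> J \<cdot> ipow I n = ipow I (Suc n)"
  and min: "!!K. ideal K R ==> K <= J ==> EX N. ALL n>=N. K \<cdot> ipow I n = ipow I (Suc n) ==> K = J"
  and indep: "!!c. form (RR) s 1 c ==> ev x s 1 c : mm \<cdot> I ==> form mm s 1 c"
  and f: "form (RR) s n f" "ev x s n f : mm \<cdot> ipow I n"
 shows "form mm s n f"
proof (rule ccontr)
 let ?P = "ipow I"
 assume nf: "~ form mm s n f"
 note Pi = pow_ideal[OF I]
 note mI = ideal_prod_is_ideal[OF mm_ideal I]
 have xI: "x j : I" if "j < s" for j using J gen_mem[OF x that] by auto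
 obtain a where a: "point a" "ev a s n f ~: mm" using form_nonvanishing[OF mm_ideal mm_ideal f(1) nf f(1) nf] by blast
 have n0: "n ~= 0"
 proof
  assume n: "n = 0"
  have "f {#} : mm" using f(2) n ideal_prod_one[OF mm_ideal] by simp
  thus False using nf n by (simp add: form_def)
 qed
 \<comment> \<open>A form of positive degree has its values in \<open>mm\<close> at points with
   coordinates in \<open>mm\<close>.\<close>
 have "EX l<s. a l ~: mm"
 proof (rule ccontr)
  assume *: "~ (EX l<s. a l ~: mm)"
  let ?U = "%n. case n of 0 => RR | Suc _ => mm"
  have "ev a s n f : ?U (0 + n)"
  proof (rule ev_graded[where U = ?U])
   show "ideal (?U n) R" for n using mm_ideal oneideal by (cases n) auto
   show "form (?U 0) s n f" using f by simp
   fix i n u assume "i < s" "u : ?U n"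
   thus "a i \<otimes> u : ?U (Suc n)" using * id_carr[OF mm_ideal] id_multr[OF mm_ideal] by (cases n) auto
  qed
  thus False using a(2) n0 by (cases n) auto
 qed
 then obtain l where l: "l < s" "a l ~: mm" by blast
 note ac = pointD[OF a(1)] and xc = pointD[OF x]
 define y where "y j = (if j < s then a l \<otimes> x j \<ominus> a j \<otimes> x l else \<zero>)" for j
 have y: "point y" using ac xc by (simp add: y_def point_def)
 define K where "K = gen y s"
 have K: "ideal K R" unfolding K_def using gen_ideal[OF y] .
 have Ji: "ideal J R" unfolding J(1) using gen_ideal[OF x] .
 have yJ: "y j : J" if "j < s" for j
  unfolding y_def J(1) using gen_ideal[OF x, of s] gen_mem[OF x, of j s] gen_mem[OF x, of l s] that l ac
  by (simp add: id_minus id_mult)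
 have KJ: "K <= J" unfolding K_def by (rule gen_least[OF Ji yJ])
 have KI: "K <= I" using KJ J(2) by blast
 have yK: "y j : K" if "j < s" for j unfolding K_def using gen_mem[OF y that] .

 define W :: "'a set" where "W = (K \<cdot> ?P (n - 1)) <+> (mm \<cdot> ?P n)"
 have KP: "ideal (K \<cdot> ?P k) R" for k using ideal_prod_is_ideal[OF K Pi] .
 have mP: "ideal (mm \<cdot> ?P k) R" for k using ideal_prod_is_ideal[OF mm_ideal Pi] .
 have W: "ideal W R" unfolding W_def using add_ideals[OF KP mP] .
 have KPmult: "b \<otimes> c : K \<cdot> ?P (k + k')" if "b : K \<cdot> ?P k" "c : ?P k'" for b c k k'
 proof -
  have "b \<otimes> c : (K \<cdot> ?P k) \<cdot> ?P k'" using that by (rule ideal_prod.prod)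
  thus ?thesis unfolding ideal_prod_assoc[OF K Pi Pi] pow_add[OF I] .
 qed
 \<comment> \<open>\<open>f\<close> is evaluated at the points \<open>a l x\<close> and
   \<open>x l a\<close>, which agree modulo \<open>K\<close>. By homogeneity the values are
   \<open>a l^n f(x)\<close>, an element of \<open>mm I^n\<close>, and \<open>x l^n f(a)\<close>
   with \<open>f(a)\<close> a unit.\<close>
 have xl: "x l [^] n : W"
 proof -
  define x' where "x' j = (if j < s then a l \<otimes> x j else \<zero>)" for j
  define z where "z j = (if j < s then x l \<otimes> a j else \<zero>)" for j
  have "ev x' s n f \<ominus> ev z s n f : (case n of 0 => {\<zero>} | Suc k => K \<cdot> ?P k)"
  proof (rule ev_diff[OF I K _ _ _ f(1)])
   fix j
   show "x' j : I" "z j : I" using xI l(1) ac id_zero[OF I] by (auto simp: x'_def z_def id_mult[OF I] id_multr[OF I])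
   have "x' j \<ominus> z j = y j" using ac xc by (simp add: x'_def z_def y_def m_comm a_minus_def)
   moreover have "y j : K" using yK[of j] id_zero[OF K] by (cases "j < s") (auto simp: y_def)
   ultimately show "x' j \<ominus> z j : K" by simp
  qed
  hence d: "ev x' s n f \<ominus> ev z s n f : K \<cdot> ?P (n - 1)" using n0 by (cases n) auto
  have "ev x' s n f = ev (%j. a l \<otimes> x j) s n f" by (rule ev_point_cong) (simp add: x'_def)
  also have "... = a l [^] n \<otimes> ev x s n f" by (rule ev_scale[OF x ac f(1)])
  finally have e1: "ev x' s n f = a l [^] n \<otimes> ev x s n f" .
  have "ev z s n f = ev (%j. x l \<otimes> a j) s n f" by (rule ev_point_cong) (simp add: z_def)
  also have "... = x l [^] n \<otimes> ev a s n f" by (rule ev_scale[OF a(1) xc f(1)])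
  finally have e2: "ev z s n f = ev a s n f \<otimes> x l [^] n" using ev_closed[OF f(1) a(1)] xc by (simp add: m_comm)
  have WW: "K \<cdot> ?P (n - 1) <= W" "mm \<cdot> ?P n <= W"
   unfolding W_def by (rule set_add_sub1[OF KP mP], rule set_add_sub2[OF KP mP])
  have "ev x' s n f : W" unfolding e1
   using WW(2) id_mult[OF mP f(2), of "a l [^] n"] ac by auto
  moreover have "ev x' s n f \<ominus> ev z s n f : W" using d WW(1) by auto
  moreover have "ev x' s n f : RR" "ev z s n f : RR"
   unfolding e1 e2 using ev_closed[OF f(1) a(1)] ev_closed[OF f(1) x] ac xc by auto
  ultimately have "ev z s n f : W" using id_minus_cancel[OF W] by blast
  thus ?thesis unfolding e2 using unit_cancel[OF W ev_closed[OF f(1) a(1)] a(2)] xc by simp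
 qed
 have JA: "J <= addel K (x l)" unfolding J(1)
 proof (rule gen_least[OF addel_ideal[OF K xc]])
  fix k assume k: "k < s"
  have "a l \<otimes> x k = y k \<oplus> a k \<otimes> x l"
  proof -
   have "A \<otimes> X = (A \<otimes> X \<ominus> B \<otimes> Y) \<oplus> B \<otimes> Y"
    if "A : RR" "B : RR" "X : RR" "Y : RR" for A B X Y using that by algebra
   thus ?thesis using k ac xc by (simp add: y_def)
  qed
  hence "a l \<otimes> x k : addel K (x l)" using addelI[OF yK[OF k] ac] by simp
  thus "x k : addel K (x l)" using unit_cancel[OF addel_ideal[OF K xc] ac l(2) xc] by blast
 qed
 \<comment> \<open>Because \<open>J = K + (x l)\<close>, only the pure power of \<open>x l\<close>
   survives in \<open>J^(i + 1)\<close> modulo \<open>K I^i\<close>.\<close>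
 have JW: "ipow J (Suc i) <= addel (K \<cdot> ?P i) (x l [^] Suc i)" for i
 proof (induction i)
  case 0 thus ?case using JA pow_1[OF Ji] K xc by (simp add: ideal_prod_one)
 next
  case (Suc i)
  have A: "ideal (addel (K \<cdot> ?P (Suc i)) (x l [^] Suc (Suc i))) R" by (rule addel_ideal[OF KP]) (use xc in simp)
  show ?case unfolding pow_Suc2[OF Ji, of "Suc i"]
  proof (rule prod_least[OF A])
   fix t v assume t: "t : J" and v: "v : ipow J (Suc i)"
   obtain k r where k: "k : K" "r : RR" "t = k \<oplus> r \<otimes> x l" using t JA by (blast elim: addelE)
   obtain k' r' where k': "k' : K \<cdot> ?P i" "r' : RR" "v = k' \<oplus> r' \<otimes> x l [^] Suc i" using v Suc.IH by (blast elim: addelE)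
   have vP: "v : ?P (Suc i)" using v pow_mono[OF J(2)] by blast
   have c: "k : RR" "k' : RR" "v : RR" "x l : RR" "x l [^] Suc i : RR"
    using id_carr[OF K] id_carr[OF KP] id_carr[OF Pi] k k' vP xc by blast+
   have "k' \<otimes> x l : K \<cdot> ?P (i + 1)" using KPmult[OF k'(1), of "x l" 1] xI l(1) pow_1[OF I] by simp
   hence "k \<otimes> v \<oplus> r \<otimes> (k' \<otimes> x l) : K \<cdot> ?P (Suc i)"
    using id_add[OF KP] id_mult[OF KP _ k(2)] ideal_prod.prod[OF k(1) vP, of R] by simp
   moreover have "t \<otimes> v = (k \<otimes> v \<oplus> r \<otimes> (k' \<otimes> x l)) \<oplus> (r \<otimes> r') \<otimes> x l [^] Suc (Suc i)"
   proof -
    have "(k \<oplus> r \<otimes> X) \<otimes> v = (k \<otimes> v \<oplus> r \<otimes> (k' \<otimes> X)) \<oplus> (r \<otimes> r') \<otimes> (Y \<otimes> X)"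
     if "v = k' \<oplus> r' \<otimes> Y" "X : RR" "Y : RR" for X Y unfolding that(1) using that(2,3) c(1,2) k(2) k'(2) by algebra
    from this[OF k'(3) c(4,5)] show ?thesis using k(3) by simp
   qed
   ultimately show "t \<otimes> v : addel (K \<cdot> ?P (Suc i)) (x l [^] Suc (Suc i))" using addelI k(2) k'(2) by simp
  qed
 qed
 have red': "?P (n0 + i) = ipow J i \<cdot> ?P n0" for i
 proof (induction i)
  case 0 thus ?case using ideal_prod_one[OF Pi] ideal_prod_commute[OF oneideal Pi] by simp
 next
  case (Suc i)
  thus ?case using red[of "n0 + i"] ideal_prod_assoc[OF Ji pow_ideal[OF Ji] Pi] pow_Suc2[OF Ji] by simp
 qed
 \<comment> \<open>With \<open>N + 1 = n0 + n\<close>, multiplication by \<open>I^n0\<close> turns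
   the inclusion for \<open>J^n\<close> into one for \<open>I^(N + 1)\<close>, to which Nakayama
   applies.\<close>
 define N where "N = n0 + n - 1"
 have N: "Suc N = n0 + n" "n - 1 + n0 = N" using n0 by (auto simp: N_def)
 note S = add_ideals[OF KP[of N] mP[of "Suc N"]]
 have "K \<cdot> ?P (n - 1) <= W" unfolding W_def by (rule set_add_sub1[OF KP mP])
 hence AW: "addel (K \<cdot> ?P (n - 1)) (x l [^] n) <= W" by (rule addel_least[OF W _ xl])
 have n1: "Suc (n - 1) = n" using n0 by simp
 have JnW: "ipow J n <= W" using order_trans[OF JW[of "n - 1", unfolded n1] AW] .
 have WP: "w \<otimes> u : K \<cdot> ?P N <+> mm \<cdot> ?P (Suc N)" if w: "w : W" and u: "u : ?P n0" for w u
 proof -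
  obtain b c where b: "b : K \<cdot> ?P (n - 1)" "c : mm \<cdot> ?P n" "w = b \<oplus> c" using w unfolding W_def by (auto simp: set_add_iff)
  have "c \<otimes> u : (mm \<cdot> ?P n) \<cdot> ?P n0" using b(2) u by (rule ideal_prod.prod)
  hence "c \<otimes> u : mm \<cdot> ?P (Suc N)"
   unfolding ideal_prod_assoc[OF mm_ideal Pi Pi] pow_add[OF I, symmetric] N(1) by (simp add: add.commute)
  moreover have "b \<otimes> u : K \<cdot> ?P N" using KPmult[OF b(1) u] unfolding N(2) .
  moreover have "w \<otimes> u = b \<otimes> u \<oplus> c \<otimes> u" unfolding b(3) using id_carr[OF KP b(1)] id_carr[OF mP b(2)] id_carr[OF Pi u] by (rule l_distr)
  ultimately show ?thesis unfolding set_add_iff by blast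
 qed
 have "ipow J n \<cdot> ?P n0 <= K \<cdot> ?P N <+> mm \<cdot> ?P (Suc N)"
  by (rule prod_least[OF S]) (use JnW WP in blast)
 hence "?P (Suc N) <= K \<cdot> ?P N <+> mm \<cdot> ?P (Suc N)" using red'[of n] unfolding N(1) by simp
 hence "?P (Suc N) <= K \<cdot> ?P N" by (rule nakayama[OF Pi KP])
 hence eqN: "K \<cdot> ?P N = ?P (Suc N)" using prod_mono[OF KI subset_refl, of "?P N"] pow_Suc2[OF I] by auto
 have "K \<cdot> ?P k = ?P (Suc k)" if "k >= N" for k
  using that
 proof (induction k rule: dec_induct)
  case base show ?case by (rule eqN)
 next
  case (step k)
  have "K \<cdot> ?P (Suc k) = (K \<cdot> ?P k) \<cdot> I" unfolding pow_Suc using ideal_prod_assoc[OF K Pi I] by simp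
  thus ?case using step by (simp add: pow_Suc)
 qed
 hence KeqJ: "K = J" using min[OF K KJ] by blast

 define T where "T = {ev x s 1 c | c. form (RR) s 1 c & ev a s 1 c : mm}"
 have TI: "ev x s 1 c : T" if "form (RR) s 1 c" "ev a s 1 c : mm" for c using that unfolding T_def by blast
 have T: "ideal T R"
 proof (rule idI)
  show "T <= RR" using x by (auto simp: T_def simp del: One_nat_def)
  show "\<zero> : T" using TI[of "%_. \<zero>"] ev_zero[OF x] ev_zero[OF a(1)] id_zero[OF mm_ideal] by (simp add: form_def del: One_nat_def)
 next
  fix t t' assume "t : T" "t' : T"
  then obtain c c' where c: "form (RR) s 1 c" "ev a s 1 c : mm" "form (RR) s 1 c'" "ev a s 1 c' : mm"
   "t = ev x s 1 c" "t' = ev x s 1 c'" unfolding T_def by blast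
  thus "t \<oplus> t' : T"
   using TI[OF form_add[OF oneideal c(1,3)]] ev_add[OF x c(1,3)] ev_add[OF a(1) c(1,3)] id_add[OF mm_ideal c(2,4)] by simp
 next
  fix t b assume "t : T" and b: "b : RR"
  then obtain c where c: "form (RR) s 1 c" "ev a s 1 c : mm" "t = ev x s 1 c" unfolding T_def by blast
  thus "b \<otimes> t : T"
   using TI[OF form_smult[OF oneideal c(1) b]] ev_smult[OF x b c(1)] ev_smult[OF a(1) b c(1)] id_mult[OF mm_ideal c(2) b] by simp
 qed
 have one: "form (RR) s 0 (%_. \<one>)" by (simp add: form_def)
 define e where "e j = shift j (%_. \<one>)" for j
 have ef: "form (RR) s 1 (e j)" for j using form_shift[OF zero_closed one] by (simp add: e_def)
 have ee: "ev z s 1 (e j) = z j" if "point z" "j < s" for z j using ev_shift[OF that one] that by (simp add: e_def)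
 have "K <= T" unfolding K_def
 proof (rule gen_least[OF T])
  fix j assume j: "j < s"
  let ?c = "%mu. a l \<otimes> e j mu \<ominus> a j \<otimes> e l mu"
  note 1 = form_smult[OF oneideal ef ac]
  have ev: "ev z s 1 ?c = a l \<otimes> z j \<ominus> a j \<otimes> z l" if "point z" for z
   using ev_minus[OF that 1 1] ev_smult[OF that ac ef] ee[OF that] j l(1) by simp
  have "form (RR) s 1 ?c" by (rule form_minus[OF oneideal 1 1])
  moreover have "ev x s 1 ?c = y j" using ev[OF x] j by (simp add: y_def)
  moreover have "ev a s 1 ?c = \<zero>" using ev[OF a(1)] ac by (simp add: m_comm a_minus_def r_neg)
  ultimately show "y j : T" using TI[of ?c] id_zero[OF mm_ideal] by simp
 qed
 hence "x l : T" using KeqJ J(1) gen_mem[OF x l(1)] by blast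
 then obtain c where c: "form (RR) s 1 c" "ev a s 1 c : mm" "x l = ev x s 1 c" unfolding T_def by blast
 have "form mm s 1 (%mu. e l mu \<ominus> c mu)"
  by (rule indep[OF form_minus[OF oneideal ef c(1)]])
   (use ev_minus[OF x ef c(1)] ee[OF x l(1)] c(3) xc[of l] id_zero[OF mI] in \<open>simp add: a_minus_def r_neg\<close>)
 hence "ev a s 1 (%mu. e l mu \<ominus> c mu) : mm" by (rule ev_in[OF mm_ideal _ a(1)])
 hence "a l \<ominus> ev a s 1 c : mm" using ev_minus[OF a(1) ef c(1)] ee[OF a(1) l(1)] by simp
 hence "a l : mm" using id_minus_cancel[OF mm_ideal ac ev_closed[OF c(1) a(1)]] c(2) by blast
 thus False using l by simp
qed

end

section \<open>Torsion freeness of the fiber cone over the polynomial ring\<close>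

context local_noeth
begin

text \<open>Iterating the reduction equation gives \<open>I^(n + 1) = J^n I\<close>. With reduction
  number at most one this starts at \<open>n = 0\<close>, which is why forms with coefficients in
  \<open>I\<close> itself are enough.\<close>

lemma vals_eq_pow:
 assumes I: "ideal I R" and x: "point x" and J: "gen x s <= I"
  and red: "!!n. n >= 1 ==> gen x s \<cdot> ipow I n = ipow I (Suc n)"
 shows "vals x s n I = ipow I (Suc n)"
proof
 note Pi = pow_ideal[OF I]
 show "vals x s n I <= ipow I (Suc n)"
 proof
  fix u assume "u : vals x s n I"
  then obtain c where c: "form I s n c" "u = ev x s n c" by (elim valsE)
  have "ev x s n c : ipow I (1 + n)"
  proof (rule ev_graded[where U = "ipow I"])
   show "ideal (ipow I n) R" for n by (rule Pi)
   show "form (ipow I 1) s n c" using c(1) pow_1[OF I] by simp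
   show "x i \<otimes> u : ipow I (Suc n)" if "i < s" "u : ipow I n" for i n u
    unfolding pow_Suc2[OF I] using J gen_mem[OF x that(1)] that(2) by (blast intro: ideal_prod.prod)
  qed
  thus "u : ipow I (Suc n)" using c by simp
 qed
 show "ipow I (Suc n) <= vals x s n I"
 proof (induction n)
  case 0 thus ?case using pow_1[OF I] by simp
 next
  case (Suc n)
  have "gen x s \<cdot> ipow I (Suc n) <= vals x s (Suc n) I"
   by (rule prod_least[OF vals_ideal[OF I x]]) (use gen_mult_vals[OF x I] Suc in blast)
  thus ?case using red[of "Suc n"] by simp
 qed
qed

end

context local_inf
begin

text \<open>For \<open>n > 0\<close> write \<open>u\<close> as the value of a form \<open>w\<close>
  of degree \<open>n - 1\<close> over \<open>I\<close> and put \<open>L = J + mm I\<close>. If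
  \<open>w\<close> is a form over \<open>L\<close>, then modulo \<open>mm I^n\<close> the element
  \<open>u\<close> comes from the polynomial ring and analytic independence decides. Otherwise the
  product form is nonzero modulo \<open>L\<close>, while relations over \<open>I\<close> have
  coefficients in \<open>J\<close> only.\<close>

lemma fiber_torsion_free:
 assumes I: "ideal I R" and x: "point x" and J: "gen x (Suc r) <= I"
  and red: "!!n. n >= 1 ==> gen x (Suc r) \<cdot> ipow I n = ipow I (Suc n)"
  and indep: "!!n f. form (RR) (Suc r) n f ==> ev x (Suc r) n f : mm \<cdot> ipow I n ==> form mm (Suc r) n f"
  and reg: "!!i. i < r ==> nzd (gen x i) (x i)"
  and last: "!!w. w : I ==> x r \<otimes> w : gen x r ==> w : gen x r"
  and u: "u : ipow I n" "u ~: mm \<cdot> ipow I n"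
  and f: "form (RR) (Suc r) k f" "~ form mm (Suc r) k f"
 shows "ev x (Suc r) k f \<otimes> u ~: mm \<cdot> ipow I (k + n)"
proof
 let ?s = "Suc r"
 let ?P = "ipow I"
 let ?J = "gen x ?s"
 assume bad: "ev x ?s k f \<otimes> u : mm \<cdot> ?P (k + n)"
 note Pi = pow_ideal[OF I]
 have mP: "ideal (mm \<cdot> ?P k) R" for k using ideal_prod_is_ideal[OF mm_ideal Pi] .
 have mI: "ideal (mm \<cdot> I) R" using ideal_prod_is_ideal[OF mm_ideal I] .
 have Ji: "ideal ?J R" by (rule gen_ideal[OF x])
 have uc: "u : RR" using u id_carr[OF Pi] by blast
 have ef: "ev x ?s k f : RR" using ev_closed[OF f(1) x] .
 show False
 proof (cases n)
  case 0
  hence um: "u ~: mm" using u(2) ideal_prod_one[OF mm_ideal] by simp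
  have "u \<otimes> ev x ?s k f : mm \<cdot> ?P k" using bad 0 ef uc by (simp add: m_comm)
  hence "ev x ?s k f : mm \<cdot> ?P k" using unit_cancel[OF mP uc um ef] by simp
  thus False using indep[OF f(1)] f(2) by blast
 next
  case (Suc n')
  note V = vals_eq_pow[OF I x J red]
  obtain w where w: "form I ?s n' w" "u = ev x ?s n' w" using u(1) V[of n'] Suc by (auto elim: valsE)
  define L :: "'a set" where "L = ?J <+> mm \<cdot> I"
  have L: "ideal L R" unfolding L_def using add_ideals[OF Ji mI] .
  have mL: "mm \<cdot> I <= L" "?J <= L" unfolding L_def using set_add_sub1[OF Ji mI] set_add_sub2[OF Ji mI] by auto
  have Vm: "vals x ?s n' (mm \<cdot> I) = mm \<cdot> ?P (Suc n')" for n' using vals_mm_prod[OF x I] V[of n'] by simp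
  show False
  proof (cases "form L ?s n' w")
   case True
   have Vi: "ideal (vals x ?s i ?J) R" "ideal (vals x ?s i (mm \<cdot> I)) R" for i using vals_ideal[OF Ji x] vals_ideal[OF mI x] by auto
   \<comment> \<open>Coefficients in \<open>J\<close> can be traded for one more variable and give a
     form of degree \<open>n\<close> over \<open>R\<close>; those in \<open>mm I\<close> contribute
     only to \<open>mm I^n\<close>.\<close>
   have "ev x ?s n' w : vals x ?s (0 + n') ?J <+> vals x ?s (0 + n') (mm \<cdot> I)"
   proof (rule ev_graded[where U = "%n'. set_add R (vals x ?s n' ?J) (vals x ?s n' (mm \<cdot> I))"])
    show "ideal (vals x ?s i ?J <+> vals x ?s i (mm \<cdot> I)) R" for i using add_ideals[OF Vi] .
    show "form (vals x ?s 0 ?J <+> vals x ?s 0 (mm \<cdot> I)) ?s n' w" using True by (simp add: L_def)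
    fix i m and v :: 'a assume i: "i < ?s" "v : vals x ?s m ?J <+> vals x ?s m (mm \<cdot> I)"
    then obtain b c where bc: "b : vals x ?s m ?J" "c : vals x ?s m (mm \<cdot> I)" "v = b \<oplus> c" by (auto simp: set_add_iff simp del: gen.simps)
    have "x i \<otimes> v = x i \<otimes> b \<oplus> x i \<otimes> c" unfolding bc(3) using bc id_carr[OF Vi(1)] id_carr[OF Vi(2)] x by (simp add: r_distr del: gen.simps)
    thus "x i \<otimes> v : vals x ?s (Suc m) ?J <+> vals x ?s (Suc m) (mm \<cdot> I)"
     using vals_shift[OF x Ji i(1) bc(1)] vals_shift[OF x mI i(1) bc(2)] set_add_iff by blast
   qed
   then obtain u1 u2 where u12: "u1 : vals x ?s n' ?J" "u2 : mm \<cdot> ?P n" "u = u1 \<oplus> u2"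
    using w(2) Vm[of n'] Suc by (auto simp: set_add_iff simp del: gen.simps)
   obtain g where g: "form (RR) ?s n g" "u1 = ev x ?s n g" using u12(1) gen_vals[OF x, of ?s n'] Suc by (auto elim: valsE simp del: gen.simps)
   have u1c: "u1 : RR" "u2 : RR" using g(2) ev_closed[OF g(1) x] id_carr[OF mP u12(2)] by auto
   have "~ form mm ?s n g"
   proof
    assume "form mm ?s n g"
    have "ev x ?s n g : mm \<cdot> ?P (0 + n)"
    proof (rule ev_graded[where U = "%n. mm \<cdot> ?P n"])
     show "ideal (mm \<cdot> ?P i) R" for i by (rule mP)
     show "form (mm \<cdot> ?P 0) ?s n g" using \<open>form mm ?s n g\<close> ideal_prod_one[OF mm_ideal] by simp
     fix i m v assume i: "i < ?s" "v : mm \<cdot> ?P m"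
     have "x i : I" using J gen_mem[OF x i(1)] by blast
     hence "v \<otimes> x i : (mm \<cdot> ?P m) \<cdot> I" using i(2) by (intro ideal_prod.prod)
     hence "v \<otimes> x i : mm \<cdot> ?P (Suc m)" unfolding pow_Suc ideal_prod_assoc[OF mm_ideal Pi I] .
     thus "x i \<otimes> v : mm \<cdot> ?P (Suc m)" using m_comm[OF pointD[OF x] id_carr[OF mP i(2)]] by simp
    qed
    hence "u : mm \<cdot> ?P n" using u12 g(2) id_add[OF mP] by simp
    thus False using u by simp
   qed
   then obtain h where h: "~ form mm ?s (k + n) h" "form (RR) ?s (k + n) h" "ev x ?s (k + n) h = ev x ?s k f \<otimes> u1"
    using form_product_nonzero[OF oneideal mm_ideal f g(1)] g(2) x by metis
   have "ev x ?s k f \<otimes> u2 : mm \<cdot> ?P (k + n)"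
   proof -
    have "ev x ?s k f : ?P (0 + k)"
    proof (rule ev_graded[where U = ?P])
     show "ideal (?P i) R" for i by (rule Pi)
     show "form (?P 0) ?s k f" using f(1) by simp
     show "x i \<otimes> v : ?P (Suc m)" if "i < ?s" "v : ?P m" for i m v
      unfolding pow_Suc2[OF I] using J gen_mem[OF x that(1)] that(2) by (blast intro: ideal_prod.prod)
    qed
    hence "u2 \<otimes> ev x ?s k f : (mm \<cdot> ?P n) \<cdot> ?P k" using u12(2) by (simp add: ideal_prod.prod)
    thus ?thesis unfolding ideal_prod_assoc[OF mm_ideal Pi Pi] pow_add[OF I, symmetric] using ef u1c by (simp add: m_comm add.commute)
   qed
   moreover have "ev x ?s k f \<otimes> u1 \<oplus> ev x ?s k f \<otimes> u2 : mm \<cdot> ?P (k + n)" using bad u12(3) ef u1c by (simp add: r_distr)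
   ultimately have "ev x ?s k f \<otimes> u1 : mm \<cdot> ?P (k + n)" using id_add_cancel(1)[OF mP] ef u1c by simp
   thus False using indep[OF h(2)] h by simp
  next
   case False
   obtain h where h: "form I ?s (k + n') h" "~ form L ?s (k + n') h" "ev x ?s (k + n') h = ev x ?s k f \<otimes> u"
    using form_product_nonzero[OF I L f w(1) False] w(2) x by metis
   \<comment> \<open>If the product lay in \<open>mm I^(k + n)\<close>, it would also be the value
     of a form \<open>g\<close> over \<open>mm I\<close>; the difference of \<open>h\<close> and
     \<open>g\<close> is then a relation with coefficients in \<open>I\<close>.\<close>
   have "ev x ?s (k + n') h : vals x ?s (k + n') (mm \<cdot> I)" unfolding Vm h(3) using bad Suc by simp
   then obtain g where g: "form (mm \<cdot> I) ?s (k + n') g" "ev x ?s (k + n') h = ev x ?s (k + n') g" by (elim valsE)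
   have gI: "form I ?s (k + n') g" using form_mono[OF g(1) prod_sub[OF mm_ideal I]] .
   have hg: "form I ?s (k + n') (%mu. h mu \<ominus> g mu)" using form_minus[OF I h(1) gI] .
   have ev0: "ev x ?s (k + n') (%mu. h mu \<ominus> g mu) = \<zero>"
    using ev_minus[OF x form_carr[OF h(1) I] form_carr[OF gI I]] g(2) ev_closed[OF form_carr[OF gI I] x] by (simp add: a_minus_def r_neg)
   have "x r [^] (0::nat) \<otimes> ev x ?s (k + n') (%mu. h mu \<ominus> g mu) : vals x r (Suc (k + n')) (RR)"
    unfolding ev0 using id_zero[OF vals_ideal[OF oneideal x]] by simp
   hence fJ: "form ?J ?s (k + n') (%mu. h mu \<ominus> g mu)" using relation_coeffs[OF x reg I J last hg] by blast
   have "form L ?s (k + n') h" unfolding form_def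
   proof
    fix mu assume a: "mu : Mon ?s (k + n')"
    have "h mu \<ominus> g mu : L" "g mu : L" "h mu : RR" "g mu : RR"
     using fJ g(1) mL form_carr[OF h(1) I] form_carr[OF gI I] a unfolding form_def by blast+
    thus "h mu : L" using id_minus_cancel[OF L] by blast
   qed
   thus False using h by simp
  qed
 qed
qed

end

section \<open>Localization\<close>

context cring
begin

lemma fraction_self: "mult_set S ==> a : RR ==> s : S ==> (a, s) : fraction R S a s"
 unfolding fraction_def using mult_setD(2)[of S] by blast

lemma fraction_mem:
 "(b, t) : fraction R S a s \<longleftrightarrow> b : RR & t : S & (EX u:S. u \<otimes> (t \<otimes> a) = u \<otimes> (s \<otimes> b))"
 unfolding fraction_def by simp

lemma fraction_trans:
 assumes S: "mult_set S" and "a : RR" "s : S" "b : RR" "t : S" "c : RR" "r : S"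
  and 1: "u : S" "u \<otimes> (t \<otimes> a) = u \<otimes> (s \<otimes> b)" and 2: "v : S" "v \<otimes> (r \<otimes> b) = v \<otimes> (t \<otimes> c)"
 shows "EX w:S. w \<otimes> (r \<otimes> a) = w \<otimes> (s \<otimes> c)"
proof -
 note SD = mult_setD[OF S]
 have c: "s : RR" "t : RR" "r : RR" "u : RR" "v : RR" using assms SD by auto
 have "(u \<otimes> v \<otimes> t) \<otimes> (r \<otimes> a) = (v \<otimes> r) \<otimes> (u \<otimes> (t \<otimes> a))" using c assms(2,4,6) by algebra
 also have "... = (u \<otimes> s) \<otimes> (v \<otimes> (r \<otimes> b))" unfolding 1(2) using c assms(2,4,6) by algebra
 also have "... = (u \<otimes> v \<otimes> t) \<otimes> (s \<otimes> c)" unfolding 2(2) using c assms(2,4,6) by algebra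
 finally show ?thesis using SD(3) assms by blast
qed

lemma fraction_eq_iff:
 assumes S: "mult_set S" and a: "a : RR" "s : S" and b: "b : RR" "t : S"
 shows "fraction R S a s = fraction R S b t \<longleftrightarrow> (EX u:S. u \<otimes> (t \<otimes> a) = u \<otimes> (s \<otimes> b))"
proof
 assume "fraction R S a s = fraction R S b t"
 hence "(b, t) : fraction R S a s" using fraction_self[OF S b] by simp
 thus "EX u:S. u \<otimes> (t \<otimes> a) = u \<otimes> (s \<otimes> b)" by (simp add: fraction_mem)
next
 assume "EX u:S. u \<otimes> (t \<otimes> a) = u \<otimes> (s \<otimes> b)"
 then obtain u where u: "u : S" "u \<otimes> (t \<otimes> a) = u \<otimes> (s \<otimes> b)" by blast
 have sub: "(c, r) : fraction R S b' t'"
  if "a' : RR" "s' : S" "b' : RR" "t' : S" "u \<otimes> (t' \<otimes> a') = u \<otimes> (s' \<otimes> b')" "(c, r) : fraction R S a' s'"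
  for a' s' b' t' c r
 proof -
  note h = that
  obtain v where v: "c : RR" "r : S" "v : S" "v \<otimes> (r \<otimes> a') = v \<otimes> (s' \<otimes> c)" using h(6) unfolding fraction_mem by blast
  thus ?thesis
   using fraction_trans[OF S h(3,4,1,2) v(1,2) u(1) h(5)[symmetric] v(3,4)] by (simp add: fraction_mem)
 qed
 show "fraction R S a s = fraction R S b t"
  using sub[OF a b u(2)] sub[OF b a u(2)[symmetric]] by auto
qed

lemma loc_mult:
 assumes S: "mult_set S" and a: "a : RR" "s : S" and b: "b : RR" "t : S"
 shows "fraction R S a s \<otimes>\<^bsub>localization R S\<^esub> fraction R S b t = fraction R S (a \<otimes> b) (s \<otimes> t)"
proof -
 note SD = mult_setD[OF S]
 have "fraction R S (a' \<otimes> b') (s' \<otimes> t') = fraction R S (a \<otimes> b) (s \<otimes> t)"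
  if "(a', s') : fraction R S a s" "(b', t') : fraction R S b t" for a' s' b' t'
 proof -
  note h = that
  obtain u where u: "a' : RR" "s' : S" "u : S" "u \<otimes> (s' \<otimes> a) = u \<otimes> (s \<otimes> a')" using h(1) unfolding fraction_mem by blast
  obtain v where v: "b' : RR" "t' : S" "v : S" "v \<otimes> (t' \<otimes> b) = v \<otimes> (t \<otimes> b')" using h(2) unfolding fraction_mem by blast
  have c: "s : RR" "t : RR" "s' : RR" "t' : RR" "u : RR" "v : RR" using a b u v SD by auto
  have "(u \<otimes> v) \<otimes> ((s \<otimes> t) \<otimes> (a' \<otimes> b')) = (u \<otimes> (s \<otimes> a')) \<otimes> (v \<otimes> (t \<otimes> b'))" using c u(1) v(1) by algebra
  also have "... = (u \<otimes> v) \<otimes> ((s' \<otimes> t') \<otimes> (a \<otimes> b))" unfolding u(4)[symmetric] v(4)[symmetric] using c a b by algebra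
  finally have "EX w:S. w \<otimes> ((s \<otimes> t) \<otimes> (a' \<otimes> b')) = w \<otimes> ((s' \<otimes> t') \<otimes> (a \<otimes> b))" using SD(3)[OF u(3) v(3)] by blast
  thus ?thesis using fraction_eq_iff[OF S, of "a' \<otimes> b'" "s' \<otimes> t'" "a \<otimes> b" "s \<otimes> t"] u v a b SD by simp
 qed
 moreover have "fraction R S a s ~= {}" "fraction R S b t ~= {}" using fraction_self[OF S] a b by auto
 ultimately show ?thesis unfolding localization_def by fastforce
qed

lemma loc_add:
 assumes S: "mult_set S" and a: "a : RR" "s : S" and b: "b : RR" "t : S"
 shows "fraction R S a s \<oplus>\<^bsub>localization R S\<^esub> fraction R S b t = fraction R S (a \<otimes> t \<oplus> b \<otimes> s) (s \<otimes> t)"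
proof -
 note SD = mult_setD[OF S]
 have "fraction R S (a' \<otimes> t' \<oplus> b' \<otimes> s') (s' \<otimes> t') = fraction R S (a \<otimes> t \<oplus> b \<otimes> s) (s \<otimes> t)"
  if "(a', s') : fraction R S a s" "(b', t') : fraction R S b t" for a' s' b' t'
 proof -
  note h = that
  obtain u where u: "a' : RR" "s' : S" "u : S" "u \<otimes> (s' \<otimes> a) = u \<otimes> (s \<otimes> a')" using h(1) unfolding fraction_mem by blast
  obtain v where v: "b' : RR" "t' : S" "v : S" "v \<otimes> (t' \<otimes> b) = v \<otimes> (t \<otimes> b')" using h(2) unfolding fraction_mem by blast
  have c: "s : RR" "t : RR" "s' : RR" "t' : RR" "u : RR" "v : RR" using a b u v SD by auto
  have "(u \<otimes> v) \<otimes> ((s \<otimes> t) \<otimes> (a' \<otimes> t' \<oplus> b' \<otimes> s')) = (u \<otimes> (s \<otimes> a')) \<otimes> (v \<otimes> t \<otimes> t') \<oplus> (v \<otimes> (t \<otimes> b')) \<otimes> (u \<otimes> s \<otimes> s')"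
   using c u(1) v(1) by algebra
  also have "... = (u \<otimes> v) \<otimes> ((s' \<otimes> t') \<otimes> (a \<otimes> t \<oplus> b \<otimes> s))" unfolding u(4)[symmetric] v(4)[symmetric] using c a b by algebra
  finally have "EX w:S. w \<otimes> ((s \<otimes> t) \<otimes> (a' \<otimes> t' \<oplus> b' \<otimes> s')) = w \<otimes> ((s' \<otimes> t') \<otimes> (a \<otimes> t \<oplus> b \<otimes> s))" using SD(3)[OF u(3) v(3)] by blast
  thus ?thesis
   using fraction_eq_iff[OF S, of "a' \<otimes> t' \<oplus> b' \<otimes> s'" "s' \<otimes> t'" "a \<otimes> t \<oplus> b \<otimes> s" "s \<otimes> t"] u v a b c SD by simp
 qed
 moreover have "fraction R S a s ~= {}" "fraction R S b t ~= {}" using fraction_self[OF S] a b by auto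
 ultimately show ?thesis unfolding localization_def by fastforce
qed

lemma loc_carrier: "carrier (localization R S) = {fraction R S a s | a s. a : RR & s : S}"
 by (simp add: localization_def)

lemma loc_zero: "\<zero>\<^bsub>localization R S\<^esub> = fraction R S \<zero> \<one>" and loc_one: "\<one>\<^bsub>localization R S\<^esub> = fraction R S \<one> \<one>"
 by (simp_all add: localization_def)

lemma loc_eqI:
 assumes S: "mult_set S" and "a : RR" "s : S" "b : RR" "t : S" "t \<otimes> a = s \<otimes> b"
 shows "fraction R S a s = fraction R S b t"
 using fraction_eq_iff[OF assms(1-5)] assms mult_setD(2)[OF S] by auto

lemma loc_cring:
 assumes S: "mult_set S" shows "cring (localization R S)"
proof -
 let ?L = "localization R S"
 note SD = mult_setD[OF S]
 have el: "EX a s. X = fraction R S a s & a : RR & s : S & s : RR" if "X : carrier ?L" for X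
  using that SD(1) by (auto simp: loc_carrier)
 have mem: "fraction R S a s : carrier ?L" if "a : RR" "s : S" for a s using that by (auto simp: loc_carrier)
 note ops = loc_mult[OF S] loc_add[OF S] loc_zero loc_one
 show ?thesis
 proof (rule cringI)
  show "abelian_group ?L"
  proof (rule abelian_groupI)
   fix X Y assume XY: "X : carrier ?L" "Y : carrier ?L"
   from el[OF XY(1)] el[OF XY(2)] obtain a s b t where *: "X = fraction R S a s" "a : RR" "s : S" "s : RR" "Y = fraction R S b t" "b : RR" "t : S" "t : RR"
    by blast
   show "X \<oplus>\<^bsub>?L\<^esub> Y : carrier ?L" unfolding * using ops * SD(3) by (simp add: mem)
   show "X \<oplus>\<^bsub>?L\<^esub> Y = Y \<oplus>\<^bsub>?L\<^esub> X" unfolding * using ops * by (simp add: a_comm m_comm)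
  next
   fix X Y Z assume XYZ: "X : carrier ?L" "Y : carrier ?L" "Z : carrier ?L"
   from el[OF XYZ(1)] el[OF XYZ(2)] el[OF XYZ(3)] obtain a s b t c r where *: "X = fraction R S a s" "a : RR" "s : S" "s : RR" "Y = fraction R S b t" "b : RR" "t : S" "t : RR"
     "Z = fraction R S c r" "c : RR" "r : S" "r : RR"
    by blast
   have "(a \<otimes> t \<oplus> b \<otimes> s) \<otimes> r \<oplus> c \<otimes> (s \<otimes> t) = a \<otimes> (t \<otimes> r) \<oplus> (b \<otimes> r \<oplus> c \<otimes> t) \<otimes> s" using * by algebra
   thus "X \<oplus>\<^bsub>?L\<^esub> Y \<oplus>\<^bsub>?L\<^esub> Z = X \<oplus>\<^bsub>?L\<^esub> (Y \<oplus>\<^bsub>?L\<^esub> Z)" unfolding * using ops * SD(3) by (simp add: m_assoc)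
  next
   show "\<zero>\<^bsub>?L\<^esub> : carrier ?L" using mem SD(2) by (simp add: loc_zero)
  next
   fix X assume "X : carrier ?L"
   then obtain a s where *: "X = fraction R S a s" "a : RR" "s : S" "s : RR" using el by metis
   show "\<zero>\<^bsub>?L\<^esub> \<oplus>\<^bsub>?L\<^esub> X = X" unfolding * using ops * SD(2) by simp
   have "fraction R S (\<ominus> a) s \<oplus>\<^bsub>?L\<^esub> X = fraction R S (\<ominus> a \<otimes> s \<oplus> a \<otimes> s) (s \<otimes> s)" unfolding * using ops * by simp
   also have "... = \<zero>\<^bsub>?L\<^esub>" unfolding loc_zero by (rule loc_eqI[OF S]) (use * SD in \<open>auto simp: l_minus l_neg\<close>)
   finally show "EX Y:carrier ?L. Y \<oplus>\<^bsub>?L\<^esub> X = \<zero>\<^bsub>?L\<^esub>" using mem[of "\<ominus> a" s] * by blast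
  qed
  show "comm_monoid ?L"
  proof (rule comm_monoidI)
   fix X Y assume XY: "X : carrier ?L" "Y : carrier ?L"
   from el[OF XY(1)] el[OF XY(2)] obtain a s b t where *: "X = fraction R S a s" "a : RR" "s : S" "s : RR" "Y = fraction R S b t" "b : RR" "t : S" "t : RR"
    by blast
   show "X \<otimes>\<^bsub>?L\<^esub> Y : carrier ?L" unfolding * using ops * SD(3) by (simp add: mem)
   show "X \<otimes>\<^bsub>?L\<^esub> Y = Y \<otimes>\<^bsub>?L\<^esub> X" unfolding * using ops * by (simp add: m_comm)
  next
   fix X Y Z assume XYZ: "X : carrier ?L" "Y : carrier ?L" "Z : carrier ?L"
   from el[OF XYZ(1)] el[OF XYZ(2)] el[OF XYZ(3)] obtain a s b t c r where *: "X = fraction R S a s" "a : RR" "s : S" "s : RR" "Y = fraction R S b t" "b : RR" "t : S" "t : RR"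
     "Z = fraction R S c r" "c : RR" "r : S" "r : RR"
    by blast
   show "X \<otimes>\<^bsub>?L\<^esub> Y \<otimes>\<^bsub>?L\<^esub> Z = X \<otimes>\<^bsub>?L\<^esub> (Y \<otimes>\<^bsub>?L\<^esub> Z)" unfolding * using ops * SD(3) by (simp add: m_assoc)
  next
   show "\<one>\<^bsub>?L\<^esub> : carrier ?L" using mem SD(2) by (simp add: loc_one)
  next
   fix X assume "X : carrier ?L"
   then obtain a s where *: "X = fraction R S a s" "a : RR" "s : S" "s : RR" using el by metis
   show "\<one>\<^bsub>?L\<^esub> \<otimes>\<^bsub>?L\<^esub> X = X" unfolding * using ops * SD(2) by simp
  qed
  fix X Y Z assume XYZ: "X : carrier ?L" "Y : carrier ?L" "Z : carrier ?L"
  from el[OF XYZ(1)] el[OF XYZ(2)] el[OF XYZ(3)] obtain a s b t c r where *: "X = fraction R S a s" "a : RR" "s : S" "s : RR" "Y = fraction R S b t" "b : RR" "t : S" "t : RR"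
    "Z = fraction R S c r" "c : RR" "r : S" "r : RR"
   by blast
  have "(X \<oplus>\<^bsub>?L\<^esub> Y) \<otimes>\<^bsub>?L\<^esub> Z = fraction R S ((a \<otimes> t \<oplus> b \<otimes> s) \<otimes> c) ((s \<otimes> t) \<otimes> r)" unfolding * using ops * SD(3) by simp
  also have "... = fraction R S ((a \<otimes> c) \<otimes> (t \<otimes> r) \<oplus> (b \<otimes> c) \<otimes> (s \<otimes> r)) ((s \<otimes> r) \<otimes> (t \<otimes> r))"
  proof (rule loc_eqI[OF S])
   show "((s \<otimes> r) \<otimes> (t \<otimes> r)) \<otimes> ((a \<otimes> t \<oplus> b \<otimes> s) \<otimes> c) = ((s \<otimes> t) \<otimes> r) \<otimes> ((a \<otimes> c) \<otimes> (t \<otimes> r) \<oplus> (b \<otimes> c) \<otimes> (s \<otimes> r))"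
    using *(2,4,6,8,10,12) by algebra
  qed (use * SD(3) in auto)
  also have "... = X \<otimes>\<^bsub>?L\<^esub> Z \<oplus>\<^bsub>?L\<^esub> Y \<otimes>\<^bsub>?L\<^esub> Z" unfolding * using ops * SD(3) by simp
  finally show "(X \<oplus>\<^bsub>?L\<^esub> Y) \<otimes>\<^bsub>?L\<^esub> Z = X \<otimes>\<^bsub>?L\<^esub> Z \<oplus>\<^bsub>?L\<^esub> Y \<otimes>\<^bsub>?L\<^esub> Z" .
 qed
qed

text \<open>The link between ideals of the localization and \<open>sat\<close>; through it a regular
  sequence of the localization is read off in \<open>R\<close>.\<close>

lemma loc_ideal_mem:
 assumes S: "mult_set S" and Q: "ideal Q R" and a: "a : RR" "s : S"
 shows "fraction R S a s : localized_ideal R S Q \<longleftrightarrow> a : sat S Q"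
proof
 note SD = mult_setD[OF S]
 assume "fraction R S a s : localized_ideal R S Q"
 then obtain b t where b: "b : Q" "t : S" "fraction R S a s = fraction R S b t" unfolding localized_ideal_def by blast
 have bc: "b : RR" using b Q id_carr by blast
 obtain u where u: "u : S" "u \<otimes> (t \<otimes> a) = u \<otimes> (s \<otimes> b)" using b fraction_eq_iff[OF S a bc b(2)] by blast
 have c: "u : RR" "t : RR" "s : RR" using u b a SD by auto
 have "(u \<otimes> t) \<otimes> a = (u \<otimes> s) \<otimes> b" using u(2) c a bc by (simp add: m_assoc)
 also have "... : Q" using id_mult[OF Q b(1)] c by simp
 finally show "a : sat S Q" using satI[OF a(1) SD(3)[OF u(1) b(2)]] by simp
next
 note SD = mult_setD[OF S]
 assume "a : sat S Q"
 then obtain u where u: "u : S" "u \<otimes> a : Q" by (elim satE)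
 have "fraction R S a s = fraction R S (u \<otimes> a) (u \<otimes> s)"
  by (rule loc_eqI[OF S]) (use a u SD in \<open>auto simp: m_assoc m_lcomm\<close>)
 thus "fraction R S a s : localized_ideal R S Q" using u a SD(3)[OF u(1) a(2)] unfolding localized_ideal_def by blast
qed

lemma loc_ideal_ideal:
 assumes S: "mult_set S" and Q: "ideal Q R"
 shows "ideal (localized_ideal R S Q) (localization R S)"
proof -
 let ?L = "localization R S"
 interpret L: cring ?L by (rule loc_cring[OF S])
 note SD = mult_setD[OF S]
 show ?thesis
 proof (rule L.idI)
  show "localized_ideal R S Q <= carrier ?L" using id_carr[OF Q] by (auto simp: loc_carrier localized_ideal_def)
  show "\<zero>\<^bsub>?L\<^esub> : localized_ideal R S Q" using id_zero[OF Q] SD(2) by (auto simp: loc_zero localized_ideal_def)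
 next
  fix X Y assume "X : localized_ideal R S Q" "Y : localized_ideal R S Q"
  then obtain a s b t where *: "X = fraction R S a s" "a : Q" "s : S" "Y = fraction R S b t" "b : Q" "t : S" unfolding localized_ideal_def by blast
  have c: "a : RR" "b : RR" using * Q id_carr by blast+
  have "a \<otimes> t \<oplus> b \<otimes> s : Q" using id_add[OF Q id_multr[OF Q] id_multr[OF Q]] * SD(1) by blast
  thus "X \<oplus>\<^bsub>?L\<^esub> Y : localized_ideal R S Q" unfolding * using loc_add[OF S c(1) *(3) c(2) *(6)] SD(3)[OF *(3,6)]
   unfolding localized_ideal_def by auto
 next
  fix X Y assume "X : localized_ideal R S Q" "Y : carrier ?L"
  then obtain a s b t where *: "X = fraction R S a s" "a : Q" "s : S" "Y = fraction R S b t" "b : RR" "t : S"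
   unfolding localized_ideal_def loc_carrier by blast
  have c: "a : RR" using * Q id_carr by blast
  have "b \<otimes> a : Q" using id_mult[OF Q *(2,5)] .
  thus "Y \<otimes>\<^bsub>?L\<^esub> X : localized_ideal R S Q" unfolding * using loc_mult[OF S *(5,6) c *(3)] SD(3)[OF *(6,3)]
   unfolding localized_ideal_def by auto
 qed
qed

end

section \<open>Regular sequences on the ring\<close>

context cring
begin

lemma Idl_empty: "Idl {} = {\<zero>}"
proof
 show "Idl {} <= {\<zero>}" by (rule genideal_minimal[OF zeroideal]) simp
 show "{\<zero>} <= Idl {}" using id_zero[OF genideal_ideal[of "{}"]] by simp
qed

lemma Idl_insert:
 assumes "S <= RR" "x : RR"
 shows "Idl (insert x S) = addel (Idl S) x"
proof
 note S = genideal_ideal[OF assms(1)]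
 have "insert x S <= addel (Idl S) x"
  using addel_mem[OF S assms(2)] addel_sub[OF S assms(2)] genideal_self[OF assms(1)] by blast
 thus "Idl (insert x S) <= addel (Idl S) x" by (rule genideal_minimal[OF addel_ideal[OF S assms(2)]])
 have i: "insert x S <= RR" using assms by simp
 have self: "insert x S <= Idl (insert x S)" by (rule genideal_self[OF i])
 have "Idl S <= Idl (insert x S)" by (rule genideal_minimal[OF genideal_ideal[OF i]]) (use self in blast)
 thus "addel (Idl S) x <= Idl (insert x S)" by (rule addel_least[OF genideal_ideal[OF i]]) (use self in blast)
qed

lemma ring_as_module_simps [simp]:
 "carrier (ring_as_module R) = RR" "add (ring_as_module R) = add R" "\<zero>\<^bsub>ring_as_module R\<^esub> = \<zero>"
 "smult (ring_as_module R) = mult R"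
 by (simp_all add: ring_as_module_def)

lemma ring_as_module_coset [simp]: "a_r_coset (ring_as_module R) = a_r_coset R"
 by (intro ext) (simp add: a_r_coset_def r_coset_def)

lemma ring_as_module_module: "module R (ring_as_module R)"
proof (rule moduleI[OF is_cring])
 show "abelian_group (ring_as_module R)"
  by (rule abelian_groupI) (auto simp: a_ac intro: l_neg)
qed (auto simp: l_distr r_distr m_assoc)

lemma submodule_ring: "submodule H R (ring_as_module R) \<longleftrightarrow> ideal H R"
proof
 assume H: "submodule H R (ring_as_module R)"
 note M = module.submoduleE[OF ring_as_module_module H]
 show "ideal H R"
 proof (rule idI)
  obtain h where "h : H" using M(2) by blast
  thus "\<zero> : H" using M(4)[of \<zero> h] M(1) by auto
 qed (use M in auto)
next
 assume H: "ideal H R"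
 show "submodule H R (ring_as_module R)"
 proof (rule module.submoduleI[OF ring_as_module_module])
  fix a assume a: "a : H"
  have "\<ominus>\<^bsub>ring_as_module R\<^esub> a = \<ominus> a" by (simp add: a_inv_def m_inv_def)
  thus "\<ominus>\<^bsub>ring_as_module R\<^esub> a : H" using id_neg[OF H a] by simp
 qed (use id_sub[OF H] id_zero[OF H] id_add[OF H] id_mult[OF H] in auto)
qed

lemma ideal_smult_ring:
 assumes "ideal q R" shows "ideal_smult R (ring_as_module R) q (RR) = q"
proof -
 have "{a \<otimes> x | a x. a : q & x : RR} = q"
 proof
  show "{a \<otimes> x | a x. a : q & x : RR} <= q" using id_multr[OF assms] by blast
  show "q <= {a \<otimes> x | a x. a : q & x : RR}"
  proof
   fix a assume "a : q"
   hence "a = a \<otimes> \<one>" using id_carr[OF assms] by simp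
   thus "a : {a \<otimes> x | a x. a : q & x : RR}" using \<open>a : q\<close> by blast
  qed
 qed
 thus ?thesis unfolding ideal_smult_def module_span_def submodule_ring using assms by auto
qed

lemma regular_element_nzd:
 assumes q: "ideal q R" and a: "a : RR" and r: "regular_element (quot_module (ring_as_module R) q) a"
 shows "nzd q a"
 unfolding nzd_def
proof (intro conjI ballI impI a)
 fix z assume z: "z : RR" "a \<otimes> z : q"
 have q0: "q +> y = q" if "y : q" for y
  using quotient_eq_iff_same_a_r_cos[OF q id_carr[OF q that] zero_closed] that a_coset_add_zero[OF id_sub[OF q]] id_carr[OF q that]
  by (simp add: a_minus_def)
 let ?X = "q +> z"
 have X: "?X : carrier (quot_module (ring_as_module R) q)"
  using z unfolding quot_module_def A_RCOSETS_def RCOSETS_def by (auto simp: a_r_coset_def r_coset_def)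
 have zX: "z : ?X" using id_zero[OF q] l_zero[OF z(1)] unfolding a_r_coset_def' by force
 have ax: "a \<otimes> x : q" if "x : ?X" for x
 proof -
  note h = that
  obtain b where b: "b : q" "x = b \<oplus> z" using h unfolding a_r_coset_def' by blast
  thus ?thesis using id_add[OF q id_mult[OF q b(1) a] z(2)] a z(1) id_carr[OF q b(1)] by (simp add: r_distr)
 qed
 have "a \<odot>\<^bsub>quot_module (ring_as_module R) q\<^esub> ?X = q"
  using ax q0 zX by (auto simp: quot_module_def coset_smult_def)
 hence "?X = q" using r X unfolding regular_element_def by (auto simp: quot_module_def)
 thus "z : q" using zX by simp
qed

lemma regular_sequence_nzd:
 assumes "regular_sequence R (ring_as_module R) xs" "i < length xs"
 shows "nzd (Idl (set (take i xs))) (xs ! i)"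
proof -
 have xs: "set xs <= RR" using assms(1) by (simp add: regular_sequence_def)
 have "ideal (Idl (set (take i xs))) R" by (rule genideal_ideal[OF order_trans[OF set_take_subset xs]])
 note q = this
 have "regular_element (quot_module (ring_as_module R) (ideal_smult R (ring_as_module R) (Idl (set (take i xs))) (RR))) (xs ! i)"
  using assms unfolding regular_sequence_def by simp
 from regular_element_nzd[OF q subsetD[OF xs nth_mem[OF assms(2)]] this[unfolded ideal_smult_ring[OF q]]]
 show ?thesis .
qed

lemma Idl_take_Suc:
 assumes "set xs <= RR" "i < length xs"
 shows "Idl (set (take (Suc i) xs)) = addel (Idl (set (take i xs))) (xs ! i)"
proof -
 have "set (take (Suc i) xs) = insert (xs ! i) (set (take i xs))" using assms(2) by (simp add: take_Suc_conv_app_nth)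
 moreover have "xs ! i : RR" using assms nth_mem[OF assms(2)] by blast
 ultimately show ?thesis using Idl_insert[OF order_trans[OF set_take_subset assms(1)]] by simp
qed

lemma mult_set_compl:
 assumes P: "primeideal P R" shows "mult_set (RR - P)"
 unfolding mult_set_def
proof (intro conjI ballI)
 fix a b assume ab: "a : RR - P" "b : RR - P"
 hence "a \<otimes> b ~: P" using primeideal_mult[OF P, of a b] by blast
 thus "a \<otimes> b : RR - P" using ab by blast
next
 show "\<one> : RR - P" using primeideal_one[OF P] by blast
qed blast

text \<open>Denominators are units in the localization, so the numerators of the given generators do
  the job. They are continued by zero because a point has coordinates at all indices.\<close>

lemma local_complete_intersection_gens:
 assumes P: "minimal_prime_over R I P" and I: "ideal I R" and lci: "locally_complete_intersection R I"
 defines "S \<equiv> RR - P"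
 shows "EX f h. point f & (ALL i<h. f i : I) & enat h = prime_height R P & regular_upto S f h & I <= sat S (gen f h)"
proof -
 have Pp: "primeideal P R" using P unfolding minimal_prime_over_def by (rule conjunct1)
 have S: "mult_set S" unfolding S_def using mult_set_compl[OF Pp] .
 note SD = mult_setD[OF S]
 let ?L = "localization R S"
 interpret L: cring ?L by (rule loc_cring[OF S])
 obtain xs where xs: "regular_sequence ?L (ring_as_module ?L) xs" "enat (length xs) = prime_height R P"
   "localized_ideal R S I = Idl\<^bsub>?L\<^esub> (set xs)"
  using lci P unfolding locally_complete_intersection_def S_def Let_def by blast
 let ?h = "length xs"
 have xc: "set xs <= carrier ?L" using xs(1) by (simp add: regular_sequence_def)
 have "EX a s. a : I & s : S & xs ! i = fraction R S a s" if "i < ?h" for i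
 proof -
  have "xs ! i : Idl\<^bsub>?L\<^esub> (set xs)" using L.genideal_self[OF xc] nth_mem[OF that] by blast
  thus ?thesis unfolding xs(3)[symmetric] localized_ideal_def by blast
 qed
 then obtain g s where gs: "!!i. i < ?h ==> g i : I & s i : S & xs ! i = fraction R S (g i) (s i)" by metis
 define f where "f i = (if i < ?h then g i else \<zero>)" for i
 have fI: "f i : I" for i using gs id_zero[OF I] by (simp add: f_def)
 have f: "point f" using id_carr[OF I fI] by (simp add: point_def)
 have xi: "xs ! i = fraction R S (f i) (s i)" "s i : S" if "i < ?h" for i using gs[OF that] that by (simp_all add: f_def)
 have Idl: "Idl\<^bsub>?L\<^esub> (set (take i xs)) = localized_ideal R S (gen f i)" if "i <= ?h" for i
  using that
 proof (induction i)
  case 0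
  have "localized_ideal R S {\<zero>} = {\<zero>\<^bsub>?L\<^esub>}"
  proof
   show "localized_ideal R S {\<zero>} <= {\<zero>\<^bsub>?L\<^esub>}"
    using loc_eqI[OF S zero_closed _ zero_closed SD(2)] SD(1) by (auto simp: localized_ideal_def loc_zero)
   show "{\<zero>\<^bsub>?L\<^esub>} <= localized_ideal R S {\<zero>}" using SD(2) by (auto simp: localized_ideal_def loc_zero)
  qed
  thus ?case using L.Idl_empty by simp
 next
  case (Suc i)
  hence i: "i < ?h" by simp
  note gi = gen_ideal[OF f, of i] and gsi = gen_ideal[OF f, of "Suc i"]
  have "Idl\<^bsub>?L\<^esub> (set (take (Suc i) xs)) = L.addel (localized_ideal R S (gen f i)) (xs ! i)"
   using L.Idl_take_Suc[OF xc i] Suc by simp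
  also have "... = localized_ideal R S (gen f (Suc i))"
  proof
   show "L.addel (localized_ideal R S (gen f i)) (xs ! i) <= localized_ideal R S (gen f (Suc i))"
   proof (rule L.addel_least[OF loc_ideal_ideal[OF S gsi]])
    show "localized_ideal R S (gen f i) <= localized_ideal R S (gen f (Suc i))"
     using gen_mono[OF f, of i "Suc i"] unfolding localized_ideal_def by auto
    show "xs ! i : localized_ideal R S (gen f (Suc i))"
     using xi[OF i] gen_mem[OF f, of i "Suc i"] unfolding localized_ideal_def by auto
   qed
   have Ai: "ideal (L.addel (localized_ideal R S (gen f i)) (xs ! i)) ?L"
    by (rule L.addel_ideal[OF loc_ideal_ideal[OF S gi]]) (use xc i in auto)
   have xA: "xs ! i : L.addel (localized_ideal R S (gen f i)) (xs ! i)"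
    by (rule L.addel_mem[OF loc_ideal_ideal[OF S gi]]) (use xc i in auto)
   show "localized_ideal R S (gen f (Suc i)) <= L.addel (localized_ideal R S (gen f i)) (xs ! i)"
   proof
    fix X assume "X : localized_ideal R S (gen f (Suc i))"
    then obtain a t where a: "a : gen f (Suc i)" "t : S" "X = fraction R S a t" unfolding localized_ideal_def by blast
    then obtain b c where b: "b : gen f i" "c : RR" "a = b \<oplus> c \<otimes> f i" by (auto elim: addelE)
    have cc: "b : RR" "t : RR" "f i : RR" "s i : RR"
     using b(1) id_carr[OF gi] a SD(1) f xi(2)[OF i] by auto
    \<comment> \<open>Since \<open>xs ! i\<close> is \<open>f i\<close> over \<open>s i\<close>, the
      multiplier \<open>c\<close> has to be enlarged by the factor \<open>s i\<close>.\<close>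
    have "fraction R S b t \<oplus>\<^bsub>?L\<^esub> (fraction R S (c \<otimes> s i) t \<otimes>\<^bsub>?L\<^esub> (xs ! i)) = X"
    proof -
     have "fraction R S b t \<oplus>\<^bsub>?L\<^esub> (fraction R S (c \<otimes> s i) t \<otimes>\<^bsub>?L\<^esub> (xs ! i))
      = fraction R S (b \<otimes> (t \<otimes> s i) \<oplus> ((c \<otimes> s i) \<otimes> f i) \<otimes> t) (t \<otimes> (t \<otimes> s i))"
      using loc_mult[OF S _ a(2) cc(3) xi(2)[OF i], of "c \<otimes> s i"] loc_add[OF S cc(1) a(2), of "(c \<otimes> s i) \<otimes> f i" "t \<otimes> s i"]
       cc b(2) SD(3)[OF a(2) xi(2)[OF i]] xi(1)[OF i] by simp
     also have "... = fraction R S a t"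
     proof (rule loc_eqI[OF S])
      show "t \<otimes> (b \<otimes> (t \<otimes> s i) \<oplus> ((c \<otimes> s i) \<otimes> f i) \<otimes> t) = (t \<otimes> (t \<otimes> s i)) \<otimes> a"
       unfolding b(3) using cc b(2) by algebra
     qed (use cc b a(2) SD(3) xi(2)[OF i] in auto)
     finally show ?thesis using a(3) by simp
    qed
    moreover have "fraction R S b t : localized_ideal R S (gen f i)" using b(1) a(2) unfolding localized_ideal_def by blast
    moreover have "fraction R S (c \<otimes> s i) t : carrier ?L" using b(2) cc a(2) by (auto simp: loc_carrier)
    ultimately show "X : L.addel (localized_ideal R S (gen f i)) (xs ! i)" using L.addelI by metis
   qed
  qed
  finally show ?case .
 qed
 have "regular_upto S f ?h" unfolding regular_upto_def
 proof (intro allI impI ballI)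
  fix i a assume i: "i < ?h" and a: "a : RR" "f i \<otimes> a : sat S (gen f i)"
  note gi = gen_ideal[OF f, of i]
  have "L.nzd (localized_ideal R S (gen f i)) (xs ! i)"
   using L.regular_sequence_nzd[OF xs(1) i] Idl[of i] i by simp
  moreover have "(xs ! i) \<otimes>\<^bsub>?L\<^esub> fraction R S a \<one> : localized_ideal R S (gen f i)"
  proof -
   have "(xs ! i) \<otimes>\<^bsub>?L\<^esub> fraction R S a \<one> = fraction R S (f i \<otimes> a) (s i \<otimes> \<one>)"
    using loc_mult[OF S pointD[OF f] xi(2)[OF i] a(1) SD(2)] xi(1)[OF i] by simp
   thus ?thesis using loc_ideal_mem[OF S gi, of "f i \<otimes> a" "s i \<otimes> \<one>"] a f SD(3)[OF xi(2)[OF i] SD(2)] by simp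
  qed
  moreover have "fraction R S a \<one> : carrier ?L" using a SD(2) by (auto simp: loc_carrier)
  ultimately have "fraction R S a \<one> : localized_ideal R S (gen f i)" unfolding L.nzd_def by blast
  thus "a : sat S (gen f i)" using loc_ideal_mem[OF S gi a(1) SD(2)] by blast
 qed
 moreover have "I <= sat S (gen f ?h)"
 proof
  fix a assume a: "a : I"
  have "fraction R S a \<one> : localized_ideal R S I" using a SD(2) unfolding localized_ideal_def by blast
  hence "fraction R S a \<one> : localized_ideal R S (gen f ?h)" using xs(3) Idl[of ?h] by simp
  thus "a : sat S (gen f ?h)" using loc_ideal_mem[OF S gen_ideal[OF f] id_carr[OF I a] SD(2)] by blast
 qed
 ultimately show ?thesis using f fI xs(2) by blast
qed

end

section \<open>Dimension and depth\<close>

text \<open>Below \<open>d\<close> there is always a strictly larger member, whether the supremum is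
  finite or not; \<open>p 0\<close> covers \<open>d = 0\<close>, where the set might be
  empty.\<close>

lemma enat_Sup_attained:
 assumes "enat d <= Sup {enat n | n. p n}" "p 0"
 shows "EX n>=d. p n"
proof (cases d)
 case 0 thus ?thesis using assms by blast
next
 case (Suc k)
 have "enat k < enat d" using Suc by simp
 also note assms(1)
 finally obtain e where "e : {enat n | n. p n}" "enat k < e" unfolding less_Sup_iff by (elim bexE)
 thus ?thesis using Suc by (auto simp: Suc_le_eq)
qed

context cring
begin

lemma prime_chain_shift:
 assumes "prime_chain R n C" "k <= n"
 shows "prime_chain R k (%i. C (i + (n - k)))"
 using assms unfolding prime_chain_def by auto

lemma prime_chain_append:
 assumes "prime_chain R n C" "prime_chain R r D" "C n = D 0"
 shows "prime_chain R (n + r) (%i. if i <= n then C i else D (i - n))"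
 unfolding prime_chain_def
proof (intro conjI allI impI)
 fix i assume "i <= n + r"
 thus "primeideal (if i <= n then C i else D (i - n)) R" using assms unfolding prime_chain_def by auto
next
 fix i assume i: "i < n + r"
 consider "Suc i <= n" | "i = n" | "i > n" by linarith
 thus "(if i <= n then C i else D (i - n)) \<subset> (if Suc i <= n then C (Suc i) else D (Suc i - n))"
 proof cases
  case 2
  hence "D 0 \<subset> D (Suc 0)" using assms(2) i unfolding prime_chain_def by auto
  thus ?thesis using 2 assms(3) by simp
 next
  case 3
  hence "D (i - n) \<subset> D (Suc (i - n))" using assms(2) i unfolding prime_chain_def by auto
  thus ?thesis using 3 by (simp add: Suc_diff_le)
 qed (use assms(1) in \<open>auto simp: prime_chain_def\<close>)
qed

lemma chain_le_dim: "prime_chain R n C ==> krull_dim R = enat d ==> n <= d"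
proof -
 assume "prime_chain R n C" "krull_dim R = enat d"
 hence "enat n <= enat d" unfolding krull_dim_def by (metis (mono_tags, lifting) Sup_upper mem_Collect_eq)
 thus "n <= d" by simp
qed

lemma prime_chain_0: "primeideal P R ==> prime_chain R 0 (%_. P)"
 by (simp add: prime_chain_def)

lemma height_chain:
 assumes "primeideal P R" "enat h <= prime_height R P"
 shows "EX C. prime_chain R h C & C h = P"
proof -
 obtain n C where n: "h <= n" "prime_chain R n C" "C n = P"
  using enat_Sup_attained[of h "%n. EX C. prime_chain R n C & C n = P"] assms prime_chain_0[OF assms(1)] unfolding prime_height_def by blast
 thus ?thesis using prime_chain_shift[OF n(2,1)] by (intro exI[of _ "%i. C (i + (n - h))"]) simp
qed

lemma ideal_height_le: "primeideal P R ==> I <= P ==> ideal_height R I <= prime_height R P"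
 unfolding ideal_height_def by (rule Inf_lower) blast

lemma ideal_height_attained:
 assumes "ideal_height R I = enat h"
 shows "EX P. primeideal P R & I <= P & prime_height R P = enat h"
proof -
 let ?S = "{prime_height R P | P. primeideal P R & I <= P}"
 have "?S ~= {}" using assms unfolding ideal_height_def by (metis Inf_empty enat.distinct(1) top_enat_def)
 hence "Inf ?S : ?S" unfolding Inf_enat_def by (metis (mono_tags, lifting) LeastI ex_in_conv)
 thus ?thesis using assms unfolding ideal_height_def by auto
qed

lemma annihilator_ring: "annihilator R (ring_as_module R) = {\<zero>}"
proof -
 have "a = \<zero>" if "a : RR" "ALL x:RR. a \<otimes> x = \<zero>" for a
  using that(2)[rule_format, of \<one>] that(1) by simp
 thus ?thesis by (auto simp: annihilator_def)
qed

text \<open>The depth of a Cohen-Macaulay ring is compared with the dimension of \<open>R\<close>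
  modulo its annihilator, which is zero. This inequality makes the depth at least
  \<open>krull_dim R\<close>; the quotient consists of singletons.\<close>

lemma krull_dim_quot_zero: "krull_dim R <= krull_dim (R Quot {\<zero>})"
proof -
 let ?Q = "R Quot {\<zero>}"
 have Qc: "cring ?Q" by (rule ideal.quotient_is_cring[OF zeroideal is_cring])
 have cos: "{\<zero>} +> x = {x}" if "x : RR" for x using that by (auto simp: a_r_coset_def')
 have car: "carrier ?Q = (%x. {x}) ` RR" using cos by (auto simp: FactRing_def A_RCOSETS_def')
 have ad: "{x} \<oplus>\<^bsub>?Q\<^esub> {y} = {x \<oplus> y}" for x y by (auto simp: FactRing_def set_add_def')
 have mu: "{x} \<otimes>\<^bsub>?Q\<^esub> {y} = {x \<otimes> y}" if "x : RR" "y : RR" for x y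
  using that cos by (auto simp: FactRing_def rcoset_mult_def)
 have ze: "\<zero>\<^bsub>?Q\<^esub> = {\<zero>}" by (simp add: FactRing_def)
 have pr: "primeideal ((%x. {x}) ` P) ?Q" if P: "primeideal P R" for P
 proof -
  note Pi = primeideal.axioms(1)[OF P]
  interpret Q: cring ?Q by (rule Qc)
  show ?thesis
  proof (rule primeidealI)
   show "ideal ((%x. {x}) ` P) ?Q"
    by (rule Q.idI) (use id_sub[OF Pi] id_zero[OF Pi] id_add[OF Pi] id_mult[OF Pi] in \<open>auto simp: car ad ze mu subsetD\<close>)
   show "carrier ?Q ~= (%x. {x}) ` P" using primeideal_one[OF P] one_closed by (auto simp: car)
  qed (use Qc primeideal_mult[OF P] in \<open>auto simp: car mu\<close>)
 qed
 have "EX C. prime_chain ?Q n C" if "prime_chain R n C" for n C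
 proof (intro exI[of _ "%i. (%x. {x}) ` C i"])
  have "inj (%x::'a. {x})" by (simp add: inj_def)
  thus "prime_chain ?Q n (%i. (%x. {x}) ` C i)"
   using that pr unfolding prime_chain_def by (auto simp: image_strict_mono)
 qed
 thus ?thesis unfolding krull_dim_def by (intro Sup_subset_mono) blast
qed

end

context local_noeth
begin

lemma dep_mono: "dep q r ==> k <= r ==> dep q k"
proof (induction k arbitrary: q r)
 case (Suc k) thus ?case by (cases r) auto
qed simp

lemma regular_sequence_dep:
 assumes xs: "regular_sequence R (ring_as_module R) xs" "set xs <= mm"
 shows "i <= length xs ==> dep (Idl (set (take i xs))) (length xs - i)"
proof (induction "length xs - i" arbitrary: i)
 case (Suc n)
 hence i: "i < length xs" by simp
 have xc: "set xs <= RR" using xs(1) by (simp add: regular_sequence_def)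
 have "dep (Idl (set (take (Suc i) xs))) (length xs - Suc i)" using Suc i by simp
 moreover have "length xs - i = Suc (length xs - Suc i)" using i by simp
 ultimately show ?case using regular_sequence_nzd[OF xs(1) i] subsetD[OF xs(2) nth_mem[OF i]] Idl_take_Suc[OF xc i]
  by (auto intro!: bexI[of _ "xs ! i"])
qed simp

lemma cohen_macaulay_dep:
 assumes "cohen_macaulay_module R mm (ring_as_module R)" "krull_dim R = enat d"
 shows "dep {\<zero>} d"
proof -
 have "depth R mm (ring_as_module R) = krull_dim (R Quot {\<zero>})"
  using assms(1)[unfolded cohen_macaulay_module_def module_dim_def annihilator_ring] by (elim conjE)
 hence "enat d <= depth R mm (ring_as_module R)" using krull_dim_quot_zero by (simp only: assms(2))
 also have "... = Sup {enat n | n. EX xs. n = length xs & set xs <= mm & regular_sequence R (ring_as_module R) xs}"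
  unfolding depth_def by (intro arg_cong[where f = Sup] Collect_cong) metis
 finally have le: "enat d <= Sup {enat n | n. EX xs. n = length xs & set xs <= mm & regular_sequence R (ring_as_module R) xs}" .
 have "regular_sequence R (ring_as_module R) []"
 proof -
  have "\<one> ~: {\<zero>}" using mm_one id_zero[OF mm_ideal] by auto
  hence "{\<zero>} ~= RR" using one_closed by metis
  thus ?thesis by (simp add: regular_sequence_def Idl_empty ideal_smult_ring[OF zeroideal])
 qed
 hence nil: "EX xs. 0 = length xs & set xs <= mm & regular_sequence R (ring_as_module R) xs"
  by (intro exI[of _ "[]"]) simp
 from enat_Sup_attained[where p = "%n. EX xs. n = length xs & set xs <= mm & regular_sequence R (ring_as_module R) xs", OF le nil]
 obtain xs where xs: "d <= length xs" "set xs <= mm" "regular_sequence R (ring_as_module R) xs"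
  by blast
 hence "dep {\<zero>} (length xs)" using regular_sequence_dep[OF xs(3,2), of 0] by (simp add: Idl_empty)
 thus ?thesis using dep_mono xs(1) by blast
qed

end

section \<open>Local generators at the minimal primes\<close>

context cring
begin

lemma Mon_1: "Mon s (Suc 0) = (%l. {#l#}) ` {..<s}"
 by (induction s) (auto simp: Mon_Suc lessThan_Suc)

lemma form_1: "form Q s 1 c \<longleftrightarrow> (ALL l<s. c {#l#} : Q)"
 by (auto simp: form_def Mon_1)

lemma ev_linear:
 assumes x: "point x"
 shows "form (RR) s 1 c ==> ev x s 1 c = (\<Oplus>l\<in>{..<s}. c {#l#} \<otimes> x l)"
proof (induction s)
 case (Suc s)
 have c: "form (RR) s 1 c" "c {#s#} : RR" using Suc.prems by (simp_all add: form_1 del: One_nat_def)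
 have cl: "c {#l#} : RR" if "l < s" for l using c(1) that by (simp add: form_1 del: One_nat_def)
 have "(\<Oplus>l\<in>{..<Suc s}. c {#l#} \<otimes> x l) = c {#s#} \<otimes> x s \<oplus> (\<Oplus>l\<in>{..<s}. c {#l#} \<otimes> x l)"
  unfolding lessThan_Suc by (rule finsum_insert) (use c cl x in auto)
 also have "... = ev x s 1 c \<oplus> x s \<otimes> c {#s#}"
  using Suc.IH[OF c(1)] c(2) x ev_closed[OF c(1) x] by (simp add: m_comm a_comm)
 finally show ?case by simp
qed simp

text \<open>Where \<open>f\<close> generates \<open>I\<close> locally at \<open>P\<close>, these are
  the elements of the local power \<open>I_P^n\<close> that come from forms vanishing at the point
  \<open>rh\<close> over the residue field of \<open>P\<close>.\<close>

definition vanishing_vals :: "'a set => (nat => 'a) => (nat => 'a) => nat => nat => 'a set"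
 where "vanishing_vals P f rh h n = {w : RR. EX u:RR - P. EX c.
  form (RR) h n c & u \<otimes> w = ev f h n c & ev rh h n c : P}"

lemma vanishing_valsI:
 "w : RR ==> u : RR - P ==> form (RR) h n c ==> u \<otimes> w = ev f h n c ==> ev rh h n c : P
  ==> w : vanishing_vals P f rh h n"
 unfolding vanishing_vals_def by blast

lemma vanishing_valsE:
 assumes "w : vanishing_vals P f rh h n"
 obtains u c where "w : RR" "u : RR - P" "form (RR) h n c" "u \<otimes> w = ev f h n c" "ev rh h n c : P"
 using assms unfolding vanishing_vals_def by blast

lemma vanishing_vals_ideal:
 assumes P: "primeideal P R" and f: "point f" and r: "point rh"
 shows "ideal (vanishing_vals P f rh h n) R"
proof (rule idI)
 note Pi = primeideal.axioms(1)[OF P]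
 note SD = mult_setD[OF mult_set_compl[OF P]]
 show "vanishing_vals P f rh h n <= RR" by (auto simp: vanishing_vals_def)
 have z: "form (RR) h n (%_. \<zero>)" by (simp add: form_def)
 show "\<zero> : vanishing_vals P f rh h n"
  by (rule vanishing_valsI[OF zero_closed SD(2) z]) (use ev_zero[OF f] ev_zero[OF r] id_zero[OF Pi] in auto)
next
 note Pi = primeideal.axioms(1)[OF P]
 note SD = mult_setD[OF mult_set_compl[OF P]]
 fix a b assume "a : vanishing_vals P f rh h n" "b : vanishing_vals P f rh h n"
 then obtain u c v e where *: "a : RR" "u : RR - P" "form (RR) h n c" "u \<otimes> a = ev f h n c" "ev rh h n c : P"
  "b : RR" "v : RR - P" "form (RR) h n e" "v \<otimes> b = ev f h n e" "ev rh h n e : P" by (elim vanishing_valsE)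
 have uv: "u : RR" "v : RR" using * by auto
 note vc = form_smult[OF oneideal *(3) uv(2)] and ue = form_smult[OF oneideal *(8) uv(1)]
 have ev: "ev z h n (%mu. v \<otimes> c mu \<oplus> u \<otimes> e mu) = v \<otimes> ev z h n c \<oplus> u \<otimes> ev z h n e" if "point z" for z
  using ev_add[OF that vc ue] ev_smult[OF that uv(2) *(3)] ev_smult[OF that uv(1) *(8)] by simp
 show "a \<oplus> b : vanishing_vals P f rh h n"
 proof (rule vanishing_valsI[OF _ SD(3)[OF *(2,7)] form_add[OF oneideal vc ue]])
  show "(u \<otimes> v) \<otimes> (a \<oplus> b) = ev f h n (%mu. v \<otimes> c mu \<oplus> u \<otimes> e mu)"
   unfolding ev[OF f] *(4)[symmetric] *(9)[symmetric] using uv *(1,6) by algebra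
  show "ev rh h n (%mu. v \<otimes> c mu \<oplus> u \<otimes> e mu) : P"
   unfolding ev[OF r] using id_add[OF Pi id_mult[OF Pi *(5) uv(2)] id_mult[OF Pi *(10) uv(1)]] .
 qed (use * in simp)
next
 note Pi = primeideal.axioms(1)[OF P]
 fix a b assume "a : vanishing_vals P f rh h n" and b: "b : RR"
 then obtain u c where *: "a : RR" "u : RR - P" "form (RR) h n c" "u \<otimes> a = ev f h n c" "ev rh h n c : P"
  by (elim vanishing_valsE)
 have uc: "u : RR" using * by simp
 show "b \<otimes> a : vanishing_vals P f rh h n"
 proof (rule vanishing_valsI[OF _ *(2) form_smult[OF oneideal *(3) b]])
  show "u \<otimes> (b \<otimes> a) = ev f h n (%mu. b \<otimes> c mu)" unfolding ev_smult[OF f b *(3)] *(4)[symmetric] by (rule m_lcomm[OF uc b *(1)])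
  show "ev rh h n (%mu. b \<otimes> c mu) : P" unfolding ev_smult[OF r b *(3)] by (rule id_mult[OF Pi *(5) b])
 qed (use * b in simp)
qed

lemma vanishing_vals_sat:
 assumes P: "primeideal P R"
 shows "sat (RR - P) (vanishing_vals P f rh h n) <= vanishing_vals P f rh h n"
proof
 note SD = mult_setD[OF mult_set_compl[OF P]]
 fix a assume "a : sat (RR - P) (vanishing_vals P f rh h n)"
 then obtain v where v: "v : RR - P" "v \<otimes> a : vanishing_vals P f rh h n" "a : RR" by (elim satE)
 then obtain u c where *: "u : RR - P" "form (RR) h n c" "u \<otimes> (v \<otimes> a) = ev f h n c" "ev rh h n c : P"
  by (elim vanishing_valsE)
 have "(u \<otimes> v) \<otimes> a = ev f h n c" using * v by (simp add: m_assoc)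
 thus "a : vanishing_vals P f rh h n" using vanishing_valsI[OF v(3) SD(3)[OF *(1) v(1)] *(2)] *(4) by blast
qed

text \<open>The pullback to \<open>R\<close> of the subspace of \<open>I_P / P I_P\<close> spanned
  by \<open>x 0, ..., x (i - 1)\<close>.\<close>

definition local_span :: "'a set => 'a set => (nat => 'a) => nat => 'a set"
 where "local_span P I x i = sat (RR - P) (gen x i <+> P \<cdot> I)"

lemma local_span_ideal:
 "primeideal P R ==> ideal I R ==> point x ==> ideal (local_span P I x i) R"
 unfolding local_span_def
 by (intro sat_ideal mult_set_compl add_ideals gen_ideal ideal_prod_is_ideal) (auto intro: primeideal.axioms(1))

lemma local_form:
 assumes "point f" "I <= sat S (gen f h)" "w : I"
 obtains u c where "u : S" "form (RR) h 1 c" "u \<otimes> w = ev f h 1 c"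
proof -
 have "w : sat S (vals f h 1 (RR))" using assms gen_eq_vals by auto
 thus ?thesis using that by (blast elim: satE valsE)
qed

lemma local_coeffs:
 assumes f: "point f" and I: "I <= sat S (gen f h)" and x: "x ` K <= I"
 shows "EX u c. (ALL k:K. u k : S & u k \<otimes> x k = ev f h 1 (c k)) & (ALL k. form (RR) h 1 (c k)) & (ALL k l. c k {#l#} : RR)"
proof -
 have "EX u c. k : K --> u : S & form (RR) h 1 c & u \<otimes> x k = ev f h 1 c" for k
 proof (cases "k : K")
  case True
  hence "x k : I" using x by blast
  thus ?thesis by (rule local_form[OF f I]) blast
 qed simp
 then obtain u c where uc: "!!k. k : K ==> u k : S & form (RR) h 1 (c k) & u k \<otimes> x k = ev f h 1 (c k)" by metis
 \<comment> \<open>Outside \<open>K\<close> and off the monomials of degree one the entries are set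
   to zero, so that all of them lie in the ring, as \<open>underdetermined\<close> demands.\<close>
 define c' where "c' k mu = (if k : K & mu : Mon h 1 then c k mu else \<zero>)" for k mu
 have "form (RR) h 1 (c' k)" "c' k {#l#} : RR" for k l using uc[of k] by (auto simp: form_def c'_def)
 moreover have "u k \<otimes> x k = ev f h 1 (c' k)" if "k : K" for k
  using uc[OF that] ev_cong[of h 1 "c' k" "c k" f] that by (simp add: c'_def)
 ultimately show ?thesis using uc by blast
qed

text \<open>If \<open>I\<^sub>P\<close> is generated by a regular sequence of length \<open>h\<close>, the fiber cone of \<open>I\<^sub>P\<close> is a polynomial
  ring; hence no ideal \<open>J\<close> with \<open>I\<^sup>2 = J I\<close> is contained in a proper subspace of \<open>I\<^sub>P/P I\<^sub>P\<close>.\<close>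

lemma reduction_not_in_span:
 assumes P: "primeideal P R" and I: "ideal I R" "I <= P" and J: "ideal J R" "J <= I"
  and JI: "!!a b. a : I ==> b : I ==> a \<otimes> b : J \<cdot> I"
  and f: "point f" "!!l. l < h ==> f l : I" "regular_upto (RR - P) f h" "I <= sat (RR - P) (gen f h)"
  and x: "point x" "!!k. k < i ==> x k : I" and ih: "i < h"
 shows "~ J <= local_span P I x i"
proof
 assume le: "J <= local_span P I x i"
 define S where "S = RR - P"
 have S: "mult_set S" unfolding S_def by (rule mult_set_compl[OF P])
 note SD = mult_setD[OF S]
 note Pi = primeideal.axioms(1)[OF P]
 note lin = local_form[OF f(1) f(4)[folded S_def]]
 have "x ` {..<i} <= I" using x(2) by auto
 from local_coeffs[OF f(1) f(4)[folded S_def] this]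
 obtain u c where uc: "!!k. k : {..<i} ==> u k : S" "!!k. form (RR) h 1 (c k)" "!!k l. c k {#l#} : RR"
  "!!k. k : {..<i} ==> u k \<otimes> x k = ev f h 1 (c k)" by blast
 \<comment> \<open>The linear forms that represent the \<open>x k\<close> are \<open>i < h\<close>
   in number, so they have a common zero \<open>rh\<close> that is nonzero over the residue field of
   \<open>P\<close>.\<close>
 have "EX rh. (ALL l. rh l : RR) & (EX l:{..<h}. rh l ~: P) & (ALL k:{..<i}. (\<Oplus>l\<in>{..<h}. c k {#l#} \<otimes> rh l) : P)"
  by (rule underdetermined[OF P]) (use ih uc(3) in auto)
 then obtain rh where r: "!!l. rh l : RR" "EX l:{..<h}. rh l ~: P" "!!k. k : {..<i} ==> (\<Oplus>l\<in>{..<h}. c k {#l#} \<otimes> rh l) : P" by blast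
 have rp: "point rh" using r(1) by (simp add: point_def)
 let ?N = "vanishing_vals P f rh h"
 note N = vanishing_vals_ideal[OF P f(1) rp]
 have "gen x i <= ?N 1"
 proof (rule gen_least[OF N])
  fix k assume k: "k < i"
  have "ev rh h 1 (c k) : P" using r(3) k ev_linear[OF rp uc(2)] by simp
  thus "x k : ?N 1" using vanishing_valsI[OF pointD[OF x(1)] _ uc(2) uc(4)] uc(1)[of k] k by (simp add: S_def)
 qed
 moreover have "P \<cdot> I <= ?N 1"
 proof (rule prod_least[OF N])
  fix p w assume p: "p : P" and w: "w : I"
  obtain u c where u: "u : S" "form (RR) h 1 c" "u \<otimes> w = ev f h 1 c" by (rule lin[OF w])
  have pc: "p : RR" "w : RR" "u : RR" using p Pi w I SD(1)[OF u(1)] id_carr by blast+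
  show "p \<otimes> w : ?N 1"
  proof (rule vanishing_valsI[OF _ _ form_smult[OF oneideal u(2) pc(1)]])
   show "u : RR - P" using u(1) by (simp add: S_def)
   show "u \<otimes> (p \<otimes> w) = ev f h 1 (%mu. p \<otimes> c mu)" unfolding ev_smult[OF f(1) pc(1) u(2)] u(3)[symmetric] by (rule m_lcomm[OF pc(3,1,2)])
   show "ev rh h 1 (%mu. p \<otimes> c mu) : P" unfolding ev_smult[OF rp pc(1) u(2)] by (rule id_multr[OF Pi p ev_closed[OF u(2) rp]])
  qed (use pc in simp)
 qed
 ultimately have "gen x i <+> P \<cdot> I <= ?N 1" by (rule set_add_least[OF N])
 hence "local_span P I x i <= ?N 1"
  using sat_mono[of "gen x i <+> P \<cdot> I" "?N 1" S] vanishing_vals_sat[OF P, of f rh h 1] unfolding local_span_def S_def by blast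
 hence JN: "J <= ?N 1" using le by blast
 have JIN: "J \<cdot> I <= ?N 2"
 proof (rule prod_least[OF N])
  fix j w assume j: "j : J" and w: "w : I"
  obtain u c where u: "j : RR" "u : RR - P" "form (RR) h 1 c" "u \<otimes> j = ev f h 1 c" "ev rh h 1 c : P"
   using JN j by (blast elim: vanishing_valsE)
  obtain t e where t: "t : S" "form (RR) h 1 e" "t \<otimes> w = ev f h 1 e" by (rule lin[OF w])
  have wc: "w : RR" "t : RR" "u : RR" using w I(1) id_carr SD(1)[OF t(1)] u by auto
  obtain g where g: "form (RR) h (1 + 1) g" "!!z. point z ==> ev z h (1 + 1) g = ev z h 1 c \<otimes> ev z h 1 e"
   using form_product[OF oneideal subset_refl subset_refl _ t(2) order_refl u(3)] by auto
  show "j \<otimes> w : ?N 2"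
  proof (rule vanishing_valsI)
   show "u \<otimes> t : RR - P" using SD(3)[of u t] u t by (simp add: S_def)
   show "form (RR) h 2 g" using g(1) by (simp add: numeral_2_eq_2)
   have "(u \<otimes> t) \<otimes> (j \<otimes> w) = (u \<otimes> j) \<otimes> (t \<otimes> w)" using wc u(1) by algebra
   thus "(u \<otimes> t) \<otimes> (j \<otimes> w) = ev f h 2 g" using g(2)[OF f(1)] u(4) t(3) by (simp add: numeral_2_eq_2)
   show "ev rh h 2 g : P" using g(2)[OF rp] id_multr[OF Pi u(5) ev_closed[OF t(2) rp]] by (simp add: numeral_2_eq_2)
  qed (use u wc in simp)
 qed
 obtain l where l: "l < h" "rh l ~: P" using r(2) by auto
 \<comment> \<open>The quadric \<open>X_l^2\<close> for some \<open>rh l\<close> outside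
   \<open>P\<close> does not vanish at \<open>rh\<close>. Yet \<open>f l^2\<close> lies in
   \<open>J I\<close>, whose elements come from quadrics \<open>g\<close> that do; by
   quasi-regularity \<open>g\<close> and a multiple of \<open>X_l^2\<close> by a unit at
   \<open>P\<close> agree modulo \<open>P\<close>.\<close>
 define e where "e = shift l (shift l (%_. \<one>))"
 have one: "form (RR) h 0 (%_. \<one>)" by (simp add: form_def)
 note s1 = form_shift[OF zero_closed one, of l]
 have ef: "form (RR) h 2 e" unfolding e_def numeral_2_eq_2 by (rule form_shift[OF zero_closed s1])
 have ee: "ev z h 2 e = z l \<otimes> z l" if "point z" for z
  unfolding e_def numeral_2_eq_2 using ev_shift[OF that l(1) s1] ev_shift[OF that l(1) one] that by simp
 have "f l \<otimes> f l : ?N 2" using JI[OF f(2)[OF l(1)] f(2)[OF l(1)]] JIN by blast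
 then obtain t g where t: "t : RR - P" "form (RR) h 2 g" "t \<otimes> (f l \<otimes> f l) = ev f h 2 g" "ev rh h 2 g : P"
  by (elim vanishing_valsE)
 have tc: "t : RR" using t by simp
 note tf = form_smult[OF oneideal ef tc]
 have "ev f h 2 (%mu. t \<otimes> e mu \<ominus> g mu) = \<zero>"
  using ev_minus[OF f(1) tf t(2)] ev_smult[OF f(1) tc ef] ee[OF f(1)] t(3) ev_closed[OF t(2) f(1)] by (simp add: a_minus_def r_neg)
 hence "form (sat S (gen f h)) h 2 (%mu. t \<otimes> e mu \<ominus> g mu)"
  using quasi_regular_zero[OF S f(1) f(3)[folded S_def] form_minus[OF oneideal tf t(2)]] id_zero[OF sat_ideal[OF S zeroideal]] by simp
 moreover have "sat S (gen f h) <= P"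
 proof
  fix a assume "a : sat S (gen f h)"
  then obtain u where u: "u : S" "u \<otimes> a : gen f h" "a : RR" by (elim satE)
  have "gen f h <= P" by (rule gen_least[OF Pi]) (use f(2) I(2) in blast)
  thus "a : P" using u primeideal_mult[OF P _ u(3), of u] by (auto simp: S_def)
 qed
 ultimately have "form P h 2 (%mu. t \<otimes> e mu \<ominus> g mu)" by (rule form_mono)
 hence "ev rh h 2 (%mu. t \<otimes> e mu \<ominus> g mu) : P" by (rule ev_in[OF Pi _ rp])
 hence "t \<otimes> (rh l \<otimes> rh l) \<ominus> ev rh h 2 g : P"
  using ev_minus[OF rp tf t(2)] ev_smult[OF rp tc ef] ee[OF rp] by simp
 hence "t \<otimes> (rh l \<otimes> rh l) : P" using id_minus_cancel[OF Pi _ ev_closed[OF t(2) rp]] t(4) tc r(1) by simp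
 thus False using primeideal_mult[OF P] tc r(1) l(2) t(1) by simp
qed

text \<open>In a space with \<open>h\<close> generators, \<open>h\<close> independent vectors span;
  Nakayama at \<open>P\<close>, in the form of \<open>elimination\<close>, lifts this from
  \<open>I_P / P I_P\<close> to \<open>I_P\<close>.\<close>

lemma independent_generate:
 assumes P: "primeideal P R" and I: "ideal I R"
  and f: "point f" "!!l. l < h ==> f l : I" "I <= sat (RR - P) (gen f h)"
  and x: "point x" "!!k. k < h ==> x k : I" "!!k. k < h ==> x k ~: local_span P I x k"
 shows "I <= sat (RR - P) (gen x h)"
proof -
 define S where "S = RR - P"
 have S: "mult_set S" unfolding S_def by (rule mult_set_compl[OF P])
 note SD = mult_setD[OF S] and Pi = primeideal.axioms(1)[OF P] and fS = f(3)[folded S_def]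
 have PI: "ideal (P \<cdot> I) R" by (rule ideal_prod_is_ideal[OF Pi I])
 have span: "w : local_span P I x h" if w: "w : I" for w
 proof -
  define z where "z = x(h := w)"
  have zI: "z k : I" if "k : {..h}" for k using that x(2) w by (auto simp: z_def)
  hence "z ` {..h} <= I" by auto
  from local_coeffs[OF f(1) fS this]
  obtain u c where uc: "!!k. k : {..h} ==> u k : S" "!!k. form (RR) h 1 (c k)" "!!k l. c k {#l#} : RR"
   "!!k. k : {..h} ==> u k \<otimes> z k = ev f h 1 (c k)" by blast
  have "EX rh. (ALL k. rh k : RR) & (EX k:{..h}. rh k ~: P) & (ALL l:{..<h}. (\<Oplus>k\<in>{..h}. c k {#l#} \<otimes> rh k) : P)"
   by (rule underdetermined[OF P]) (use uc(3) in auto)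
  then obtain rh where r: "!!k. rh k : RR" "EX k:{..h}. rh k ~: P" "!!l. l : {..<h} ==> (\<Oplus>k\<in>{..h}. c k {#l#} \<otimes> rh k) : P" by blast
  \<comment> \<open>The linear relation between the \<open>h + 1\<close> vectors is solved for the
    last one with coefficient outside \<open>P\<close>. Independence of the \<open>x k\<close>
    leaves only the index \<open>h\<close>, which is \<open>w\<close>.\<close>
  define k where "k = Max {k. k <= h & rh k ~: P}"
  have fin: "finite {k. k <= h & rh k ~: P}" by (rule finite_subset[of _ "{..h}"]) auto
  have "k : {k. k <= h & rh k ~: P}" unfolding k_def by (rule Max_in[OF fin]) (use r(2) in auto)
  hence k: "k <= h" "rh k ~: P" by auto
  have k3: "rh j : P" if "k < j" "j <= h" for j using Max_ge[OF fin, of j] that unfolding k_def[symmetric] by force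
  let ?t = "%j. rh j \<otimes> (u j \<otimes> z j)" and ?L = "gen x k <+> P \<cdot> I"
  have L: "ideal ?L R" "gen x k <= ?L" "P \<cdot> I <= ?L"
   using add_ideals[OF gen_ideal[OF x(1)] PI] set_add_sub1[OF gen_ideal[OF x(1)] PI] set_add_sub2[OF gen_ideal[OF x(1)] PI] by auto
  have c: "u j : RR" "z j : RR" if "j <= h" for j using SD(1)[OF uc(1)] id_carr[OF I zI] that by auto
  have "(\<Oplus>j\<in>{..h}. ?t j) = (\<Oplus>j\<in>{..h}. rh j \<otimes> (\<Oplus>l\<in>{..<h}. c j {#l#} \<otimes> f l))"
   by (rule finsum_cong') (use uc ev_linear[OF f(1) uc(2)] ev_closed[OF uc(2) f(1)] r(1) in auto)
  also have "... = (\<Oplus>l\<in>{..<h}. (\<Oplus>j\<in>{..h}. c j {#l#} \<otimes> rh j) \<otimes> f l)"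
   by (rule finsum_swap_linear) (use uc(3) r(1) f(1) in auto)
  also have "... : ?L"
   by (rule finsum_in_ideal[OF L(1)]) (use L(3) ideal_prod.prod[OF r(3) f(2)] in auto)
  finally have "?t k \<oplus> (\<Oplus>j\<in>{..h} - {k}. ?t j) : ?L"
   using finsum_insert[of "{..h} - {k}" k ?t] c r(1) k(1) by (simp add: insert_absorb)
  moreover have "(\<Oplus>j\<in>{..h} - {k}. ?t j) : ?L"
  proof (rule finsum_in_ideal[OF L(1)])
   fix j assume j: "j : {..h} - {k}"
   show "?t j : ?L"
   proof (cases "j < k")
    case True
    hence "z j : ?L" using L(2) gen_mem[OF x(1) True] k(1) by (auto simp: z_def)
    thus ?thesis using id_mult[OF L(1)] c[of j] r(1) j by simp
   next
    case False
    hence "?t j : P \<cdot> I" using j by (intro ideal_prod.prod k3 id_mult[OF I zI]) (auto intro: c)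
    thus ?thesis using L(3) by blast
   qed
  qed simp
  ultimately have "?t k : ?L"
   using id_add_cancel(1)[OF L(1)] c[OF k(1)] r(1) by (meson id_carr[OF L(1)] m_closed)
  moreover have "rh k \<otimes> u k : S" using SD(3) uc(1) k r(1) by (simp add: S_def)
  ultimately have "z k : local_span P I x k" unfolding local_span_def S_def[symmetric]
   using satI[of "z k" "rh k \<otimes> u k"] c[OF k(1)] r(1) by (simp add: m_assoc)
  thus ?thesis using x(3)[of k] k(1) by (cases "k = h") (auto simp: z_def)
 qed
 have PV: "P \<cdot> I <= sat S (vals f h 1 P)"
 proof (rule prod_least[OF sat_ideal[OF S vals_ideal[OF Pi f(1)]]])
  fix p w assume p: "p : P" and w: "w : I"
  obtain u c where u: "u : S" "form (RR) h 1 c" "u \<otimes> w = ev f h 1 c" by (rule local_form[OF f(1) fS w])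
  have pc: "p : RR" "w : RR" "u : RR" using p Pi w I SD(1)[OF u(1)] id_carr by blast+
  have "form P h 1 (%mu. p \<otimes> c mu)" using u(2) id_multr[OF Pi p] by (simp add: form_def del: One_nat_def)
  moreover have "u \<otimes> (p \<otimes> w) = ev f h 1 (%mu. p \<otimes> c mu)"
   unfolding ev_smult[OF f(1) pc(1) u(2)] u(3)[symmetric] by (rule m_lcomm[OF pc(3,1,2)])
  ultimately show "p \<otimes> w : sat S (vals f h 1 P)" using satI[OF _ u(1)] valsI pc by simp
 qed
 note gi = gen_ideal[OF x(1), of h]
 have "EX t c. l < h --> t : S & form P h 1 c & t \<otimes> f l \<ominus> ev f h 1 c : gen x h" for l
 proof (cases "l < h")
  case True
  obtain u where u: "u : S" "u \<otimes> f l : gen x h <+> P \<cdot> I" using span[OF f(2)[OF True]] unfolding local_span_def S_def by (elim satE)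
  then obtain a b where ab: "a : gen x h" "b : P \<cdot> I" "u \<otimes> f l = a \<oplus> b" by (auto simp: set_add_iff)
  obtain v c where v: "v : S" "form P h 1 c" "v \<otimes> b = ev f h 1 c" using PV ab(2) by (blast elim: satE valsE)
  have cc: "u : RR" "v : RR" "a : RR" "b : RR" "f l : RR"
   using u(1) v(1) SD(1) id_carr[OF gi ab(1)] id_carr[OF PI ab(2)] f(1) by auto
  have "(v \<otimes> u) \<otimes> f l \<ominus> v \<otimes> b = v \<otimes> (u \<otimes> f l) \<ominus> v \<otimes> b" using cc by (simp add: m_assoc)
  also have "... = v \<otimes> a" unfolding ab(3) using cc(1-4) by algebra
  finally show ?thesis using v SD(3)[OF v(1) u(1)] id_mult[OF gi ab(1) cc(2)] by metis
 qed simp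
 then obtain t c where tc: "!!l. l < h ==> t l : S" "!!l. l < h ==> form P h 1 (c l)"
  "!!l. l < h ==> t l \<otimes> f l \<ominus> ev f h 1 (c l) : gen x h" by metis
 \<comment> \<open>Modulo \<open>gen x h\<close> each \<open>t l f l\<close> is a combination of the
   \<open>f m\<close> with coefficients in \<open>P\<close>, and an element of \<open>S\<close>
   minus one of \<open>P\<close> is in \<open>S\<close>. So the determinant trick applies with
   \<open>G = S\<close> and \<open>H = P\<close>.\<close>
 have "EX v:S. ALL l<h. v \<otimes> f l : gen x h"
 proof (rule elimination[OF gi, where H = P and u = t and h = "%l m. c l {#m#}"])
  show "t l \<otimes> f l \<ominus> (\<Oplus>m\<in>{..<h}. c l {#m#} \<otimes> f m) : gen x h" if "l < h" for l
   using tc(3)[OF that] ev_linear[OF f(1) form_carr[OF tc(2)[OF that] Pi]] by simp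
  show "c l {#m#} : P" if "l < h" "m < h" for l m using tc(2)[OF that(1)] that(2) unfolding form_1 by blast
  show "a \<ominus> b : S" if "a : S" "b : P" for a b
   using id_minus_cancel[OF Pi] that id_carr[OF Pi that(2)] by (auto simp: S_def)
 qed (use SD tc(1) f(1) Pi in \<open>auto simp: id_add id_mult id_carr\<close>)
 then obtain v where v: "v : S" "!!l. l < h ==> v \<otimes> f l : gen x h" by blast
 have "gen f h <= sat S (gen x h)"
  by (rule gen_least[OF sat_ideal[OF S gi]]) (use satI[OF _ v] f(1) in simp)
 thus ?thesis using fS sat_mono sat_cancel[OF S] unfolding S_def[symmetric] by (blast elim: satE)
qed

end

context noeth
begin

text \<open>Noetherian induction: a maximal counterexample \<open>q\<close> is not prime, so it
  contains a product \<open>a b\<close> of elements outside it, and a prime minimal over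
  \<open>q\<close> is minimal over \<open>q + (a)\<close> or over \<open>q + (b)\<close>.\<close>

lemma finite_minimal_primes:
 assumes "ideal I R" shows "finite {P. minimal_prime_over R I P}"
proof (rule ccontr)
 assume inf: "infinite {P. minimal_prime_over R I P}"
 obtain q where q: "ideal q R" "infinite {P. minimal_prime_over R q P}"
  and mx: "!!q'. ideal q' R ==> q <= q' ==> infinite {P. minimal_prime_over R q' P} ==> q' = q"
  using max_ideal_obtain[where P = "%q. infinite {P. minimal_prime_over R q P}", OF assms inf] by blast
 have np: "~ primeideal q R"
 proof
  assume p: "primeideal q R"
  have "{P. minimal_prime_over R q P} <= {q}" unfolding minimal_prime_over_def using p by auto
  thus False using q(2) finite_subset by blast
 qed
 have "RR ~= q"
 proof
  assume "RR = q"
  hence "{P. minimal_prime_over R q P} = {}"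
   unfolding minimal_prime_over_def using primeideal_one one_closed by blast
  thus False using q(2) by simp
 qed
 then obtain a b where ab: "a : RR" "b : RR" "a \<otimes> b : q" "a ~: q" "b ~: q"
  using np primeidealI[OF q(1) is_cring] by blast
 have fin: "finite {P. minimal_prime_over R (addel q c) P}" if "c : RR" "c ~: q" for c
  using mx[OF addel_ideal[OF q(1) that(1)] addel_sub[OF q(1) that(1)]] addel_mem[OF q(1) that(1)] that(2) by blast
 have "{P. minimal_prime_over R q P} <= {P. minimal_prime_over R (addel q a) P} Un {P. minimal_prime_over R (addel q b) P}"
 proof
  fix P assume "P : {P. minimal_prime_over R q P}"
  hence P: "primeideal P R" "q <= P" and mn: "!!Q. primeideal Q R ==> q <= Q ==> Q <= P ==> Q = P"
   unfolding minimal_prime_over_def by auto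
  have *: "minimal_prime_over R (addel q c) P" if c: "c : RR" "c : P" for c
  proof -
   have "addel q c <= P" by (rule addel_least[OF primeideal.axioms(1)[OF P(1)] P(2) c(2)])
   moreover have "Q = P" if "primeideal Q R" "addel q c <= Q" "Q <= P" for Q
    using mn[OF that(1) _ that(3)] addel_sub[OF q(1) c(1)] that(2) by blast
   ultimately show ?thesis unfolding minimal_prime_over_def using P(1) by blast
  qed
  have "a : P | b : P" using primeideal_mult[OF P(1) ab(1,2)] ab(3) P(2) by blast
  thus "P : {P. minimal_prime_over R (addel q a) P} Un {P. minimal_prime_over R (addel q b) P}"
   using *[OF ab(1)] *[OF ab(2)] by blast
 qed
 thus False using q(2) fin[OF ab(1,4)] fin[OF ab(2,5)] by (meson finite_UnI finite_subset)
qed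

end

section \<open>Generic generators of a reduction\<close>

context cring
begin

lemma prime_chain_cons:
 assumes P: "primeideal P R" and D: "prime_chain R r D" "P \<subset> D 0"
 shows "prime_chain R (Suc r) (%i. case i of 0 => P | Suc j => D j)"
 unfolding prime_chain_def
proof (intro conjI allI impI)
 fix i assume "i <= Suc r"
 thus "primeideal (case i of 0 => P | Suc j => D j) R" using D(1) P unfolding prime_chain_def by (cases i) auto
next
 fix i assume "i < Suc r"
 thus "(case i of 0 => P | Suc j => D j) \<subset> (case Suc i of 0 => P | Suc j => D j)"
  using D unfolding prime_chain_def by (cases i) auto
qed

lemma chains_le_dim:
 assumes "krull_dim R = enat d" "prime_chain R n C" "prime_chain R r D" "C n = D 0"
 shows "n + r <= d"
 using chain_le_dim[OF prime_chain_append[OF assms(2-4)] assms(1)] .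

lemma gen_cong: "(!!i. i < s ==> x i = y i) ==> gen x s = gen y s"
 by (induction s) auto

lemma point_upd: "point x ==> y : RR ==> point (x(i := y))"
 by (simp add: point_def)

end

context local_inf
begin

lemma dep_gen:
 assumes "dep {\<zero>} d" "point x"
 shows "i <= d ==> (!!k. k < i ==> x k : mm & nzd (gen x k) (x k)) ==> dep (gen x i) (d - i)"
proof (induction i)
 case (Suc i)
 hence "dep (gen x i) (Suc (d - Suc i))" by (simp add: Suc_diff_Suc)
 thus ?case using dep_exchange[OF gen_ideal[OF assms(2)], of i "d - Suc i" "x i"] Suc.prems(2)[of i] by simp
qed (simp add: assms)

text \<open>A chain of length \<open>d - 1\<close> ends at \<open>Q\<close> because \<open>Q\<close>
  contains \<open>I\<close>, and one of length \<open>d - i\<close> starts there by depth. In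
  dimension \<open>d\<close> this leaves only \<open>i = d - 1\<close>, and a smaller prime over
  \<open>I\<close> would make the combined chain too long.\<close>

lemma assoc_contains:
 assumes d: "krull_dim R = enat d" "d >= 1" and dep: "dep {\<zero>} d"
  and ht: "enat (d - 1) <= ideal_height R I"
  and x: "point x" "!!k. k < i ==> x k : mm & nzd (gen x k) (x k)" and i: "i <= d - 1"
  and Q: "assoc_prime (gen x i) Q" "I <= Q"
 shows "i = d - 1 & minimal_prime_over R I Q"
proof -
 have Qp: "primeideal Q R" using assoc_prime_prime[OF Q(1)] .
 have chainI: "EX C. prime_chain R (d - 1) C & C (d - 1) = Q'" if "primeideal Q' R" "I <= Q'" for Q'
  using height_chain[OF that(1)] order_trans[OF ht ideal_height_le[OF that]] by blast
 have "dep (gen x i) (d - i)" by (rule dep_gen[OF dep x(1)]) (use i x(2) in auto)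
 then obtain D where D: "prime_chain R (d - i) D" "D 0 = Q"
  using dep_prime_chain[OF gen_ideal[OF x(1)] Q(1)] by blast
 obtain C where C: "prime_chain R (d - 1) C" "C (d - 1) = Q" using chainI[OF Qp Q(2)] by blast
 have "d - 1 + (d - i) <= d" by (rule chains_le_dim[OF d(1) C(1) D(1)]) (simp only: C(2) D(2))
 hence id: "i = d - 1" using i d(2) by linarith
 have "Q' = Q" if Q': "primeideal Q' R" "I <= Q'" "Q' <= Q" for Q'
 proof (rule ccontr)
  assume "Q' ~= Q"
  hence "Q' \<subset> D 0" using Q'(3) D(2) by blast
  from prime_chain_cons[OF Q'(1) D(1) this]
  have E: "prime_chain R (Suc (d - i)) (%i. case i of 0 => Q' | Suc j => D j)" .
  obtain C' where C': "prime_chain R (d - 1) C'" "C' (d - 1) = Q'" using chainI[OF Q'(1,2)] by blast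
  have "d - 1 + Suc (d - i) <= d" by (rule chains_le_dim[OF d(1) C'(1) E]) (simp only: C'(2) nat.case)
  thus False using id d(2) by linarith
 qed
 thus ?thesis using id Qp Q(2) unfolding minimal_prime_over_def by blast
qed

text \<open>Height at least \<open>d\<close> would force \<open>P = mm\<close>. But
  \<open>mm\<close> contains a prime of height \<open>d - 1\<close> over \<open>I\<close>, which
  minimality of \<open>P\<close> would identify with \<open>mm\<close>.\<close>

lemma minimal_prime_height:
 assumes d: "krull_dim R = enat d" "d >= 1" and ht: "ideal_height R I = enat (d - 1)"
  and P: "minimal_prime_over R I P"
 shows "prime_height R P = enat (d - 1)"
proof (rule antisym)
 have Pp: "primeideal P R" "I <= P" and mn: "!!Q. primeideal Q R ==> I <= Q ==> Q <= P ==> Q = P"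
  using P unfolding minimal_prime_over_def by auto
 show "enat (d - 1) <= prime_height R P" using ideal_height_le[OF Pp] ht by simp
 show "prime_height R P <= enat (d - 1)"
 proof (rule ccontr)
  assume "~ ?thesis"
  hence "enat (d - 1) < prime_height R P" by simp
  hence ge: "enat d <= prime_height R P" using d(2) by (metis Suc_diff_1 Suc_ile_eq less_le_trans zero_less_one)
  obtain C where C: "prime_chain R d C" "C d = P" using height_chain[OF Pp(1) ge] by blast
  have Pm: "P <= mm" using proper_sub_mm[OF primeideal.axioms(1)[OF Pp(1)] primeideal_one[OF Pp(1)]] .
  show False
  proof (cases "P = mm")
   case True
   obtain P0 where P0: "primeideal P0 R" "I <= P0" "prime_height R P0 = enat (d - 1)" using ideal_height_attained[OF ht] by blast
   have "P0 <= P" unfolding True using proper_sub_mm[OF primeideal.axioms(1)[OF P0(1)] primeideal_one[OF P0(1)]] .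
   hence "P0 = P" using mn[OF P0(1,2)] by blast
   thus False using P0(3) ge d(2) by auto
  next
   case False
   hence "P \<subset> mm" using Pm by blast
   hence "prime_chain R (Suc 0) (%i. case i of 0 => P | Suc j => mm)"
    using prime_chain_cons[OF Pp(1) prime_chain_0[OF mm_prime]] by simp
   from chains_le_dim[OF d(1) C(1) this] C(2) show False by simp
  qed
 qed
qed

text \<open>Each element is chosen in \<open>J\<close> outside finitely many ideals: the earlier
  ones plus \<open>mm I\<close>, the associated primes not containing \<open>I\<close> and, before
  the last choice, the local spans at the minimal primes of \<open>I\<close>. For
  \<open>i < d - 1\<close> no associated prime contains \<open>I\<close>, so the element is regular;
  at \<open>i = d - 1\<close> those that do are minimal over \<open>I\<close>, where the earlier
  elements already generate \<open>I\<close>.\<close>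

lemma generic_generators:
 assumes d: "krull_dim R = enat d" "d >= 1" and dep: "dep {\<zero>} d" and I: "ideal I R"
  and ht: "ideal_height R I = enat (d - 1)" and lci: "locally_complete_intersection R I"
  and J: "ideal J R" "J <= I" and red: "!!n. n >= 1 ==> J \<cdot> ipow I n = ipow I (Suc n)"
  and big: "!!x i. point x ==> (!!k. k < i ==> x k : J) ==> i < d ==> ~ J <= gen x i <+> mm \<cdot> I"
 shows "EX x. point x & (ALL k<d. x k : J & x k ~: gen x k <+> mm \<cdot> I) & (ALL k<d - 1. nzd (gen x k) (x k)) &
  (ALL w:I. x (d - 1) \<otimes> w : gen x (d - 1) --> w : gen x (d - 1))"
proof -
 have mI: "ideal (mm \<cdot> I) R" using ideal_prod_is_ideal[OF mm_ideal I] .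
 have Im: "I <= mm"
 proof -
  obtain P where P: "primeideal P R" "I <= P" using ideal_height_attained[OF ht] by blast
  thus ?thesis using proper_sub_mm[OF primeideal.axioms(1)[OF P(1)] primeideal_one[OF P(1)]] by blast
 qed
 have JI: "a \<otimes> b : J \<cdot> I" if "a : I" "b : I" for a b
  using ideal_prod.prod[OF that, of R] red[of 1] pow_1[OF I] pow_Suc2[OF I, of 1] by simp
 have htle: "enat (d - 1) <= ideal_height R I" unfolding ht by (rule order_refl)
 let ?Min = "{P. minimal_prime_over R I P}"
 have span: "~ J <= local_span P I x i"
  if P: "minimal_prime_over R I P" and x: "point x" "!!k. k < i ==> x k : J" and i: "i < d - 1" for P x i
 proof -
  have Pp: "primeideal P R" "I <= P" using P unfolding minimal_prime_over_def by auto
  obtain f h where f: "point f" "!!i. i < h ==> f i : I" "enat h = prime_height R P" "regular_upto (RR - P) f h"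
   "I <= sat (RR - P) (gen f h)" using local_complete_intersection_gens[OF P I lci] by blast
  have h: "h = d - 1" using minimal_prime_height[OF d ht P] f(3) by simp
  have xI: "x k : I" if "k < i" for k using x(2)[OF that] J(2) by blast
  show ?thesis
   by (rule reduction_not_in_span[OF Pp(1) I Pp(2) J JI f(1,2,4,5) x(1) _ i[folded h]]) (assumption | erule xI)+
 qed
 define good where "good x i \<longleftrightarrow> point x & (ALL k<i. x k : J & x k ~: gen x k <+> mm \<cdot> I & nzd (gen x k) (x k) &
  (ALL P:?Min. x k ~: local_span P I x k))" for x i
 have step: "EX y:J. y ~: gen x i <+> mm \<cdot> I & (ALL Q. assoc_prime (gen x i) Q --> ~ I <= Q --> y ~: Q) &
  (i < d - 1 --> (ALL P:?Min. y ~: local_span P I x i))" if x: "good x i" and i: "i < d" for x i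
 proof -
  have xp: "point x" and xJ: "!!k. k < i ==> x k : J" using x unfolding good_def by auto
  note gi = gen_ideal[OF xp, of i]
  let ?Ls = "{gen x i <+> mm \<cdot> I} Un {Q. assoc_prime (gen x i) Q & ~ I <= Q} Un {local_span P I x i | P. P : ?Min & i < d - 1}"
  have "EX y:J. ALL L:?Ls. y ~: L"
  proof (rule avoid[OF J(1)])
   show "finite ?Ls" using finite_assoc[OF gi] finite_minimal_primes[OF I] by simp
   show "ideal L R" if "L : ?Ls" for L
    using that add_ideals[OF gi mI] assoc_prime_ideal local_span_ideal[OF _ I xp] unfolding minimal_prime_over_def by blast
  next
   fix L assume "L : ?Ls"
   then consider "L = gen x i <+> mm \<cdot> I" | "assoc_prime (gen x i) L" "~ I <= L"
    | P where "minimal_prime_over R I P" "i < d - 1" "L = local_span P I x i" by blast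
   thus "~ J <= L"
   proof cases
    case 1 thus ?thesis using big[OF xp xJ i] by blast
   next
    case 2
    note Lp = assoc_prime_prime[OF 2(1)]
    note Li = primeideal.axioms(1)[OF Lp]
    \<comment> \<open>A prime that contains \<open>J\<close> contains \<open>J I\<close>, hence the
      square of every element of \<open>I\<close>, hence \<open>I\<close>.\<close>
    obtain a where a: "a : I" "a ~: L" using 2(2) by blast
    have ac: "a : RR" using id_carr[OF I a(1)] .
    have "a \<otimes> a ~: L" using primeideal_mult[OF Lp ac ac] a(2) by blast
    moreover have "J \<cdot> I <= L" if "J <= L" using prod_least[OF Li] that id_multr[OF Li] id_carr[OF I] by (metis subsetD)
    ultimately show ?thesis using JI[OF a(1) a(1)] by blast
   next
    case (3 P) thus ?thesis using span[OF _ xp xJ] by blast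
   qed
  qed
  thus ?thesis by blast
 qed
 have "EX x. good x i" if "i <= d - 1" for i
  using that
 proof (induction i)
  case 0
  have "good (%_. \<zero>) 0" by (simp add: good_def point_def)
  thus ?case by blast
 next
  case (Suc i)
  then obtain x where x: "good x i" by auto
  have xp: "point x" and xm: "!!k. k < i ==> x k : mm & nzd (gen x k) (x k)" using x J(2) Im unfolding good_def by blast+
  have i: "i < d - 1" "i <= d - 1" "i < d" using Suc.prems by auto
  obtain y :: 'a where y: "y : J" "y ~: gen x i <+> mm \<cdot> I" "!!Q. assoc_prime (gen x i) Q ==> ~ I <= Q ==> y ~: Q"
   "!!P. P : ?Min ==> y ~: local_span P I x i" using step[OF x i(3)] i(1) by blast
  have yc: "y : RR" using y(1) id_carr[OF J(1)] by blast
  have "~ I <= Q" if "assoc_prime (gen x i) Q" for Q using assoc_contains[OF d dep htle xp xm i(2) that] i(1) by blast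
  hence yn: "nzd (gen x i) y" using not_nzd_assoc[OF gen_ideal[OF xp] yc] y(3) by blast
  have gx: "gen (x(i := y)) k = gen x k" if "k <= i" for k by (rule gen_cong) (use that in simp)
  have "good (x(i := y)) (Suc i)"
   using x y(1,2,4) yn point_upd[OF xp yc] unfolding good_def local_span_def less_Suc_eq by (auto simp: gx)
  thus ?case by blast
 qed
 then obtain x where x: "good x (d - 1)" by blast
 have xp: "point x" and xJ: "!!k. k < d - 1 ==> x k : J" and xn: "!!k. k < d - 1 ==> nzd (gen x k) (x k)"
  and xs: "!!k P. k < d - 1 ==> minimal_prime_over R I P ==> x k ~: local_span P I x k"
  using x unfolding good_def by auto
 have xm: "x k : mm & nzd (gen x k) (x k)" if "k < d - 1" for k using xJ[OF that] xn[OF that] J(2) Im by blast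
 let ?i = "d - 1"
 have i: "?i < d" using d(2) by simp
 note gi = gen_ideal[OF xp, of ?i]
 have loc: "I <= sat (RR - P) (gen x ?i)" if P: "minimal_prime_over R I P" for P
 proof -
  have Pp: "primeideal P R" "I <= P" using P unfolding minimal_prime_over_def by auto
  obtain f h where f: "point f" "!!i. i < h ==> f i : I" "enat h = prime_height R P"
   "I <= sat (RR - P) (gen f h)" using local_complete_intersection_gens[OF P I lci] by blast
  have h: "h = d - 1" using minimal_prime_height[OF d ht P] f(3) by simp
  show ?thesis
   by (rule independent_generate[OF Pp(1) I f(1) f(2)[unfolded h] f(4)[unfolded h] xp _ xs[OF _ P]]) (use xJ J(2) in auto)
 qed
 obtain y :: 'a where y: "y : J" "y ~: gen x ?i <+> mm \<cdot> I" "!!Q. assoc_prime (gen x ?i) Q ==> ~ I <= Q ==> y ~: Q"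
  using step[OF x i] by blast
 have yc: "y : RR" using y(1) id_carr[OF J(1)] by blast
 \<comment> \<open>A failure yields an associated prime that annihilates a multiple of
   \<open>w\<close> and contains \<open>y\<close>. By the choice of \<open>y\<close> it contains
   \<open>I\<close> and is minimal over it; there \<open>w\<close> is locally in the ideal, so an
   element outside the prime kills \<open>w\<close>, a contradiction.\<close>
 have last: "w : gen x ?i" if w: "w : I" "y \<otimes> w : gen x ?i" for w
 proof (rule ccontr)
  assume wn: "w ~: gen x ?i"
  have wc: "w : RR" using id_carr[OF I w(1)] .
  obtain b where b: "b : RR" "assoc_prime (gen x ?i) (colon (gen x ?i) (b \<otimes> w))"
   "colon (gen x ?i) w <= colon (gen x ?i) (b \<otimes> w)" using assoc_prime_exists[OF gi wc wn] by blast
  let ?Q = "colon (gen x ?i) (b \<otimes> w)"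
  have "y : ?Q" using b(3) w(2) yc by (auto simp: colon_iff)
  hence IQ: "I <= ?Q" using y(3)[OF b(2)] by blast
  have "minimal_prime_over R I ?Q"
   using assoc_contains[OF d dep htle xp xm order_refl b(2) IQ] by blast
  hence "w : sat (RR - ?Q) (gen x ?i)" using loc w(1) by blast
  then obtain u where u: "u : RR - ?Q" "u \<otimes> w : gen x ?i" by (elim satE)
  hence "u : colon (gen x ?i) w" by (simp add: colon_iff)
  thus False using u(1) b(3) by blast
 qed
 let ?x = "x(?i := y)"
 have gx: "gen ?x k = gen x k" if "k <= ?i" for k by (rule gen_cong) (use that in simp)
 have 1: "?x k : J & ?x k ~: gen ?x k <+> mm \<cdot> I" if "k < d" for k
 proof (cases "k = ?i")
  case True thus ?thesis using y(1,2) gx[of ?i] by simp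
 next
  case False
  hence "k < ?i" using that by simp
  thus ?thesis using x gx[of k] unfolding good_def by simp
 qed
 have 2: "nzd (gen ?x k) (?x k)" if "k < d - 1" for k using xn[OF that] gx[of k] that by simp
 have 3: "w : gen ?x ?i" if "w : I" "?x ?i \<otimes> w : gen ?x ?i" for w using last[of w] that gx[of ?i] by simp
 show ?thesis using point_upd[OF xp yc, of ?i] 1 2 3 by blast
qed

end

section \<open>The fiber cone\<close>

context cring
begin

lemma coset_eq_iff: "ideal K R ==> a : RR ==> b : RR ==> K +> a = K +> b \<longleftrightarrow> a \<ominus> b : K"
 using quotient_eq_iff_same_a_r_cos by blast

lemma coset_zero: "ideal K R ==> K +> \<zero> = K"
 by (rule a_coset_add_zero[OF id_sub])

lemma coset_zero_iff: "ideal K R ==> a : RR ==> K +> a = K \<longleftrightarrow> a : K"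
 using coset_eq_iff[of K a \<zero>] coset_zero[of K] by (simp add: a_minus_def)

lemma coset_mem: "y : K +> a \<longleftrightarrow> (EX k:K. y = k \<oplus> a)"
 by (auto simp: a_r_coset_def')

lemma coset_self: "ideal K R ==> a : RR ==> a : K +> a"
 unfolding coset_mem using id_zero[of K] l_zero[of a] by metis

end

locale fiber = local_noeth R mm for R :: "('a, 'r) ring_scheme" (structure) and mm +
 fixes I assumes I: "ideal I R"
begin

abbreviation "P \<equiv> ipow I"
definition "KK n = mm \<cdot> P n"
definition "FF = fiber_cone R mm I"
text \<open>The Rees algebra of \<open>I\<close> inside the polynomial ring. The map
  \<open>cl\<close> from it onto the fiber cone replaces computations with cosets by computations
  with sequences in \<open>R\<close>.\<close>

definition "rees = {a : up R. ALL n. a n : P n}"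
definition "cl a n = KK n +> a n" for a :: "nat => 'a"
definition "conv a b n = (\<Oplus>i\<in>{..n}. a i \<otimes> b (n - i))" for a b :: "nat => 'a"
definition "single n x k = (if k = n then x else \<zero>)" for n k :: nat and x

lemma Pi: "ideal (P n) R" by (rule pow_ideal[OF I])
lemma KKi: "ideal (KK n) R" unfolding KK_def by (rule ideal_prod_is_ideal[OF mm_ideal Pi])
lemma KK_sub: "KK n <= P n" unfolding KK_def by (rule prod_sub[OF mm_ideal Pi])

lemma KK_mult: "k : KK i ==> b : P j ==> k \<otimes> b : KK (i + j)"
 unfolding KK_def pow_add[OF I] ideal_prod_assoc[OF mm_ideal Pi Pi, symmetric] by (rule ideal_prod.prod)

lemma KK_mult2: "b : P i ==> k : KK j ==> b \<otimes> k : KK (i + j)"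
 using KK_mult[of k j b i] m_comm[OF id_carr[OF Pi] id_carr[OF KKi], of b i k j] by (simp add: add.commute)

lemma KK_0: "KK 0 = mm" unfolding KK_def by (simp add: ideal_prod_one[OF mm_ideal])

lemma rees_carr: "a : rees ==> a n : RR" "a : rees ==> a n : P n"
 using id_carr[OF Pi] unfolding rees_def by auto

lemma rees_bound: "a : rees ==> EX N. ALL n>N. a n = \<zero>"
 unfolding rees_def by (auto dest!: bound_upD simp: bound_def)

lemma reesI: "(!!n. a n : P n) ==> (!!n. n > N ==> a n = \<zero>) ==> a : rees"
 unfolding rees_def using id_carr[OF Pi] by (auto intro!: mem_upI exI[of _ N] simp: bound_def)

lemma conv_term: "a : rees ==> b : rees ==> i <= n ==> a i \<otimes> b (n - i) : P n"
 using pow_mult[OF I, of "a i" i "b (n - i)" "n - i"] rees_carr(2) by simp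

lemma single_rees: "x : P n ==> single n x : rees"
 by (rule reesI[of _ n]) (auto simp: single_def id_zero[OF Pi])

lemma add_rees: "a : rees ==> b : rees ==> (%n. a n \<oplus> b n) : rees"
 unfolding rees_def using up_add_closed id_add[OF Pi] by auto

lemma smult_rees: "a : rees ==> c : RR ==> (%n. c \<otimes> a n) : rees"
 unfolding rees_def using up_smult_closed id_mult[OF Pi] by auto

lemma conv_rees:
 assumes a: "a : rees" and b: "b : rees" shows "conv a b : rees"
proof -
 have "conv a b : up R" unfolding conv_def using a b up_mult_closed by (simp add: rees_def)
 moreover have "conv a b n : P n" for n unfolding conv_def by (rule finsum_in_ideal[OF Pi]) (use conv_term[OF a b] in auto)
 ultimately show ?thesis by (simp add: rees_def)
qed

lemma FF_carrier: "carrier FF = cl ` rees"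
proof
 show "cl ` rees <= carrier FF"
 proof
  fix z assume "z : cl ` rees"
  then obtain a where a: "a : rees" "z = cl a" by blast
  obtain N where N: "!!n. n > N ==> a n = \<zero>" using rees_bound[OF a(1)] by blast
  have "{n. cl a n ~= KK n} <= {..N}"
  proof
   fix n assume n: "n : {n. cl a n ~= KK n}"
   show "n : {..N}"
   proof (rule ccontr)
    assume "n ~: {..N}"
    hence "a n = \<zero>" using N by simp
    thus False using n coset_zero[OF KKi] by (simp add: cl_def)
   qed
  qed
  hence "finite {n. cl a n ~= KK n}" using finite_subset by blast
  thus "z : carrier FF"
   using a rees_carr(2)[OF a(1)] unfolding FF_def fiber_cone_def cl_def KK_def ipow_def by auto
 qed
 show "carrier FF <= cl ` rees"
 proof
  fix z assume z: "z : carrier FF"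
  have z1: "EX x. x : P n & z n = KK n +> x" for n
   using z unfolding FF_def fiber_cone_def KK_def ipow_def by auto
  have z2: "finite {n. z n ~= KK n}" using z unfolding FF_def fiber_cone_def KK_def ipow_def by simp
  \<comment> \<open>The trivial coset is represented by zero, so that the chosen sequence has finite
    support.\<close>
  define a where "a n = (if z n = KK n then \<zero> else (SOME x. x : P n & z n = KK n +> x))" for n
  have a: "a n : P n & z n = KK n +> a n" for n
  proof (cases "z n = KK n")
   case True thus ?thesis using id_zero[OF Pi] coset_zero[OF KKi] by (simp add: a_def)
  next
   case False thus ?thesis unfolding a_def using someI_ex[OF z1] by simp
  qed
  obtain N where N: "{n. z n ~= KK n} <= {..N}" using z2 finite_nat_iff_bounded_le by blast
  have "a n = \<zero>" if "n > N" for n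
  proof -
   have "z n = KK n" using N that by fastforce
   thus ?thesis by (simp add: a_def)
  qed
  hence "a : rees" using a by (intro reesI[of a N]) blast+
  moreover have "z = cl a" using a by (auto simp: cl_def)
  ultimately show "z : cl ` rees" by blast
 qed
qed

lemma cl_closed [simp]: "a : rees ==> cl a : carrier FF"
 using FF_carrier by blast

lemma FF_rep: assumes "z : carrier FF" obtains a where "a : rees" "z = cl a"
 using assms FF_carrier by blast

lemma cl_eq_iff: "a : rees ==> b : rees ==> cl a = cl b \<longleftrightarrow> (ALL n. a n \<ominus> b n : KK n)"
 unfolding fun_eq_iff cl_def using coset_eq_iff[OF KKi] rees_carr by metis

lemma cl_add: "a : rees ==> b : rees ==> cl a \<oplus>\<^bsub>FF\<^esub> cl b = cl (%n. a n \<oplus> b n)"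
proof -
 assume ab: "a : rees" "b : rees"
 have "(KK n +> a n) <+> (KK n +> b n) = KK n +> (a n \<oplus> b n)" for n
  using abelian_subgroup.a_rcos_sum[OF abelian_subgroupI3[OF ideal.axioms(1)[OF KKi] is_abelian_group]] rees_carr(1) ab by blast
 thus ?thesis unfolding FF_def fiber_cone_def cl_def KK_def ipow_def by (simp add: FactRing_def)
qed

lemma cl_mult: "a : rees ==> b : rees ==> cl a \<otimes>\<^bsub>FF\<^esub> cl b = cl (conv a b)"
proof -
 assume ab: "a : rees" "b : rees"
 have rm: "rcoset_mult R (KK n) (KK i +> a i) (KK (n - i) +> b (n - i)) = KK n +> (a i \<otimes> b (n - i))" if i: "i <= n" for n i
 proof -
  have eq: "KK n +> (a' \<otimes> b') = KK n +> (a i \<otimes> b (n - i))" if "a' : KK i +> a i" "b' : KK (n - i) +> b (n - i)" for a' b'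
  proof -
   from that obtain k k' where k: "k : KK i" "a' = k \<oplus> a i" "k' : KK (n - i)" "b' = k' \<oplus> b (n - i)" unfolding coset_mem by blast
   have c: "k : RR" "k' : RR" "a i : RR" "b (n - i) : RR"
    using k id_carr[OF KKi] ab rees_carr by auto
   have "k \<otimes> b' : KK (i + (n - i))"
    by (rule KK_mult[OF k(1)]) (use k(3,4) KK_sub id_add[OF Pi] rees_carr(2)[OF ab(2)] in blast)
   moreover have "a i \<otimes> k' : KK (i + (n - i))" by (rule KK_mult2[OF rees_carr(2)[OF ab(1)] k(3)])
   moreover have "a' \<otimes> b' \<ominus> a i \<otimes> b (n - i) = k \<otimes> b' \<oplus> a i \<otimes> k'" unfolding k using c by algebra
   ultimately have "a' \<otimes> b' \<ominus> a i \<otimes> b (n - i) : KK n" using id_add[OF KKi] i by simp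
   moreover have "a' \<otimes> b' : RR" unfolding k using c by simp
   ultimately show ?thesis using coset_eq_iff[OF KKi] c by simp
  qed
  have "a i : KK i +> a i" "b (n - i) : KK (n - i) +> b (n - i)" using coset_self[OF KKi] rees_carr(1) ab by auto
  thus ?thesis unfolding rcoset_mult_def using eq by blast
 qed
 have "(\<Oplus>\<^bsub>R Quot KK n\<^esub>i\<in>{..n}. rcoset_mult R (KK n) (KK i +> a i) (KK (n - i) +> b (n - i))) = KK n +> conv a b n" for n
 proof -
  interpret h: ring_hom_cring R "R Quot KK n" "(+>) (KK n)" by (rule ideal.rcos_ring_hom_cring[OF KKi is_cring])
  have c: "a i \<otimes> b (n - i) : RR" for i using rees_carr(1) ab by simp
  have "KK n +> conv a b n = (\<Oplus>\<^bsub>R Quot KK n\<^esub>i\<in>{..n}. KK n +> (a i \<otimes> b (n - i)))"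
   unfolding conv_def using h.hom_finsum[of "%i. a i \<otimes> b (n - i)" "{..n}"] c by (simp add: comp_def)
  also have "... = (\<Oplus>\<^bsub>R Quot KK n\<^esub>i\<in>{..n}. rcoset_mult R (KK n) (KK i +> a i) (KK (n - i) +> b (n - i)))"
  proof (rule h.S.finsum_cong')
   show "(%i. rcoset_mult R (KK n) (KK i +> a i) (KK (n - i) +> b (n - i))) : {..n} \<rightarrow> carrier (R Quot KK n)"
    using rm h.hom_closed[OF c] by auto
  qed (use rm in auto)
  finally show ?thesis by simp
 qed
 thus ?thesis unfolding FF_def fiber_cone_def cl_def KK_def ipow_def by simp
qed

lemma cl_zero: "\<zero>\<^bsub>FF\<^esub> = cl (%n. \<zero>)"
 unfolding cl_def using coset_zero[OF KKi] unfolding FF_def fiber_cone_def KK_def ipow_def by simp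

lemma cl_one: "\<one>\<^bsub>FF\<^esub> = cl (single 0 \<one>)"
proof
 fix n
 have "\<one>\<^bsub>FF\<^esub> n = (if n = 0 then KK 0 +> \<one> else KK n)" unfolding FF_def fiber_cone_def KK_def ipow_def by simp
 thus "\<one>\<^bsub>FF\<^esub> n = cl (single 0 \<one>) n" using coset_zero[OF KKi] by (simp add: cl_def single_def)
qed

lemma zero_rees: "(%n. \<zero>) : rees"
 by (rule reesI[of _ 0]) (auto simp: id_zero[OF Pi])

lemma one_rees: "single 0 \<one> : rees"
 by (rule single_rees) simp

text \<open>The ring axioms are inherited: \<open>rees\<close> is a subring of the polynomial ring,
  and the fiber cone is its image under a map compatible with the operations.\<close>

lemma FF_cring: "cring FF"
proof -
 interpret U: UP_cring R "UP R" by unfold_locales (rule Pure.reflexive | rule is_cring)+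
 have add: "a \<oplus>\<^bsub>UP R\<^esub> b = (%n. a n \<oplus> b n)" "a \<otimes>\<^bsub>UP R\<^esub> b = conv a b" if "a : rees" "b : rees" for a b
  using that unfolding rees_def UP_def conv_def by auto
 have one: "\<one>\<^bsub>UP R\<^esub> = single 0 \<one>" unfolding UP_def single_def by auto
 have zero: "\<zero>\<^bsub>UP R\<^esub> = (%n. \<zero>)" unfolding UP_def by simp
 have sub: "rees <= carrier (UP R)" unfolding rees_def UP_def by auto
 have neg: "\<ominus>\<^bsub>UP R\<^esub> a : rees" if a: "a : rees" for a
 proof -
  have n: "(%n. \<ominus> a n) : rees" using a up_a_inv_closed id_neg[OF Pi] unfolding rees_def by auto
  have "(%n. \<ominus> a n) \<oplus>\<^bsub>UP R\<^esub> a = \<zero>\<^bsub>UP R\<^esub>" unfolding add(1)[OF n a] zero using rees_carr(1)[OF a] by (simp add: l_neg)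
  hence "\<ominus>\<^bsub>UP R\<^esub> a = (%n. \<ominus> a n)" using U.P.minus_equality subsetD[OF sub a] subsetD[OF sub n] by blast
  thus ?thesis using n by simp
 qed
 have T: "subring rees (UP R)" by (rule U.P.subringI[OF sub]) (use neg add_rees conv_rees one_rees in \<open>simp_all add: add one\<close>)
 have hom: "cl : ring_hom ((UP R)\<lparr>carrier := rees\<rparr>) FF"
  by (rule ring_hom_memI) (use cl_mult cl_add cl_one in \<open>simp_all add: add one\<close>)
 have "ring FF" using ring.ring_hom_imp_img_ring[OF U.P.subring_is_ring[OF T] hom] by (simp add: zero cl_zero[symmetric] FF_carrier[symmetric])
 moreover have "cl a \<otimes>\<^bsub>FF\<^esub> cl b = cl b \<otimes>\<^bsub>FF\<^esub> cl a" if "a : rees" "b : rees" for a b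
  using U.UP_m_comm[OF subsetD[OF sub that(1)] subsetD[OF sub that(2)]] that by (simp add: cl_mult add)
 ultimately show ?thesis by (intro cring.intro monoid.monoid_comm_monoidI ring.is_monoid) (auto simp: FF_carrier)
qed

sublocale F: cring FF by (rule FF_cring)

lemma cl_eq_zero: "a : rees ==> cl a = \<zero>\<^bsub>FF\<^esub> \<longleftrightarrow> (ALL n. a n : KK n)"
 unfolding cl_zero using cl_eq_iff[OF _ zero_rees, of a] rees_carr(1)[of a] by (simp add: a_minus_def)

definition "hm n x = cl (single n x)"

lemma hm_closed [simp]: "x : P n ==> hm n x : carrier FF"
 unfolding hm_def by (simp add: single_rees)

lemma conv_single:
 assumes "x : P k" "b : rees"
 shows "conv (single k x) b n = (if k <= n then x \<otimes> b (n - k) else \<zero>)"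
proof -
 have xc: "x : RR" using assms(1) id_carr[OF Pi] by blast
 have "conv (single k x) b n = (\<Oplus>i\<in>{..n}. if k = i then x \<otimes> b (n - i) else \<zero>)"
  unfolding conv_def by (rule finsum_cong') (use xc rees_carr(1)[OF assms(2)] in \<open>auto simp: single_def\<close>)
 also have "... = (if k <= n then x \<otimes> b (n - k) else \<zero>)"
 proof (cases "k <= n")
  case True
  thus ?thesis using finsum_singleton[of k "{..n}" "%i. x \<otimes> b (n - i)"] xc rees_carr(1)[OF assms(2)] by simp
 next
  case False
  have "(\<Oplus>i\<in>{..n}. if k = i then x \<otimes> b (n - i) else \<zero>) = (\<Oplus>i\<in>{..n}. \<zero>)"
   by (rule finsum_cong') (use False in auto)
  thus ?thesis using False finsum_zero by simp
 qed
 finally show ?thesis .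
qed

lemma hm_cl_mult: "x : P k ==> b : rees ==> hm k x \<otimes>\<^bsub>FF\<^esub> cl b = cl (%n. if k <= n then x \<otimes> b (n - k) else \<zero>)"
proof -
 assume xb: "x : P k" "b : rees"
 have "conv (single k x) b = (%n. if k <= n then x \<otimes> b (n - k) else \<zero>)" using conv_single[OF xb] by (rule ext)
 thus ?thesis unfolding hm_def using cl_mult[OF single_rees[OF xb(1)] xb(2)] by (simp only:)
qed

lemma scal_cl: "x : RR ==> b : rees ==> hm 0 x \<otimes>\<^bsub>FF\<^esub> cl b = cl (%n. x \<otimes> b n)"
 using hm_cl_mult[of x 0 b] by simp

lemma hm_mult: "x : P k ==> y : P l ==> hm k x \<otimes>\<^bsub>FF\<^esub> hm l y = hm (k + l) (x \<otimes> y)"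
proof -
 assume xy: "x : P k" "y : P l"
 have "(%n. if k <= n then x \<otimes> single l y (n - k) else \<zero>) = single (k + l) (x \<otimes> y)"
  by (rule ext) (use id_carr[OF Pi xy(1)] in \<open>auto simp: single_def\<close>)
 thus ?thesis unfolding hm_def[of l] using hm_cl_mult[OF xy(1) single_rees[OF xy(2)]] by (simp add: hm_def)
qed

lemma hm_zero: "x : P n ==> hm n x = \<zero>\<^bsub>FF\<^esub> \<longleftrightarrow> x : KK n"
 unfolding hm_def using cl_eq_zero[OF single_rees] id_zero[OF KKi] by (auto simp: single_def)

lemma cl_finsum:
 assumes "finite L" "!!l. l : L ==> a l : rees"
 shows "(\<Oplus>\<^bsub>FF\<^esub>l\<in>L. cl (a l)) = cl (%n. \<Oplus>l\<in>L. a l n) & (%n. \<Oplus>l\<in>L. a l n) : rees"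
 using assms
proof (induction L rule: finite_induct)
 case empty thus ?case using zero_rees by (simp add: cl_zero)
next
 case (insert l L)
 have eq: "(%n. \<Oplus>l\<in>insert l L. a l n) = (%n. a l n \<oplus> (\<Oplus>l\<in>L. a l n))"
  using insert rees_carr(1) by (intro ext finsum_insert) auto
 have "(\<Oplus>\<^bsub>FF\<^esub>l\<in>insert l L. cl (a l)) = cl (a l) \<oplus>\<^bsub>FF\<^esub> (\<Oplus>\<^bsub>FF\<^esub>l\<in>L. cl (a l))"
  using insert by (intro F.finsum_insert) auto
 thus ?case unfolding eq using insert by (simp add: cl_add add_rees)
qed

end

section \<open>Primes lying over the primes of a subring\<close>

context cring
begin

text \<open>Zorn's lemma is used in place of a chain condition, since the fiber cone is the ring in
  view. The last clause records maximality: adjoining an element outside \<open>P\<close> makes the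
  ideal meet \<open>T\<close>.\<close>

lemma prime_avoiding_exists:
 assumes Q: "ideal Q R" and T: "T <= RR" "\<one> : T" "!!a b. a : T ==> b : T ==> a \<otimes> b : T" and disj: "Q Int T = {}"
 shows "EX P. primeideal P R & Q <= P & P Int T = {} & (ALL a:RR - P. EX m:P. EX c:RR. m \<oplus> c \<otimes> a : T)"
proof -
 define Z where "Z = {L. ideal L R & Q <= L & L Int T = {}}"
 have "Q : Z" using Q disj by (simp add: Z_def)
 have "EX M:Z. ALL X:Z. M <= X --> X = M"
 proof (rule subset_Zorn_nonempty)
  show "Z ~= {}" using \<open>Q : Z\<close> by blast
 next
  fix C assume C: "C ~= {}" "subset.chain Z C"
  hence "C <= Z" unfolding subset_chain_def by blast
  have "subset.chain {I. ideal I R} C" using C(2) unfolding subset_chain_def Z_def by blast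
  from chain_Union_is_ideal[OF this] C(1) have "ideal (\<Union>C) R" by simp
  thus "\<Union>C : Z" using C(1) \<open>C <= Z\<close> unfolding Z_def by blast
 qed
 then obtain M where M: "M : Z" and max: "!!X. X : Z ==> M <= X ==> X = M" by blast
 have Mi: "ideal M R" "Q <= M" "M Int T = {}" using M by (auto simp: Z_def)
 have meet: "EX m:M. EX c:RR. m \<oplus> c \<otimes> a : T" if a: "a : RR" "a ~: M" for a
 proof (rule ccontr)
  assume no: "~ ?thesis"
  have "addel M a : Z" unfolding Z_def using addel_ideal[OF Mi(1) a(1)] addel_sub[OF Mi(1) a(1)] Mi(2) no
   by (auto elim!: addelE)
  from max[OF this addel_sub[OF Mi(1) a(1)]] addel_mem[OF Mi(1) a(1)] a(2) show False by blast
 qed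
 have "primeideal M R"
 proof (rule primeidealI[OF Mi(1) is_cring])
  have "\<one> ~: M" using Mi(3) T(2) by blast
  thus "RR ~= M" by (metis one_closed)
  fix a b assume ab: "a : RR" "b : RR" "a \<otimes> b : M"
  show "a : M | b : M"
  proof (rule ccontr)
   assume "~ (a : M | b : M)"
   hence n: "a ~: M" "b ~: M" by simp_all
   obtain m c m' c' where m: "m : M" "c : RR" "m \<oplus> c \<otimes> a : T" "m' : M" "c' : RR" "m' \<oplus> c' \<otimes> b : T"
    using meet[OF ab(1) n(1)] meet[OF ab(2) n(2)] by (elim bexE) (rule that)
   have mc: "m : RR" "m' : RR" by (rule id_carr[OF Mi(1) m(1)], rule id_carr[OF Mi(1) m(4)])
   have "(m' \<oplus> c' \<otimes> b) \<otimes> m : M" by (rule id_mult[OF Mi(1) m(1)]) (use mc m ab in auto)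
   moreover have "(c \<otimes> a) \<otimes> m' : M" by (rule id_mult[OF Mi(1) m(4)]) (use mc m ab in auto)
   moreover have "(c \<otimes> c') \<otimes> (a \<otimes> b) : M" by (rule id_mult[OF Mi(1) ab(3)]) (use mc m ab in auto)
   ultimately have "(m' \<oplus> c' \<otimes> b) \<otimes> m \<oplus> ((c \<otimes> a) \<otimes> m' \<oplus> (c \<otimes> c') \<otimes> (a \<otimes> b)) : M"
    using id_add[OF Mi(1)] by simp
   moreover have "(m' \<oplus> c' \<otimes> b) \<otimes> m \<oplus> ((c \<otimes> a) \<otimes> m' \<oplus> (c \<otimes> c') \<otimes> (a \<otimes> b)) = (m \<oplus> c \<otimes> a) \<otimes> (m' \<oplus> c' \<otimes> b)"
    using mc m(2,5) ab(1,2) by algebra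
   ultimately show False using T(3)[OF m(3,6)] Mi(3) by auto
  qed
 qed
 thus ?thesis using Mi meet by blast
qed

definition bspan :: "'a set => (nat => 'a) => nat => 'a set"
 where "bspan B g n = {(\<Oplus>l\<in>{..<n}. c l \<otimes> g l) | c. ALL l. c l : B}"

lemma bspanI: "(!!l. c l : B) ==> (\<Oplus>l\<in>{..<n}. c l \<otimes> g l) : bspan B g n"
 unfolding bspan_def by blast

lemma bspan_closed:
 assumes B: "subring B R" and g: "point g"
 shows "f : bspan B g n ==> h : bspan B g n ==> f \<oplus> h : bspan B g n"
  and "b : B ==> f : bspan B g n ==> b \<otimes> f : bspan B g n"
  and "l < n ==> g l : bspan B g n"
proof -
 note sc = subringE[OF B]
 have cc: "c l : RR" if "ALL l. c l : B" for c and l :: nat using that sc(1) by blast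
 show "f \<oplus> h : bspan B g n" if fh: "f : bspan B g n" "h : bspan B g n"
 proof -
  obtain c d where cd: "ALL l. c l : B" "f = (\<Oplus>l\<in>{..<n}. c l \<otimes> g l)" "ALL l. d l : B" "h = (\<Oplus>l\<in>{..<n}. d l \<otimes> g l)"
   using fh unfolding bspan_def by blast
  have "f \<oplus> h = (\<Oplus>l\<in>{..<n}. c l \<otimes> g l \<oplus> d l \<otimes> g l)"
   unfolding cd(2,4) by (rule finsum_addf[symmetric]) (use cc cd g in auto)
  also have "... = (\<Oplus>l\<in>{..<n}. (c l \<oplus> d l) \<otimes> g l)" by (rule finsum_cong') (use cc cd g in \<open>auto simp: l_distr\<close>)
  finally show ?thesis using bspanI[of "%l. c l \<oplus> d l"] cd sc(7) by simp
 qed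
 show "b \<otimes> f : bspan B g n" if f: "b : B" "f : bspan B g n"
 proof -
  obtain c where c: "ALL l. c l : B" "f = (\<Oplus>l\<in>{..<n}. c l \<otimes> g l)" using f unfolding bspan_def by blast
  have b: "b : RR" using f sc(1) by blast
  have "b \<otimes> f = (\<Oplus>l\<in>{..<n}. b \<otimes> (c l \<otimes> g l))" unfolding c(2) by (rule finsum_rdistr) (use cc c g b in auto)
  also have "... = (\<Oplus>l\<in>{..<n}. (b \<otimes> c l) \<otimes> g l)" by (rule finsum_cong') (use cc c g b in \<open>auto simp: m_assoc\<close>)
  finally show ?thesis using bspanI[of "%l. b \<otimes> c l"] c f sc(6) by simp
 qed
 show "g l : bspan B g n" if l: "l < n"
 proof -
  have "(\<Oplus>m\<in>{..<n}. (if l = m then \<one> else \<zero>) \<otimes> g m) = (\<Oplus>m\<in>{..<n}. if l = m then g m else \<zero>)"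
   by (rule finsum_cong') (use g in auto)
  also have "... = g l" by (rule finsum_singleton) (use g l in auto)
  finally show ?thesis using bspanI[of "%m. if l = m then \<one> else \<zero>" B g n] sc(2,3) by simp
 qed
qed

text \<open>\<open>R\<close> is finite over \<open>B\<close>, and the prime \<open>H\<close> of
  \<open>B\<close> is given as a set. An ideal \<open>Q'\<close> over \<open>Q\<close>, maximal
  among those that avoid \<open>B - H\<close>, contains \<open>H\<close>: for \<open>y\<close> in
  \<open>H\<close> outside \<open>Q'\<close> some \<open>m + f y\<close> with \<open>m\<close> in
  \<open>Q'\<close> lies in \<open>B - H\<close>, and the determinant trick for multiplication by
  \<open>f\<close> on the module generators puts an element of \<open>B - H\<close> into
  \<open>Q'\<close>.\<close>

lemma going_up:
 assumes B: "subring B R" and H: "H <= B" "!!a b. a : H ==> b : H ==> a \<oplus> b : H" "!!a b. a : B ==> b : H ==> a \<otimes> b : H"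
  and prime: "\<one> ~: H" "!!a b. a : B ==> b : B ==> a \<otimes> b : H ==> a : H | b : H"
  and g: "point g" "g e = \<one>" "e < n" and span: "RR <= bspan B g n"
  and Q: "ideal Q R" "Q Int B <= H"
 obtains Q' where "primeideal Q' R" "Q <= Q'" "H <= Q'" "Q' Int B <= H"
proof -
 define G where "G = B - H"
 note sc = subringE[OF B]
 have Bc: "a : RR" if "a : B" for a using that sc(1) by blast
 have oneG: "\<one> : G" using sc(3) prime(1) unfolding G_def by blast
 have GG: "a \<otimes> b : G" if "a : G" "b : G" for a b using that sc(6) prime(2) unfolding G_def by blast
 have Gc: "G <= RR" unfolding G_def using Bc by blast
 have "Q Int G = {}" using Q(2) unfolding G_def by blast
 from prime_avoiding_exists[OF Q(1) Gc oneG GG this] obtain Q' where Q': "primeideal Q' R" "Q <= Q'" "Q' Int G = {}"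
  and meet: "!!a. a : RR ==> a ~: Q' ==> EX m:Q'. EX c:RR. m \<oplus> c \<otimes> a : G" by blast
 note Qi = primeideal.axioms(1)[OF Q'(1)]
 have "y : Q'" if y: "y : H" for y
 proof (rule ccontr)
  assume "y ~: Q'"
  have yc: "y : RR" using y H(1) Bc by blast
  then obtain m f where m: "m : Q'" "f : RR" "m \<oplus> f \<otimes> y : G" using meet \<open>y ~: Q'\<close> by blast
  have "EX c. (ALL k. c k : B) & f \<otimes> g l = (\<Oplus>k\<in>{..<n}. c k \<otimes> g k)" for l
   using subsetD[OF span m_closed[OF m(2) pointD[OF g(1)]], of l] unfolding bspan_def by blast
  then obtain c where c: "!!l k. c l k : B" "!!l. f \<otimes> g l = (\<Oplus>k\<in>{..<n}. c l k \<otimes> g k)" by metis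
  have "EX v:G. ALL l<n. v \<otimes> g l : Q'"
  proof (rule elimination[OF Qi Gc _ oneG GG, where H = H and u = "%_. m \<oplus> f \<otimes> y" and h = "%l k. y \<otimes> c l k"])
   show "a \<ominus> b : G" if "a : G" "b : H" for a b
   proof -
    have ab: "a : B" "b : B" "a ~: H" using that H(1) unfolding G_def by auto
    have "(a \<ominus> b) \<oplus> b = a" using Bc[OF ab(1)] Bc[OF ab(2)] by algebra
    hence "a \<ominus> b ~: H" using H(2)[OF _ that(2)] ab(3) by metis
    thus ?thesis using ab sc(5,7) unfolding G_def by (simp add: a_minus_def)
   qed
   show "y \<otimes> c l k : H" if "l < n" "k < n" for l k using H(3)[OF c(1) y] m_comm[OF yc Bc[OF c(1)]] by simp
   fix l assume "l < n"
   have "(\<Oplus>k\<in>{..<n}. (y \<otimes> c l k) \<otimes> g k) = (\<Oplus>k\<in>{..<n}. y \<otimes> (c l k \<otimes> g k))"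
    by (rule finsum_cong') (use Bc[OF c(1)] g(1) yc in \<open>auto simp: m_assoc\<close>)
   also have "... = y \<otimes> (f \<otimes> g l)" unfolding c(2)
    by (rule finsum_rdistr[symmetric]) (use Bc[OF c(1)] g(1) yc in auto)
   also have "(m \<oplus> f \<otimes> y) \<otimes> g l \<ominus> ... = g l \<otimes> m"
    using id_carr[OF Qi m(1)] m(2) yc pointD[OF g(1), of l] by algebra
   finally show "(m \<oplus> f \<otimes> y) \<otimes> g l \<ominus> (\<Oplus>k\<in>{..<n}. (y \<otimes> c l k) \<otimes> g k) : Q'"
    using id_mult[OF Qi m(1)] g(1) by simp
  qed (use m(3) g(1) H Bc in \<open>auto simp: G_def\<close>)
  then obtain v where v: "v : G" "v \<otimes> g e : Q'" using g(3) by blast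
  hence "v : Q'" using g(2) subsetD[OF Gc v(1)] by simp
  thus False using v(1) Q'(3) by blast
 qed
 thus ?thesis using that Q' unfolding G_def by blast
qed

end

context fiber
begin

text \<open>Algebraic independence, over the residue field, of the classes of the \<open>x i\<close>
  in degree one of the fiber cone. Testing forms is enough because the fiber cone is graded.\<close>

definition alg_indep :: "(nat => 'a) => nat => bool"
 where "alg_indep x s \<longleftrightarrow> (ALL n f. form (RR) s n f --> ev x s n f : KK n --> form mm s n f)"

lemma vals_span:
 assumes x: "point x" and u: "point u"
 shows "v : vals x s n (gen u e) ==> EX w. (ALL l. w l : vals x s n (RR)) & v = (\<Oplus>l\<in>{..<e}. w l \<otimes> u l)"
proof (induction e arbitrary: v)
 case 0
 then obtain c where c: "form {\<zero>} s n c" "v = ev x s n c" by (auto elim: valsE)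
 have "v = \<zero>" unfolding c(2) using ev_cong[of s n c "%_. \<zero>" x] c(1) ev_zero[OF x] by (simp add: form_def)
 thus ?case using id_zero[OF vals_ideal[OF oneideal x]] by (intro exI[of _ "%_. \<zero>"]) simp
next
 case (Suc e)
 then obtain c where c: "form (gen u (Suc e)) s n c" "v = ev x s n c" by (auto elim: valsE)
 have "ALL mu. EX b r. mu : Mon s n --> b : gen u e & r : RR & c mu = b \<oplus> r \<otimes> u e"
  using c(1) unfolding form_def gen.simps by (metis addelE)
 from choice[OF this] obtain b where b: "ALL mu. EX r. mu : Mon s n --> b mu : gen u e & r : RR & c mu = b mu \<oplus> r \<otimes> u e" ..
 from choice[OF this] obtain r where br: "!!mu. mu : Mon s n ==> b mu : gen u e & r mu : RR & c mu = b mu \<oplus> r mu \<otimes> u e" by blast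
 have fb: "form (gen u e) s n b" "form (RR) s n r" using br unfolding form_def by auto
 note fb' = form_carr[OF fb(1) gen_ideal[OF u]]
 obtain w where w: "ALL l. w l : vals x s n (RR)" "ev x s n b = (\<Oplus>l\<in>{..<e}. w l \<otimes> u l)"
  using Suc.IH[OF valsI[OF fb(1)]] by blast
 define w' where "w' l = (if l = e then ev x s n r else w l)" for l
 have w'v: "w' l : vals x s n (RR)" for l using w(1) valsI[OF fb(2)] by (simp add: w'_def)
 have wc: "w' l : RR" for l using w'v id_carr[OF vals_ideal[OF oneideal x]] by blast
 have s1: "(%l. w' l \<otimes> u l) : {..<e} \<rightarrow> RR" "w' e \<otimes> u e : RR" using wc u by auto
 have "(\<Oplus>l\<in>{..<e}. w' l \<otimes> u l) = (\<Oplus>l\<in>{..<e}. w l \<otimes> u l)"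
 proof (rule finsum_cong')
  show "(%l. w l \<otimes> u l) : {..<e} \<rightarrow> RR"
   using id_carr[OF vals_ideal[OF oneideal x] w(1)[rule_format]] u by simp
 qed (simp_all add: w'_def)
 hence s2: "(\<Oplus>l\<in>{..<Suc e}. w' l \<otimes> u l) = ev x s n r \<otimes> u e \<oplus> ev x s n b"
  unfolding lessThan_Suc w(2) using finsum_insert[OF _ _ s1] by (simp add: w'_def)
 have m: "form (RR) s n (%mu. u e \<otimes> r mu)" using form_smult[OF oneideal fb(2)] u by simp
 have "v = ev x s n (%mu. b mu \<oplus> u e \<otimes> r mu)" unfolding c(2)
  by (rule ev_cong) (use br u in \<open>auto simp: m_comm\<close>)
 also have "... = ev x s n b \<oplus> u e \<otimes> ev x s n r" using ev_add[of x s n b "%mu. u e \<otimes> r mu"] fb' m x u fb(2) by (simp add: ev_smult)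
 also have "... = (\<Oplus>l\<in>{..<Suc e}. w' l \<otimes> u l)"
  unfolding s2 using ev_closed[OF fb' x] ev_closed[OF fb(2) x] u by (simp add: a_comm m_comm)
 finally show ?case using w'v by blast
qed

lemma F_neg: "a : rees ==> (%n. \<ominus> a n) : rees & \<ominus>\<^bsub>FF\<^esub> cl a = cl (%n. \<ominus> a n)"
proof -
 assume a: "a : rees"
 hence n: "(%n. \<ominus> a n) : rees" using up_a_inv_closed id_neg[OF Pi] unfolding rees_def by auto
 have "cl (%n. \<ominus> a n) \<oplus>\<^bsub>FF\<^esub> cl a = \<zero>\<^bsub>FF\<^esub>" unfolding cl_add[OF n a] cl_zero using rees_carr(1)[OF a] by (simp add: l_neg)
 thus ?thesis using n F.minus_equality[OF _ cl_closed[OF a] cl_closed[OF n]] by simp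
qed

end

locale fiber_inf = fiber + local_inf

context cring
begin

text \<open>Points that are zero from \<open>j\<close> on see only the coefficients on the first
  \<open>j\<close> variables; membership in \<open>V j\<close> is tested with them.\<close>

lemma ev_cut:
 assumes z: "point z" and "j <= s"
 shows "form (RR) s n f ==> ev (%l. if l < j then z l else \<zero>) s n f = ev z j n f"
 using assms(2)
proof (induction s rule: dec_induct)
 case base show ?case by (rule ev_point_cong) simp
next
 case (step s)
 show ?case
 proof (cases n)
  case (Suc m)
  have "form (RR) s n f" "form (RR) (Suc s) m (%mu. f (add_mset s mu))"
   using step.prems unfolding Suc form_Suc by auto
  moreover have "point (%l. if l < j then z l else \<zero>)" "form (RR) j n f"
   using z step.hyps step.prems Mon_mono[of j "Suc s" n] unfolding form_def point_def by auto
  ultimately show ?thesis using step.IH step.hyps z unfolding Suc by simp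
 qed simp
qed

end

section \<open>The coordinate primes of \<open>k[x]\<close> lifted to the fiber cone\<close>

locale fiber_tower = fiber_inf +
 fixes x s
 assumes xI: "x i : I" and ai: "alg_indep x s"
begin

lemma xpt [simp]: "point x"
 unfolding point_def using xI id_carr[OF I] by blast

lemma xP: "x i : P (Suc 0)"
 using xI pow_1[OF I] by simp

abbreviation "vx n \<equiv> vals x s n (RR)"

text \<open>Modulo \<open>mm\<close> this is the degree \<open>n\<close> part of the prime of
  \<open>k[x]\<close> generated by \<open>x j, ..., x (s - 1)\<close>: the irrelevant ideal for
  \<open>j = 0\<close> and zero for \<open>j = s\<close>.\<close>

definition "V j n = {ev x s n f | f. form (RR) s n f & form mm j n f}"

text \<open>For \<open>U = vx\<close> this is the subring \<open>k[x]\<close> of the fiber cone, and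
  for \<open>U = V j\<close> a prime of that subring.\<close>

definition "gset U = {cl a | a. a : rees & (ALL n. a n : U n)}"

lemma vi: "ideal (vx n) R" by (rule vals_ideal[OF oneideal xpt])

lemma vals_P: "vx n <= P n"
proof
 fix u assume "u : vx n"
 then obtain c where c: "form (RR) s n c" "u = ev x s n c" by (elim valsE)
 have "x i \<otimes> u : P (Suc n)" if "u : P n" for i n u using pow_mult[OF I xP that] by simp
 thus "u : P n" using ev_graded[of P s x 0 n c] Pi c by simp
qed

lemma VI: "form (RR) s n f ==> form mm j n f ==> ev x s n f : V j n"
 unfolding V_def by blast

lemma V_vals: "V j n <= vx n"
 unfolding V_def using valsI by blast

lemma V_mono: "j <= j' ==> V j' n <= V j n"
 unfolding V_def form_def using Mon_mono by blast

lemma V_ideal: "ideal (V j n) R"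
proof (rule idI)
 show "V j n <= RR" using V_vals id_sub[OF vi] by blast
 show "\<zero> : V j n" using VI[of n "%_. \<zero>" j] ev_zero[OF xpt] id_zero[OF mm_ideal] by (simp add: form_def)
next
 fix a b assume "a : V j n" "b : V j n"
 then obtain f g where f: "form (RR) s n f" "form mm j n f" "a = ev x s n f"
  and g: "form (RR) s n g" "form mm j n g" "b = ev x s n g" unfolding V_def by blast
 show "a \<oplus> b : V j n"
  using VI[OF form_add[OF oneideal f(1) g(1)] form_add[OF mm_ideal f(2) g(2)]] ev_add[OF xpt f(1) g(1)] f(3) g(3) by simp
next
 fix a b assume "a : V j n" and b: "b : RR"
 then obtain f where f: "form (RR) s n f" "form mm j n f" "a = ev x s n f" unfolding V_def by blast
 show "b \<otimes> a : V j n"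
  using VI[OF form_smult[OF oneideal f(1) b] form_smult[OF mm_ideal f(2) b]] ev_smult[OF xpt b f(1)] f(3) by simp
qed

lemma cut_point: "point z ==> point (%l. if l < j then z l else \<zero>)"
 by (simp add: point_def)

lemma vals_product:
 assumes "a : vx i" "b : vx k"
 obtains f g h where "form (RR) s i f" "a = ev x s i f" "form (RR) s k g" "b = ev x s k g"
  "form (RR) s (i + k) h" "!!z. point z ==> ev z s (i + k) h = ev z s i f \<otimes> ev z s k g"
proof -
 obtain f g where fg: "form (RR) s i f" "a = ev x s i f" "form (RR) s k g" "b = ev x s k g"
  using assms by (elim valsE)
 thus ?thesis using form_product[OF oneideal subset_refl subset_refl m_closed fg(3) order_refl fg(1)] that by metis
qed

lemma vals_mult: "a : vx i ==> b : vx k ==> a \<otimes> b : vx (i + k)"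
 by (erule vals_product, assumption) (metis valsI xpt)

text \<open>By algebraic independence the value determines the coefficients modulo
  \<open>mm\<close>, so membership in \<open>V j\<close> does not depend on the form chosen.\<close>

lemma form_unique:
 assumes "form (RR) s n f" "form (RR) s n g" "ev x s n f \<ominus> ev x s n g : KK n" "form mm j n g" "j <= s"
 shows "form mm j n f"
proof -
 have "form mm s n (%mu. f mu \<ominus> g mu)"
  using ai form_minus[OF oneideal assms(1,2)] ev_minus[OF xpt assms(1,2)] assms(3) unfolding alg_indep_def by simp
 thus ?thesis using assms id_minus_cancel[OF mm_ideal] Mon_mono[OF assms(5)] unfolding form_def by (meson subsetD)
qed

text \<open>A coefficient of the product on the first \<open>j\<close> variables outside
  \<open>mm\<close> would show at a point with zeros from \<open>j\<close> on, but there the second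
  factor has its value in \<open>mm\<close>.\<close>

lemma V_mult:
 assumes "a : vx i" "b : V j k" "j <= s" shows "a \<otimes> b : V j (i + k)"
proof -
 obtain g' where g': "form (RR) s k g'" "form mm j k g'" "b = ev x s k g'" using assms(2) unfolding V_def by blast
 obtain f g h where h: "form (RR) s i f" "a = ev x s i f" "form (RR) s k g" "b = ev x s k g"
  "form (RR) s (i + k) h" "!!z. point z ==> ev z s (i + k) h = ev z s i f \<otimes> ev z s k g"
  using vals_product[OF assms(1) subsetD[OF V_vals assms(2)]] by metis
 have g: "form mm j k g"
  using form_unique[OF h(3) g'(1) _ g'(2) assms(3)] h(4) g'(3) id_zero[OF KKi] ev_closed[OF h(3) xpt] by (simp add: a_minus_def r_neg)
 have hj: "form (RR) j (i + k) h" using h(5) Mon_mono[OF assms(3)] unfolding form_def by blast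
 have "form mm j (i + k) h"
 proof (rule ccontr)
  assume n: "~ ?thesis"
  obtain z where z: "point z" "ev z j (i + k) h ~: mm" using form_nonvanishing[OF mm_ideal mm_ideal hj n hj n] by blast
  note c = cut_point[OF z(1), of j]
  have "ev z j (i + k) h = ev (%l. if l < j then z l else \<zero>) s i f \<otimes> ev z j k g"
   using h(6)[OF c] ev_cut[OF z(1) assms(3) h(5)] ev_cut[OF z(1) assms(3) h(3)] by simp
  thus False using z(2) id_mult[OF mm_ideal ev_in[OF mm_ideal g z(1)] ev_closed[OF h(1) c]] by simp
 qed
 thus ?thesis using VI[OF h(5)] h(2,4) h(6)[OF xpt] by metis
qed

text \<open>If neither factor is in \<open>V j\<close>, some point with zeros from \<open>j\<close>
  on gives both of them unit values, and so the product.\<close>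

lemma V_prime:
 assumes "a : vx i" "b : vx k" "a \<otimes> b : V j (i + k)" "j <= s" shows "a : V j i | b : V j k"
proof (rule ccontr)
 assume no: "~ ?thesis"
 obtain f g h where h: "form (RR) s i f" "a = ev x s i f" "form (RR) s k g" "b = ev x s k g"
  "form (RR) s (i + k) h" "!!z. point z ==> ev z s (i + k) h = ev z s i f \<otimes> ev z s k g"
  using vals_product[OF assms(1,2)] by metis
 obtain h' where h': "form (RR) s (i + k) h'" "form mm j (i + k) h'" "a \<otimes> b = ev x s (i + k) h'"
  using assms(3) unfolding V_def by blast
 have "ev x s (i + k) h \<ominus> ev x s (i + k) h' : KK (i + k)"
  using h(2,4) h(6)[OF xpt] h'(3) id_zero[OF KKi] ev_closed[OF h'(1) xpt] by (simp add: a_minus_def r_neg)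
 note hm = form_unique[OF h(5) h'(1) this h'(2) assms(4)]
 have fj: "form (RR) j i f" "form (RR) j k g" using h(1,3) Mon_mono[OF assms(4)] unfolding form_def by blast+
 have "~ form mm j i f" "~ form mm j k g" using no VI[OF h(1)] VI[OF h(3)] h(2,4) by auto
 then obtain z where z: "point z" "ev z j i f ~: mm" "ev z j k g ~: mm"
  using form_nonvanishing[OF mm_ideal mm_ideal fj(1) _ fj(2)] by blast
 have "ev z j (i + k) h = ev z j i f \<otimes> ev z j k g"
  using h(6)[OF cut_point[OF z(1), of j]] ev_cut[OF z(1) assms(4) h(5)] ev_cut[OF z(1) assms(4) h(1)] ev_cut[OF z(1) assms(4) h(3)] by simp
 hence "ev z j i f \<otimes> ev z j k g : mm" using ev_in[OF mm_ideal hm z(1)] by simp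
 thus False using primeideal_mult[OF mm_prime ev_closed[OF fj(1) z(1)] ev_closed[OF fj(2) z(1)]] z(2,3) by blast
qed

lemma V_KK:
 assumes "a : vx n" "a : KK n" "j <= s" shows "a : V j n"
proof -
 obtain f where f: "form (RR) s n f" "a = ev x s n f" using assms(1) by (elim valsE)
 have "form mm s n f" using ai f assms(2) unfolding alg_indep_def by blast
 thus ?thesis using VI[OF f(1)] f(2) Mon_mono[OF assms(3)] unfolding form_def by blast
qed

lemma x_V:
 assumes j: "j < s" shows "x j : V j (Suc 0)" "x j ~: V (Suc j) (Suc 0)" "x j : vx (Suc 0)"
proof -
 let ?e = "shift j (%_. \<one>)"
 have one: "form (RR) s 0 (%_. \<one>)" by (simp add: form_def)
 have e: "form (RR) s (Suc 0) ?e" "ev x s (Suc 0) ?e = x j"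
  using form_shift[OF zero_closed one, of j] ev_shift[OF xpt j one] by simp_all
 have "form mm j (Suc 0) ?e" using id_zero[OF mm_ideal] Mon_notin by (simp add: form_def shift_def)
 thus "x j : V j (Suc 0)" using VI[OF e(1)] e(2) by simp
 thus "x j : vx (Suc 0)" using V_vals by blast
 show "x j ~: V (Suc j) (Suc 0)"
 proof
  assume "x j : V (Suc j) (Suc 0)"
  then obtain f where f: "form (RR) s (Suc 0) f" "form mm (Suc j) (Suc 0) f" "x j = ev x s (Suc 0) f" unfolding V_def by blast
  have "form mm (Suc j) (Suc 0) ?e"
   by (rule form_unique[OF e(1) f(1) _ f(2)]) (use e(2) f(3) j id_zero[OF KKi] r_neg[OF ev_closed[OF f(1) xpt]] in \<open>auto simp: a_minus_def\<close>)
  moreover have "{#j#} : Mon (Suc j) (Suc 0)" using Mon_add[of "{#}" "Suc j" 0 j] by simp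
  ultimately show False using mm_one unfolding form_def shift_def by force
 qed
qed

lemma gsetI: "a : rees ==> (!!n. a n : U n) ==> cl a : gset U"
 unfolding gset_def by blast

lemma gsetD: "z : gset U ==> EX a. a : rees & z = cl a & (ALL n. a n : U n)"
 unfolding gset_def by blast

lemma gset_add:
 assumes "!!n. ideal (U n) R" "z : gset U" "z' : gset U" shows "z \<oplus>\<^bsub>FF\<^esub> z' : gset U"
proof -
 obtain a b where "a : rees" "z = cl a" "!!n. a n : U n" "b : rees" "z' = cl b" "!!n. b n : U n"
  using gsetD[OF assms(2)] gsetD[OF assms(3)] by metis
 thus ?thesis using gsetI[OF add_rees, of a b U] id_add[OF assms(1)] by (simp add: cl_add)
qed

lemma gset_mult:
 assumes W: "!!n. ideal (W n) R" and UW: "!!i k a b. a : U i ==> b : U' k ==> a \<otimes> b : W (i + k)"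
  and z: "z : gset U" "z' : gset U'"
 shows "z \<otimes>\<^bsub>FF\<^esub> z' : gset W"
proof -
 obtain a b where a: "a : rees" "z = cl a" "!!n. a n : U n" and b: "b : rees" "z' = cl b" "!!n. b n : U' n"
  using gsetD[OF z(1)] gsetD[OF z(2)] by metis
 have "conv a b n : W n" for n
  unfolding conv_def by (rule finsum_in_ideal[OF W]) (use UW[OF a(3) b(3)] in \<open>force simp: le_iff_add\<close>)+
 thus ?thesis unfolding a(2) b(2) cl_mult[OF a(1) b(1)] using gsetI[OF conv_rees[OF a(1) b(1)]] by blast
qed

lemma hm_gset: "(!!n. ideal (U n) R) ==> U k <= P k ==> v : U k ==> hm k v : gset U"
 unfolding hm_def by (rule gsetI[OF single_rees]) (auto simp: single_def id_zero)

lemma gset_subring: "subring (gset vx) FF"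
proof (rule F.subringI)
 show "gset vx <= carrier FF" unfolding gset_def by auto
 show "\<one>\<^bsub>FF\<^esub> : gset vx" unfolding cl_one hm_def[symmetric] using hm_gset[of vx, OF vi vals_P, of \<one> 0] by simp
 show "\<ominus>\<^bsub>FF\<^esub> h : gset vx" if "h : gset vx" for h
  using gsetD[OF that] F_neg gsetI[of "%n. \<ominus> _ n" vx] id_neg[OF vi] by metis
 fix h h' assume h: "h : gset vx" "h' : gset vx"
 show "h \<oplus>\<^bsub>FF\<^esub> h' : gset vx" by (rule gset_add[OF _ h]) (rule vi)
 show "h \<otimes>\<^bsub>FF\<^esub> h' : gset vx" by (rule gset_mult[OF _ _ h]) (rule vi, rule vals_mult)
qed

lemma gset_V:
 assumes a: "a : rees" "!!n. a n : vx n" "cl a : gset (V j)" and j: "j <= s" shows "a n : V j n"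
proof -
 obtain c where c: "c : rees" "cl a = cl c" "c n : V j n" using gsetD[OF a(3)] by metis
 have "a n \<ominus> c n : KK n" using c cl_eq_iff[OF a(1) c(1)] by simp
 hence "a n \<ominus> c n : V j n" using V_KK[OF id_minus[OF vi a(2) subsetD[OF V_vals c(3)]] _ j] by blast
 thus ?thesis using id_minus_cancel[OF V_ideal] c rees_carr(1)[OF a(1)] rees_carr(1)[OF c(1)] by blast
qed

text \<open>For a graded ideal it is enough to multiply the lowest components outside it: in degree
  \<open>i + k\<close> every other term of the product has a factor in \<open>V j\<close>.\<close>

lemma gset_prime:
 assumes z: "z : gset vx" "z' : gset vx" "z \<otimes>\<^bsub>FF\<^esub> z' : gset (V j)" and j: "j <= s"
 shows "z : gset (V j) | z' : gset (V j)"
proof (rule ccontr)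
 assume no: "~ ?thesis"
 obtain a b where a: "a : rees" "z = cl a" "!!n. a n : vx n" and b: "b : rees" "z' = cl b" "!!n. b n : vx n"
  using gsetD[OF z(1)] gsetD[OF z(2)] by metis
 have ex: "EX n. a n ~: V j n" "EX n. b n ~: V j n" using no a(1,2) b(1,2) gsetI by blast+
 define i where "i = (LEAST n. a n ~: V j n)"
 define k where "k = (LEAST n. b n ~: V j n)"
 have i: "a i ~: V j i" "!!n. n < i ==> a n : V j n" unfolding i_def using LeastI_ex[OF ex(1)] not_less_Least by blast+
 have k: "b k ~: V j k" "!!n. n < k ==> b n : V j n" unfolding k_def using LeastI_ex[OF ex(2)] not_less_Least by blast+
 have ab: "a l \<otimes> b m : vx (l + m)" for l m by (rule vals_mult[OF a(3) b(3)])
 have "conv a b n : vx n" for n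
  unfolding conv_def by (rule finsum_in_ideal[OF vi]) (use ab in \<open>force simp: le_iff_add\<close>)+
 from gset_V[OF conv_rees[OF a(1) b(1)] this _ j] have cV: "conv a b (i + k) : V j (i + k)"
  using z(3) unfolding a(2) b(2) cl_mult[OF a(1) b(1)] .
 have c: "a l : RR" "b l : RR" for l using rees_carr(1) a(1) b(1) by auto
 let ?r = "\<Oplus>l\<in>{..i + k} - {i}. a l \<otimes> b (i + k - l)"
 have rV: "?r : V j (i + k)"
 proof (rule finsum_in_ideal[OF V_ideal])
  fix l assume l: "l : {..i + k} - {i}"
  show "a l \<otimes> b (i + k - l) : V j (i + k)"
  proof (cases "l < i")
   case True
   thus ?thesis using V_mult[OF b(3)[of "i + k - l"] i(2)[OF True] j] m_comm[OF c] l by simp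
  next
   case False
   hence "i + k - l < k" using l by auto
   from V_mult[OF a(3)[of l] k(2)[OF this] j] show ?thesis using l by simp
  qed
 qed simp
 have "conv a b (i + k) = a i \<otimes> b k \<oplus> ?r"
  unfolding conv_def using finsum_insert[of "{..i + k} - {i}" i "%l. a l \<otimes> b (i + k - l)"] c by (simp add: insert_absorb)
 hence "a i \<otimes> b k : V j (i + k)" using cV id_add_cancel(1)[OF V_ideal m_closed[OF c] rV] by simp
 thus False using V_prime[OF a(3) b(3) _ j] i(1) k(1) by blast
qed

text \<open>The fiber cone is a finite module over \<open>k[x]\<close> because
  \<open>I^(n + 1)\<close> is obtained from \<open>I\<close> by forms in \<open>x\<close>: the
  classes of the generators of \<open>I\<close> and the unit, placed at index \<open>e\<close>,
  generate it.\<close>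

lemma fiber_spanned:
 assumes u: "point u" "gen u e = I" and eq: "!!n. vals x s n I = P (Suc n)"
 shows "carrier FF <= F.bspan (gset vx) (%l. if l < e then hm (Suc 0) (u l) else \<one>\<^bsub>FF\<^esub>) (Suc e)"
  and "F.point (%l. if l < e then hm (Suc 0) (u l) else \<one>\<^bsub>FF\<^esub>)"
proof -
 let ?g = "%l. if l < e then hm (Suc 0) (u l) else \<one>\<^bsub>FF\<^esub>"
 let ?W = "F.bspan (gset vx) ?g (Suc e)"
 have uP: "u l : P (Suc 0)" if "l < e" for l using gen_mem[OF u(1) that] u(2) pow_1[OF I] by simp
 show g: "F.point ?g" using uP by (simp add: F.point_def)
 note W = F.bspan_closed[OF gset_subring g]
 have hB: "hm n v : gset vx" if "v : vx n" for n v using hm_gset[of vx, OF vi vals_P that] .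
 \<comment> \<open>The elements of \<open>I^(m + 1)\<close> whose classes lie in the span form an
   ideal, and multiplication by the \<open>x i\<close> shifts these ideals; so they contain all
   values of forms over \<open>I\<close>.\<close>
 define N where "N m = {v : P (Suc m). hm (Suc m) v : ?W}" for m
 have mult: "hm (n + m) (a \<otimes> v) : ?W" if "a : vx n" "v : P m" "hm m v : ?W" for n m a v
  using W(2)[OF hB[OF that(1)] that(3)] hm_mult[OF subsetD[OF vals_P that(1)] that(2)] by simp
 have hadd: "hm n (a \<oplus> b) = hm n a \<oplus>\<^bsub>FF\<^esub> hm n b" if "a : P n" "b : P n" for n a b
  unfolding hm_def cl_add[OF single_rees[OF that(1)] single_rees[OF that(2)]]
  by (rule arg_cong[of _ _ cl]) (use id_carr[OF Pi that(1)] in \<open>auto simp: single_def\<close>)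
 have one: "hm 0 r : ?W" if "r : RR" for r
  using W(2)[OF hB[of r 0] W(3)[of e "Suc e"]] that by simp
 have "hm n \<zero> = \<zero>\<^bsub>FF\<^esub>" for n using hm_zero[OF id_zero[OF Pi]] id_zero[OF KKi] by simp
 hence zero: "hm n \<zero> : ?W" for n using one[of \<zero>] by simp
 have Ni: "ideal (N m) R" for m
 proof (rule idI)
  show "N m <= RR" using id_carr[OF Pi] by (auto simp: N_def)
  show "\<zero> : N m" using zero id_zero[OF Pi] by (simp add: N_def)
  show "a \<oplus> b : N m" if "a : N m" "b : N m" for a b using that W(1) hadd id_add[OF Pi] by (simp add: N_def)
  show "r \<otimes> a : N m" if "a : N m" "r : RR" for a r using that mult[of r 0 a "Suc m"] id_mult[OF Pi] by (simp add: N_def)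
 qed
 have "gen u e <= N 0"
 proof (rule gen_least[OF Ni])
  fix l assume "l < e" thus "u l : N 0" using W(3)[of l "Suc e"] uP by (simp add: N_def)
 qed
 moreover have "x i \<otimes> v : N (Suc m)" if "i < s" "v : N m" for i m v
  using mult[OF x_V(3)[OF that(1)], of v "Suc m"] pow_mult[OF I xP, of v "Suc m" i] that(2) by (simp add: N_def)
 ultimately have "vals x s m I <= N m" for m
  using ev_graded[of N s x 0 m] Ni u(2) form_mono by (force elim: valsE)
 hence hW: "hm n v : ?W" if "v : P n" for n v using that one eq by (cases n) (auto simp: N_def)
 show "carrier FF <= ?W"
 proof
  fix f assume "f : carrier FF"
  then obtain a where a: "a : rees" "f = cl a" by (rule FF_rep)
  have trunc: "cl (%n. if n < N then a n else \<zero>) : ?W" for N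
  proof (induction N)
   case 0
   have "single 0 \<zero> = (%_. \<zero>)" by (rule ext) (simp add: single_def)
   thus ?case using zero[of 0] unfolding hm_def by simp
  next
   case (Suc N)
   have r: "(%n. if n < N then a n else \<zero>) : rees" by (rule reesI[of _ N]) (use rees_carr(2)[OF a(1)] id_zero[OF Pi] in auto)
   have "(%n. if n < Suc N then a n else \<zero>) = (%n. (if n < N then a n else \<zero>) \<oplus> single N (a N) n)"
    using rees_carr(1)[OF a(1)] by (auto simp: single_def less_Suc_eq)
   hence "cl (%n. if n < Suc N then a n else \<zero>) = cl (%n. if n < N then a n else \<zero>) \<oplus>\<^bsub>FF\<^esub> hm N (a N)"
    unfolding hm_def using cl_add[OF r single_rees[OF rees_carr(2)[OF a(1)]]] by simp
   thus ?case using W(1)[OF Suc hW[OF rees_carr(2)[OF a(1)]]] by simp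
  qed
  obtain N where "!!n. n > N ==> a n = \<zero>" using rees_bound[OF a(1)] by blast
  hence eq: "(%n. if n < Suc N then a n else \<zero>) = a" by (auto simp: less_Suc_eq_le not_le)
  show "f : ?W" unfolding a(2) using trunc[of "Suc N", unfolded eq] .
 qed
qed

text \<open>The coordinate primes of \<open>k[x]\<close> form a chain of length \<open>s\<close>,
  which \<open>going_up\<close> lifts one prime at a time; the class of \<open>x j\<close> separates
  consecutive members.\<close>

lemma alg_indep_le_dim:
 assumes u: "point u" "gen u e = I" and eq: "!!n. vals x s n I = P (Suc n)"
  and dim: "krull_dim FF = enat d"
 shows "s <= d"
proof -
 let ?g = "%l. if l < e then hm (Suc 0) (u l) else \<one>\<^bsub>FF\<^esub>"
 note spn = fiber_spanned[OF u eq]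
 have step: "EX Q'. primeideal Q' FF & Q <= Q' & gset (V j) <= Q' & Q' Int gset vx <= gset (V j)"
  if j: "j <= s" and Q: "ideal Q FF" "Q Int gset vx <= gset (V j)" for j Q
 proof (rule F.going_up[OF gset_subring _ _ _ _ _ spn(2) _ _ spn(1) Q, of e])
  show "gset (V j) <= gset vx" unfolding gset_def using V_vals by blast
  show "a \<oplus>\<^bsub>FF\<^esub> b : gset (V j)" if "a : gset (V j)" "b : gset (V j)" for a b by (rule gset_add[OF _ that]) (rule V_ideal)
  show "a \<otimes>\<^bsub>FF\<^esub> b : gset (V j)" if "a : gset vx" "b : gset (V j)" for a b by (rule gset_mult[OF _ _ that]) (rule V_ideal, rule V_mult[OF _ _ j])
  show "a : gset (V j) | b : gset (V j)" if "a : gset vx" "b : gset vx" "a \<otimes>\<^bsub>FF\<^esub> b : gset (V j)" for a b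
   using gset_prime[OF that j] .
  show "\<one>\<^bsub>FF\<^esub> ~: gset (V j)"
  proof
   assume o: "\<one>\<^bsub>FF\<^esub> : gset (V j)"
   have "single 0 \<one> n : vx n" for n using id_zero[OF vi] by (simp add: single_def)
   from gset_V[OF one_rees this o[unfolded cl_one] j, of 0] show False
    using mm_one by (auto simp: V_def single_def form_def)
  qed
 qed auto
 have "i <= s ==> EX C. prime_chain FF i C & C i Int gset vx <= gset (V (s - i))" for i
 proof (induction i)
  case 0
  have "\<zero>\<^bsub>FF\<^esub> : gset (V s)" unfolding gset_def cl_zero using zero_rees id_zero[OF V_ideal] by blast
  then obtain Q' where "primeideal Q' FF" "Q' Int gset vx <= gset (V s)" using step[OF order_refl F.zeroideal] by auto
  thus ?case using F.prime_chain_0 by (intro exI[of _ "%_. Q'"]) simp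
 next
  case (Suc i)
  then obtain C where C: "prime_chain FF i C" "C i Int gset vx <= gset (V (s - i))" by auto
  define j where "j = s - Suc i"
  have j: "j < s" "s - i = Suc j" using Suc.prems by (auto simp: j_def)
  have "gset (V (Suc j)) <= gset (V j)" unfolding gset_def using V_mono[of j "Suc j"] by (simp add: subset_iff) blast
  hence "C i Int gset vx <= gset (V j)" using C(2) unfolding j(2) by blast
  moreover have "ideal (C i) FF" using C(1) primeideal.axioms(1) unfolding prime_chain_def by blast
  ultimately obtain Q' where Q': "primeideal Q' FF" "C i <= Q'" "gset (V j) <= Q'" "Q' Int gset vx <= gset (V j)"
   using step[OF less_imp_le[OF j(1)]] by blast
  have "hm (Suc 0) (x j) : Q'" using hm_gset[of "V j", OF V_ideal _ x_V(1)[OF j(1)]] Q'(3) V_vals vals_P by blast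
  moreover have "hm (Suc 0) (x j) ~: C i"
  proof
   assume "hm (Suc 0) (x j) : C i"
   hence h: "cl (single (Suc 0) (x j)) : gset (V (Suc j))"
    using C(2) hm_gset[of vx, OF vi vals_P x_V(3)[OF j(1)]] unfolding j(2) hm_def by blast
   have "single (Suc 0) (x j) n : vx n" for n using x_V(3)[OF j(1)] id_zero[OF vi] by (simp add: single_def)
   from gset_V[OF single_rees[OF xP] this h, of "Suc 0"] show False using x_V(2)[OF j(1)] j(1) by (simp add: single_def)
  qed
  ultimately have "C i \<subset> Q'" using Q'(2) by blast
  hence "prime_chain FF (Suc i) (%k. if k <= i then C k else Q')"
   using C(1) Q'(1) unfolding prime_chain_def by (auto simp: less_Suc_eq le_Suc_eq)
  thus ?case using Q'(4) unfolding j_def by (intro exI[of _ "%k. if k <= i then C k else Q'"]) simp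
 qed
 from this[of s] show ?thesis using F.chain_le_dim dim by blast
qed

end

section \<open>Growth of the fiber cone and the length of its chains of primes\<close>

definition LL :: "nat => nat => nat list set"
 where "LL D n = {l. set l <= {..n} & length l = D}"

lemma finite_LL: "finite (LL D n)"
 unfolding LL_def by (rule finite_lists_length_eq) simp

lemma card_LL: "card (LL D n) = Suc n ^ D"
 unfolding LL_def by (simp add: card_lists_length_eq)

lemma LL_0: "LL 0 n = {[]}"
 unfolding LL_def by auto

lemma LL_Suc: "LL (Suc D) n = (%(e, l). e # l) ` ({..n} \<times> LL D n)"
 unfolding LL_def by (auto simp: length_Suc_conv image_iff)

context cring
begin

lemma finsum_Cons:
 assumes "finite A" "finite B" "!!l. f l : RR"
 shows "(\<Oplus>l\<in>(%(e, l). e # l) ` (A \<times> B). f l) = (\<Oplus>e\<in>A. \<Oplus>l\<in>B. f (e # l))"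
 using assms(1)
proof (induction A rule: finite_induct)
 case (insert a A)
 have im: "(%(e, l). e # l) ` (insert a A \<times> B) = (#) a ` B Un (%(e, l). e # l) ` (A \<times> B)" by auto
 have "(\<Oplus>l\<in>(%(e, l). e # l) ` (insert a A \<times> B). f l)
   = (\<Oplus>l\<in>(#) a ` B. f l) \<oplus> (\<Oplus>l\<in>(%(e, l). e # l) ` (A \<times> B). f l)"
  unfolding im by (rule finsum_Un_disjoint) (use assms insert in auto)
 also have "(\<Oplus>l\<in>(#) a ` B. f l) = (\<Oplus>l\<in>B. f (a # l))"
  by (rule finsum_reindex) (use assms(3) in auto)
 finally show ?case using insert assms(3) by (simp add: finsum_insert)
qed simp

fun lmon :: "(nat => 'a) => nat list => 'a" where
 "lmon g [] = \<one>"
| "lmon g (e # l) = g 0 [^] e \<otimes> lmon (%i. g (Suc i)) l"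

lemma lmon_closed [simp]: "point g ==> lmon g l : RR"
 by (induction l arbitrary: g) (auto simp: point_def)

text \<open>Modulo \<open>Q'\<close> the powers of \<open>t\<close> disappear and \<open>b 0\<close>
  remains, which is therefore zero. Then \<open>t\<close> cancels modulo the prime \<open>Q\<close>
  and the sum has become shorter.\<close>

lemma power_sum_zero:
 assumes Q: "primeideal Q R" "ideal Q' R" "Q <= Q'" and t: "t : Q'" "t ~: Q"
 shows "(!!e. b e : RR) ==> (!!e. b e : Q' ==> b e = \<zero>) ==> (\<Oplus>e\<in>{..m::nat}. t [^] e \<otimes> b e) : Q ==>
  ALL e<=m. b e = \<zero>"
proof (induction m arbitrary: b)
 case 0
 have tc: "t : RR" using id_carr[OF Q(2) t(1)] .
 have "(\<Oplus>e\<in>{..0::nat}. t [^] e \<otimes> b e) = b 0" using 0(1) tc by (simp add: finsum_insert)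
 thus ?case using 0 Q(3) by auto
next
 case (Suc m)
 have Qi: "ideal Q R" by (rule primeideal.axioms(1)[OF Q(1)])
 have tc: "t : RR" using id_carr[OF Q(2) t(1)] .
 note b = Suc.prems(1)
 define r where "r = (\<Oplus>e\<in>{..m}. t [^] e \<otimes> b (Suc e))"
 have rc: "r : RR" unfolding r_def by (rule finsum_closed) (use b tc in auto)
 have "(\<Oplus>e\<in>{..Suc m}. t [^] e \<otimes> b e) = (\<Oplus>e\<in>{..m}. t [^] Suc e \<otimes> b (Suc e)) \<oplus> t [^] (0::nat) \<otimes> b 0"
  by (rule finsum_Suc2) (use b tc in auto)
 also have "(\<Oplus>e\<in>{..m}. t [^] Suc e \<otimes> b (Suc e)) = (\<Oplus>e\<in>{..m}. t \<otimes> (t [^] e \<otimes> b (Suc e)))"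
  by (rule finsum_cong') (use b tc in \<open>auto simp: m_ac\<close>)
 also have "... = t \<otimes> r" unfolding r_def by (rule finsum_rdistr[symmetric]) (use b tc in auto)
 finally have eq: "(\<Oplus>e\<in>{..Suc m}. t [^] e \<otimes> b e) = t \<otimes> r \<oplus> b 0" using b by simp
 hence s: "t \<otimes> r \<oplus> b 0 : Q" using Suc.prems(3) by simp
 have "b 0 = (t \<otimes> r \<oplus> b 0) \<ominus> r \<otimes> t" using b[of 0] tc rc by algebra
 also have "... : Q'" using id_minus[OF Q(2) subsetD[OF Q(3) s] id_mult[OF Q(2) t(1) rc]] .
 finally have b0: "b 0 = \<zero>" by (rule Suc.prems(2))
 hence "t \<otimes> r : Q" using s tc rc by simp
 hence "r : Q" using primeideal_mult[OF Q(1) tc rc] t(2) by blast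
 hence "ALL e<=m. b (Suc e) = \<zero>"
  unfolding r_def using Suc.IH[of "%e. b (Suc e)", OF b Suc.prems(2)] by blast
 thus ?case using b0 by (metis Suc_le_mono not0_implies_Suc)
qed

text \<open>\<open>K\<close> plays the part of a field: it meets every prime in zero only. One
  element from each step of a prime chain then gives an algebraically independent family. The sum is
  ordered by powers of \<open>g 0\<close>, and its coefficients are treated with the chain that
  starts one prime later.\<close>

lemma monomials_independent:
 assumes K: "K <= RR" "!!a Q. a : K ==> primeideal Q R ==> a : Q ==> a = \<zero>"
 shows "prime_chain R D Q ==> point g ==> ALL i<D. g i : Q (Suc i) - Q i ==> ALL l. c l : K ==>
  (\<Oplus>l\<in>LL D n. c l \<otimes> lmon g l) : Q 0 ==> ALL l:LL D n. c l = \<zero>"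
proof (induction D arbitrary: Q g c)
 case 0
 have c: "c [] : RR" using 0(4) K by blast
 have "(\<Oplus>l\<in>LL 0 n. c l \<otimes> lmon g l) = c []" unfolding LL_0 using c by (simp add: finsum_insert)
 thus ?case using K(2)[of "c []" "Q 0"] 0 unfolding LL_0 by (simp add: prime_chain_def)
next
 case (Suc D)
 have pr: "primeideal (Q 0) R" "primeideal (Q 1) R" "Q 0 <= Q 1" using Suc.prems(1) by (auto simp: prime_chain_def)
 have cc: "c l : RR" for l using Suc.prems(4) K(1) by blast
 have pt: "point (%i. g (Suc i))" using Suc.prems(2) by (simp add: point_def)
 have gc: "g 0 : RR" using Suc.prems(2) by simp
 define b where "b e = (\<Oplus>l\<in>LL D n. c (e # l) \<otimes> lmon (%i. g (Suc i)) l)" for e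
 have bc: "b e : RR" for e unfolding b_def by (rule finsum_closed) (use cc pt in auto)
 have IH: "ALL l:LL D n. c (e # l) = \<zero>" if "b e : Q 1" for e
 proof (rule Suc.IH[of "%i. Q (Suc i)" "%i. g (Suc i)" "%l. c (e # l)"])
  show "prime_chain R D (%i. Q (Suc i))" using Suc.prems(1) by (auto simp: prime_chain_def)
 qed (use that pt Suc.prems in \<open>auto simp: b_def\<close>)
 have bz: "b e = \<zero>" if "b e : Q 1" for e
 proof -
  have "b e = (\<Oplus>l\<in>LL D n. \<zero>)" unfolding b_def by (rule finsum_cong') (use IH[OF that] pt in auto)
  thus ?thesis by (simp add: finsum_zero)
 qed
 have "(\<Oplus>l\<in>LL (Suc D) n. c l \<otimes> lmon g l) = (\<Oplus>e\<in>{..n}. \<Oplus>l\<in>LL D n. c (e # l) \<otimes> lmon g (e # l))"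
  unfolding LL_Suc by (rule finsum_Cons) (use finite_LL cc Suc.prems(2) in auto)
 also have "... = (\<Oplus>e\<in>{..n}. g 0 [^] e \<otimes> b e)"
 proof (rule finsum_cong')
  fix e assume "e : {..n}"
  have "(\<Oplus>l\<in>LL D n. c (e # l) \<otimes> lmon g (e # l)) = (\<Oplus>l\<in>LL D n. g 0 [^] e \<otimes> (c (e # l) \<otimes> lmon (%i. g (Suc i)) l))"
   by (rule finsum_cong') (use cc pt gc in \<open>auto simp: m_lcomm\<close>)
  also have "... = g 0 [^] e \<otimes> b e" unfolding b_def
   by (rule finsum_rdistr[symmetric]) (use cc pt gc finite_LL in auto)
  finally show "(\<Oplus>l\<in>LL D n. c (e # l) \<otimes> lmon g (e # l)) = g 0 [^] e \<otimes> b e" .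
 qed (use gc bc in auto)
 finally have "(\<Oplus>e\<in>{..n}. g 0 [^] e \<otimes> b e) : Q 0" using Suc.prems(5) by simp
 moreover have "g 0 : Q 1" "g 0 ~: Q 0" using Suc.prems(3) by auto
 ultimately have "ALL e<=n. b e = \<zero>"
  using power_sum_zero[OF pr(1) primeideal.axioms(1)[OF pr(2)] pr(3), of "g 0" b n] bc bz by blast
 hence "ALL e<=n. b e : Q 1" using id_zero[OF primeideal.axioms(1)[OF pr(2)]] by simp
 thus ?case using IH unfolding LL_Suc by auto
qed

lemma ev_finsum:
 assumes "finite K" "!!k. k : K ==> form (RR) s n (f k)" "!!k. k : K ==> rh k : RR" "point x"
 shows "ev x s n (%mu. \<Oplus>k\<in>K. f k mu \<otimes> rh k) = (\<Oplus>k\<in>K. ev x s n (f k) \<otimes> rh k)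
  & form (RR) s n (%mu. \<Oplus>k\<in>K. f k mu \<otimes> rh k)"
 using assms(1-3)
proof (induction K rule: finite_induct)
 case empty thus ?case using ev_zero[OF assms(4)] by (simp add: form_def)
next
 case (insert k K)
 have IH: "ev x s n (%mu. \<Oplus>k\<in>K. f k mu \<otimes> rh k) = (\<Oplus>k\<in>K. ev x s n (f k) \<otimes> rh k)"
  "form (RR) s n (%mu. \<Oplus>k\<in>K. f k mu \<otimes> rh k)" using insert.IH insert.prems by auto
 have fk: "form (RR) s n (f k)" "rh k : RR" using insert.prems by auto
 have m: "form (RR) s n (%mu. rh k \<otimes> f k mu)" by (rule form_smult[OF oneideal fk])
 have eq: "(\<Oplus>k\<in>insert k K. f k mu \<otimes> rh k) = rh k \<otimes> f k mu \<oplus> (\<Oplus>k\<in>K. f k mu \<otimes> rh k)" if "mu : Mon s n" for mu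
  using insert that unfolding form_def by (simp add: m_comm)
 have "ev x s n (%mu. \<Oplus>k\<in>insert k K. f k mu \<otimes> rh k) = ev x s n (%mu. rh k \<otimes> f k mu \<oplus> (\<Oplus>k\<in>K. f k mu \<otimes> rh k))"
  by (rule ev_cong) (rule eq)
 also have "... = rh k \<otimes> ev x s n (f k) \<oplus> (\<Oplus>k\<in>K. ev x s n (f k) \<otimes> rh k)"
  using ev_add[of x s n "%mu. rh k \<otimes> f k mu"] m IH fk assms(4) by (simp add: ev_smult)
 also have "... = (\<Oplus>k\<in>insert k K. ev x s n (f k) \<otimes> rh k)"
  using insert fk assms(4) by (simp add: m_comm)
 finally show ?case using form_add[OF oneideal m IH(2)] eq unfolding form_def by simp
qed

end

lemma card_bounded_multisets:
 "finite {mu. set_mset mu <= {..<s::nat} & size mu < N} & card {mu. set_mset mu <= {..<s} & size mu < N} <= N ^ s"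
proof -
 let ?A = "{mu. set_mset mu <= {..<s} & size mu < N}"
 let ?f = "%mu. map (count mu) [0..<s]"
 let ?B = "{l. set l <= {..<N} & length l = s}"
 have inj: "inj_on ?f ?A"
 proof (rule inj_onI)
  fix mu nu assume ab: "mu : ?A" "nu : ?A" "?f mu = ?f nu"
  have "count mu i = count nu i" for i
  proof (cases "i < s")
   case True thus ?thesis using ab(3) by (simp add: map_eq_conv)
  next
   case False
   hence "i ~:# mu" "i ~:# nu" using ab by auto
   thus ?thesis by (simp add: not_in_iff)
  qed
  thus "mu = nu" by (rule multiset_eqI)
 qed
 have "?f mu : ?B" if "mu : ?A" for mu
 proof -
  have "size mu < N" using that by simp
  hence "count mu i < N" for i using count_le_size[of mu i] by linarith
  thus ?thesis by auto
 qed
 hence im: "?f ` ?A <= ?B" by blast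
 have B: "finite ?B" "card ?B = N ^ s" using finite_lists_length_eq[of "{..<N}" s] card_lists_length_eq[of "{..<N}" s] by auto
 show ?thesis using inj_on_finite[OF inj im B(1)] card_inj_on_le[OF inj im B(1)] B(2) by simp
qed

context fiber
begin

definition "dg N z \<longleftrightarrow> (EX a:rees. z = cl a & (ALL k>N. a k = \<zero>))" for N :: nat and z

lemma dg_exists: "z : carrier FF ==> EX N. dg N z"
 unfolding dg_def using FF_rep rees_bound by metis

lemma dg_mono: "dg N z ==> N <= M ==> dg M z"
 unfolding dg_def by (meson le_less_trans)

lemma dg_one: "dg 0 \<one>\<^bsub>FF\<^esub>"
 unfolding dg_def cl_one using one_rees by (auto simp: single_def)

lemma dg_mult: assumes "dg N z" "dg M w" shows "dg (N + M) (z \<otimes>\<^bsub>FF\<^esub> w)"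
proof -
 obtain a where a: "a : rees" "z = cl a" "!!k. k > N ==> a k = \<zero>" using assms(1) unfolding dg_def by blast
 obtain b where b: "b : rees" "w = cl b" "!!k. k > M ==> b k = \<zero>" using assms(2) unfolding dg_def by blast
 have "conv a b k = \<zero>" if k: "k > N + M" for k
 proof -
  have "conv a b k = (\<Oplus>i\<in>{..k}. \<zero>)" unfolding conv_def
  proof (rule finsum_cong')
   fix i assume "i : {..k}"
   show "a i \<otimes> b (k - i) = \<zero>"
   proof (cases "i > N")
    case True thus ?thesis using a(3) rees_carr(1)[OF b(1)] by simp
   next
    case False
    hence "k - i > M" using k by simp
    thus ?thesis using b(3) rees_carr(1)[OF a(1)] by simp
   qed
  qed auto
  thus ?thesis by (simp add: finsum_zero)
 qed
 thus ?thesis unfolding dg_def a(2) b(2) cl_mult[OF a(1) b(1)] using conv_rees[OF a(1) b(1)] by blast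
qed

lemma dg_pow: "dg N z ==> dg (e * N) (z [^]\<^bsub>FF\<^esub> (e::nat))"
proof (induction e)
 case 0 thus ?case using dg_one by simp
next
 case (Suc e) thus ?case using dg_mult[of "e * N" _ N z] by (simp add: add.commute)
qed

lemma dg_lmon: "ALL i. dg N (g i) ==> l : LL D n ==> dg (D * (n * N)) (F.lmon g l)"
proof (induction D arbitrary: g l)
 case 0 thus ?case using dg_one by (simp add: LL_0)
next
 case (Suc D)
 then obtain e k where l: "l = e # k" "e <= n" "k : LL D n" unfolding LL_Suc by auto
 have "dg (e * N + D * (n * N)) (F.lmon g l)" unfolding l(1) F.lmon.simps
  by (rule dg_mult[OF dg_pow Suc.IH]) (use Suc.prems l in auto)
 thus ?case by (rule dg_mono) (use l(2) in simp)
qed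

text \<open>A component of positive degree is a combination of the generators of \<open>I\<close>
  with values of forms as multipliers. The coefficients of these forms are the coordinates for the
  count that follows.\<close>

lemma coordinates:
 assumes x: "point x" and u: "point u" "gen u e = I" and eq: "!!n. vals x s n I = P (Suc n)" and a: "a : rees"
 shows "EX \<phi>. (ALL k l. form (RR) s k (\<phi> k l)) & (ALL k. a (Suc k) = (\<Oplus>l\<in>{..<e}. ev x s k (\<phi> k l) \<otimes> u l))"
proof -
 have "EX f. (ALL l. form (RR) s k (f l)) & a (Suc k) = (\<Oplus>l\<in>{..<e}. ev x s k (f l) \<otimes> u l)" for k
 proof -
  have "a (Suc k) : vals x s k (gen u e)" using rees_carr(2)[OF a] eq u(2) by simp
  from vals_span[OF x u(1) this] obtain w where w: "ALL l. w l : vals x s k (RR)" "a (Suc k) = (\<Oplus>l\<in>{..<e}. w l \<otimes> u l)" by blast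
  from w(1) have "ALL l. EX f. form (RR) s k f & w l = ev x s k f" unfolding vals_def by blast
  from choice[OF this] obtain f where f: "!!l. form (RR) s k (f l)" "!!l. w l = ev x s k (f l)" by blast
  thus ?thesis using w(2) by auto
 qed
 thus ?thesis by metis
qed

text \<open>A chain of primes of length \<open>d\<close> makes the fibre cone grow at least like \<open>n\<^sup>d\<close>, while \<open>s\<close>
  generators of a reduction make it grow at most like \<open>n\<^sup>s\<close>.\<close>

lemma chain_le_generators:
 assumes x: "point x" "!!i. x i : I" and u: "point u" "gen u e = I" and eq: "!!n. vals x s n I = P (Suc n)"
  and ch: "prime_chain FF D Q"
 shows "D <= s"
proof (rule ccontr)
 assume no: "~ D <= s"
 have "EX h. h : carrier FF & (i < D --> h : Q (Suc i) - Q i)" for i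
 proof (cases "i < D")
  case True
  hence "Q i \<subset> Q (Suc i)" "primeideal (Q (Suc i)) FF" using ch unfolding prime_chain_def by auto
  thus ?thesis using F.id_carr[OF primeideal.axioms(1)] by blast
 qed (use F.zero_closed in blast)
 then obtain g where g: "!!i. g i : carrier FF" "ALL i<D. g i : Q (Suc i) - Q i" by metis
 \<comment> \<open>Past the end of the chain the value one is used, so that a single bound
   \<open>\<delta>\<close> on the degree holds for all indices.\<close>
 define g' where "g' i = (if i < D then g i else \<one>\<^bsub>FF\<^esub>)" for i
 have g': "F.point g'" "ALL i<D. g' i : Q (Suc i) - Q i" using g by (auto simp: F.point_def g'_def)
 have "ALL i. EX N. dg N (g i)" using dg_exists[OF g(1)] by blast
 from choice[OF this] obtain \<delta>f where \<delta>f: "!!i. dg (\<delta>f i) (g i)" by blast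
 define \<delta> where "\<delta> = Max (\<delta>f ` {..D})"
 have \<delta>: "ALL i. dg \<delta> (g' i)"
 proof
  fix i show "dg \<delta> (g' i)"
  proof (cases "i < D")
   case True
   hence "\<delta>f i <= \<delta>" unfolding \<delta>_def by (intro Max_ge) auto
   thus ?thesis using dg_mono[OF \<delta>f] True by (simp add: g'_def)
  qed (use dg_mono[OF dg_one] in \<open>simp add: g'_def\<close>)
 qed
 \<comment> \<open>The constant makes the number of equations, at most \<open>1 + e N^s\<close>,
   smaller than the number \<open>(n + 1)^D\<close> of monomials:
   \<open>N <= (D \<delta> + 1) n\<close>, and \<open>D > s\<close> supplies one more power of
   \<open>n\<close>.\<close>
 define n where "n = 1 + e * (D * \<delta> + 1) ^ s"
 define N where "N = D * (n * \<delta>) + 1"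
 let ?K = "LL D n"
 have "ALL l. EX a. l : ?K --> a : rees & F.lmon g' l = cl a & (ALL k>=N. a k = \<zero>)"
  using dg_lmon[OF \<delta>] unfolding dg_def N_def by (metis Suc_eq_plus1 Suc_le_lessD)
 from choice[OF this] obtain A0 where A0: "!!l. l : ?K ==> A0 l : rees & F.lmon g' l = cl (A0 l) & (ALL k>=N. A0 l k = \<zero>)" by blast
 define A where "A l = (if l : ?K then A0 l else (%_. \<zero>))" for l
 have A: "A l : rees" "!!k. k >= N ==> A l k = \<zero>" "l : ?K ==> F.lmon g' l = cl (A l)" for l
  using A0[of l] zero_rees by (auto simp: A_def)
 have "ALL l. EX \<phi>. (ALL k j. form (RR) s k (\<phi> k j)) & (ALL k. A l (Suc k) = (\<Oplus>j\<in>{..<e}. ev x s k (\<phi> k j) \<otimes> u j))"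
  using coordinates[OF x(1) u eq A(1)] by blast
 from choice[OF this] obtain \<phi> where \<phi>: "!!l k j. form (RR) s k (\<phi> l k j)"
  "!!l k. A l (Suc k) = (\<Oplus>j\<in>{..<e}. ev x s k (\<phi> l k j) \<otimes> u j)" by blast
 let ?M = "{mu. set_mset mu <= {..<s} & size mu < N}"
 let ?E = "insert None (Some ` ({..<e} \<times> ?M))"
 \<comment> \<open>One equation belongs to the component of degree zero, and one to each generator
   \<open>u j\<close> with each monomial of degree below \<open>N\<close>. The unknowns are scalars
   for the monomials in \<open>g'\<close>; a solution modulo \<open>mm\<close> makes their
   combination vanish in the fiber cone.\<close>
 define v where "v E l = (case E of None => A l 0 | Some (j, mu) => if mu : Mon s (size mu) then \<phi> l (size mu) j mu else \<zero>)" for E l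
 have M: "finite ?M" "card ?M <= N ^ s" using card_bounded_multisets by auto
 have E: "finite ?E" using M(1) by simp
 have "card ?E = Suc (card (Some ` ({..<e} \<times> ?M)))" using M(1) by (intro card_insert_disjoint) auto
 also have "card (Some ` ({..<e} \<times> ?M)) = e * card ?M" by (simp add: card_image card_cartesian_product)
 finally have "card ?E <= Suc (e * N ^ s)" using M(2) by simp
 also have "... < Suc n ^ D"
 proof -
  have n1: "n >= 1" by (simp add: n_def)
  have "N <= (D * \<delta> + 1) * n" unfolding N_def using n1 by (simp add: algebra_simps)
  hence "N ^ s <= (D * \<delta> + 1) ^ s * n ^ s" by (metis power_mono power_mult_distrib zero_le)
  hence "e * N ^ s <= (e * (D * \<delta> + 1) ^ s) * n ^ s" by (metis mult.assoc mult_le_mono2)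
  moreover have "1 <= n ^ s" using n1 by simp
  ultimately have "1 + e * N ^ s <= n ^ s + (e * (D * \<delta> + 1) ^ s) * n ^ s" by (rule add_mono[rotated])
  hence "Suc (e * N ^ s) <= (1 + e * (D * \<delta> + 1) ^ s) * n ^ s" unfolding distrib_right by simp
  also have "... = n ^ Suc s" by (simp add: n_def)
  also have "... < Suc n ^ Suc s" by (rule power_strict_mono) auto
  also have "... <= Suc n ^ D" using no by (intro power_increasing) auto
  finally show ?thesis .
 qed
 finally have card: "card ?E < card ?K" by (simp only: card_LL)
 have vc: "ALL E l. v E l : RR"
  using rees_carr(1)[OF A(1)] \<phi>(1) unfolding v_def form_def by (auto split: option.splits)
 obtain rh where rh: "!!k. rh k : RR" "EX k:?K. rh k ~: mm" "ALL E:?E. (\<Oplus>k\<in>?K. v E k \<otimes> rh k) : mm"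
  using underdetermined[OF mm_prime E finite_LL card vc] by blast
 have Ac: "A l k : RR" for l k using rees_carr(1)[OF A(1)] .
 have "(\<Oplus>\<^bsub>FF\<^esub>l\<in>?K. hm 0 (rh l) \<otimes>\<^bsub>FF\<^esub> F.lmon g' l) = (\<Oplus>\<^bsub>FF\<^esub>l\<in>?K. cl (%k. rh l \<otimes> A l k))"
  by (rule F.finsum_cong') (use A scal_cl[OF rh(1) A(1)] smult_rees[OF A(1) rh(1)] in auto)
 also have "... = cl (%k. \<Oplus>l\<in>?K. rh l \<otimes> A l k)"
  using cl_finsum[OF finite_LL, of D n "%l k. rh l \<otimes> A l k"] smult_rees[OF A(1) rh(1)] by blast
 also have "... = \<zero>\<^bsub>FF\<^esub>"
 proof (subst cl_eq_zero)
  show "(%k. \<Oplus>l\<in>?K. rh l \<otimes> A l k) : rees"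
   using cl_finsum[OF finite_LL, of D n "%l k. rh l \<otimes> A l k"] smult_rees[OF A(1) rh(1)] by blast
  show "ALL k. (\<Oplus>l\<in>?K. rh l \<otimes> A l k) : KK k"
  proof
   fix k show "(\<Oplus>l\<in>?K. rh l \<otimes> A l k) : KK k"
   proof (cases k)
    case 0
    have "(\<Oplus>l\<in>?K. rh l \<otimes> A l k) = (\<Oplus>l\<in>?K. v None l \<otimes> rh l)"
     by (rule finsum_cong') (use rh(1) Ac in \<open>auto simp: v_def 0 m_comm\<close>)
    thus ?thesis using rh(3) 0 by (simp add: KK_0)
   next
    case (Suc m)
    have evc: "ev x s m (\<phi> l m j) : RR" for l j using \<phi>(1) x(1) by simp
    have "(\<Oplus>l\<in>?K. rh l \<otimes> A l k) = (\<Oplus>l\<in>?K. rh l \<otimes> (\<Oplus>j\<in>{..<e}. ev x s m (\<phi> l m j) \<otimes> u j))"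
     unfolding Suc \<phi>(2) ..
    also have "... = (\<Oplus>j\<in>{..<e}. (\<Oplus>l\<in>?K. ev x s m (\<phi> l m j) \<otimes> rh l) \<otimes> u j)"
     by (rule finsum_swap_linear) (use finite_LL evc rh(1) u(1) in auto)
    finally have e1: "(\<Oplus>l\<in>?K. rh l \<otimes> A l k) = (\<Oplus>j\<in>{..<e}. (\<Oplus>l\<in>?K. ev x s m (\<phi> l m j) \<otimes> rh l) \<otimes> u j)" .
    show ?thesis
    proof (cases "m < N")
     case True
     show ?thesis unfolding e1
     proof (rule finsum_in_ideal[OF KKi])
      fix j assume j: "j : {..<e}"
      have ef: "ev x s m (%mu. \<Oplus>l\<in>?K. \<phi> l m j mu \<otimes> rh l) = (\<Oplus>l\<in>?K. ev x s m (\<phi> l m j) \<otimes> rh l)"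
       using ev_finsum[OF finite_LL, of D n s m "%l. \<phi> l m j" rh x] \<phi>(1) rh(1) x(1) by blast
      have "form mm s m (%mu. \<Oplus>l\<in>?K. \<phi> l m j mu \<otimes> rh l)" unfolding form_def
      proof
       fix mu assume mu: "mu : Mon s m"
       hence mu': "size mu = m" "set_mset mu <= {..<s}" unfolding Mon_def by auto
       hence "Some (j, mu) : ?E" using j True by auto
       from rh(3)[rule_format, OF this] show "(\<Oplus>l\<in>?K. \<phi> l m j mu \<otimes> rh l) : mm" using mu mu' by (simp add: v_def)
      qed
      moreover have "x i \<otimes> w : KK (Suc k)" if "w : KK k" for i k w
       using KK_mult2[of "x i" "Suc 0" w k] x(2) pow_1[OF I] that by simp
      ultimately have "ev x s m (%mu. \<Oplus>l\<in>?K. \<phi> l m j mu \<otimes> rh l) : KK m"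
       using ev_graded[of KK s x 0 m] KKi by (simp add: KK_0)
      moreover have "u j : P (Suc 0)" using gen_mem[OF u(1), of j e] u(2) pow_1[OF I] j by simp
      ultimately show "(\<Oplus>l\<in>?K. ev x s m (\<phi> l m j) \<otimes> rh l) \<otimes> u j : KK k"
       using KK_mult[of _ m "u j" "Suc 0"] unfolding ef Suc by simp
     qed simp
    next
     case False
     have "(\<Oplus>l\<in>?K. rh l \<otimes> A l k) = (\<Oplus>l\<in>?K. \<zero>)"
      by (rule finsum_cong') (use False A(2) rh(1) Suc in auto)
     thus ?thesis using id_zero[OF KKi] by (simp add: finsum_zero)
    qed
   qed
  qed
 qed
 finally have zero: "(\<Oplus>\<^bsub>FF\<^esub>l\<in>?K. hm 0 (rh l) \<otimes>\<^bsub>FF\<^esub> F.lmon g' l) = \<zero>\<^bsub>FF\<^esub>" .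
 have Q0: "primeideal (Q 0) FF" using ch by (simp add: prime_chain_def)
 have Kc: "hm 0 ` RR <= carrier FF" by auto
 \<comment> \<open>A nonzero scalar of the residue field is invertible in the fiber cone, hence in
   no prime; so the scalars can serve as the coefficient set \<open>K\<close>.\<close>
 have unit: "a = \<zero>\<^bsub>FF\<^esub>" if a: "a : hm 0 ` RR" "primeideal Q' FF" "a : Q'" for a Q'
 proof (rule ccontr)
  assume nz: "a ~= \<zero>\<^bsub>FF\<^esub>"
  obtain r where r: "r : RR" "a = hm 0 r" using a(1) by blast
  have "r ~: mm" using nz hm_zero[of r 0] r by (simp add: KK_0)
  then obtain r' where r': "r' : RR" "r' \<otimes> r = \<one>" using unit_inverse[OF r(1)] m_comm r(1) by metis
  have "hm 0 r' \<otimes>\<^bsub>FF\<^esub> hm 0 r = \<one>\<^bsub>FF\<^esub>" using hm_mult[of r' 0 r 0] r r' by (simp add: cl_one hm_def)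
  hence "\<one>\<^bsub>FF\<^esub> : Q'" using F.id_mult[OF primeideal.axioms(1)[OF a(2)] a(3), of "hm 0 r'"] r r' by simp
  thus False using F.primeideal_one[OF a(2)] by blast
 qed
 have "ALL l:?K. hm 0 (rh l) = \<zero>\<^bsub>FF\<^esub>"
  using F.monomials_independent[OF Kc unit ch g', where c = "%l. hm 0 (rh l)" and n = n] zero rh(1) F.id_zero[OF primeideal.axioms(1)[OF Q0]] by simp
 thus False using rh(1,2) hm_zero[of _ 0] by (auto simp: KK_0)
qed

end

section \<open>Minimal generators of the reduction and their number\<close>

context noeth
begin

lemma ideal_generators:
 assumes "ideal L R" obtains u e where "point u" "gen u e = L"
proof -
 obtain A where A: "A <= RR" "finite A" "L = Idl A"
  using noetherian_ring.finetely_gen[OF noetherian assms] by blast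
 from A(2) have "EX n f. A = f ` {i::nat. i < n}" by (simp only: finite_conv_nat_seg_image)
 then obtain n and f :: "nat => 'a" where f: "A = f ` {i. i < n}" by blast
 define u where "u i = (if i < n then f i else \<zero>)" for i
 have u: "point u" using A(1) f unfolding point_def u_def by auto
 have "f i : gen u n" if "i < n" for i using gen_mem[OF u that] that by (simp add: u_def)
 hence Au: "A <= gen u n" unfolding f by blast
 have "gen u n <= L"
 proof (rule gen_least[OF assms])
  fix i assume "i < n"
  hence "u i : A" unfolding f by (simp add: u_def)
  thus "u i : L" using A genideal_self[OF A(1)] by blast
 qed
 moreover have "L <= gen u n" unfolding A(3) by (rule genideal_minimal[OF gen_ideal[OF u] Au])
 ultimately show ?thesis using that u by blast
qed

end

context fiber_inf
begin

lemma mI: "ideal (mm \<cdot> I) R" by (rule ideal_prod_is_ideal[OF mm_ideal I])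

lemma sum_ideal: "point x ==> ideal (gen x i <+> mm \<cdot> I) R"
 by (rule add_ideals[OF gen_ideal mI])

text \<open>The part of \<open>J\<close> not covered by \<open>gen x s\<close> lies in
  \<open>mm I\<close> and is absorbed by Nakayama.\<close>

lemma gen_reduction:
 assumes J: "ideal J R" "J <= I" and red: "!!n. n >= 1 ==> J \<cdot> P n = P (Suc n)"
  and x: "point x" "gen x s <= I" and le: "J <= gen x s <+> mm \<cdot> I" and n: "n >= 1"
 shows "gen x s \<cdot> P n = P (Suc n)"
proof
 note gi = gen_ideal[OF x(1), of s]
 note gP = ideal_prod_is_ideal[OF gi Pi, of n]
 show "gen x s \<cdot> P n <= P (Suc n)" unfolding pow_Suc2[OF I] by (rule prod_mono[OF x(2) subset_refl])
 have mm: "ideal (mm \<cdot> P (Suc n)) R" by (rule ideal_prod_is_ideal[OF mm_ideal Pi])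
 have "J \<cdot> P n <= gen x s \<cdot> P n <+> mm \<cdot> P (Suc n)"
 proof (rule prod_least[OF add_ideals[OF gP mm]])
  fix a b assume ab: "a : J" "b : P n"
  obtain g h where gh: "g : gen x s" "h : mm \<cdot> I" "a = g \<oplus> h" using ab(1) le set_add_iff[of a "gen x s" "mm \<cdot> I"] by blast
  have "h \<otimes> b : (mm \<cdot> I) \<cdot> P n" using ideal_prod.prod[OF gh(2) ab(2)] .
  hence "h \<otimes> b : mm \<cdot> P (Suc n)" unfolding pow_Suc2[OF I] using ideal_prod_assoc[OF mm_ideal I Pi] by simp
  moreover have "g \<otimes> b : gen x s \<cdot> P n" using ideal_prod.prod[OF gh(1) ab(2)] .
  moreover have "a \<otimes> b = g \<otimes> b \<oplus> h \<otimes> b" unfolding gh(3)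
   using id_carr[OF gi gh(1)] id_carr[OF mI gh(2)] id_carr[OF Pi ab(2)] by (simp add: l_distr)
  ultimately show "a \<otimes> b : gen x s \<cdot> P n <+> mm \<cdot> P (Suc n)" using set_add_iff[of "a \<otimes> b"] by blast
 qed
 thus "P (Suc n) <= gen x s \<cdot> P n" unfolding red[OF n] by (rule nakayama[OF Pi gP])
qed

text \<open>Coordinates from \<open>s\<close> on are replaced by zero, because
  \<open>chain_le_generators\<close> and \<open>fiber_tower\<close> ask for points all of whose
  coordinates lie in \<open>I\<close>.\<close>

lemma gen_reduction_point:
 assumes "ideal J R" "J <= I" "!!n. n >= 1 ==> J \<cdot> P n = P (Suc n)"
  "point x" "!!k. k < s ==> x k : I" "J <= gen x s <+> mm \<cdot> I"
 shows "EX y. point y & (ALL k. y k : I) & (ALL k<s. y k = x k) & gen y s = gen x s & (ALL n. vals y s n I = P (Suc n))"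
proof -
 define y where "y k = (if k < s then x k else \<zero>)" for k
 have yI: "y k : I" for k using assms(5) id_zero[OF I] by (simp add: y_def)
 have y: "point y" using yI id_carr[OF I] unfolding point_def by blast
 have g: "gen y s = gen x s" by (rule gen_cong) (simp add: y_def)
 have gI: "gen y s <= I" by (rule gen_least[OF I yI])
 have le: "J <= gen y s <+> mm \<cdot> I" unfolding g by (rule assms(6))
 have red: "gen y s \<cdot> P n = P (Suc n)" if "n >= 1" for n
  by (rule gen_reduction[OF assms(1-3) y gI le that])
 have "vals y s n I = P (Suc n)" for n by (rule vals_eq_pow[OF I y gI red])
 thus ?thesis using y yI g by (auto simp: y_def intro!: exI[of _ y])
qed

lemma degree_one_independence:
 "point x ==> (!!k. k < s ==> x k : I & x k ~: gen x k <+> mm \<cdot> I) ==> form (RR) s (Suc 0) c ==>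
  ev x s (Suc 0) c : mm \<cdot> I ==> form mm s (Suc 0) c"
proof (induction s)
 case 0 thus ?case by (simp add: form_def)
next
 case (Suc s)
 note x = Suc.prems(1)
 have fc: "form (RR) s (Suc 0) c" "c {#s#} : RR" using Suc.prems(3) unfolding form_Suc by (auto simp: form_def)
 let ?w = "ev x s (Suc 0) c"
 have w: "?w : gen x s" unfolding gen_eq_vals[OF x] using valsI[OF fc(1), of x] by simp
 have wc: "?w : RR" using fc(1) x by simp
 have xs: "x s : I" "x s ~: gen x s <+> mm \<cdot> I" "x s : RR" using Suc.prems(2)[of s] x by auto
 have e: "?w \<oplus> x s \<otimes> c {#s#} : mm \<cdot> I" using Suc.prems(4) by simp
 have cm: "c {#s#} : mm"
 proof (rule ccontr)
  assume "c {#s#} ~: mm"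
  have "\<ominus> ?w : gen x s" using id_neg[OF gen_ideal[OF x] w] .
  moreover have "c {#s#} \<otimes> x s = \<ominus> ?w \<oplus> (?w \<oplus> x s \<otimes> c {#s#})" using wc xs(3) fc(2) by algebra
  ultimately have "c {#s#} \<otimes> x s : gen x s <+> mm \<cdot> I" using e set_add_iff[of "c {#s#} \<otimes> x s" "gen x s" "mm \<cdot> I"] by blast
  thus False using unit_cancel[OF sum_ideal[OF x] fc(2) \<open>c {#s#} ~: mm\<close> xs(3)] xs(2) by blast
 qed
 have "c {#s#} \<otimes> x s : mm \<cdot> I" using ideal_prod.prod[OF cm xs(1)] .
 hence "(?w \<oplus> x s \<otimes> c {#s#}) \<ominus> c {#s#} \<otimes> x s : mm \<cdot> I" using id_minus[OF mI e] by blast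
 moreover have "(?w \<oplus> x s \<otimes> c {#s#}) \<ominus> c {#s#} \<otimes> x s = ?w" using wc xs(3) fc(2) by algebra
 ultimately have "form mm s (Suc 0) c" using Suc.IH[OF x Suc.prems(2) fc(1)] by simp
 thus ?case unfolding form_Suc using cm by (simp add: form_def)
qed

text \<open>The process of appending elements ends by the Noetherian property: take a maximal ideal
  \<open>gen y s + mm I\<close> among the admissible extensions; an element of \<open>J\<close>
  outside it could be appended.\<close>

lemma extend_to_generators:
 assumes J: "ideal J R" "J <= I" and x: "point x" "!!k. k < d ==> x k : J & x k ~: gen x k <+> mm \<cdot> I"
 obtains y s where "d <= s" "point y" "ALL k<d. y k = x k" "ALL k<s. y k : J & y k ~: gen y k <+> mm \<cdot> I" "J <= gen y s <+> mm \<cdot> I"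
proof -
 define ok where "ok y s \<longleftrightarrow> d <= s & point y & (ALL k<d. y k = x k) & (ALL k<s. y k : J & y k ~: gen y k <+> mm \<cdot> I)" for y s
 define p where "p X \<longleftrightarrow> (EX y s. ok y s & X = gen y s <+> mm \<cdot> I)" for X :: "'a set"
 have "ok x d" unfolding ok_def using x by blast
 hence "p (gen x d <+> mm \<cdot> I)" unfolding p_def by blast
 from max_ideal_obtain[of _ p, OF sum_ideal[OF x(1)] this] obtain X where
  X: "p X" "!!Y. ideal Y R ==> X <= Y ==> p Y ==> Y = X" by metis
 obtain y s where y: "ok y s" "X = gen y s <+> mm \<cdot> I" using X(1) unfolding p_def by blast
 have yp: "point y" "d <= s" using y(1) unfolding ok_def by blast+
 have "J <= X"
 proof (rule ccontr)
  assume "~ J <= X"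
  then obtain z where z: "z : J" "z ~: X" by blast
  define y' where "y' = y(s := z)"
  have y': "point y'" unfolding y'_def by (rule point_upd[OF yp(1) id_carr[OF J(1) z(1)]])
  have g: "gen y' k = gen y k" if "k <= s" for k by (rule gen_cong) (use that in \<open>simp add: y'_def\<close>)
  have ok': "ok y' (Suc s)" unfolding ok_def
  proof (intro conjI allI impI)
   show "d <= Suc s" "point y'" using yp y' by auto
   show "y' k = x k" if "k < d" for k using y(1) that yp(2) unfolding ok_def y'_def by simp
   fix k assume k: "k < Suc s"
   show "y' k : J" using y(1) k z(1) unfolding ok_def y'_def by (auto simp: less_Suc_eq)
   show "y' k ~: gen y' k <+> mm \<cdot> I" using y k z(2) g[of k] unfolding ok_def by (auto simp: less_Suc_eq y'_def)
  qed
  have sub: "X <= gen y' (Suc s) <+> mm \<cdot> I"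
  proof -
   have "gen y s <= gen y' (Suc s)" using gen_mono[OF y', of s "Suc s"] g[of s] by simp
   hence "gen y s <= gen y' (Suc s) <+> mm \<cdot> I" "mm \<cdot> I <= gen y' (Suc s) <+> mm \<cdot> I"
    using set_add_sub1[OF gen_ideal[OF y'] mI] set_add_sub2[OF gen_ideal[OF y'] mI] by blast+
   thus ?thesis unfolding y(2) by (rule set_add_least[OF sum_ideal[OF y']])
  qed
  have "p (gen y' (Suc s) <+> mm \<cdot> I)" using ok' unfolding p_def by blast
  from X(2)[OF sum_ideal[OF y'] sub this] have eq: "gen y' (Suc s) <+> mm \<cdot> I = X" .
  have "z : gen y' (Suc s)" using gen_mem[OF y', of s "Suc s"] by (simp add: y'_def)
  thus False using z(2) set_add_sub1[OF gen_ideal[OF y'] mI] eq by blast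
 qed
 thus ?thesis using that y(1) unfolding y(2) ok_def by blast
qed

text \<open>The analytic spread fixes the number of generators. Fewer than \<open>d\<close> elements
  never cover \<open>J\<close> modulo \<open>mm I\<close>, by \<open>chain_le_generators\<close>, so
  \<open>d\<close> generic ones exist and extend to \<open>s >= d\<close> minimal generators of
  \<open>J\<close>. These are algebraically independent by minimality of the reduction, so
  \<open>s <= d\<close> by going up, and the generic elements generate \<open>J\<close>.\<close>

theorem generators_torsion_free:
 assumes d: "krull_dim R = enat d" "d >= 1" and dep: "dep {\<zero>} d"
  and ht: "ideal_height R I = enat (d - 1)" and lci: "locally_complete_intersection R I"
  and J: "ideal J R" "J <= I" and red: "!!n. n >= 1 ==> J \<cdot> P n = P (Suc n)"
  and min: "!!K. ideal K R ==> K <= J ==> EX N. ALL n>=N. K \<cdot> P n = P (Suc n) ==> K = J"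
  and spread: "krull_dim FF = enat d"
 obtains x where "point x" "!!i. i < d ==> x i : I"
  "!!n u k f. u : P n ==> u ~: mm \<cdot> P n ==> form (RR) d k f ==> ~ form mm d k f ==>
   ev x d k f \<otimes> u ~: mm \<cdot> P (k + n)"
proof -
 obtain u e where u: "point u" "gen u e = I" using ideal_generators[OF I] .
 \<comment> \<open>The dimension is a supremum over chains, and a first prime is needed to attain
   it; one exists because the unit of the fiber cone is nonzero.\<close>
 have "EX n>=d. EX C. prime_chain FF n C"
 proof (rule enat_Sup_attained)
  show "enat d <= Sup {enat n |n. EX C. prime_chain FF n C}" using spread unfolding krull_dim_def by simp
  obtain Q where "primeideal Q FF"
  proof -
   have "\<one>\<^bsub>FF\<^esub> ~= \<zero>\<^bsub>FF\<^esub>" using hm_zero[of \<one> 0] mm_one unfolding cl_one by (simp add: hm_def KK_0)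
   hence "{\<zero>\<^bsub>FF\<^esub>} Int {\<one>\<^bsub>FF\<^esub>} = {}" by simp
   from F.prime_avoiding_exists[OF F.zeroideal _ _ _ this] show ?thesis using that by auto
  qed
  thus "EX C. prime_chain FF 0 C" using F.prime_chain_0 by blast
 qed
 then obtain D Q where Q: "d <= D" "prime_chain FF D Q" by blast
 have big: "~ J <= gen x i <+> mm \<cdot> I" if h: "point x" "!!k. k < i ==> x k : J" "i < d" for x i
 proof
  assume "J <= gen x i <+> mm \<cdot> I"
  from gen_reduction_point[OF J red h(1) _ this] h(2) J(2) obtain y where
   y: "point y" "ALL k. y k : I" "ALL n. vals y i n I = P (Suc n)" by blast
  from chain_le_generators[OF y(1) y(2)[rule_format] u y(3)[rule_format] Q(2)] Q(1) h(3) show False by simp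
 qed
 obtain x where x: "point x" "ALL k<d. x k : J & x k ~: gen x k <+> mm \<cdot> I"
  "ALL k<d - 1. nzd (gen x k) (x k)" "ALL w:I. x (d - 1) \<otimes> w : gen x (d - 1) --> w : gen x (d - 1)"
  using generic_generators[OF d dep I ht lci J red big] by blast
 obtain y0 s where y0: "d <= s" "point y0" "ALL k<d. y0 k = x k" "ALL k<s. y0 k : J & y0 k ~: gen y0 k <+> mm \<cdot> I" "J <= gen y0 s <+> mm \<cdot> I"
  by (rule extend_to_generators[OF J x(1) x(2)[rule_format]])
 have y0I: "y0 k : I" if "k < s" for k using y0(4) J(2) that by blast
 obtain y where y: "point y" "ALL k. y k : I" "ALL k<s. y k = y0 k" "gen y s = gen y0 s" "ALL n. vals y s n I = P (Suc n)"
  using gen_reduction_point[OF J red y0(2) y0I y0(5)] by blast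
 have gk: "gen y k = gen y0 k" if "k <= s" for k by (rule gen_cong) (use y(3) that in simp)
 have yind: "y k : I & y k ~: gen y k <+> mm \<cdot> I" if "k < s" for k
  using y(3) y0(4) gk[of k] that y0I[OF that] by simp
 have gJ: "gen y s <= J" using gen_least[OF J(1), of s y0] y0(4) y(4) by simp
 have gI: "gen y s <= I" using gJ J(2) by blast
 have le: "J <= gen y s <+> mm \<cdot> I" unfolding y(4) by (rule y0(5))
 have gred: "gen y s \<cdot> P n = P (Suc n)" if "n >= 1" for n
  by (rule gen_reduction[OF J red y(1) gI le that])
 hence "gen y s = J" using min[OF gen_ideal[OF y(1)] gJ] by blast
 have ind1: "form mm s 1 c" if "form (RR) s 1 c" "ev y s 1 c : mm \<cdot> I" for c
  using degree_one_independence[OF y(1) yind] that by simp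
 have min': "K = gen y s" if "ideal K R" "K <= gen y s" "EX N. ALL n>=N. K \<cdot> P n = P (Suc n)" for K
  using min[OF that(1) _ that(3)] that(2) \<open>gen y s = J\<close> by blast
 have ai: "alg_indep y s" unfolding alg_indep_def KK_def
  using analytic_independence[OF I y(1) refl gI gred min' ind1] by blast
 interpret tw: fiber_tower R mm I y s by unfold_locales (use y(2) ai in auto)
 have "s = d" using tw.alg_indep_le_dim[OF u y(5)[rule_format] spread] y0(1) by simp
 obtain r where r: "d = Suc r" using d(2) by (cases d) auto
 have yx: "y k = x k" if "k < d" for k using y(3) y0(3) that \<open>s = d\<close> by simp
 have gx: "gen y k = gen x k" if "k <= d" for k by (rule gen_cong) (use yx that in simp)
 have "ev y d k f \<otimes> v ~: mm \<cdot> P (k + n)"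
  if h: "v : P n" "v ~: mm \<cdot> P n" "form (RR) d k f" "~ form mm d k f" for n v k f
  unfolding r
 proof (rule fiber_torsion_free[OF I y(1)])
  show "gen y (Suc r) <= I" using gI \<open>s = d\<close> r by simp
  show "gen y (Suc r) \<cdot> P n = P (Suc n)" if "n >= 1" for n using gred[OF that] \<open>s = d\<close> r by simp
  show "form mm (Suc r) n f" if "form (RR) (Suc r) n f" "ev y (Suc r) n f : mm \<cdot> P n" for n f
   using ai that \<open>s = d\<close> r unfolding alg_indep_def KK_def by simp
  show "nzd (gen y i) (y i)" if "i < r" for i using x(3) that r yx[of i] gx[of i] by simp
  show "w : gen y r" if "w : I" "y r \<otimes> w : gen y r" for w using x(4) that r yx[of r] gx[of r] by simp
 qed (use h r in auto)
 thus ?thesis using that y(1,2) by blast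
qed

end

section \<open>Quotients of modules and free modules\<close>

lemma finsum_hom:
 assumes M: "abelian_group M" and Q: "abelian_group Q"
  and h: "!!x. x : carrier M ==> h x : carrier Q" "!!x y. x : carrier M ==> y : carrier M ==> h (x \<oplus>\<^bsub>M\<^esub> y) = h x \<oplus>\<^bsub>Q\<^esub> h y"
  and A: "finite A" "!!i. i : A ==> f i : carrier M"
 shows "h (\<Oplus>\<^bsub>M\<^esub>i\<in>A. f i) = (\<Oplus>\<^bsub>Q\<^esub>i\<in>A. h (f i))"
proof -
 interpret M: abelian_group M by fact
 interpret Q: abelian_group Q by fact
 have "h \<zero>\<^bsub>M\<^esub> \<oplus>\<^bsub>Q\<^esub> h \<zero>\<^bsub>M\<^esub> = h \<zero>\<^bsub>M\<^esub>" using h(2)[of "\<zero>\<^bsub>M\<^esub>" "\<zero>\<^bsub>M\<^esub>"] by simp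
 hence z: "h \<zero>\<^bsub>M\<^esub> = \<zero>\<^bsub>Q\<^esub>" using h(1)[OF M.zero_closed] by (simp add: Q.add.r_cancel_one')
 show ?thesis using A
 proof (induction A rule: finite_induct)
  case (insert i A)
  hence "(\<Oplus>\<^bsub>M\<^esub>i\<in>A. f i) : carrier M" by (intro M.finsum_closed) auto
  thus ?case using insert h by (simp add: M.finsum_insert Q.finsum_insert)
 qed (simp add: z)
qed

context module
begin

lemma R_cring: "cring R" ..

lemma M_group: "abelian_group M" ..

lemma sub_simps:
 assumes "submodule N R M"
 shows "x : N ==> x : carrier M" "\<zero>\<^bsub>M\<^esub> : N" "x : N ==> y : N ==> x \<oplus>\<^bsub>M\<^esub> y : N" "x : N ==> \<ominus>\<^bsub>M\<^esub> x : N"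
  "a : RR ==> x : N ==> a \<odot>\<^bsub>M\<^esub> x : N" "x : N ==> y : N ==> x \<ominus>\<^bsub>M\<^esub> y : N"
proof -
 note E = submoduleE[OF assms]
 show 1: "x : N ==> x : carrier M" for x using E(1) by blast
 obtain z where z: "z : N" using E(2) by blast
 have "\<zero>\<^bsub>M\<^esub> = \<zero> \<odot>\<^bsub>M\<^esub> z" using 1[OF z] by simp
 thus "\<zero>\<^bsub>M\<^esub> : N" using E(4)[OF R.zero_closed z] by simp
 show 3: "x : N ==> y : N ==> x \<oplus>\<^bsub>M\<^esub> y : N" for x y by (rule E(5))
 show 4: "x : N ==> \<ominus>\<^bsub>M\<^esub> x : N" for x by (rule E(3))
 show "a : RR ==> x : N ==> a \<odot>\<^bsub>M\<^esub> x : N" for a x by (rule E(4))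
 show "x : N ==> y : N ==> x \<ominus>\<^bsub>M\<^esub> y : N" for x y unfolding a_minus_def by (rule 3[OF _ 4])
qed

lemma subI:
 assumes "N <= carrier M" "\<zero>\<^bsub>M\<^esub> : N" "!!x y. x : N ==> y : N ==> x \<oplus>\<^bsub>M\<^esub> y : N"
  "!!a x. a : RR ==> x : N ==> a \<odot>\<^bsub>M\<^esub> x : N"
 shows "submodule N R M"
proof (rule submoduleI)
 fix x assume x: "x : N"
 have "(\<ominus> \<one>) \<odot>\<^bsub>M\<^esub> x = \<ominus>\<^bsub>M\<^esub> x" using x assms(1) smult_l_minus[of \<one> x] by auto
 thus "\<ominus>\<^bsub>M\<^esub> x : N" using assms(4)[of "\<ominus> \<one>" x] x by simp
qed (use assms in auto)

lemma sub_finsum: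
 assumes "submodule N R M" "finite A" "!!i. i : A ==> f i : N"
 shows "(\<Oplus>\<^bsub>M\<^esub>i\<in>A. f i) : N"
 using assms(2,3)
proof (induction A rule: finite_induct)
 case (insert i A)
 have "(\<Oplus>\<^bsub>M\<^esub>i\<in>insert i A. f i) = f i \<oplus>\<^bsub>M\<^esub> (\<Oplus>\<^bsub>M\<^esub>i\<in>A. f i)"
  by (rule M.finsum_insert) (use insert sub_simps(1)[OF assms(1)] in auto)
 thus ?case using insert sub_simps(3)[OF assms(1)] by simp
qed (simp add: sub_simps(2)[OF assms(1)])

text \<open>The module axioms pass along a surjection that respects the operations; quotients and
  the fiber module get theirs in this way.\<close>

lemma module_image:
 assumes im: "h ` carrier M = carrier Q" and z: "h \<zero>\<^bsub>M\<^esub> = \<zero>\<^bsub>Q\<^esub>"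
  and add: "!!x y. x : carrier M ==> y : carrier M ==> h (x \<oplus>\<^bsub>M\<^esub> y) = h x \<oplus>\<^bsub>Q\<^esub> h y"
  and sm: "!!a x. a : RR ==> x : carrier M ==> h (a \<odot>\<^bsub>M\<^esub> x) = a \<odot>\<^bsub>Q\<^esub> h x"
 shows "module R Q"
proof -
 have el: "EX x:carrier M. u = h x" if "u : carrier Q" for u using that im by blast
 have hc: "h x : carrier Q" if "x : carrier M" for x using im that by blast
 note add' = add[symmetric] and sm' = sm[symmetric]
 have ag: "abelian_group Q"
 proof (rule abelian_groupI)
  fix u v assume "u : carrier Q" "v : carrier Q"
  then obtain x y where x: "x : carrier M" "u = h x" "y : carrier M" "v = h y" using el by blast
  show "u \<oplus>\<^bsub>Q\<^esub> v : carrier Q" unfolding x add'[OF x(1,3)] by (rule hc) (use x in simp)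
  show "u \<oplus>\<^bsub>Q\<^esub> v = v \<oplus>\<^bsub>Q\<^esub> u" unfolding x add'[OF x(1,3)] add'[OF x(3,1)] using x by (simp add: M.a_comm)
  fix w assume "w : carrier Q"
  then obtain k where k: "k : carrier M" "w = h k" using el by blast
  show "u \<oplus>\<^bsub>Q\<^esub> v \<oplus>\<^bsub>Q\<^esub> w = u \<oplus>\<^bsub>Q\<^esub> (v \<oplus>\<^bsub>Q\<^esub> w)" using x k by (simp add: add' M.a_assoc)
 next
  fix u assume "u : carrier Q"
  then obtain x where x: "x : carrier M" "u = h x" using el by blast
  show "\<zero>\<^bsub>Q\<^esub> \<oplus>\<^bsub>Q\<^esub> u = u" using x by (simp add: add' z[symmetric])
  have "h (\<ominus>\<^bsub>M\<^esub> x) \<oplus>\<^bsub>Q\<^esub> u = \<zero>\<^bsub>Q\<^esub>" using x by (simp add: add' z[symmetric] M.l_neg)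
  thus "EX v:carrier Q. v \<oplus>\<^bsub>Q\<^esub> u = \<zero>\<^bsub>Q\<^esub>" using hc[of "\<ominus>\<^bsub>M\<^esub> x"] x by blast
 qed (use hc[of "\<zero>\<^bsub>M\<^esub>"] z in simp)
 show ?thesis
 proof (rule moduleI[OF R_cring ag])
  fix a u assume a: "a : RR" "u : carrier Q"
  then obtain x where x: "x : carrier M" "u = h x" using el by blast
  show "a \<odot>\<^bsub>Q\<^esub> u : carrier Q" using hc[of "a \<odot>\<^bsub>M\<^esub> x"] a x by (simp add: sm')
  fix v assume "v : carrier Q"
  then obtain y where y: "y : carrier M" "v = h y" using el by blast
  show "a \<odot>\<^bsub>Q\<^esub> (u \<oplus>\<^bsub>Q\<^esub> v) = a \<odot>\<^bsub>Q\<^esub> u \<oplus>\<^bsub>Q\<^esub> a \<odot>\<^bsub>Q\<^esub> v" using a x y by (simp add: sm' add' smult_r_distr)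
 next
  fix a b u assume a: "a : RR" "b : RR" "u : carrier Q"
  then obtain x where x: "x : carrier M" "u = h x" using el by blast
  show "(a \<oplus> b) \<odot>\<^bsub>Q\<^esub> u = a \<odot>\<^bsub>Q\<^esub> u \<oplus>\<^bsub>Q\<^esub> b \<odot>\<^bsub>Q\<^esub> u" using a x by (simp add: sm' add' smult_l_distr)
  show "(a \<otimes> b) \<odot>\<^bsub>Q\<^esub> u = a \<odot>\<^bsub>Q\<^esub> (b \<odot>\<^bsub>Q\<^esub> u)" using a x by (simp add: sm' smult_assoc1)
 next
  fix u assume "u : carrier Q"
  then obtain x where x: "x : carrier M" "u = h x" using el by blast
  show "\<one> \<odot>\<^bsub>Q\<^esub> u = u" using x by (simp add: sm')
 qed
qed

lemma qcos_mem: "z : N +>\<^bsub>M\<^esub> x \<longleftrightarrow> (EX n:N. z = n \<oplus>\<^bsub>M\<^esub> x)"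
 by (auto simp: a_r_coset_def')

lemma qcos_self: "submodule N R M ==> x : carrier M ==> x : N +>\<^bsub>M\<^esub> x"
 unfolding qcos_mem using sub_simps(2)[of N] M.l_zero[of x] by metis

lemma qcos_eq_iff:
 assumes N: "submodule N R M" and x: "x : carrier M" and y: "y : carrier M"
 shows "N +>\<^bsub>M\<^esub> x = N +>\<^bsub>M\<^esub> y \<longleftrightarrow> x \<ominus>\<^bsub>M\<^esub> y : N"
proof
 assume "N +>\<^bsub>M\<^esub> x = N +>\<^bsub>M\<^esub> y"
 then obtain n where n: "n : N" "x = n \<oplus>\<^bsub>M\<^esub> y" using qcos_self[OF N x] qcos_mem by metis
 hence "x \<ominus>\<^bsub>M\<^esub> y = n" using sub_simps(1)[OF N n(1)] y by (simp add: a_minus_def M.a_assoc M.r_neg)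
 thus "x \<ominus>\<^bsub>M\<^esub> y : N" using n by simp
next
 assume d: "x \<ominus>\<^bsub>M\<^esub> y : N"
 have 1: "N +>\<^bsub>M\<^esub> x <= N +>\<^bsub>M\<^esub> y" if d: "x \<ominus>\<^bsub>M\<^esub> y : N" "x : carrier M" "y : carrier M" for x y
 proof
  fix z assume "z : N +>\<^bsub>M\<^esub> x"
  then obtain n where n: "n : N" "z = n \<oplus>\<^bsub>M\<^esub> x" using qcos_mem by metis
  have "z = (n \<oplus>\<^bsub>M\<^esub> (x \<ominus>\<^bsub>M\<^esub> y)) \<oplus>\<^bsub>M\<^esub> y"
   using n sub_simps(1)[OF N n(1)] d(2,3) by (simp add: a_minus_def M.a_assoc M.l_neg)
  moreover have "n \<oplus>\<^bsub>M\<^esub> (x \<ominus>\<^bsub>M\<^esub> y) : N" using sub_simps(3)[OF N] n d by blast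
  ultimately show "z : N +>\<^bsub>M\<^esub> y" using qcos_mem by metis
 qed
 have "\<ominus>\<^bsub>M\<^esub> (x \<ominus>\<^bsub>M\<^esub> y) = y \<ominus>\<^bsub>M\<^esub> x" using x y by (simp add: a_minus_def M.minus_add M.a_comm)
 thus "N +>\<^bsub>M\<^esub> x = N +>\<^bsub>M\<^esub> y" using 1[OF d x y] 1[of y x] x y sub_simps(4)[OF N d] by auto
qed

lemma qcos_zero: "submodule N R M ==> N +>\<^bsub>M\<^esub> \<zero>\<^bsub>M\<^esub> = N"
 unfolding a_r_coset_def' using sub_simps(1)[of N] by force

lemma quot_carrier: "carrier (quot_module M N) = (%x. N +>\<^bsub>M\<^esub> x) ` carrier M"
 by (auto simp: quot_module_def A_RCOSETS_def')

lemma quot_zero: "\<zero>\<^bsub>quot_module M N\<^esub> = N"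
 by (simp add: quot_module_def)

lemma quot_add:
 assumes N: "submodule N R M" and x: "x : carrier M" and y: "y : carrier M"
 shows "(N +>\<^bsub>M\<^esub> x) \<oplus>\<^bsub>quot_module M N\<^esub> (N +>\<^bsub>M\<^esub> y) = N +>\<^bsub>M\<^esub> (x \<oplus>\<^bsub>M\<^esub> y)"
proof -
 have "z : set_add M (N +>\<^bsub>M\<^esub> x) (N +>\<^bsub>M\<^esub> y) \<longleftrightarrow> z : N +>\<^bsub>M\<^esub> (x \<oplus>\<^bsub>M\<^esub> y)" for z
 proof
  assume "z : set_add M (N +>\<^bsub>M\<^esub> x) (N +>\<^bsub>M\<^esub> y)"
  then obtain n n' where n: "n : N" "n' : N" "z = (n \<oplus>\<^bsub>M\<^esub> x) \<oplus>\<^bsub>M\<^esub> (n' \<oplus>\<^bsub>M\<^esub> y)" by (auto simp: set_add_def' qcos_mem)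
  hence "z = (n \<oplus>\<^bsub>M\<^esub> n') \<oplus>\<^bsub>M\<^esub> (x \<oplus>\<^bsub>M\<^esub> y)" using sub_simps(1)[OF N] x y by (simp add: M.a_ac)
  thus "z : N +>\<^bsub>M\<^esub> (x \<oplus>\<^bsub>M\<^esub> y)" using sub_simps(3)[OF N n(1,2)] qcos_mem by metis
 next
  assume "z : N +>\<^bsub>M\<^esub> (x \<oplus>\<^bsub>M\<^esub> y)"
  then obtain n where n: "n : N" "z = n \<oplus>\<^bsub>M\<^esub> (x \<oplus>\<^bsub>M\<^esub> y)" using qcos_mem by metis
  hence "z = (n \<oplus>\<^bsub>M\<^esub> x) \<oplus>\<^bsub>M\<^esub> y" using sub_simps(1)[OF N n(1)] x y by (simp add: M.a_ac)
  moreover have "n \<oplus>\<^bsub>M\<^esub> x : N +>\<^bsub>M\<^esub> x" using n qcos_mem by metis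
  ultimately show "z : set_add M (N +>\<^bsub>M\<^esub> x) (N +>\<^bsub>M\<^esub> y)" using qcos_self[OF N y] unfolding set_add_def' by blast
 qed
 thus ?thesis by (auto simp: quot_module_def)
qed

lemma quot_coset_smult:
 assumes N: "submodule N R M" and a: "a : RR" and x: "x : carrier M"
 shows "coset_smult M N a (N +>\<^bsub>M\<^esub> x) = N +>\<^bsub>M\<^esub> (a \<odot>\<^bsub>M\<^esub> x)"
proof -
 have "N +>\<^bsub>M\<^esub> (a \<odot>\<^bsub>M\<^esub> z) = N +>\<^bsub>M\<^esub> (a \<odot>\<^bsub>M\<^esub> x)" if z: "z : N +>\<^bsub>M\<^esub> x" for z
 proof -
  obtain n where n: "n : N" "z = n \<oplus>\<^bsub>M\<^esub> x" using z qcos_mem by metis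
  have nc: "n : carrier M" using sub_simps(1)[OF N n(1)] .
  have "a \<odot>\<^bsub>M\<^esub> z \<ominus>\<^bsub>M\<^esub> a \<odot>\<^bsub>M\<^esub> x = a \<odot>\<^bsub>M\<^esub> n" unfolding n(2)
   using a nc x by (simp add: smult_r_distr a_minus_def M.a_assoc M.r_neg)
  thus ?thesis using qcos_eq_iff[OF N, of "a \<odot>\<^bsub>M\<^esub> z" "a \<odot>\<^bsub>M\<^esub> x"] sub_simps(5)[OF N a n(1)] a nc x n(2) by simp
 qed
 thus ?thesis unfolding coset_smult_def using qcos_self[OF N x] by blast
qed

lemma quot_smult:
 assumes "submodule N R M" "a : RR" "x : carrier M"
 shows "a \<odot>\<^bsub>quot_module M N\<^esub> (N +>\<^bsub>M\<^esub> x) = N +>\<^bsub>M\<^esub> (a \<odot>\<^bsub>M\<^esub> x)"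
 using quot_coset_smult[OF assms] by (simp add: quot_module_def)

lemma quot_is_module: "submodule N R M ==> module R (quot_module M N)"
 by (rule module_image[of "%x. N +>\<^bsub>M\<^esub> x"]) (simp_all add: quot_carrier qcos_zero quot_zero quot_add quot_smult)

lemma quot_finsum:
 assumes N: "submodule N R M" and A: "finite A" "!!i. i : A ==> f i : carrier M"
 shows "(\<Oplus>\<^bsub>quot_module M N\<^esub>i\<in>A. N +>\<^bsub>M\<^esub> f i) = N +>\<^bsub>M\<^esub> (\<Oplus>\<^bsub>M\<^esub>i\<in>A. f i)"
 by (rule finsum_hom[OF M_group module.M_group[OF quot_is_module[OF N]] _ _ A, symmetric])
  (simp_all add: quot_carrier quot_add[OF N])

lemma span_submodule: assumes "S <= carrier M" shows "submodule (module_span R M S) R M"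
proof (rule subI)
 have "submodule (carrier M) R M" by (rule carrier_is_submodule)
 thus "module_span R M S <= carrier M" using assms unfolding module_span_def by blast
qed (auto simp: module_span_def sub_simps)

lemma span_sub: "S <= module_span R M S"
 unfolding module_span_def by blast

lemma span_least: "submodule H R M ==> S <= H ==> module_span R M S <= H"
 unfolding module_span_def by blast

lemma restrict_module: "submodule N R M ==> module R (M\<lparr>carrier := N\<rparr>)"
 by (rule submodule.submodule_is_module) (auto intro: module_axioms)

end

text \<open>The linear map out of a free module that sends the basis element of \<open>x\<close> to
  \<open>v x\<close>; \<open>lincomb\<close> is the case in which \<open>v\<close> is the
  identity.\<close>

definition lift :: "('a, 'r) ring_scheme => ('a, 'b, 's) module_scheme => ('x => 'b) => ('x => 'a) => 'b"
 where "lift R Q v f = (\<Oplus>\<^bsub>Q\<^esub>x\<in>{x. f x ~= \<zero>\<^bsub>R\<^esub>}. f x \<odot>\<^bsub>Q\<^esub> v x)"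

lemma lincomb_lift: "lincomb R M = lift R M (%x. x)"
 by (intro ext) (simp add: lincomb_def lift_def)

context cring
begin

lemma free_carrier: "f : carrier (free_on R X) \<longleftrightarrow> (ALL x. f x : RR) & {x. f x ~= \<zero>} <= X & finite {x. f x ~= \<zero>}"
 using zero_closed unfolding free_on_def by (simp, intro iffI conjI; auto)

lemma free_simps [simp]: "\<zero>\<^bsub>free_on R X\<^esub> = (%x. \<zero>)" "f \<oplus>\<^bsub>free_on R X\<^esub> g = (%x. f x \<oplus> g x)" "a \<odot>\<^bsub>free_on R X\<^esub> f = (%x. a \<otimes> f x)"
 by (simp_all add: free_on_def)

lemma free_supp: "finite {x. f x ~= \<zero>} ==> finite {x. g x ~= \<zero>} ==> finite {x. f x \<oplus> g x ~= \<zero>}"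
 by (rule finite_subset[of _ "{x. f x ~= \<zero>} Un {x. g x ~= \<zero>}"]) auto

lemma free_closed:
 "f : carrier (free_on R X) ==> g : carrier (free_on R X) ==> (%x. f x \<oplus> g x) : carrier (free_on R X)"
 "a : RR ==> f : carrier (free_on R X) ==> (%x. a \<otimes> f x) : carrier (free_on R X)"
 "(%x. \<zero>) : carrier (free_on R X)"
proof -
 assume fg: "f : carrier (free_on R X)" "g : carrier (free_on R X)"
 have "{x. f x \<oplus> g x ~= \<zero>} <= {x. f x ~= \<zero>} Un {x. g x ~= \<zero>}" by auto
 thus "(%x. f x \<oplus> g x) : carrier (free_on R X)" using fg free_supp[of f g] unfolding free_carrier by blast
next
 assume fg: "a : RR" "f : carrier (free_on R X)"
 hence "{x. a \<otimes> f x ~= \<zero>} <= {x. f x ~= \<zero>}" by auto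
 thus "(%x. a \<otimes> f x) : carrier (free_on R X)" using fg finite_subset unfolding free_carrier by auto
qed (simp add: free_carrier)

lemma free_carr: "f : carrier (free_on R X) ==> f x : RR"
 by (simp add: free_carrier)

lemma free_module: "module R (free_on R X)"
proof (rule moduleI[OF is_cring])
 show "abelian_group (free_on R X)"
 proof (rule abelian_groupI)
  fix f assume f: "f : carrier (free_on R X)"
  have "(%x. \<ominus> f x) : carrier (free_on R X)" using f unfolding free_carrier by simp
  moreover have "(%x. \<ominus> f x) \<oplus>\<^bsub>free_on R X\<^esub> f = \<zero>\<^bsub>free_on R X\<^esub>" using free_carr[OF f] by (auto simp: l_neg)
  ultimately show "EX g:carrier (free_on R X). g \<oplus>\<^bsub>free_on R X\<^esub> f = \<zero>\<^bsub>free_on R X\<^esub>" by blast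
 qed (auto simp: free_closed free_carr a_ac)
qed (auto simp: free_closed free_carr l_distr r_distr m_assoc)

lemma free_gen_carrier: "x : X ==> free_gen R x : carrier (free_on R X)"
 unfolding free_carrier free_gen_def by (auto intro: finite_subset[of _ "{x}"])

lemma lift_superset:
 assumes Q: "module R Q" and v: "!!x. x : X ==> v x : carrier Q" and f: "f : carrier (free_on R X)"
  and A: "finite A" "{x. f x ~= \<zero>} <= A" "A <= X"
 shows "lift R Q v f = (\<Oplus>\<^bsub>Q\<^esub>x\<in>A. f x \<odot>\<^bsub>Q\<^esub> v x)"
proof -
 interpret Q: module R Q by fact
 show ?thesis unfolding lift_def
 proof (rule Q.M.add.finprod_mono_neutral_cong_left[OF A(1,2)])
  show "!!i. i : A - {x. f x ~= \<zero>} ==> f i \<odot>\<^bsub>Q\<^esub> v i = \<zero>\<^bsub>Q\<^esub>" using v A(3) by auto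
 qed (use v A(3) free_carr[OF f] in auto)
qed

lemma lift_linear:
 assumes Q: "module R Q" and v: "!!x. x : X ==> v x : carrier Q" and f: "f : carrier (free_on R X)"
 shows lift_closed: "lift R Q v f : carrier Q"
  and lift_add: "g : carrier (free_on R X) ==> lift R Q v (%x. f x \<oplus> g x) = lift R Q v f \<oplus>\<^bsub>Q\<^esub> lift R Q v g"
  and lift_smult: "a : RR ==> lift R Q v (%x. a \<otimes> f x) = a \<odot>\<^bsub>Q\<^esub> lift R Q v f"
proof -
 interpret Q: module R Q by fact
 let ?S = "%f. {x. f x ~= \<zero>}"
 have fc: "f x : RR" for x using free_carr[OF f] .
 have S: "?S f <= X" "finite (?S f)" using f unfolding free_carrier by auto
 show "lift R Q v f : carrier Q" unfolding lift_def
  by (rule Q.M.finsum_closed) (use S v fc in auto)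
 show "lift R Q v (%x. f x \<oplus> g x) = lift R Q v f \<oplus>\<^bsub>Q\<^esub> lift R Q v g" if g: "g : carrier (free_on R X)"
 proof -
  let ?A = "?S f Un ?S g"
  have gc: "g x : RR" for x using free_carr[OF g] .
  have A: "finite ?A" "?A <= X" using f g unfolding free_carrier by auto
  have "lift R Q v (%x. f x \<oplus> g x) = (\<Oplus>\<^bsub>Q\<^esub>x\<in>?A. (f x \<oplus> g x) \<odot>\<^bsub>Q\<^esub> v x)"
   by (rule lift_superset[OF Q v free_closed(1)[OF f g] A(1) _ A(2)]) auto
  also have "... = (\<Oplus>\<^bsub>Q\<^esub>x\<in>?A. f x \<odot>\<^bsub>Q\<^esub> v x \<oplus>\<^bsub>Q\<^esub> g x \<odot>\<^bsub>Q\<^esub> v x)"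
   by (rule Q.M.finsum_cong') (use A(2) v fc gc in \<open>auto intro!: Q.smult_l_distr\<close>)
  also have "... = (\<Oplus>\<^bsub>Q\<^esub>x\<in>?A. f x \<odot>\<^bsub>Q\<^esub> v x) \<oplus>\<^bsub>Q\<^esub> (\<Oplus>\<^bsub>Q\<^esub>x\<in>?A. g x \<odot>\<^bsub>Q\<^esub> v x)"
   by (rule Q.M.finsum_addf) (use A(2) v fc gc in auto)
  also have "(\<Oplus>\<^bsub>Q\<^esub>x\<in>?A. f x \<odot>\<^bsub>Q\<^esub> v x) = lift R Q v f" by (rule lift_superset[OF Q v f A(1) _ A(2), symmetric]) auto
  also have "(\<Oplus>\<^bsub>Q\<^esub>x\<in>?A. g x \<odot>\<^bsub>Q\<^esub> v x) = lift R Q v g" by (rule lift_superset[OF Q v g A(1) _ A(2), symmetric]) auto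
  finally show ?thesis .
 qed
 show "lift R Q v (%x. a \<otimes> f x) = a \<odot>\<^bsub>Q\<^esub> lift R Q v f" if a: "a : RR"
 proof -
  have "lift R Q v (%x. a \<otimes> f x) = (\<Oplus>\<^bsub>Q\<^esub>x\<in>?S f. (a \<otimes> f x) \<odot>\<^bsub>Q\<^esub> v x)"
   by (rule lift_superset[OF Q v free_closed(2)[OF a f] S(2) _ S(1)]) (use a in auto)
  also have "... = (\<Oplus>\<^bsub>Q\<^esub>x\<in>?S f. a \<odot>\<^bsub>Q\<^esub> (f x \<odot>\<^bsub>Q\<^esub> v x))"
   by (rule Q.M.finsum_cong') (use S v fc a in \<open>auto intro!: Q.smult_assoc1\<close>)
  also have "... = a \<odot>\<^bsub>Q\<^esub> lift R Q v f" unfolding lift_def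
   by (rule Q.finsum_smult_ldistr[symmetric]) (use S v fc a in auto)
  finally show ?thesis .
 qed
qed

lemma lift_gen:
 assumes Q: "module R Q" and v: "v x : carrier Q"
 shows "lift R Q v (free_gen R x) = v x"
proof -
 interpret Q: module R Q by fact
 have "lift R Q v (free_gen R x) = (\<Oplus>\<^bsub>Q\<^esub>y\<in>{x}. free_gen R x y \<odot>\<^bsub>Q\<^esub> v y)"
  by (rule lift_superset[OF Q, of "{x}"]) (use v free_gen_carrier[of x "{x}"] in \<open>auto simp: free_gen_def\<close>)
 thus ?thesis using v by (simp add: free_gen_def Q.M.finsum_insert)
qed

lemma lift_minus:
 assumes Q: "module R Q" and v: "!!x. x : X ==> v x : carrier Q"
  and f: "f : carrier (free_on R X)" and g: "g : carrier (free_on R X)"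
 shows "lift R Q v (f \<ominus>\<^bsub>free_on R X\<^esub> g) = lift R Q v f \<ominus>\<^bsub>Q\<^esub> lift R Q v g"
proof -
 interpret Q: module R Q by fact
 interpret F: module R "free_on R X" by (rule free_module)
 have m: "\<ominus>\<^bsub>free_on R X\<^esub> g = (%x. \<ominus> \<one> \<otimes> g x)" using F.smult_l_minus[OF one_closed g] F.smult_one[OF g] by simp
 have c: "(%x. \<ominus> \<one> \<otimes> g x) : carrier (free_on R X)" by (rule free_closed(2)) (use g in auto)
 have "lift R Q v (f \<ominus>\<^bsub>free_on R X\<^esub> g) = lift R Q v f \<oplus>\<^bsub>Q\<^esub> lift R Q v (%x. \<ominus> \<one> \<otimes> g x)"
  unfolding a_minus_def m free_simps by (rule lift_add[OF Q v f c])
 also have "lift R Q v (%x. \<ominus> \<one> \<otimes> g x) = (\<ominus> \<one>) \<odot>\<^bsub>Q\<^esub> lift R Q v g" by (rule lift_smult[OF Q v g]) auto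
 also have "... = \<ominus>\<^bsub>Q\<^esub> lift R Q v g" using Q.smult_l_minus[OF one_closed] lift_closed[OF Q v g] by simp
 finally show ?thesis by (simp add: a_minus_def)
qed

end

section \<open>Homomorphisms, tensor products and length\<close>

definition mhom :: "('a, 'r) ring_scheme => ('a, 'b, 's) module_scheme => ('a, 'c, 't) module_scheme => ('b => 'c) => bool"
 where "mhom R M Q h \<longleftrightarrow> (ALL x:carrier M. h x : carrier Q) &
  (ALL x:carrier M. ALL y:carrier M. h (x \<oplus>\<^bsub>M\<^esub> y) = h x \<oplus>\<^bsub>Q\<^esub> h y) &
  (ALL a:carrier R. ALL x:carrier M. h (a \<odot>\<^bsub>M\<^esub> x) = a \<odot>\<^bsub>Q\<^esub> h x)"

lemma mhomD:
 assumes "mhom R M Q h"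
 shows "x : carrier M ==> h x : carrier Q" "x : carrier M ==> y : carrier M ==> h (x \<oplus>\<^bsub>M\<^esub> y) = h x \<oplus>\<^bsub>Q\<^esub> h y"
  "a : carrier R ==> x : carrier M ==> h (a \<odot>\<^bsub>M\<^esub> x) = a \<odot>\<^bsub>Q\<^esub> h x"
 using assms unfolding mhom_def by auto

context cring
begin

lemma mhom_zero:
 assumes "module R M" "module R Q" "mhom R M Q h" shows "h \<zero>\<^bsub>M\<^esub> = \<zero>\<^bsub>Q\<^esub>"
proof -
 interpret M: module R M by fact
 interpret Q: module R Q by fact
 have "h (\<zero> \<odot>\<^bsub>M\<^esub> \<zero>\<^bsub>M\<^esub>) = \<zero> \<odot>\<^bsub>Q\<^esub> h \<zero>\<^bsub>M\<^esub>" by (rule mhomD(3)[OF assms(3)]) simp_all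
 thus ?thesis using mhomD(1)[OF assms(3), of "\<zero>\<^bsub>M\<^esub>"] by simp
qed

lemma mhom_image:
 assumes M: "module R M" and Q: "module R Q" and h: "mhom R M Q h" and N: "submodule N R M"
 shows "submodule (h ` N) R Q"
proof -
 interpret M: module R M by fact
 interpret Q: module R Q by fact
 note s = M.sub_simps[OF N] and hD = mhomD[OF h]
 show ?thesis
 proof (rule Q.subI)
  show "h ` N <= carrier Q" using s(1) hD(1) by blast
  show "\<zero>\<^bsub>Q\<^esub> : h ` N" using mhom_zero[OF M Q h] s(2) by force
  fix x assume "x : h ` N"
  then obtain u where u: "u : N" "x = h u" by blast
  show "a \<odot>\<^bsub>Q\<^esub> x : h ` N" if "a : RR" for a using hD(3)[OF that s(1)[OF u(1)]] s(5)[OF that u(1)] u(2) by force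
  fix y assume "y : h ` N"
  then obtain v where v: "v : N" "y = h v" by blast
  show "x \<oplus>\<^bsub>Q\<^esub> y : h ` N" using hD(2)[OF s(1)[OF u(1)] s(1)[OF v(1)]] s(3)[OF u(1) v(1)] u(2) v(2) by force
 qed
qed

lemma mhom_preimage:
 assumes M: "module R M" and Q: "module R Q" and h: "mhom R M Q h" and N: "submodule N R Q"
 shows "submodule {x : carrier M. h x : N} R M"
proof -
 interpret M: module R M by fact
 interpret Q: module R Q by fact
 note s = Q.sub_simps[OF N] and hD = mhomD[OF h]
 show ?thesis
  by (rule M.subI) (use hD s mhom_zero[OF M Q h] in auto)
qed

lemma zero_submodule: "module R Q ==> submodule {\<zero>\<^bsub>Q\<^esub>} R Q"
proof -
 assume "module R Q"
 then interpret Q: module R Q .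
 show ?thesis by (rule Q.subI) auto
qed

lemma mhom_lift: "module R Q ==> (!!x. x : X ==> v x : carrier Q) ==> mhom R (free_on R X) Q (lift R Q v)"
 unfolding mhom_def using lift_linear[of Q X v] by simp

lemma mhom_restrict: "submodule N R M ==> module R M ==> mhom R M Q h ==> mhom R (M\<lparr>carrier := N\<rparr>) Q h"
 using module.sub_simps(1)[of R M N] unfolding mhom_def by simp

lemma mhom_coset: "module R M ==> submodule N R M ==> mhom R M (quot_module M N) (%x. N +>\<^bsub>M\<^esub> x)"
 unfolding mhom_def by (simp add: module.quot_carrier module.quot_add module.quot_smult)

lemma lift_mhom:
 assumes Q: "module R Q" "module R Q'" and h: "mhom R Q Q' h"
  and v: "!!x. x : X ==> v x : carrier Q" and f: "f : carrier (free_on R X)"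
 shows "h (lift R Q v f) = lift R Q' (%x. h (v x)) f"
proof -
 interpret Q: module R Q by fact
 interpret Q': module R Q' by fact
 have S: "finite {x. f x ~= \<zero>}" "{x. f x ~= \<zero>} <= X" using f unfolding free_carrier by auto
 note fc = free_carr[OF f]
 have c: "f i \<odot>\<^bsub>Q\<^esub> v i : carrier Q" if "i : {x. f x ~= \<zero>}" for i using fc v that S by auto
 have "h (lift R Q v f) = (\<Oplus>\<^bsub>Q'\<^esub>x\<in>{x. f x ~= \<zero>}. h (f x \<odot>\<^bsub>Q\<^esub> v x))"
  unfolding lift_def by (rule finsum_hom[OF Q.M_group Q'.M_group mhomD(1,2)[OF h] S(1) c])
 also have "... = lift R Q' (%x. h (v x)) f" unfolding lift_def
  by (rule Q'.M.finsum_cong') (use S v fc mhomD[OF h] in auto)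
 finally show ?thesis .
qed

lemma lift_null:
 assumes Q: "module R Q" and v: "!!x. x : X ==> v x = \<zero>\<^bsub>Q\<^esub>" and f: "f : carrier (free_on R X)"
 shows "lift R Q v f = \<zero>\<^bsub>Q\<^esub>"
proof -
 interpret Q: module R Q by fact
 have "lift R Q v f = (\<Oplus>\<^bsub>Q\<^esub>x\<in>{x. f x ~= \<zero>}. \<zero>\<^bsub>Q\<^esub>)" unfolding lift_def
  by (rule Q.M.finsum_cong') (use v f in \<open>auto simp: free_carrier\<close>)
 thus ?thesis by simp
qed

lemma length_ge:
 assumes "!!i. i <= n ==> submodule (C i) R Q" "!!i. i < n ==> C i \<subset> C (Suc i)"
 shows "enat n <= module_length R Q"
 unfolding module_length_def by (rule Sup_upper) (use assms in blast)

text \<open>A map that kills \<open>B\<close> factors through the quotient of \<open>V\<close> by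
  \<open>B\<close>. The preimages of a chain in the target form a chain there, made strict by the
  witnesses \<open>z i\<close>.\<close>

lemma length_quot_ge:
 assumes V: "module R V" and B: "submodule B R V" and Q: "module R Q"
  and \<Theta>: "mhom R V Q \<Theta>" "!!b. b : B ==> \<Theta> b = \<zero>\<^bsub>Q\<^esub>"
  and E: "!!i. i <= n ==> submodule (E i) R Q" "!!i. i < n ==> E i <= E (Suc i)"
  and z: "!!i. i < n ==> z i : carrier V" "!!i. i < n ==> \<Theta> (z i) : E (Suc i)" "!!i. i < n ==> \<Theta> (z i) ~: E i"
 shows "enat n <= module_length R (quot_module V B)"
proof -
 interpret V: module R V by fact
 interpret Q: module R Q by fact
 let ?W = "quot_module V B"
 have W: "module R ?W" by (rule V.quot_is_module[OF B])
 define U where "U i = {x : carrier V. \<Theta> x : E i}" for i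
 have U: "submodule (U i) R V" if "i <= n" for i unfolding U_def by (rule mhom_preimage[OF V Q \<Theta>(1) E(1)[OF that]])
 show ?thesis
 proof (rule length_ge[of n "%i. (%x. B +>\<^bsub>V\<^esub> x) ` U i"])
  show "submodule ((%x. B +>\<^bsub>V\<^esub> x) ` U i) R ?W" if "i <= n" for i
   by (rule mhom_image[OF V W mhom_coset[OF V B] U[OF that]])
  fix i assume i: "i < n"
  have "U i <= U (Suc i)" using E(2)[OF i] unfolding U_def by blast
  moreover have "B +>\<^bsub>V\<^esub> z i : (%x. B +>\<^bsub>V\<^esub> x) ` U (Suc i)" using z(1,2)[OF i] unfolding U_def by blast
  moreover have "B +>\<^bsub>V\<^esub> z i ~: (%x. B +>\<^bsub>V\<^esub> x) ` U i"
  proof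
   assume "B +>\<^bsub>V\<^esub> z i : (%x. B +>\<^bsub>V\<^esub> x) ` U i"
   then obtain x where x: "x : carrier V" "\<Theta> x : E i" "B +>\<^bsub>V\<^esub> z i = B +>\<^bsub>V\<^esub> x" unfolding U_def by blast
   obtain b where b: "b : B" "z i = b \<oplus>\<^bsub>V\<^esub> x" using V.qcos_self[OF B z(1)[OF i]] x(3) V.qcos_mem by metis
   have "\<Theta> (z i) = \<Theta> b \<oplus>\<^bsub>Q\<^esub> \<Theta> x" unfolding b(2) by (rule mhomD(2)[OF \<Theta>(1) V.sub_simps(1)[OF B b(1)] x(1)])
   also have "... = \<Theta> x" using \<Theta>(2)[OF b(1)] mhomD(1)[OF \<Theta>(1) x(1)] by simp
   finally show False using z(3)[OF i] x(2) by simp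
  qed
  ultimately show "(%x. B +>\<^bsub>V\<^esub> x) ` U i \<subset> (%x. B +>\<^bsub>V\<^esub> x) ` U (Suc i)" by blast
 qed
qed

end

definition bilin :: "('a, 'r) ring_scheme => ('a, 'b, 's) module_scheme => ('a, 'c, 't) module_scheme => ('a, 'd, 'u) module_scheme => ('b \<times> 'c => 'd) => bool"
 where "bilin R M N Q v \<longleftrightarrow> (ALL p:carrier M \<times> carrier N. v p : carrier Q) &
  (ALL x:carrier M. ALL x':carrier M. ALL y:carrier N. v (x \<oplus>\<^bsub>M\<^esub> x', y) = v (x, y) \<oplus>\<^bsub>Q\<^esub> v (x', y)) &
  (ALL x:carrier M. ALL y:carrier N. ALL y':carrier N. v (x, y \<oplus>\<^bsub>N\<^esub> y') = v (x, y) \<oplus>\<^bsub>Q\<^esub> v (x, y')) &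
  (ALL a:carrier R. ALL x:carrier M. ALL y:carrier N. v (a \<odot>\<^bsub>M\<^esub> x, y) = a \<odot>\<^bsub>Q\<^esub> v (x, y)) &
  (ALL a:carrier R. ALL x:carrier M. ALL y:carrier N. v (x, a \<odot>\<^bsub>N\<^esub> y) = a \<odot>\<^bsub>Q\<^esub> v (x, y))"

locale two_modules = M: module R M + N: module R N
 for R :: "('a, 'r) ring_scheme" and M :: "('a, 'b, 's) module_scheme" and N :: "('a, 'c, 't) module_scheme"
begin

abbreviation "TF \<equiv> free_on R (carrier M \<times> carrier N)"
abbreviation "TK \<equiv> tensor_kernel R M N"
abbreviation "TT \<equiv> tensor R M N"
abbreviation "pt \<equiv> pure_tensor R M N"

sublocale TF: module R TF by (rule M.R.free_module)

lemma gen_closed: "x : carrier M ==> y : carrier N ==> free_gen R (x, y) : carrier TF"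
 by (rule M.R.free_gen_carrier) simp

lemma relations_closed: "tensor_relations R M N <= carrier TF"
 unfolding tensor_relations_def Let_def
 by (auto simp del: M.R.free_simps intro!: TF.M.minus_closed TF.M.add.m_closed TF.smult_closed gen_closed)

lemma TK_submodule: "submodule TK R TF"
 unfolding tensor_kernel_def by (rule TF.span_submodule[OF relations_closed])

lemma TT_quot: "TT = quot_module TF TK"
 by (simp add: tensor_def)

lemma TT_module: "module R TT"
 unfolding TT_quot by (rule TF.quot_is_module[OF TK_submodule])

lemma TT_rep: assumes "z : carrier TT" obtains f where "f : carrier TF" "z = TK +>\<^bsub>TF\<^esub> f"
 using assms unfolding TT_quot TF.quot_carrier by blast

lemma pt_coset: "pt x y = TK +>\<^bsub>TF\<^esub> free_gen R (x, y)"
 by (simp add: pure_tensor_def)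

lemma pt_bilin: "bilin R M N TT (%p. pt (fst p) (snd p))"
proof -
 have rel: "r : TK" if "r : tensor_relations R M N" for r using that TF.span_sub unfolding tensor_kernel_def by blast
 have eq: "TK +>\<^bsub>TF\<^esub> u = TK +>\<^bsub>TF\<^esub> w" if "u \<ominus>\<^bsub>TF\<^esub> w : tensor_relations R M N" "u : carrier TF" "w : carrier TF" for u w
  using TF.qcos_eq_iff[OF TK_submodule that(2,3)] rel[OF that(1)] by blast
 note add = TF.quot_add[OF TK_submodule] and sm = TF.quot_smult[OF TK_submodule]
 show ?thesis
  unfolding bilin_def
 proof (intro conjI ballI)
  fix p assume "p : carrier M \<times> carrier N"
  thus "pt (fst p) (snd p) : carrier TT" unfolding pt_coset TT_quot TF.quot_carrier using gen_closed by auto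
 next
  fix x x' y assume a: "x : carrier M" "x' : carrier M" "y : carrier N"
  show "pt (fst (x \<oplus>\<^bsub>M\<^esub> x', y)) (snd (x \<oplus>\<^bsub>M\<^esub> x', y)) = pt (fst (x, y)) (snd (x, y)) \<oplus>\<^bsub>TT\<^esub> pt (fst (x', y)) (snd (x', y))"
   unfolding pt_coset TT_quot fst_conv snd_conv add[OF gen_closed[OF a(1,3)] gen_closed[OF a(2,3)]]
   by (rule eq) (use a in \<open>auto simp del: M.R.free_simps simp: tensor_relations_def Let_def intro!: gen_closed TF.M.add.m_closed\<close>)
 next
  fix x y y' assume a: "x : carrier M" "y : carrier N" "y' : carrier N"
  show "pt (fst (x, y \<oplus>\<^bsub>N\<^esub> y')) (snd (x, y \<oplus>\<^bsub>N\<^esub> y')) = pt (fst (x, y)) (snd (x, y)) \<oplus>\<^bsub>TT\<^esub> pt (fst (x, y')) (snd (x, y'))"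
   unfolding pt_coset TT_quot fst_conv snd_conv add[OF gen_closed[OF a(1,2)] gen_closed[OF a(1,3)]]
   by (rule eq) (use a in \<open>auto simp del: M.R.free_simps simp: tensor_relations_def Let_def intro!: gen_closed TF.M.add.m_closed\<close>)
 next
  fix a x y assume a: "a : carrier R" "x : carrier M" "y : carrier N"
  show "pt (fst (a \<odot>\<^bsub>M\<^esub> x, y)) (snd (a \<odot>\<^bsub>M\<^esub> x, y)) = a \<odot>\<^bsub>TT\<^esub> pt (fst (x, y)) (snd (x, y))"
   unfolding pt_coset TT_quot fst_conv snd_conv sm[OF a(1) gen_closed[OF a(2,3)]]
   by (rule eq) (use a in \<open>auto simp del: M.R.free_simps simp: tensor_relations_def Let_def intro!: gen_closed TF.smult_closed\<close>)
  show "pt (fst (x, a \<odot>\<^bsub>N\<^esub> y)) (snd (x, a \<odot>\<^bsub>N\<^esub> y)) = a \<odot>\<^bsub>TT\<^esub> pt (fst (x, y)) (snd (x, y))"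
   unfolding pt_coset TT_quot fst_conv snd_conv sm[OF a(1) gen_closed[OF a(2,3)]]
   by (rule eq) (use a in \<open>auto simp del: M.R.free_simps simp: tensor_relations_def Let_def intro!: gen_closed TF.smult_closed\<close>)
 qed
qed

text \<open>The elements killed by \<open>lift\<close> form a submodule, and bilinearity puts the
  four kinds of tensor relations into it. This is the universal property of the tensor
  product.\<close>

lemma kernel_lift:
 assumes Q: "module R Q" and v: "bilin R M N Q v" and f: "f : TK"
 shows "lift R Q v f = \<zero>\<^bsub>Q\<^esub>"
proof -
 interpret Q: module R Q by fact
 have vc: "v p : carrier Q" if "p : carrier M \<times> carrier N" for p using v that unfolding bilin_def by blast
 let ?H = "{f : carrier TF. lift R Q v f : {\<zero>\<^bsub>Q\<^esub>}}"
 have H: "submodule ?H R TF"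
  by (rule M.R.mhom_preimage[OF M.R.free_module Q M.R.mhom_lift[OF Q vc] M.R.zero_submodule[OF Q]])
 have lg: "lift R Q v (free_gen R (x, y)) = v (x, y)" if "x : carrier M" "y : carrier N" for x y
  by (rule M.R.lift_gen[OF Q]) (use vc that in simp)
 note hm = M.R.mhom_lift[of Q "carrier M \<times> carrier N" v, OF Q vc]
 have minus: "u \<ominus>\<^bsub>TF\<^esub> w : ?H" if "u : carrier TF" "w : carrier TF" "lift R Q v u = lift R Q v w" for u w
  using M.R.lift_minus[of Q "carrier M \<times> carrier N" v, OF Q vc that(1,2)] that M.R.lift_closed[of Q "carrier M \<times> carrier N" v, OF Q vc that(2)]
   TF.M.minus_closed[OF that(1,2)] by (simp add: Q.M.r_neg a_minus_def)
 have "tensor_relations R M N <= ?H"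
 proof
  fix r assume "r : tensor_relations R M N"
  then consider (a) x x' y where "x : carrier M" "x' : carrier M" "y : carrier N"
    "r = free_gen R (x \<oplus>\<^bsub>M\<^esub> x', y) \<ominus>\<^bsub>TF\<^esub> (free_gen R (x, y) \<oplus>\<^bsub>TF\<^esub> free_gen R (x', y))"
   | (b) x y y' where "x : carrier M" "y : carrier N" "y' : carrier N"
    "r = free_gen R (x, y \<oplus>\<^bsub>N\<^esub> y') \<ominus>\<^bsub>TF\<^esub> (free_gen R (x, y) \<oplus>\<^bsub>TF\<^esub> free_gen R (x, y'))"
   | (c) a x y where "a : carrier R" "x : carrier M" "y : carrier N"
    "r = free_gen R (a \<odot>\<^bsub>M\<^esub> x, y) \<ominus>\<^bsub>TF\<^esub> (a \<odot>\<^bsub>TF\<^esub> free_gen R (x, y))"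
   | (d) a x y where "a : carrier R" "x : carrier M" "y : carrier N"
    "r = free_gen R (x, a \<odot>\<^bsub>N\<^esub> y) \<ominus>\<^bsub>TF\<^esub> (a \<odot>\<^bsub>TF\<^esub> free_gen R (x, y))"
   unfolding tensor_relations_def Let_def by (elim UnE CollectE exE conjE) metis+
  thus "r : ?H"
  proof cases
   case a
   show ?thesis unfolding a(4)
    by (rule minus) (use a v in \<open>simp_all del: M.R.free_simps add: mhomD(2)[OF hm] gen_closed lg bilin_def\<close>)
  next
   case b
   show ?thesis unfolding b(4)
    by (rule minus) (use b v in \<open>simp_all del: M.R.free_simps add: mhomD(2)[OF hm] gen_closed lg bilin_def\<close>)
  next
   case c
   show ?thesis unfolding c(4)
    by (rule minus) (use c v in \<open>simp_all del: M.R.free_simps add: mhomD(3)[OF hm] gen_closed lg bilin_def\<close>)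
  next
   case d
   show ?thesis unfolding d(4)
    by (rule minus) (use d v in \<open>simp_all del: M.R.free_simps add: mhomD(3)[OF hm] gen_closed lg bilin_def\<close>)
  qed
 qed
 thus ?thesis using TF.span_least[OF H] f unfolding tensor_kernel_def by blast
qed

lemma lift_coset_const:
 assumes Q: "module R Q" and v: "bilin R M N Q v" and f: "f : carrier TF" and g: "g : TK +>\<^bsub>TF\<^esub> f"
 shows "lift R Q v g = lift R Q v f"
proof -
 interpret Q: module R Q by fact
 have vc: "v p : carrier Q" if "p : carrier M \<times> carrier N" for p using v that unfolding bilin_def by blast
 note hm = M.R.mhom_lift[of Q "carrier M \<times> carrier N" v, OF Q vc]
 obtain k where k: "k : TK" "g = k \<oplus>\<^bsub>TF\<^esub> f" using g TF.qcos_mem by metis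
 have "lift R Q v g = lift R Q v k \<oplus>\<^bsub>Q\<^esub> lift R Q v f"
  unfolding k(2) by (rule mhomD(2)[OF hm TF.sub_simps(1)[OF TK_submodule k(1)] f])
 thus ?thesis unfolding kernel_lift[OF Q v k(1)] using mhomD(1)[OF hm f] by simp
qed

text \<open>The linear map on the tensor product induced by a bilinear \<open>v\<close>; by
  \<open>lift_coset_const\<close> the representative chosen does not matter.\<close>

definition tlift :: "('a, 'd, 'u) module_scheme => ('b \<times> 'c => 'd) => ('b \<times> 'c => 'a) set => 'd"
 where "tlift Q v Z = lift R Q v (SOME f. f : Z)"

lemma tlift_coset:
 assumes "module R Q" "bilin R M N Q v" "f : carrier TF"
 shows "tlift Q v (TK +>\<^bsub>TF\<^esub> f) = lift R Q v f"
 unfolding tlift_def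
 by (rule lift_coset_const[OF assms someI[of "%g. g : TK +>\<^bsub>TF\<^esub> f"]]) (rule TF.qcos_self[OF TK_submodule assms(3)])

lemma mhom_tlift:
 assumes Q: "module R Q" and v: "bilin R M N Q v"
 shows "mhom R TT Q (tlift Q v)"
proof -
 have vc: "v p : carrier Q" if "p : carrier M \<times> carrier N" for p using v that unfolding bilin_def by blast
 note hm = M.R.mhom_lift[of Q "carrier M \<times> carrier N" v, OF Q vc]
 note tc = tlift_coset[OF Q v]
 show ?thesis unfolding mhom_def
 proof (intro conjI ballI)
  fix z assume "z : carrier TT"
  then obtain f where f: "f : carrier TF" "z = TK +>\<^bsub>TF\<^esub> f" by (rule TT_rep)
  show "tlift Q v z : carrier Q" unfolding f(2) tc[OF f(1)] by (rule mhomD(1)[OF hm f(1)])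
  show "tlift Q v (a \<odot>\<^bsub>TT\<^esub> z) = a \<odot>\<^bsub>Q\<^esub> tlift Q v z" if a: "a : carrier R" for a
   unfolding f(2) TT_quot TF.quot_smult[OF TK_submodule a f(1)] tc[OF TF.smult_closed[OF a f(1)]] tc[OF f(1)]
   by (rule mhomD(3)[OF hm a f(1)])
  fix w assume "w : carrier TT"
  then obtain g where g: "g : carrier TF" "w = TK +>\<^bsub>TF\<^esub> g" by (rule TT_rep)
  show "tlift Q v (z \<oplus>\<^bsub>TT\<^esub> w) = tlift Q v z \<oplus>\<^bsub>Q\<^esub> tlift Q v w"
   unfolding f(2) g(2) TT_quot TF.quot_add[OF TK_submodule f(1) g(1)] tc[OF TF.M.add.m_closed[OF f(1) g(1)]] tc[OF f(1)] tc[OF g(1)]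
   by (rule mhomD(2)[OF hm f(1) g(1)])
 qed
qed

lemma tlift_pt:
 assumes Q: "module R Q" and v: "bilin R M N Q v" and "x : carrier M" "y : carrier N"
 shows "tlift Q v (pt x y) = v (x, y)"
 unfolding pt_coset tlift_coset[OF Q v gen_closed[OF assms(3,4)]]
 by (rule M.R.lift_gen[OF Q]) (use v assms(3,4) in \<open>auto simp: bilin_def\<close>)

lemma pt_zero: "y : carrier N ==> pt \<zero>\<^bsub>M\<^esub> y = \<zero>\<^bsub>TT\<^esub>" "x : carrier M ==> pt x \<zero>\<^bsub>N\<^esub> = \<zero>\<^bsub>TT\<^esub>"
proof -
 interpret T: module R TT by (rule TT_module)
 have c: "pt x y : carrier TT" if "x : carrier M" "y : carrier N" for x y
  using pt_bilin that unfolding bilin_def by auto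
 have l: "pt (a \<odot>\<^bsub>M\<^esub> x) y = a \<odot>\<^bsub>TT\<^esub> pt x y" "pt x (a \<odot>\<^bsub>N\<^esub> y) = a \<odot>\<^bsub>TT\<^esub> pt x y"
  if "a : carrier R" "x : carrier M" "y : carrier N" for a x y
  using pt_bilin that unfolding bilin_def by simp_all
 show "pt \<zero>\<^bsub>M\<^esub> y = \<zero>\<^bsub>TT\<^esub>" if y: "y : carrier N"
  using l(1)[OF M.R.zero_closed M.M.zero_closed y] T.smult_l_null[OF c[OF M.M.zero_closed y]] by simp
 show "pt x \<zero>\<^bsub>N\<^esub> = \<zero>\<^bsub>TT\<^esub>" if x: "x : carrier M"
  using l(2)[OF M.R.zero_closed x N.M.zero_closed] T.smult_l_null[OF c[OF x N.M.zero_closed]] by simp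
qed

end

text \<open>All representatives of a class contribute the same element, itself a set, so the union
  in \<open>tensor_map\<close> is that element.\<close>

lemma tensor_map_tlift:
 assumes M: "module R M" and M': "module R M'" and N: "module R N" and h: "mhom R M M' h"
 shows "bilin R M N (tensor R M' N) (%p. pure_tensor R M' N (h (fst p)) (snd p))"
  and "z : carrier (tensor R M N) ==> tensor_map R M' N h z = two_modules.tlift R (tensor R M' N) (%p. pure_tensor R M' N (h (fst p)) (snd p)) z"
proof -
 interpret M: module R M by fact
 interpret T1: two_modules R M N using M N by (rule two_modules.intro)
 interpret T2: two_modules R M' N using M' N by (rule two_modules.intro)
 let ?v = "%p. pure_tensor R M' N (h (fst p)) (snd p)"
 show b: "bilin R M N (tensor R M' N) ?v"
  using T2.pt_bilin mhomD[OF h] unfolding bilin_def by auto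
 show "tensor_map R M' N h z = T1.tlift (tensor R M' N) ?v z" if z: "z : carrier (tensor R M N)"
 proof -
  obtain f where f: "f : carrier T1.TF" "z = T1.TK +>\<^bsub>T1.TF\<^esub> f" by (rule T1.TT_rep[OF z])
  have eq: "lift R (tensor R M' N) ?v g = lift R (tensor R M' N) ?v f" if "g : z" for g
   by (rule T1.lift_coset_const[OF T2.TT_module b f(1)]) (use that f(2) in simp)
  have ne: "f : z" unfolding f(2) by (rule T1.TF.qcos_self[OF T1.TK_submodule f(1)])
  hence nz: "z ~= {}" by blast
  have "tensor_map R M' N h z = (\<Union>g\<in>z. lift R (tensor R M' N) ?v g)"
   unfolding tensor_map_def lift_def by (rule refl)
  also have "... = (\<Union>g\<in>z. lift R (tensor R M' N) ?v f)" by (rule SUP_cong[OF refl eq])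
  also have "... = lift R (tensor R M' N) ?v f" unfolding UN_constant if_not_P[OF nz] by (rule refl)
  finally have "tensor_map R M' N h z = lift R (tensor R M' N) ?v f" .
  thus ?thesis unfolding f(2) T1.tlift_coset[OF T2.TT_module b f(1)] .
 qed
qed

section \<open>Minimal generators and the length of Tor\<close>

context cring
begin

lemmas rsum_insert = finsum_insert and rsum_cong = finsum_cong' and rsum_closed = finsum_closed and radd_closed = a_closed and rsum_singleton = finsum_singleton

lemma finsum_ring_as_module:
 "finite A ==> (!!i. i : A ==> f i : RR) ==> (\<Oplus>\<^bsub>ring_as_module R\<^esub>i\<in>A. f i) = (\<Oplus>i\<in>A. f i)"
 using finsum_hom[of R "ring_as_module R" "%x. x" A f] is_abelian_group module.M_group[OF ring_as_module_module] by simp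

lemma lift_ring:
 "(!!x. x : X ==> v x : RR) ==> f : carrier (free_on R X) ==>
  lift R (ring_as_module R) v f = (\<Oplus>x\<in>{x. f x ~= \<zero>}. f x \<otimes> v x)"
 unfolding lift_def using finsum_ring_as_module[of "{x. f x ~= \<zero>}" "%x. f x \<otimes> v x"]
 by (auto simp: free_carrier)

lemma free_expand:
 assumes f: "f : carrier (free_on R X)" shows "lift R (free_on R X) (free_gen R) f = f"
proof
 fix y
 let ?S = "{x. f x ~= \<zero>}"
 interpret F: module R "free_on R X" by (rule free_module)
 have S: "finite ?S" "?S <= X" "f x : RR" for x using f unfolding free_carrier by auto
 have c: "f x \<odot>\<^bsub>free_on R X\<^esub> free_gen R x : carrier (free_on R X)" if "x : ?S" for x
  by (rule F.smult_closed[OF S(3) free_gen_carrier]) (use that S in auto)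
 have "lift R (free_on R X) (free_gen R) f y = (\<Oplus>x\<in>?S. (f x \<odot>\<^bsub>free_on R X\<^esub> free_gen R x) y)"
  unfolding lift_def
  by (rule finsum_hom[OF F.M_group is_abelian_group _ _ S(1) c, of "%g. g y"]) (auto simp: free_carr)
 also have "... = (\<Oplus>x\<in>?S. if y = x then f x else \<zero>)"
  by (rule finsum_cong') (use S in \<open>auto simp: free_gen_def\<close>)
 also have "... = f y"
 proof (cases "y : ?S")
  case True
  thus ?thesis using finsum_singleton[OF True S(1), of f] S(3) by simp
 next
  case False
  have "(\<Oplus>x\<in>?S. if y = x then f x else \<zero>) = (\<Oplus>x\<in>?S. \<zero>)" by (rule finsum_cong') (use False in auto)
  thus ?thesis using False by (simp add: finsum_zero)
 qed
 finally show "lift R (free_on R X) (free_gen R) f y = f y" .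
qed

lemma mhom_free_expand:
 assumes "module R Q" "mhom R (free_on R X) Q h" "f : carrier (free_on R X)"
 shows "h f = lift R Q (%x. h (free_gen R x)) f"
 using lift_mhom[where v = "free_gen R" and X = X, OF free_module assms(1,2) free_gen_carrier assms(3)] free_expand[OF assms(3)] by simp

lemma mhom_cong: "mhom R M Q h ==> module R M ==> (!!x. x : carrier M ==> k x = h x) ==> mhom R M Q k"
proof -
 assume h: "mhom R M Q h" and M: "module R M" and k: "!!x. x : carrier M ==> k x = h x"
 interpret M: module R M by fact
 show ?thesis using h unfolding mhom_def by (simp add: k)
qed

lemma submodule_restrict:
 assumes M: "module R M" and N: "submodule N R M" "submodule N' R M" "N' <= N"
 shows "submodule N' R (M\<lparr>carrier := N\<rparr>)"
proof -
 interpret M: module R M by fact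
 show ?thesis
  by (rule module.subI[OF M.restrict_module[OF N(1)]]) (use N(3) M.sub_simps[OF N(2)] in auto)
qed

end

locale loc_mod = local_noeth R mm + module R M for R (structure) and mm and M (structure)
begin

definition "lin B c = (\<Oplus>\<^bsub>M\<^esub>m\<in>B. c m \<odot>\<^bsub>M\<^esub> m)"
definition "scalars c \<longleftrightarrow> (ALL m. c m : RR)"
definition "gens B \<longleftrightarrow> finite B & B <= carrier M & (ALL x:carrier M. EX c. scalars c & x = lin B c)"

lemma lin_closed: "B <= carrier M ==> scalars c ==> lin B c : carrier M"
 unfolding lin_def scalars_def by (rule M.finsum_closed) auto

lemma lin_cong: "B <= carrier M ==> scalars c' ==> (!!m. m : B ==> c m = c' m) ==> lin B c = lin B c'"
 unfolding lin_def scalars_def by (rule M.finsum_cong') auto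

lemma lin_add: "B <= carrier M ==> scalars c ==> scalars e ==> lin B (%m. c m \<oplus> e m) = lin B c \<oplus>\<^bsub>M\<^esub> lin B e"
proof -
 assume a: "B <= carrier M" "scalars c" "scalars e"
 have "lin B (%m. c m \<oplus> e m) = (\<Oplus>\<^bsub>M\<^esub>m\<in>B. c m \<odot>\<^bsub>M\<^esub> m \<oplus>\<^bsub>M\<^esub> e m \<odot>\<^bsub>M\<^esub> m)"
  unfolding lin_def by (rule M.finsum_cong') (use a in \<open>auto simp: scalars_def intro!: smult_l_distr\<close>)
 also have "... = lin B c \<oplus>\<^bsub>M\<^esub> lin B e" unfolding lin_def by (rule M.finsum_addf) (use a in \<open>auto simp: scalars_def\<close>)
 finally show ?thesis .
qed

lemma lin_smult: "finite B ==> B <= carrier M ==> scalars c ==> a : RR ==> lin B (%m. a \<otimes> c m) = a \<odot>\<^bsub>M\<^esub> lin B c"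
proof -
 assume a: "finite B" "B <= carrier M" "scalars c" "a : RR"
 have "lin B (%m. a \<otimes> c m) = (\<Oplus>\<^bsub>M\<^esub>m\<in>B. a \<odot>\<^bsub>M\<^esub> (c m \<odot>\<^bsub>M\<^esub> m))"
  unfolding lin_def by (rule M.finsum_cong') (use a in \<open>auto simp: scalars_def intro!: smult_assoc1\<close>)
 also have "... = a \<odot>\<^bsub>M\<^esub> lin B c" unfolding lin_def
  by (rule finsum_smult_ldistr[symmetric]) (use a in \<open>auto simp: scalars_def\<close>)
 finally show ?thesis .
qed

lemma lin_zero: "B <= carrier M ==> lin B (%m. \<zero>) = \<zero>\<^bsub>M\<^esub>"
proof -
 assume "B <= carrier M"
 hence "lin B (%m. \<zero>) = (\<Oplus>\<^bsub>M\<^esub>m\<in>B. \<zero>\<^bsub>M\<^esub>)" unfolding lin_def by (intro M.finsum_cong') auto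
 thus ?thesis by simp
qed

definition "delta y m = (if m = y then \<one> else \<zero>)" for y m :: 'c

lemma scalars_delta: "scalars (delta y)"
 by (simp add: scalars_def delta_def)

lemma lin_delta: "finite B ==> B <= carrier M ==> y : B ==> lin B (delta y) = y"
proof -
 assume a: "finite B" "B <= carrier M" "y : B"
 have "lin B (delta y) = (\<Oplus>\<^bsub>M\<^esub>m\<in>B. if y = m then m else \<zero>\<^bsub>M\<^esub>)"
  unfolding lin_def delta_def by (rule M.finsum_cong') (use a in auto)
 also have "... = y" by (rule M.add.finprod_singleton) (use a in auto)
 finally show ?thesis .
qed

lemma span_eq_lin:
 assumes "finite S" "S <= carrier M" "x : module_span R M S"
 shows "EX c. scalars c & x = lin S c"
proof -
 have "submodule {lin S c | c. scalars c} R M"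
 proof (rule subI)
  show "{lin S c | c. scalars c} <= carrier M" using lin_closed[OF assms(2)] by blast
  have "scalars (%m. \<zero>)" by (simp add: scalars_def)
  thus "\<zero>\<^bsub>M\<^esub> : {lin S c | c. scalars c}" using lin_zero[OF assms(2)] by (metis (mono_tags, lifting) mem_Collect_eq)
  fix x assume "x : {lin S c | c. scalars c}"
  then obtain c where c: "scalars c" "x = lin S c" by blast
  show "a \<odot>\<^bsub>M\<^esub> x : {lin S c | c. scalars c}" if a: "a : RR" for a
  proof -
   have "scalars (%m. a \<otimes> c m)" using c(1) a by (simp add: scalars_def)
   thus ?thesis using lin_smult[OF assms(1,2) c(1) a] c(2) by (metis (mono_tags, lifting) mem_Collect_eq)
  qed
  fix y assume "y : {lin S c | c. scalars c}"
  then obtain e where e: "scalars e" "y = lin S e" by blast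
  have "scalars (%m. c m \<oplus> e m)" using c(1) e(1) by (simp add: scalars_def)
  thus "x \<oplus>\<^bsub>M\<^esub> y : {lin S c | c. scalars c}"
   using lin_add[OF assms(2) c(1) e(1)] c(2) e(2) by (metis (mono_tags, lifting) mem_Collect_eq)
 qed
 moreover have "S <= {lin S c | c. scalars c}"
 proof
  fix y assume "y : S"
  hence "y = lin S (delta y)" by (rule lin_delta[OF assms(1,2), symmetric])
  thus "y : {lin S c | c. scalars c}" using scalars_delta by blast
 qed
 ultimately show ?thesis using span_least assms(3) by blast
qed

lemma gens_remove:
 assumes B: "gens B" and c: "scalars c" "lin B c = \<zero>\<^bsub>M\<^esub>" and m: "m0 : B" "c m0 ~: mm"
 shows "gens (B - {m0})"
proof -
 have fB: "finite B" "B <= carrier M" using B by (auto simp: gens_def)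
 have cm: "c m0 : RR" using c(1) by (simp add: scalars_def)
 obtain b where b: "b : RR" "b \<otimes> c m0 = \<one>" using unit_inverse[OF cm m(2)] by blast
 have "EX e. scalars e & x = lin (B - {m0}) e" if x: "x : carrier M" for x
 proof -
  obtain e where e: "scalars e" "x = lin B e" using B x unfolding gens_def by blast
  have em: "e m0 : RR" using e(1) by (simp add: scalars_def)
  \<comment> \<open>This multiple of the relation cancels the coefficient of \<open>m0\<close>
    without changing the element represented.\<close>
  define k where "k = \<ominus> (e m0 \<otimes> b)"
  have kc: "k : RR" unfolding k_def using em b by simp
  define e' where "e' m = e m \<oplus> k \<otimes> c m" for m
  have kco: "scalars (%m. k \<otimes> c m)" and e'c: "scalars e'" using e(1) c(1) kc by (auto simp: scalars_def e'_def)
  have "lin B e' = lin B e \<oplus>\<^bsub>M\<^esub> k \<odot>\<^bsub>M\<^esub> lin B c"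
   unfolding e'_def lin_add[OF fB(2) e(1) kco] lin_smult[OF fB c(1) kc] ..
  hence 1: "lin B e' = x" using c(2) kc e(2) x by simp
  have "e' m0 = e m0 \<ominus> e m0 \<otimes> (b \<otimes> c m0)" unfolding e'_def k_def using em b(1) cm by algebra
  hence z: "e' m0 = \<zero>" unfolding b(2) using em by algebra
  have f: "(%m. e' m \<odot>\<^bsub>M\<^esub> m) : B - {m0} \<rightarrow> carrier M" "e' m0 \<odot>\<^bsub>M\<^esub> m0 : carrier M"
   using e'c fB(2) m(1) by (auto simp: scalars_def)
  have "lin B e' = e' m0 \<odot>\<^bsub>M\<^esub> m0 \<oplus>\<^bsub>M\<^esub> lin (B - {m0}) e'"
   unfolding lin_def using M.finsum_insert[of "B - {m0}" m0 "%m. e' m \<odot>\<^bsub>M\<^esub> m"] f fB(1) m(1) by (simp add: insert_absorb)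
  moreover have "lin (B - {m0}) e' : carrier M" by (rule lin_closed) (use fB(2) e'c in auto)
  moreover have "m0 : carrier M" using fB(2) m(1) by blast
  ultimately have "x = lin (B - {m0}) e'" using 1 z by simp
  thus ?thesis using e'c by blast
 qed
 thus ?thesis unfolding gens_def using fB by blast
qed

text \<open>With a generating set of least cardinality, a unit coefficient in a relation would let
  one generator go.\<close>

lemma minimal_gens:
 assumes "finitely_generated_module R M"
 obtains B where "gens B" "!!c m. scalars c ==> lin B c = \<zero>\<^bsub>M\<^esub> ==> m : B ==> c m : mm"
proof -
 obtain S where S: "finite S" "S <= carrier M" "module_span R M S = carrier M"
  using assms unfolding finitely_generated_module_def by blast
 have "gens S" unfolding gens_def using S span_eq_lin[OF S(1,2)] by blast
 then obtain B where B: "gens B" "!!B'. gens B' ==> card B <= card B'"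
  using ex_has_least_nat[of gens S card] by blast
 have "c m : mm" if c: "scalars c" "lin B c = \<zero>\<^bsub>M\<^esub>" "m : B" for c m
 proof (rule ccontr)
  assume "c m ~: mm"
  from B(2)[OF gens_remove[OF B(1) c(1,2,3) this]] show False
   using B(1) c(3) card_Diff1_less[of B m] unfolding gens_def by simp
 qed
 thus ?thesis using that B(1) by blast
qed

lemma lin_finsum:
 assumes "B <= carrier M" "finite B" "finite A" "!!y. y : A ==> h y : RR" "!!y. y : A ==> scalars (rh y)"
 shows "lin B (%m. \<Oplus>y\<in>A. h y \<otimes> rh y m) = (\<Oplus>\<^bsub>M\<^esub>y\<in>A. h y \<odot>\<^bsub>M\<^esub> lin B (rh y)) & scalars (%m. \<Oplus>y\<in>A. h y \<otimes> rh y m)"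
 using assms(3,4,5)
proof (induction A rule: finite_induct)
 case empty thus ?case using lin_zero[OF assms(1)] by (simp add: scalars_def)
next
 case (insert y A)
 have 1: "h y : RR" "scalars (rh y)" "scalars (%m. h y \<otimes> rh y m)" using insert.prems by (auto simp: scalars_def)
 have eq: "(%m. \<Oplus>y\<in>insert y A. h y \<otimes> rh y m) = (%m. h y \<otimes> rh y m \<oplus> (\<Oplus>y\<in>A. h y \<otimes> rh y m))"
  by (rule ext, rule rsum_insert) (use insert in \<open>auto simp: scalars_def\<close>)
 have IH: "lin B (%m. \<Oplus>y\<in>A. h y \<otimes> rh y m) = (\<Oplus>\<^bsub>M\<^esub>y\<in>A. h y \<odot>\<^bsub>M\<^esub> lin B (rh y))" "scalars (%m. \<Oplus>y\<in>A. h y \<otimes> rh y m)"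
  using insert by auto
 have "(\<Oplus>\<^bsub>M\<^esub>y\<in>insert y A. h y \<odot>\<^bsub>M\<^esub> lin B (rh y)) = h y \<odot>\<^bsub>M\<^esub> lin B (rh y) \<oplus>\<^bsub>M\<^esub> (\<Oplus>\<^bsub>M\<^esub>y\<in>A. h y \<odot>\<^bsub>M\<^esub> lin B (rh y))"
  by (rule M.finsum_insert) (use insert lin_closed[OF assms(1)] in auto)
 thus ?case unfolding eq using lin_add[OF assms(1) 1(3) IH(2)] lin_smult[OF assms(2,1) 1(2,1)] IH 1
  by (simp add: scalars_def)
qed

end

section \<open>A map on Tor that reads off one coordinate of a relation\<close>

locale tor_setup = loc_mod R mm M + fiber R mm I for R (structure) and mm and M (structure) and I +
 fixes x d B c m0 n' r N
 assumes N: "N = r + n'" and x: "point x" "!!i. i < d ==> x i : I"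
  and tf: "!!n u k f. u : P n ==> u ~: mm \<cdot> P n ==> form (carrier R) d k f ==> ~ form mm d k f ==>
   ev x d k f \<otimes> u ~: mm \<cdot> P (k + n)"
  and B: "gens B" and rel: "!!c m. scalars c ==> lin B c = \<zero>\<^bsub>M\<^esub> ==> m : B ==> c m : mm"
  and c: "scalars c" "!!m. m : B ==> c m : P n'" "lin B c = \<zero>\<^bsub>M\<^esub>" and m0: "m0 : B" "c m0 ~: mm \<cdot> P n'"
begin

lemma fB: "finite B" "B <= carrier M"
 using B by (auto simp: gens_def)

definition "F0 = free_on R (carrier M)"
definition "Z1 = {f : carrier F0. lincomb R M f = \<zero>\<^bsub>M\<^esub>}"
definition "F1 = free_on R Z1"
definition "Z2 = {f : carrier F1. lincomb R F0 f = \<zero>\<^bsub>F0\<^esub>}"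
definition "F2 = free_on R Z2"
text \<open>Coordinates of \<open>y\<close> with respect to the generators \<open>B\<close>. On
  \<open>B\<close> they are fixed as unit vectors, so that the coordinate at \<open>m0\<close> of
  the relation \<open>rl a\<close> is exactly \<open>a c m0\<close>.\<close>

definition "rh y = (if y : B then delta y else (SOME e. scalars e & y = lin B e))"
abbreviation "RM \<equiv> ring_as_module R"
text \<open>\<open>\<phi>\<close> is the coordinate at \<open>m0\<close>, extended linearly to
  \<open>F0\<close>; \<open>\<psi>\<close> applies it to the elements of \<open>Z1\<close>, that is
  to relations, and extends the result to \<open>F1\<close>.\<close>

definition "\<phi> = lift R RM (%y. rh y m0)"
definition "\<psi> = lift R RM \<phi>"

lemma rho: "y : carrier M ==> scalars (rh y) & y = lin B (rh y)"
proof (cases "y : B")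
 case True thus ?thesis using scalars_delta lin_delta[OF fB] by (simp add: rh_def)
next
 case False
 assume "y : carrier M"
 hence "EX e. scalars e & y = lin B e" using B by (simp add: gens_def)
 from someI_ex[OF this] show ?thesis using False by (simp add: rh_def)
qed

lemma F0_mod: "module R F0" and F1_mod: "module R F1" and F2_mod: "module R F2"
 unfolding F0_def F1_def F2_def by (rule free_module)+

lemma rho_carr: "y : carrier M ==> rh y m : RR"
 using rho by (simp add: scalars_def)

lemma phi_hom: "mhom R F0 RM \<phi>"
 unfolding F0_def \<phi>_def by (rule mhom_lift[OF ring_as_module_module]) (use rho_carr in simp)

text \<open>Replacing each module element by its coordinates turns an element of \<open>Z1\<close>
  into a relation between the generators \<open>B\<close>, and those have coefficients in
  \<open>mm\<close> by minimality.\<close>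

lemma phi_mm: assumes "h : Z1" shows "\<phi> h : mm"
proof -
 have h: "h : carrier (free_on R (carrier M))" "lincomb R M h = \<zero>\<^bsub>M\<^esub>" using assms by (auto simp: Z1_def F0_def)
 let ?S = "{y. h y ~= \<zero>}"
 have S: "finite ?S" "?S <= carrier M" "h y : RR" for y using h(1) unfolding free_carrier by auto
 have co: "scalars (rh y)" "lin B (rh y) = y" if "y : ?S" for y using rho[of y] S(2) that by auto
 note L = lin_finsum[OF fB(2,1) S(1), of h rh, OF S(3) co(1)]
 have "(\<Oplus>\<^bsub>M\<^esub>y\<in>?S. h y \<odot>\<^bsub>M\<^esub> lin B (rh y)) = (\<Oplus>\<^bsub>M\<^esub>y\<in>?S. h y \<odot>\<^bsub>M\<^esub> y)"
  by (rule M.finsum_cong') (use S co(2) in auto)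
 hence "lin B (%m. \<Oplus>y\<in>?S. h y \<otimes> rh y m) = \<zero>\<^bsub>M\<^esub>" using L h(2) unfolding lincomb_def by simp
 from rel[OF _ this m0(1)] L have "(\<Oplus>y\<in>?S. h y \<otimes> rh y m0) : mm" by blast
 thus ?thesis unfolding \<phi>_def using lift_ring[of "carrier M" "%y. rh y m0" h] h(1) rho_carr by simp
qed

lemma phi_carr: "h : Z1 ==> \<phi> h : RR"
 using phi_mm id_carr[OF mm_ideal] by blast

lemma psi_hom: "mhom R F1 RM \<psi>"
 unfolding F1_def \<psi>_def by (rule mhom_lift[OF ring_as_module_module]) (use phi_carr in simp)

lemma psi_mm: assumes "g : carrier F1" shows "\<psi> g : mm"
proof -
 have g: "g : carrier (free_on R Z1)" using assms by (simp add: F1_def)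
 have "lift R RM \<phi> g = (\<Oplus>h\<in>{h. g h ~= \<zero>}. g h \<otimes> \<phi> h)" by (rule lift_ring[OF phi_carr g])
 thus ?thesis unfolding \<psi>_def
  by (simp only:) (rule finsum_in_ideal[OF mm_ideal]; use g phi_mm id_mult[OF mm_ideal] in \<open>auto simp: free_carrier\<close>)
qed

lemma psi_Z2: assumes "g : Z2" shows "\<psi> g = \<zero>"
proof -
 have g: "g : carrier (free_on R Z1)" "lift R F0 (%x. x) g = \<zero>\<^bsub>F0\<^esub>" using assms by (auto simp: Z2_def F1_def lincomb_lift)
 have "\<phi> (lift R F0 (%x. x) g) = lift R RM \<phi> g"
  by (rule lift_mhom[OF F0_mod ring_as_module_module phi_hom _ g(1)]) (simp add: Z1_def)
 thus ?thesis using g(2) mhom_zero[OF F0_mod ring_as_module_module phi_hom] by (simp add: \<psi>_def)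
qed

definition "T = quot_module RM (P N)"
definition "Q = quot_module RM (KK N)"
definition "rep Y = (SOME s. s : Y)" for Y :: "'a set"
text \<open>The second argument is a class modulo \<open>I^N\<close>, but the product is taken
  modulo the smaller ideal \<open>mm I^N\<close>. It is well defined there because
  \<open>\<psi>\<close> has its values in \<open>mm\<close>.\<close>

definition "bm p = KK N +> (\<psi> (fst p) \<otimes> rep (snd p))"
definition "one_T = P N +> \<one>"

lemma PN_sub: "submodule (P N) R RM" and KN_sub: "submodule (KK N) R RM"
 unfolding submodule_ring by (rule Pi, rule KKi)

lemma T_mod: "module R T" and Q_mod: "module R Q"
 unfolding T_def Q_def by (rule module.quot_is_module[OF ring_as_module_module]; rule PN_sub KN_sub)+

lemma T_carrier: "carrier T = (%s. P N +> s) ` RR"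
 unfolding T_def using module.quot_carrier[OF ring_as_module_module, of "P N"] by simp

lemma T_ops: "s : RR ==> s' : RR ==> (P N +> s) \<oplus>\<^bsub>T\<^esub> (P N +> s') = P N +> (s \<oplus> s')"
 "s : RR ==> s' : RR ==> s \<odot>\<^bsub>T\<^esub> (P N +> s') = P N +> (s \<otimes> s')"
 unfolding T_def using module.quot_add[OF ring_as_module_module PN_sub] module.quot_smult[OF ring_as_module_module PN_sub] by simp_all

lemma Q_ops: "s : RR ==> KK N +> s : carrier Q"
 "s : RR ==> s' : RR ==> (KK N +> s) \<oplus>\<^bsub>Q\<^esub> (KK N +> s') = KK N +> (s \<oplus> s')"
 "s : RR ==> s' : RR ==> s \<odot>\<^bsub>Q\<^esub> (KK N +> s') = KK N +> (s \<otimes> s')"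
 "\<zero>\<^bsub>Q\<^esub> = KK N"
 unfolding Q_def using module.quot_add[OF ring_as_module_module KN_sub] module.quot_smult[OF ring_as_module_module KN_sub]
  module.quot_carrier[OF ring_as_module_module, of "KK N"] module.quot_zero[OF ring_as_module_module, of "KK N"] by simp_all

lemma rep: assumes "Y = P N +> s" "s : RR" shows "rep Y : RR" "rep Y \<ominus> s : P N"
proof -
 have "s : Y" unfolding assms(1) by (rule coset_self[OF Pi assms(2)])
 hence "rep Y : Y" unfolding rep_def by (rule someI)
 then obtain k where k: "k : P N" "rep Y = k \<oplus> s" unfolding assms(1) coset_mem by blast
 hence kc: "k : RR" using id_carr[OF Pi] by blast
 have "k \<oplus> s \<ominus> s = k" using kc assms(2) by algebra
 thus "rep Y : RR" "rep Y \<ominus> s : P N" using k kc assms(2) by simp_all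
qed

lemma bm_coset: assumes g: "g : carrier F1" and s: "s : RR" shows "bm (g, P N +> s) = KK N +> (\<psi> g \<otimes> s)"
proof -
 note rp = rep[OF refl s]
 have p: "\<psi> g : mm" "\<psi> g : RR" using psi_mm[OF g] id_carr[OF mm_ideal] by blast+
 have "\<psi> g \<otimes> rep (P N +> s) \<ominus> \<psi> g \<otimes> s = \<psi> g \<otimes> (rep (P N +> s) \<ominus> s)" using p(2) rp(1) s by algebra
 also have "... : KK N" unfolding KK_def by (rule ideal_prod.prod[OF p(1) rp(2)])
 finally show ?thesis unfolding bm_def fst_conv snd_conv by (subst coset_eq_iff[OF KKi]) (use p rp s in auto)
qed

lemma bm_bilin: "bilin R F1 T Q bm"
 unfolding bilin_def T_carrier
proof (intro conjI ballI)
 have pc: "\<psi> g : RR" if "g : carrier F1" for g using psi_mm[OF that] id_carr[OF mm_ideal] by blast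
 note pD = mhomD[OF psi_hom, simplified]
 interpret F1: module R F1 by (rule F1_mod)
 fix p assume "p : carrier F1 \<times> (%s. P N +> s) ` RR"
 then obtain g s where p: "p = (g, P N +> s)" "g : carrier F1" "s : RR" by auto
 show "bm p : carrier Q" unfolding p(1) bm_coset[OF p(2,3)] by (rule Q_ops(1)) (use p pc in simp)
next
 have pc: "\<psi> g : RR" if "g : carrier F1" for g using psi_mm[OF that] id_carr[OF mm_ideal] by blast
 note pD = mhomD[OF psi_hom, simplified]
 interpret F1: module R F1 by (rule F1_mod)
 fix g y assume g: "g : carrier F1" and "y : (%s. P N +> s) ` RR"
 then obtain s where s: "s : RR" "y = P N +> s" by blast
 note v = bm_coset[OF g s(1)]
 show "bm (g \<oplus>\<^bsub>F1\<^esub> g', y) = bm (g, y) \<oplus>\<^bsub>Q\<^esub> bm (g', y)" if g': "g' : carrier F1" for g'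
  unfolding s(2) v bm_coset[OF g' s(1)] bm_coset[OF F1.M.add.m_closed[OF g g'] s(1)] pD(2)[OF g g']
  using Q_ops(2) pc[OF g] pc[OF g'] s(1) by (simp add: l_distr)
 show "bm (g, y \<oplus>\<^bsub>T\<^esub> y') = bm (g, y) \<oplus>\<^bsub>Q\<^esub> bm (g, y')" if y': "y' : (%s. P N +> s) ` RR" for y'
 proof -
  obtain s' where s': "s' : RR" "y' = P N +> s'" using y' by blast
  show ?thesis unfolding s(2) s'(2) T_ops(1)[OF s(1) s'(1)] v bm_coset[OF g s'(1)] bm_coset[OF g radd_closed[OF s(1) s'(1)]]
   using Q_ops(2) pc[OF g] s(1) s'(1) by (simp add: r_distr)
 qed
 fix a assume a: "a : RR"
 show "bm (a \<odot>\<^bsub>F1\<^esub> g, y) = a \<odot>\<^bsub>Q\<^esub> bm (g, y)"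
  unfolding s(2) v bm_coset[OF F1.smult_closed[OF a g] s(1)] pD(3)[OF a g]
  using Q_ops(3) pc[OF g] s(1) a by (simp add: m_assoc)
 show "bm (g, a \<odot>\<^bsub>T\<^esub> y) = a \<odot>\<^bsub>Q\<^esub> bm (g, y)"
  unfolding s(2) v T_ops(2)[OF a s(1)] bm_coset[OF g m_closed[OF a s(1)]]
  using Q_ops(3) pc[OF g] s(1) a by (simp add: m_lcomm)
qed

end

context tor_setup
begin

text \<open>The given relation multiplied by \<open>a\<close>, as an element of \<open>F0\<close>.
  For \<open>a\<close> in \<open>I^r\<close> its coefficients lie in \<open>I^N\<close>.\<close>

definition "rl a y = (if y : B then a \<otimes> c y else \<zero>)" for a y

lemma c_carr: "c y : RR"
 using c(1) by (simp add: scalars_def)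

lemma rl_F0: "a : RR ==> rl a : carrier (free_on R (carrier M))"
proof -
 assume a: "a : RR"
 have "{y. rl a y ~= \<zero>} <= B" unfolding rl_def by auto
 thus ?thesis unfolding free_carrier using fB a c_carr finite_subset by (auto simp: rl_def)
qed

lemma rl_supp: "{y. rl a y ~= \<zero>} <= B"
 unfolding rl_def by auto

lemma rl_Z1: assumes a: "a : RR" shows "rl a : Z1"
proof -
 have "lincomb R M (rl a) = (\<Oplus>\<^bsub>M\<^esub>y\<in>B. rl a y \<odot>\<^bsub>M\<^esub> y)"
  unfolding lincomb_lift by (rule lift_superset[OF module_axioms _ rl_F0[OF a] fB(1) rl_supp fB(2)]) simp
 also have "... = lin B (%m. a \<otimes> c m)" unfolding lin_def
  by (rule M.finsum_cong') (use fB a c_carr in \<open>auto simp: rl_def\<close>)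
 also have "... = \<zero>\<^bsub>M\<^esub>" using lin_smult[OF fB c(1) a] c(3) a by simp
 finally show ?thesis using rl_F0[OF a] by (simp add: Z1_def F0_def)
qed

lemma phi_rl: assumes a: "a : RR" shows "\<phi> (rl a) = a \<otimes> c m0"
proof -
 have "\<phi> (rl a) = (\<Oplus>\<^bsub>RM\<^esub>y\<in>B. rl a y \<odot>\<^bsub>RM\<^esub> rh y m0)"
  unfolding \<phi>_def by (rule lift_superset[OF ring_as_module_module _ rl_F0[OF a] fB(1) rl_supp fB(2)]) (simp add: rho_carr)
 also have "... = (\<Oplus>y\<in>B. rl a y \<otimes> rh y m0)"
  unfolding ring_as_module_simps by (rule finsum_ring_as_module[OF fB(1)]) (use fB(2) a c_carr rho_carr in \<open>auto simp: rl_def\<close>)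
 also have "... = (\<Oplus>y\<in>B. if m0 = y then a \<otimes> c y else \<zero>)"
  by (rule rsum_cong) (use a c_carr in \<open>auto simp: rl_def rh_def delta_def\<close>)
 also have "... = a \<otimes> c m0" by (rule rsum_singleton) (use m0(1) fB(1) a c_carr in auto)
 finally show ?thesis .
qed

lemma one_T: "one_T : carrier T"
 unfolding one_T_def T_carrier by blast

lemma tm1: "two_modules R F1 T" and tm0: "two_modules R F0 T" and tm2: "two_modules R F2 T"
 using F0_mod F1_mod F2_mod T_mod by (auto intro: two_modules.intro)

lemma lincomb_hom0: "mhom R F1 F0 (lincomb R F0)" and lincomb_hom1: "mhom R F2 F1 (lincomb R F1)"
 unfolding lincomb_lift F1_def[of] F2_def
 by (rule mhom_lift[OF F0_mod]; simp add: Z1_def) (rule mhom_lift[OF F1_mod[unfolded F1_def]]; simp add: Z2_def F1_def)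

definition "\<Theta> = two_modules.tlift R Q bm"
abbreviation "tmap0 \<equiv> tensor_map R F0 T (lincomb R F0)"
abbreviation "tmap1 \<equiv> tensor_map R F1 T (lincomb R F1)"
definition "ZZ = {z : carrier (tensor R F1 T). tmap0 z = \<zero>\<^bsub>tensor R F0 T\<^esub>}"
definition "BB = tmap1 ` carrier (tensor R F2 T)"

lemma Theta_hom: "mhom R (tensor R F1 T) Q \<Theta>"
 unfolding \<Theta>_def by (rule two_modules.mhom_tlift[OF tm1 Q_mod bm_bilin])

lemma Theta_pt: "g : carrier F1 ==> y : carrier T ==> \<Theta> (pure_tensor R F1 T g y) = bm (g, y)"
 unfolding \<Theta>_def by (rule two_modules.tlift_pt[OF tm1 Q_mod bm_bilin])

lemma tmap0_hom: "mhom R (tensor R F1 T) (tensor R F0 T) tmap0"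
 by (rule mhom_cong[OF two_modules.mhom_tlift[OF tm1 two_modules.TT_module[OF tm0] tensor_map_tlift(1)[OF F1_mod F0_mod T_mod lincomb_hom0]]
    two_modules.TT_module[OF tm1] tensor_map_tlift(2)[OF F1_mod F0_mod T_mod lincomb_hom0]])

lemma tmap1_hom: "mhom R (tensor R F2 T) (tensor R F1 T) tmap1"
 by (rule mhom_cong[OF two_modules.mhom_tlift[OF tm2 two_modules.TT_module[OF tm1] tensor_map_tlift(1)[OF F2_mod F1_mod T_mod lincomb_hom1]]
    two_modules.TT_module[OF tm2] tensor_map_tlift(2)[OF F2_mod F1_mod T_mod lincomb_hom1]])

lemma pt_closed: "two_modules R V W ==> g : carrier V ==> y : carrier W ==> pure_tensor R V W g y : carrier (tensor R V W)"
 using two_modules.pt_bilin[of R V W] unfolding bilin_def by auto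

lemma tmap0_pt: assumes "g : carrier F1" "y : carrier T" shows "tmap0 (pure_tensor R F1 T g y) = pure_tensor R F0 T (lincomb R F0 g) y"
 using tensor_map_tlift(2)[OF F1_mod F0_mod T_mod lincomb_hom0 pt_closed[OF tm1 assms]]
  two_modules.tlift_pt[OF tm1 two_modules.TT_module[OF tm0] tensor_map_tlift(1)[OF F1_mod F0_mod T_mod lincomb_hom0] assms] by simp

lemma tmap1_coset:
 assumes "w : carrier (tensor R F2 T)"
 shows "EX f. f : carrier (free_on R (carrier F2 \<times> carrier T)) &
  tmap1 w = lift R (tensor R F1 T) (%p. pure_tensor R F1 T (lincomb R F1 (fst p)) (snd p)) f"
proof -
 obtain f where f: "f : carrier (free_on R (carrier F2 \<times> carrier T))"
  "w = tensor_kernel R F2 T +>\<^bsub>free_on R (carrier F2 \<times> carrier T)\<^esub> f" using two_modules.TT_rep[OF tm2 assms] .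
 show ?thesis
  using tensor_map_tlift(2)[OF F2_mod F1_mod T_mod lincomb_hom1 assms]
   two_modules.tlift_coset[OF tm2 two_modules.TT_module[OF tm1] tensor_map_tlift(1)[OF F2_mod F1_mod T_mod lincomb_hom1] f(1)]
   f by auto
qed

lemma lincomb_lincomb: assumes k: "k : carrier F2" shows "lincomb R F0 (lincomb R F1 k) = \<zero>\<^bsub>F0\<^esub>" "\<psi> (lincomb R F1 k) = \<zero>"
proof -
 have k': "k : carrier (free_on R Z2)" using k by (simp add: F2_def)
 have v: "z : carrier F1" if "z : Z2" for z using that by (simp add: Z2_def)
 have "lincomb R F0 (lift R F1 (%z. z) k) = lift R F0 (%z. lincomb R F0 z) k"
  by (rule lift_mhom[OF F1_mod F0_mod lincomb_hom0 v k'])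
 also have "... = \<zero>\<^bsub>F0\<^esub>" by (rule lift_null[OF F0_mod _ k']) (simp add: Z2_def)
 finally show "lincomb R F0 (lincomb R F1 k) = \<zero>\<^bsub>F0\<^esub>" by (simp add: lincomb_lift)
 have "\<psi> (lift R F1 (%z. z) k) = lift R RM (%z. \<psi> z) k"
  by (rule lift_mhom[OF F1_mod ring_as_module_module psi_hom v k'])
 also have "... = \<zero>\<^bsub>RM\<^esub>" by (rule lift_null[OF ring_as_module_module _ k']) (simp add: psi_Z2)
 finally show "\<psi> (lincomb R F1 k) = \<zero>" by (simp add: lincomb_lift)
qed

text \<open>\<open>\<psi>\<close> vanishes on the image of \<open>F2\<close>, since
  \<open>\<phi>\<close> is linear on \<open>F0\<close>. Hence \<open>\<Theta>\<close> is defined on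
  Tor.\<close>

lemma Theta_BB: assumes "b : BB" shows "\<Theta> b = \<zero>\<^bsub>Q\<^esub>"
proof -
 obtain w where w: "w : carrier (tensor R F2 T)" "b = tmap1 w" using assms unfolding BB_def by blast
 obtain f where f: "f : carrier (free_on R (carrier F2 \<times> carrier T))"
  "b = lift R (tensor R F1 T) (%p. pure_tensor R F1 T (lincomb R F1 (fst p)) (snd p)) f"
  using tmap1_coset[OF w(1)] w(2) by auto
 note hc = mhomD(1)[OF lincomb_hom1]
 have "\<Theta> b = lift R Q (%p. \<Theta> (pure_tensor R F1 T (lincomb R F1 (fst p)) (snd p))) f"
  unfolding f(2) by (rule lift_mhom[OF two_modules.TT_module[OF tm1] Q_mod Theta_hom _ f(1)]) (use pt_closed[OF tm1] hc in auto)
 also have "... = \<zero>\<^bsub>Q\<^esub>"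
 proof (rule lift_null[OF Q_mod _ f(1)])
  fix p assume "p : carrier F2 \<times> carrier T"
  then obtain k y where p: "p = (k, y)" "k : carrier F2" "y : carrier T" by auto
  obtain s where s: "s : RR" "y = P N +> s" using p(3) unfolding T_carrier by blast
  show "\<Theta> (pure_tensor R F1 T (lincomb R F1 (fst p)) (snd p)) = \<zero>\<^bsub>Q\<^esub>"
   unfolding p(1) fst_conv snd_conv Theta_pt[OF hc[OF p(2)] p(3)]
   unfolding s(2) bm_coset[OF hc[OF p(2)] s(1)] lincomb_lincomb(2)[OF p(2)] Q_ops(4)
   using coset_zero[OF KKi] s(1) by simp
 qed
 finally show ?thesis .
qed

lemma BB_ZZ: "BB <= ZZ"
proof
 fix b assume "b : BB"
 then obtain w where w: "w : carrier (tensor R F2 T)" "b = tmap1 w" unfolding BB_def by blast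
 obtain f where f: "f : carrier (free_on R (carrier F2 \<times> carrier T))"
  "b = lift R (tensor R F1 T) (%p. pure_tensor R F1 T (lincomb R F1 (fst p)) (snd p)) f"
  using tmap1_coset[OF w(1)] w(2) by auto
 note hc = mhomD(1)[OF lincomb_hom1]
 have "tmap0 b = lift R (tensor R F0 T) (%p. tmap0 (pure_tensor R F1 T (lincomb R F1 (fst p)) (snd p))) f"
  unfolding f(2)
  by (rule lift_mhom[OF two_modules.TT_module[OF tm1] two_modules.TT_module[OF tm0] tmap0_hom _ f(1)]) (use pt_closed[OF tm1] hc in auto)
 also have "... = \<zero>\<^bsub>tensor R F0 T\<^esub>"
 proof (rule lift_null[OF two_modules.TT_module[OF tm0] _ f(1)])
  fix p assume "p : carrier F2 \<times> carrier T"
  then obtain k y where p: "p = (k, y)" "k : carrier F2" "y : carrier T" by auto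
  show "tmap0 (pure_tensor R F1 T (lincomb R F1 (fst p)) (snd p)) = \<zero>\<^bsub>tensor R F0 T\<^esub>"
   unfolding p(1) fst_conv snd_conv tmap0_pt[OF hc[OF p(2)] p(3)] lincomb_lincomb(1)[OF p(2)]
   by (rule two_modules.pt_zero(1)[OF tm0 p(3)])
 qed
 finally show "b : ZZ" unfolding ZZ_def w(2) using mhomD(1)[OF tmap1_hom w(1)] by simp
qed

definition "zz a = pure_tensor R F1 T (free_gen R (rl a)) one_T" for a

lemma gen_rl: "a : RR ==> free_gen R (rl a) : carrier F1"
 unfolding F1_def by (rule free_gen_carrier[OF rl_Z1])

lemma Theta_zz: assumes a: "a : RR" shows "\<Theta> (zz a) = KK N +> (a \<otimes> c m0)"
proof -
 have "\<psi> (free_gen R (rl a)) = \<phi> (rl a)"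
  unfolding \<psi>_def by (rule lift_gen[OF ring_as_module_module]) (simp add: phi_carr[OF rl_Z1[OF a]])
 hence "\<Theta> (zz a) = KK N +> (\<phi> (rl a) \<otimes> \<one>)"
  using Theta_pt[OF gen_rl[OF a] one_T] bm_coset[OF gen_rl[OF a] one_closed] unfolding zz_def one_T_def by simp
 thus ?thesis unfolding phi_rl[OF a] using a c_carr by simp
qed

text \<open>In \<open>F0\<close> tensored with \<open>R/I^N\<close> the element becomes a sum of
  basis elements with coefficients \<open>a c y\<close> from \<open>I^N\<close>, which vanish when
  moved into the second factor.\<close>

lemma zz_ZZ: assumes a: "a : P r" shows "zz a : ZZ"
proof -
 have ac: "a : RR" using a id_carr[OF Pi] by blast
 have "lincomb R F0 (free_gen R (rl a)) = rl a"
  unfolding lincomb_lift by (rule lift_gen[OF F0_mod]) (use rl_F0[OF ac] in \<open>simp add: F0_def\<close>)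
 hence 1: "tmap0 (zz a) = pure_tensor R F0 T (rl a) one_T"
  unfolding zz_def tmap0_pt[OF gen_rl[OF ac] one_T] by simp
 note b = two_modules.pt_bilin[OF tm0, unfolded bilin_def]
 have hom: "mhom R (free_on R (carrier M)) (tensor R F0 T) (%h. pure_tensor R F0 T h one_T)"
  unfolding mhom_def F0_def[symmetric] using b one_T by (auto simp del: free_simps)
 interpret T0: module R "tensor R F0 T" by (rule two_modules.TT_module[OF tm0])
 have "pure_tensor R F0 T (rl a) one_T = lift R (tensor R F0 T) (%y. pure_tensor R F0 T (free_gen R y) one_T) (rl a)"
  by (rule mhom_free_expand[OF two_modules.TT_module[OF tm0] hom rl_F0[OF ac]])
 also have "... = (\<Oplus>\<^bsub>tensor R F0 T\<^esub>y\<in>{y. rl a y ~= \<zero>}. \<zero>\<^bsub>tensor R F0 T\<^esub>)"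
  unfolding lift_def
 proof (rule T0.M.finsum_cong')
  fix y assume "y : {y. rl a y ~= \<zero>}"
  hence y: "y : B" "y : carrier M" using rl_supp fB(2) by blast+
  have g: "free_gen R y : carrier F0" unfolding F0_def by (rule free_gen_carrier[OF y(2)])
  have "rl a y : P N" using pow_mult[OF I a c(2)[OF y(1)]] y(1) unfolding rl_def N by simp
  hence z: "P N +> rl a y = P N" using coset_zero_iff[OF Pi] id_carr[OF Pi] by blast
  have rc: "rl a y : RR" using ac c_carr by (simp add: rl_def)
  have "rl a y \<odot>\<^bsub>T\<^esub> one_T = \<zero>\<^bsub>T\<^esub>"
   unfolding one_T_def T_ops(2)[OF rc one_closed] using z rc module.quot_zero[OF ring_as_module_module] by (simp add: T_def)
  moreover have "rl a y \<odot>\<^bsub>tensor R F0 T\<^esub> pure_tensor R F0 T (free_gen R y) one_T = pure_tensor R F0 T (free_gen R y) (rl a y \<odot>\<^bsub>T\<^esub> one_T)"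
   using b g one_T rc by simp
  ultimately show "rl a y \<odot>\<^bsub>tensor R F0 T\<^esub> pure_tensor R F0 T (free_gen R y) one_T = \<zero>\<^bsub>tensor R F0 T\<^esub>"
   using two_modules.pt_zero(2)[OF tm0 g] by simp
 qed auto
 finally have "tmap0 (zz a) = \<zero>\<^bsub>tensor R F0 T\<^esub>" unfolding 1 by simp
 thus ?thesis unfolding ZZ_def using pt_closed[OF tm1 gen_rl[OF ac] one_T] by (simp add: zz_def)
qed

text \<open>\<open>\<Theta>\<close> takes the cycle of the \<open>i\<close>-th monomial to the class
  of \<open>w i\<close>, this monomial in \<open>x\<close> times \<open>c m0\<close>. Adding these
  elements to \<open>KK N\<close> one by one gives strictly increasing ideals, because torsion
  freeness makes them independent modulo \<open>mm I^N\<close>; length is bounded by pulling this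
  chain back.\<close>

lemma tor_length: "enat (card (Mon d r)) <= module_length R (Tor1 R M (quot_module RM (P N)))"
proof -
 let ?K = "card (Mon d r)"
 obtain h where h: "bij_betw h {0..<?K} (Mon d r)" using ex_bij_betw_nat_finite[OF finite_Mon] by blast
 define al where "al i = ev x d r (%nu. if nu = h i then \<one> else \<zero>)" for i
 define w where "w i = (if i < ?K then al i \<otimes> c m0 else \<zero>)" for i
 have f1: "form (RR) d r (%nu. if nu = h i then \<one> else \<zero>)" for i by (simp add: form_def)
 have alP: "al i : P r" for i
 proof -
  define x' where "x' i = (if i < d then x i else \<zero>)" for i
  have "x' i \<otimes> u : P (Suc n)" if "u : P n" for i n u
   using pow_mult[OF I, of "x' i" "Suc 0" u n] that x(2) pow_1[OF I] id_zero[OF I] by (simp add: x'_def)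
  hence "ev x' d r (%nu. if nu = h i then \<one> else \<zero>) : P (0 + r)"
   by (intro ev_graded[of P]) (use Pi f1 in auto)
  moreover have "ev x' d r (%nu. if nu = h i then \<one> else \<zero>) = al i"
   unfolding al_def by (rule ev_point_cong) (simp add: x'_def)
  ultimately show ?thesis by simp
 qed
 have alc: "al i : RR" for i using alP id_carr[OF Pi] by blast
 have w: "point w" unfolding point_def w_def using alc c_carr by simp
 define ID where "ID i = gen w i <+> KK N" for i
 have IDi: "ideal (ID i) R" for i unfolding ID_def by (rule add_ideals[OF gen_ideal[OF w] KKi])
 have KID: "KK N <= ID i" for i unfolding ID_def by (rule set_add_sub2[OF gen_ideal[OF w] KKi])
 have gID: "gen w i <= ID i" for i unfolding ID_def by (rule set_add_sub1[OF gen_ideal[OF w] KKi])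
 \<comment> \<open>Elements generated by the first \<open>i\<close> products are \<open>c m0\<close>
   times the value of a form supported on the first \<open>i\<close> monomials.\<close>
 have gf: "EX f. form (RR) d r f & (ALL nu. nu ~: h ` {..<i} --> f nu = \<zero>) & g = ev x d r f \<otimes> c m0"
  if "g : gen w i" "i <= ?K" for i g
  using that
 proof (induction i arbitrary: g)
  case 0
  thus ?case using ev_zero[OF x(1)] c_carr by (intro exI[of _ "%_. \<zero>"]) (simp add: form_def)
 next
  case (Suc i)
  obtain g' b where g': "g' : gen w i" "b : RR" "g = g' \<oplus> b \<otimes> w i" using Suc.prems(1) by (auto elim: addelE)
  obtain f where f: "form (RR) d r f" "ALL nu. nu ~: h ` {..<i} --> f nu = \<zero>" "g' = ev x d r f \<otimes> c m0"
   using Suc.IH[OF g'(1)] Suc.prems(2) by auto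
  let ?e = "%nu. if nu = h i then \<one> else \<zero>"
  let ?f = "%nu. f nu \<oplus> b \<otimes> ?e nu"
  have bf: "form (RR) d r (%nu. b \<otimes> ?e nu)" by (rule form_smult[OF oneideal f1 g'(2)])
  have e1: "ev x d r ?f = ev x d r f \<oplus> b \<otimes> al i"
   using ev_add[OF x(1) f(1) bf] ev_smult[OF x(1) g'(2) f1[of i]] by (simp add: al_def)
  have e2: "g = (ev x d r f \<oplus> b \<otimes> al i) \<otimes> c m0"
   unfolding g'(3) f(3) w_def using Suc.prems(2) ev_closed[OF f(1) x(1)] g'(2) alc[of i] c_carr[of m0]
   by (simp add: l_distr m_assoc)
  have e3: "form (RR) d r ?f" by (rule form_add[OF oneideal f(1) bf])
  have e4: "ALL nu. nu ~: h ` {..<Suc i} --> ?f nu = \<zero>" using f(2) g'(2) by (auto simp: lessThan_Suc)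
  show ?case by (intro exI[of _ ?f] conjI e3 e4) (simp only: e1 e2)
 qed
 have wn: "w i ~: ID i" if i: "i < ?K" for i
 proof
  assume "w i : ID i"
  then obtain g k where g: "g : gen w i" "k : KK N" "w i = g \<oplus> k"
   unfolding ID_def using set_add_iff[of "w i" "gen w i" "KK N"] by blast
  obtain f where f: "form (RR) d r f" "ALL nu. nu ~: h ` {..<i} --> f nu = \<zero>" "g = ev x d r f \<otimes> c m0"
   using gf[OF g(1)] i by auto
  \<comment> \<open>\<open>f\<close> is supported on earlier monomials, so the difference has
    coefficient one at \<open>h i\<close> and is nonzero over the residue field.\<close>
  let ?f = "%nu. (if nu = h i then \<one> else \<zero>) \<ominus> f nu"
  have hi: "h i : Mon d r" using h i by (auto simp: bij_betw_def)
  have "h i ~: h ` {..<i}"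
  proof
   assume "h i : h ` {..<i}"
   then obtain l where "l < i" "h i = h l" by auto
   moreover have "inj_on h {0..<?K}" using h by (simp add: bij_betw_def)
   ultimately show False using i inj_onD[of h "{0..<?K}" i l] by simp
  qed
  hence "?f (h i) = \<one>" using f(2) by (simp add: a_minus_def)
  hence nf: "~ form mm d r ?f" unfolding form_def using hi mm_one by metis
  have "ev x d r ?f \<otimes> c m0 = k"
  proof -
   have "ev x d r ?f = al i \<ominus> ev x d r f" unfolding al_def by (rule ev_minus[OF x(1) f1 f(1)])
   moreover have "al i \<otimes> c m0 = ev x d r f \<otimes> c m0 \<oplus> k" using g(3) i unfolding w_def f(3) by simp
   moreover have "(al i \<ominus> e) \<otimes> c m0 = (al i \<otimes> c m0) \<ominus> e \<otimes> c m0" if "e : RR" for e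
    using alc[of i] c_carr[of m0] that by algebra
   moreover have "(e \<oplus> k) \<ominus> e = k" if "e : RR" for e using that id_carr[OF KKi g(2)] by algebra
   ultimately show ?thesis using ev_closed[OF f(1) x(1)] c_carr by simp
  qed
  thus False using tf[OF c(2)[OF m0(1)] m0(2) form_minus[OF oneideal f1 f(1)] nf] g(2) unfolding KK_def N by simp
 qed
 define E where "E i = (%s. KK N +> s) ` ID i" for i
 have Emem: "KK N +> s : E i \<longleftrightarrow> s : ID i" if s: "s : RR" for s i
 proof
  assume "KK N +> s : E i"
  then obtain e where e: "e : ID i" "KK N +> s = KK N +> e" unfolding E_def by blast
  have ec: "e : RR" using id_carr[OF IDi e(1)] .
  have "s \<ominus> e : ID i" using e(2) coset_eq_iff[OF KKi s ec] KID by blast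
  hence "(s \<ominus> e) \<oplus> e : ID i" using id_add[OF IDi] e(1) by blast
  moreover have "(s \<ominus> e) \<oplus> e = s" using s ec by algebra
  ultimately show "s : ID i" by simp
 qed (auto simp: E_def)
 have Es: "submodule (E i) R Q" for i
 proof -
  have s: "submodule (ID i) R RM" unfolding submodule_ring by (rule IDi)
  have "mhom R RM Q (%s. KK N +> s)" using mhom_coset[OF ring_as_module_module KN_sub] by (simp add: Q_def)
  thus ?thesis unfolding E_def by (rule mhom_image[OF ring_as_module_module Q_mod _ s])
 qed
 interpret V: module R "tensor R F1 T" by (rule two_modules.TT_module[OF tm1])
 have ZZs: "submodule ZZ R (tensor R F1 T)"
  using mhom_preimage[OF two_modules.TT_module[OF tm1] two_modules.TT_module[OF tm0] tmap0_hom
    zero_submodule[OF two_modules.TT_module[OF tm0]]] by (simp add: ZZ_def)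
 interpret V2: module R "tensor R F2 T" by (rule two_modules.TT_module[OF tm2])
 have BBs: "submodule BB R (tensor R F1 T)"
  unfolding BB_def by (rule mhom_image[OF two_modules.TT_module[OF tm2] two_modules.TT_module[OF tm1] tmap1_hom V2.carrier_is_submodule])
 have "enat ?K <= module_length R (quot_module ((tensor R F1 T)\<lparr>carrier := ZZ\<rparr>) BB)"
 proof (rule length_quot_ge[where \<Theta> = \<Theta> and E = E and z = "%i. zz (al i)"])
  show "module R ((tensor R F1 T)\<lparr>carrier := ZZ\<rparr>)" by (rule V.restrict_module[OF ZZs])
  show "submodule BB R ((tensor R F1 T)\<lparr>carrier := ZZ\<rparr>)"
   by (rule submodule_restrict[OF two_modules.TT_module[OF tm1] ZZs BBs BB_ZZ])
  show "module R Q" by (rule Q_mod)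
  show "mhom R ((tensor R F1 T)\<lparr>carrier := ZZ\<rparr>) Q \<Theta>"
   by (rule mhom_restrict[OF ZZs two_modules.TT_module[OF tm1] Theta_hom])
  show "\<Theta> b = \<zero>\<^bsub>Q\<^esub>" if "b : BB" for b by (rule Theta_BB[OF that])
  show "submodule (E i) R Q" for i by (rule Es)
  have "gen w i <= ID (Suc i)" for i using gen_mono[OF w, of i "Suc i"] gID[of "Suc i"] by auto
  hence "ID i <= ID (Suc i)" for i unfolding ID_def[of i] by (rule set_add_least[OF IDi _ KID])
  thus "E i <= E (Suc i)" for i unfolding E_def by blast
  show "zz (al i) : carrier ((tensor R F1 T)\<lparr>carrier := ZZ\<rparr>)" for i using zz_ZZ[OF alP] by simp
  fix i assume i: "i < ?K"
  have t: "\<Theta> (zz (al i)) = KK N +> w i" using Theta_zz[OF alc] i by (simp add: w_def)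
  have wc: "w i : RR" using w by simp
  show "\<Theta> (zz (al i)) : E (Suc i)" unfolding t Emem[OF wc] using gen_mem[OF w, of i "Suc i"] gID[of "Suc i"] by blast
  show "\<Theta> (zz (al i)) ~: E i" unfolding t Emem[OF wc] by (rule wn[OF i])
 qed
 moreover have "Tor1 R M (quot_module RM (P N)) = quot_module ((tensor R F1 T)\<lparr>carrier := ZZ\<rparr>) BB"
  unfolding Tor1_def Let_def ZZ_def BB_def F0_def Z1_def F1_def Z2_def F2_def T_def by (rule refl)
 ultimately show ?thesis by simp
qed

end

section \<open>Freeness of the fiber module\<close>

locale fib_mod = loc_mod R mm M + fiber R mm I for R (structure) and mm and M (structure) and I +
 fixes B
 assumes B: "gens B"
  and star: "!!c n. ALL m. c m : P n ==> lin B c = \<zero>\<^bsub>M\<^esub> ==> ALL m:B. c m : KK n"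
begin

lemma fB: "finite B" "B <= carrier M"
 using B by (auto simp: gens_def)

text \<open>For an ideal \<open>X\<close> this is the submodule \<open>X M\<close>.\<close>

definition "LB X = {lin B c | c. ALL m. c m : X}"

lemma scalarsI: "ideal X R ==> ALL m. c m : X ==> scalars c"
 unfolding scalars_def using id_carr by blast

lemma LBI: "ALL m. c m : X ==> lin B c : LB X"
 unfolding LB_def by blast

lemma LB_mono: "X <= Y ==> LB X <= LB Y"
 unfolding LB_def by blast

lemma LB_submodule: assumes X: "ideal X R" shows "submodule (LB X) R M"
proof (rule subI)
 show "LB X <= carrier M" unfolding LB_def using lin_closed[OF fB(2) scalarsI[OF X]] by blast
 show "\<zero>\<^bsub>M\<^esub> : LB X" using LBI[of "%_. \<zero>" X] id_zero[OF X] lin_zero[OF fB(2)] by simp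
 fix x assume "x : LB X"
 then obtain c where c: "ALL m. c m : X" "x = lin B c" unfolding LB_def by blast
 show "a \<odot>\<^bsub>M\<^esub> x : LB X" if a: "a : RR" for a
  using LBI[of "%m. a \<otimes> c m" X] id_mult[OF X _ a] c lin_smult[OF fB scalarsI[OF X c(1)] a] by simp
 fix y assume "y : LB X"
 then obtain e where e: "ALL m. e m : X" "y = lin B e" unfolding LB_def by blast
 show "x \<oplus>\<^bsub>M\<^esub> y : LB X"
  using LBI[of "%m. c m \<oplus> e m" X] id_add[OF X] c e lin_add[OF fB(2) scalarsI[OF X c(1)] scalarsI[OF X e(1)]] by simp
qed

lemma LB_smult:
 assumes X: "ideal X R" and Y: "ideal Y R" and a: "a : X" and z: "z : LB Y" shows "a \<odot>\<^bsub>M\<^esub> z : LB (X \<cdot> Y)"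
proof -
 obtain c where c: "ALL m. c m : Y" "z = lin B c" using z unfolding LB_def by blast
 have "ALL m. a \<otimes> c m : X \<cdot> Y" using ideal_prod.prod[OF a] c(1) by blast
 from LBI[OF this] show ?thesis using lin_smult[OF fB scalarsI[OF Y c(1)] id_carr[OF X a]] c(2) by simp
qed

lemma ideal_smult_LB: assumes X: "ideal X R" and Y: "ideal Y R" shows "ideal_smult R M X (LB Y) = LB (X \<cdot> Y)"
proof
 let ?S = "{a \<odot>\<^bsub>M\<^esub> x |a x. a : X & x : LB Y}"
 have XY: "ideal (X \<cdot> Y) R" by (rule ideal_prod_is_ideal[OF X Y])
 show "ideal_smult R M X (LB Y) <= LB (X \<cdot> Y)"
  unfolding ideal_smult_def by (rule span_least[OF LB_submodule[OF XY]]) (use LB_smult[OF X Y] in blast)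
 have S: "?S <= carrier M" using sub_simps(1)[OF LB_submodule[OF Y]] id_carr[OF X] by blast
 note H = span_submodule[OF S]
 show "LB (X \<cdot> Y) <= ideal_smult R M X (LB Y)"
 proof
  fix z assume "z : LB (X \<cdot> Y)"
  then obtain c where c: "ALL m. c m : X \<cdot> Y" "z = lin B c" unfolding LB_def by blast
  have key: "w \<odot>\<^bsub>M\<^esub> m : module_span R M ?S" if "w : X \<cdot> Y" and m: "m : B" for w m
   using that(1)
  proof (induction w rule: ideal_prod.induct)
   case (prod a b)
   have mc: "m : carrier M" using m fB(2) by blast
   have bY: "ALL k. b \<otimes> delta m k : Y" using prod(2) id_carr[OF Y prod(2)] id_zero[OF Y] by (simp add: delta_def)
   have "lin B (%k. b \<otimes> delta m k) = b \<odot>\<^bsub>M\<^esub> m"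
    using lin_smult[OF fB scalars_delta id_carr[OF Y prod(2)], of m] lin_delta[OF fB m] by simp
   hence "b \<odot>\<^bsub>M\<^esub> m : LB Y" using LBI[OF bY] by simp
   hence "a \<odot>\<^bsub>M\<^esub> (b \<odot>\<^bsub>M\<^esub> m) : ?S" using prod(1) by blast
   thus ?case using span_sub[of ?S] smult_assoc1[OF id_carr[OF X prod(1)] id_carr[OF Y prod(2)] mc] by auto
  next
   case (sum a b)
   have mc: "m : carrier M" using m fB(2) by blast
   have "a : RR" "b : RR" using sum(1,2) id_carr[OF XY] by blast+
   thus ?case using sub_simps(3)[OF H sum(3,4)] smult_l_distr[OF _ _ mc] by simp
  qed
  show "z : ideal_smult R M X (LB Y)" unfolding c(2) lin_def ideal_smult_def
   by (rule sub_finsum[OF H fB(1)]) (use key c(1) in blast)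
 qed
qed

lemma carrier_LB: "carrier M = LB (RR)"
proof
 show "carrier M <= LB (RR)"
 proof
  fix x assume "x : carrier M"
  then obtain c where "scalars c" "x = lin B c" using B unfolding gens_def by blast
  thus "x : LB (RR)" unfolding LB_def scalars_def by blast
 qed
 show "LB (RR) <= carrier M" using sub_simps(1)[OF LB_submodule[OF oneideal]] by blast
qed

lemma Ln: "ideal_smult R M (P n) (carrier M) = LB (P n)"
 unfolding carrier_LB ideal_smult_LB[OF Pi oneideal] by (simp add: ideal_prod_one[OF Pi])

lemma Kn: "ideal_smult R M mm (LB (P n)) = LB (KK n)"
 unfolding ideal_smult_LB[OF mm_ideal Pi] KK_def ..

definition "FM = fiber_module R mm I M"
text \<open>The element of the fiber module with coordinates \<open>a m\<close> in the Rees algebra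
  with respect to the generators \<open>B\<close>.\<close>

definition "mc a n = LB (KK n) +>\<^bsub>M\<^esub> lin B (%m. a m n)" for a :: "'c => nat => 'a"
definition "fam a \<longleftrightarrow> (ALL m. a m : rees)" for a :: "'c => nat => 'a"

lemma KLs: "submodule (LB (KK n)) R M" by (rule LB_submodule[OF KKi])

lemma fam_P: "fam a ==> ALL m. a m n : P n"
 unfolding fam_def using rees_carr(2) by blast

lemma fam_scalars: "fam a ==> scalars (%m. a m n)"
 unfolding fam_def scalars_def using rees_carr(1) by blast

lemma fam_lin: "fam a ==> lin B (%m. a m n) : carrier M"
 by (rule lin_closed[OF fB(2) fam_scalars])

lemma FM_simps:
 "carrier FM = {u. (ALL n. u n : (%x. LB (KK n) +>\<^bsub>M\<^esub> x) ` LB (P n)) & finite {n. u n ~= LB (KK n)}}"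
 "\<zero>\<^bsub>FM\<^esub> = (%n. LB (KK n))" "u \<oplus>\<^bsub>FM\<^esub> v = (%n. u n \<oplus>\<^bsub>quot_module M (LB (KK n))\<^esub> v n)"
 "f \<odot>\<^bsub>FM\<^esub> u = (%n. \<Oplus>\<^bsub>quot_module M (LB (KK n))\<^esub>i\<in>{..n}. \<Union>a\<in>f i. coset_smult M (LB (KK n)) a (u (n - i)))"
proof -
 have L: "ideal_smult R M (ideal_pow R I n) (carrier M) = LB (P n)" for n using Ln[of n] by (simp add: ipow_def)
 show "carrier FM = {u. (ALL n. u n : (%x. LB (KK n) +>\<^bsub>M\<^esub> x) ` LB (P n)) & finite {n. u n ~= LB (KK n)}}"
  "\<zero>\<^bsub>FM\<^esub> = (%n. LB (KK n))" "u \<oplus>\<^bsub>FM\<^esub> v = (%n. u n \<oplus>\<^bsub>quot_module M (LB (KK n))\<^esub> v n)"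
  "f \<odot>\<^bsub>FM\<^esub> u = (%n. \<Oplus>\<^bsub>quot_module M (LB (KK n))\<^esub>i\<in>{..n}. \<Union>a\<in>f i. coset_smult M (LB (KK n)) a (u (n - i)))"
  unfolding FM_def fiber_module_def Let_def L Kn by simp_all
qed

text \<open>This is where \<open>star\<close> yields uniqueness of coordinates: if two families have
  the same class, their difference, corrected by coefficients in \<open>mm I^n\<close>, is a
  relation with coefficients in \<open>I^n\<close>.\<close>

lemma mc_eq_iff:
 assumes a: "fam a" and b: "fam b" shows "mc a = mc b \<longleftrightarrow> (ALL m:B. cl (a m) = cl (b m))"
proof
 have d: "lin B (%m. a m n \<ominus> b m n) = lin B (%m. a m n) \<ominus>\<^bsub>M\<^esub> lin B (%m. b m n)" for n
 proof -
  have 1: "scalars (%m. \<ominus> \<one> \<otimes> b m n)" using fam_scalars[OF b] by (simp add: scalars_def)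
  have "lin B (%m. a m n \<ominus> b m n) = lin B (%m. a m n \<oplus> \<ominus> \<one> \<otimes> b m n)"
  proof (rule lin_cong[OF fB(2)])
   show "scalars (%m. a m n \<oplus> \<ominus> \<one> \<otimes> b m n)" using fam_scalars[OF a] fam_scalars[OF b] by (simp add: scalars_def)
   fix m show "a m n \<ominus> b m n = a m n \<oplus> \<ominus> \<one> \<otimes> b m n"
    using fam_scalars[OF a] fam_scalars[OF b] unfolding scalars_def by algebra
  qed
  also have "... = lin B (%m. a m n) \<oplus>\<^bsub>M\<^esub> (\<ominus> \<one>) \<odot>\<^bsub>M\<^esub> lin B (%m. b m n)"
   using lin_add[OF fB(2) fam_scalars[OF a] 1] lin_smult[OF fB fam_scalars[OF b]] by simp
  also have "... = lin B (%m. a m n) \<ominus>\<^bsub>M\<^esub> lin B (%m. b m n)"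
   using smult_l_minus[OF one_closed fam_lin[OF b]] fam_lin[OF b] by (simp add: a_minus_def)
  finally show ?thesis .
 qed
 have ac: "a m n : RR" "b m n : RR" for m n using fam_scalars[OF a] fam_scalars[OF b] by (auto simp: scalars_def)
 have ar: "a m : rees" "b m : rees" for m using a b by (auto simp: fam_def)
 show "ALL m:B. cl (a m) = cl (b m)" if eq: "mc a = mc b"
 proof
  fix m assume m: "m : B"
  have "a m n \<ominus> b m n : KK n" for n
  proof -
   have "lin B (%m. a m n \<ominus> b m n) : LB (KK n)"
    unfolding d using eq qcos_eq_iff[OF KLs fam_lin[OF a] fam_lin[OF b]] unfolding mc_def fun_eq_iff by blast
   then obtain e where e: "ALL m. e m : KK n" "lin B (%m. a m n \<ominus> b m n) = lin B e" unfolding LB_def by blast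
   have es: "scalars e" by (rule scalarsI[OF KKi e(1)])
   have ec: "e m : RR" for m using es by (simp add: scalars_def)
   have se: "scalars (%m. \<ominus> \<one> \<otimes> e m)" "scalars (%m. a m n \<ominus> b m n)" using ec ac by (auto simp: scalars_def)
   have "lin B (%m. (a m n \<ominus> b m n) \<oplus> \<ominus> \<one> \<otimes> e m) = lin B e \<oplus>\<^bsub>M\<^esub> (\<ominus> \<one>) \<odot>\<^bsub>M\<^esub> lin B e"
    using lin_add[OF fB(2) se(2,1)] lin_smult[OF fB es] e(2) by simp
   also have "... = \<zero>\<^bsub>M\<^esub>" using lin_closed[OF fB(2) es] smult_l_minus[OF one_closed] by (simp add: M.r_neg)
   finally have z: "lin B (%m. (a m n \<ominus> b m n) \<oplus> \<ominus> \<one> \<otimes> e m) = \<zero>\<^bsub>M\<^esub>" .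
   have "ALL m. (a m n \<ominus> b m n) \<oplus> \<ominus> \<one> \<otimes> e m : P n"
   proof
    fix m
    have "e m : P n" using e(1) KK_sub by blast
    thus "(a m n \<ominus> b m n) \<oplus> \<ominus> \<one> \<otimes> e m : P n"
     by (intro id_add[OF Pi id_minus[OF Pi rees_carr(2)[OF ar(1)] rees_carr(2)[OF ar(2)]] id_mult[OF Pi]]) simp_all
   qed
   from star[OF this z] m have "(a m n \<ominus> b m n) \<oplus> \<ominus> \<one> \<otimes> e m : KK n" by blast
   hence "((a m n \<ominus> b m n) \<oplus> \<ominus> \<one> \<otimes> e m) \<oplus> e m : KK n" using id_add[OF KKi] e(1) by blast
   moreover have "((a m n \<ominus> b m n) \<oplus> \<ominus> \<one> \<otimes> e m) \<oplus> e m = a m n \<ominus> b m n" using ac ec[of m] by algebra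
   ultimately show ?thesis by simp
  qed
  thus "cl (a m) = cl (b m)" using cl_eq_iff[OF ar] by blast
 qed
 show "mc a = mc b" if eq: "ALL m:B. cl (a m) = cl (b m)"
 proof
  fix n
  define e where "e m = (if m : B then a m n \<ominus> b m n else \<zero>)" for m
  have "a m n \<ominus> b m n : KK n" if "m : B" for m using eq cl_eq_iff[OF ar] that by blast
  hence "ALL m. e m : KK n" using id_zero[OF KKi] by (simp add: e_def)
  from LBI[OF this] have "lin B e : LB (KK n)" .
  moreover have "lin B (%m. a m n \<ominus> b m n) = lin B e"
   by (rule lin_cong[OF fB(2)]) (use ac in \<open>auto simp: e_def scalars_def\<close>)
  ultimately show "mc a n = mc b n" unfolding mc_def using qcos_eq_iff[OF KLs fam_lin[OF a] fam_lin[OF b]] d by simp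
 qed
qed

lemma mc_carrier: "carrier FM = mc ` {a. fam a}"
proof
 show "mc ` {a. fam a} <= carrier FM"
 proof
  fix u assume "u : mc ` {a. fam a}"
  then obtain a where a: "fam a" "u = mc a" by blast
  have "ALL m. EX N. ALL n>N. a m n = \<zero>" using a(1) rees_bound unfolding fam_def by blast
  from choice[OF this] obtain N where N: "!!m n. n > N m ==> a m n = \<zero>" by blast
  define N' where "N' = Max (insert 0 (N ` B))"
  have "{n. u n ~= LB (KK n)} <= {..N'}"
  proof (rule subsetI, rule ccontr)
   fix n assume n: "n : {n. u n ~= LB (KK n)}" "n ~: {..N'}"
   have "a m n = \<zero>" if "m : B" for m
   proof -
    have "N m <= N'" unfolding N'_def using fB(1) that by (intro Max_ge) auto
    thus ?thesis using N[of m n] n(2) by simp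
   qed
   hence "lin B (%m. a m n) = lin B (%m. \<zero>)" by (intro lin_cong[OF fB(2)]) (auto simp: scalars_def)
   hence "u n = LB (KK n)" unfolding a(2) mc_def using lin_zero[OF fB(2)] qcos_zero[OF KLs] by simp
   thus False using n(1) by simp
  qed
  hence "finite {n. u n ~= LB (KK n)}" using finite_subset by blast
  moreover have "u n : (%x. LB (KK n) +>\<^bsub>M\<^esub> x) ` LB (P n)" for n
   unfolding a(2) mc_def using LBI[OF fam_P[OF a(1)]] by blast
  ultimately show "u : carrier FM" unfolding FM_simps by blast
 qed
 show "carrier FM <= mc ` {a. fam a}"
 proof
  fix u assume u: "u : carrier FM"
  have "EX c. (ALL m. c m : P n) & u n = LB (KK n) +>\<^bsub>M\<^esub> lin B c & (u n = LB (KK n) --> c = (%_. \<zero>))" for n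
  proof (cases "u n = LB (KK n)")
   case True
   thus ?thesis using id_zero[OF Pi] lin_zero[OF fB(2)] qcos_zero[OF KLs] by (intro exI[of _ "%_. \<zero>"]) simp
  next
   case False
   have "u n : (%x. LB (KK n) +>\<^bsub>M\<^esub> x) ` LB (P n)" using u unfolding FM_simps by blast
   then obtain c where "ALL m. c m : P n" "u n = LB (KK n) +>\<^bsub>M\<^esub> lin B c" unfolding LB_def[of "P n"] by blast
   thus ?thesis using False by blast
  qed
  hence "ALL n. EX c. (ALL m. c m : P n) & u n = LB (KK n) +>\<^bsub>M\<^esub> lin B c & (u n = LB (KK n) --> c = (%_. \<zero>))" ..
  from choice[OF this] obtain c where c: "!!n m. c n m : P n" "!!n. u n = LB (KK n) +>\<^bsub>M\<^esub> lin B (c n)"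
   "!!n. u n = LB (KK n) ==> c n = (%_. \<zero>)" by blast
  have "finite {n. u n ~= LB (KK n)}" using u unfolding FM_simps by simp
  then obtain N where N: "{n. u n ~= LB (KK n)} <= {..N}" using finite_nat_iff_bounded_le by blast
  have z: "c n m = \<zero>" if "n > N" for n m
  proof -
   have "u n = LB (KK n)" using N that by fastforce
   thus ?thesis using c(3) by simp
  qed
  have "fam (%m n. c n m)" unfolding fam_def by (intro allI reesI[OF c(1) z])
  moreover have "u = mc (%m n. c n m)" by (rule ext) (simp add: mc_def c(2))
  ultimately show "u : mc ` {a. fam a}" by blast
 qed
qed

lemma mc_add: assumes a: "fam a" and b: "fam b"
 shows "mc a \<oplus>\<^bsub>FM\<^esub> mc b = mc (%m n. a m n \<oplus> b m n)"
 unfolding FM_simps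
proof
 fix n
 show "mc a n \<oplus>\<^bsub>quot_module M (LB (KK n))\<^esub> mc b n = mc (%m n. a m n \<oplus> b m n) n"
  unfolding mc_def quot_add[OF KLs fam_lin[OF a] fam_lin[OF b]] lin_add[OF fB(2) fam_scalars[OF a] fam_scalars[OF b]] ..
qed

lemma mc_smult: assumes b: "b : rees" and a: "fam a"
 shows "cl b \<odot>\<^bsub>FM\<^esub> mc a = mc (%m. conv b (a m))"
 unfolding FM_simps
proof
 fix n
 note bc = rees_carr[OF b]
 have t: "(\<Union>x\<in>cl b i. coset_smult M (LB (KK n)) x (mc a (n - i))) = LB (KK n) +>\<^bsub>M\<^esub> (b i \<odot>\<^bsub>M\<^esub> lin B (%m. a m (n - i)))"
  if i: "i <= n" for i
 proof -
  let ?y = "lin B (%m. a m (n - i))"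
  have yP: "?y : LB (P (n - i))" by (rule LBI[OF fam_P[OF a]])
  have yc: "?y : carrier M" by (rule fam_lin[OF a])
  have KP: "KK i \<cdot> P (n - i) <= KK n" and PK: "P i \<cdot> KK (n - i) <= KK n"
  proof -
   have e: "KK n = KK (i + (n - i))" using i by simp
   show "KK i \<cdot> P (n - i) <= KK n" unfolding e by (rule prod_least[OF KKi KK_mult])
   show "P i \<cdot> KK (n - i) <= KK n" unfolding e by (rule prod_least[OF KKi KK_mult2])
  qed
  have eq: "LB (KK n) +>\<^bsub>M\<^esub> (x \<odot>\<^bsub>M\<^esub> z) = LB (KK n) +>\<^bsub>M\<^esub> (b i \<odot>\<^bsub>M\<^esub> ?y)" if xz: "x : cl b i" "z : mc a (n - i)" for x z
  proof -
   obtain k where k: "k : KK i" "x = k \<oplus> b i" using xz(1) unfolding cl_def coset_mem by blast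
   obtain l where l: "l : LB (KK (n - i))" "z = l \<oplus>\<^bsub>M\<^esub> ?y" using xz(2) unfolding mc_def qcos_mem by blast
   have c: "k : RR" "b i : RR" "l : carrier M" using id_carr[OF KKi k(1)] bc(1) sub_simps(1)[OF KLs l(1)] by auto
   have zP: "z : LB (P (n - i))" unfolding l(2)
    by (rule sub_simps(3)[OF LB_submodule[OF Pi] subsetD[OF LB_mono[OF KK_sub] l(1)] yP])
   have zc: "z : carrier M" using sub_simps(1)[OF LB_submodule[OF Pi] zP] .
   \<comment> \<open>A change of either representative alters the product by an element of
     \<open>mm I^n M\<close>.\<close>
   have "k \<odot>\<^bsub>M\<^esub> z : LB (KK n)" using LB_smult[OF KKi Pi k(1) zP] LB_mono[OF KP] by blast
   moreover have "b i \<odot>\<^bsub>M\<^esub> l : LB (KK n)" using LB_smult[OF Pi KKi bc(2) l(1)] LB_mono[OF PK] by blast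
   ultimately have s: "k \<odot>\<^bsub>M\<^esub> z \<oplus>\<^bsub>M\<^esub> b i \<odot>\<^bsub>M\<^esub> l : LB (KK n)" by (rule sub_simps(3)[OF KLs])
   have "x \<odot>\<^bsub>M\<^esub> z = k \<odot>\<^bsub>M\<^esub> z \<oplus>\<^bsub>M\<^esub> b i \<odot>\<^bsub>M\<^esub> z" unfolding k(2) by (rule smult_l_distr[OF c(1,2) zc])
   also have "b i \<odot>\<^bsub>M\<^esub> z = b i \<odot>\<^bsub>M\<^esub> l \<oplus>\<^bsub>M\<^esub> b i \<odot>\<^bsub>M\<^esub> ?y" unfolding l(2) by (rule smult_r_distr[OF c(2,3) yc])
   finally have "x \<odot>\<^bsub>M\<^esub> z \<ominus>\<^bsub>M\<^esub> b i \<odot>\<^bsub>M\<^esub> ?y = k \<odot>\<^bsub>M\<^esub> z \<oplus>\<^bsub>M\<^esub> b i \<odot>\<^bsub>M\<^esub> l"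
    using c zc yc by (simp add: a_minus_def M.a_assoc M.r_neg)
   thus ?thesis using s c zc yc k(2) by (subst qcos_eq_iff[OF KLs]) auto
  qed
  have "b i : cl b i" unfolding cl_def by (rule coset_self[OF KKi bc(1)])
  moreover have "?y : mc a (n - i)" unfolding mc_def by (rule qcos_self[OF KLs yc])
  ultimately show ?thesis unfolding coset_smult_def using eq by blast
 qed
 have yc: "b i \<odot>\<^bsub>M\<^esub> lin B (%m. a m (n - i)) : carrier M" for i using bc(1) fam_lin[OF a] by simp
 interpret Qm: module R "quot_module M (LB (KK n))" by (rule quot_is_module[OF KLs])
 have "(\<Oplus>\<^bsub>quot_module M (LB (KK n))\<^esub>i\<in>{..n}. \<Union>x\<in>cl b i. coset_smult M (LB (KK n)) x (mc a (n - i)))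
   = (\<Oplus>\<^bsub>quot_module M (LB (KK n))\<^esub>i\<in>{..n}. LB (KK n) +>\<^bsub>M\<^esub> (b i \<odot>\<^bsub>M\<^esub> lin B (%m. a m (n - i))))"
  by (rule Qm.M.finsum_cong') (use t yc in \<open>auto simp: quot_carrier\<close>)
 also have "... = LB (KK n) +>\<^bsub>M\<^esub> (\<Oplus>\<^bsub>M\<^esub>i\<in>{..n}. b i \<odot>\<^bsub>M\<^esub> lin B (%m. a m (n - i)))"
  by (rule quot_finsum[OF KLs _ yc]) simp
 also have "(\<Oplus>\<^bsub>M\<^esub>i\<in>{..n}. b i \<odot>\<^bsub>M\<^esub> lin B (%m. a m (n - i))) = lin B (%m. conv b (a m) n)"
  unfolding conv_def using lin_finsum[of B "{..n}" b "%i m. a m (n - i)", OF fB(2,1) _ bc(1) fam_scalars[OF a]] by simp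
 finally show "(\<Oplus>\<^bsub>quot_module M (LB (KK n))\<^esub>i\<in>{..n}. \<Union>x\<in>cl b i. coset_smult M (LB (KK n)) x (mc a (n - i))) = mc (%m. conv b (a m)) n"
  by (simp add: mc_def)
qed

definition "G = free_on FF B"
text \<open>Arbitrary representatives in the Rees algebra; by \<open>mc_eq_iff\<close> the map
  \<open>\<Psi>\<close> does not depend on them.\<close>

definition "fr f m = (if m : B then (SOME a. a : rees & f m = cl a) else (%_. \<zero>))" for f :: "'c => nat => 'a set" and m
definition "\<Psi> f = mc (fr f)"

lemma G_mod: "module FF G"
 unfolding G_def by (rule F.free_module)

lemma fr: "f : carrier G ==> fam (fr f) & (ALL m:B. f m = cl (fr f m))"
proof -
 assume f: "f : carrier G"
 have "fr f m : rees & f m = cl (fr f m)" if "m : B" for m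
 proof -
  have "f m : carrier FF" using f unfolding G_def by (rule F.free_carr)
  hence "EX a. a : rees & f m = cl a" unfolding FF_carrier by blast
  from someI_ex[OF this] show ?thesis using that by (simp add: fr_def)
 qed
 thus ?thesis unfolding fam_def using zero_rees by (auto simp: fr_def)
qed

lemma Psi_eq: assumes "f : carrier G" "fam a" "!!m. m : B ==> f m = cl (a m)" shows "\<Psi> f = mc a"
 unfolding \<Psi>_def using mc_eq_iff[of "fr f" a] fr[OF assms(1)] assms(2,3) by metis

lemma Psi_inj: assumes "f : carrier G" "g : carrier G" "\<Psi> f = \<Psi> g" shows "f = g"
proof
 fix m
 show "f m = g m"
 proof (cases "m : B")
  case True
  thus ?thesis using mc_eq_iff[of "fr f" "fr g"] fr[OF assms(1)] fr[OF assms(2)] assms(3) unfolding \<Psi>_def by metis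
 next
  case False
  hence "f m = \<zero>\<^bsub>FF\<^esub>" "g m = \<zero>\<^bsub>FF\<^esub>" using assms(1,2) unfolding G_def F.free_carrier by auto
  thus ?thesis by simp
 qed
qed

lemma Psi_hom: "mhom FF G FM \<Psi>" and Psi_im: "\<Psi> ` carrier G = carrier FM" and Psi_zero: "\<Psi> \<zero>\<^bsub>G\<^esub> = \<zero>\<^bsub>FM\<^esub>"
proof -
 have Psi_c: "\<Psi> f : carrier FM" if "f : carrier G" for f unfolding \<Psi>_def mc_carrier using fr[OF that] by blast
 interpret G: module FF G by (rule G_mod)
 show "mhom FF G FM \<Psi>"
  unfolding mhom_def
 proof (intro conjI ballI Psi_c)
  fix f assume f: "f : carrier G"
  note ff = fr[OF f]
  have fr1: "fr f m : rees" for m using ff by (simp add: fam_def)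
  show "\<Psi> (f \<oplus>\<^bsub>G\<^esub> g) = \<Psi> f \<oplus>\<^bsub>FM\<^esub> \<Psi> g" if g: "g : carrier G" for g
  proof -
   note gg = fr[OF g]
   have fr2: "fr g m : rees" for m using gg by (simp add: fam_def)
   have "fam (%m n. fr f m n \<oplus> fr g m n)" unfolding fam_def using add_rees[OF fr1 fr2] by blast
   hence "\<Psi> (f \<oplus>\<^bsub>G\<^esub> g) = mc (%m n. fr f m n \<oplus> fr g m n)"
   proof (rule Psi_eq[OF G.M.add.m_closed[OF f g]])
    fix m assume m: "m : B"
    have "(f \<oplus>\<^bsub>G\<^esub> g) m = f m \<oplus>\<^bsub>FF\<^esub> g m" by (simp add: G_def)
    also have "... = cl (fr f m) \<oplus>\<^bsub>FF\<^esub> cl (fr g m)"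
     using bspec[OF conjunct2[OF ff] m] bspec[OF conjunct2[OF gg] m] by (rule arg_cong2)
    also have "... = cl (%n. fr f m n \<oplus> fr g m n)" by (rule cl_add[OF fr1 fr2])
    finally show "(f \<oplus>\<^bsub>G\<^esub> g) m = cl (%n. fr f m n \<oplus> fr g m n)" .
   qed
   thus ?thesis using mc_add[of "fr f" "fr g"] ff gg unfolding \<Psi>_def by simp
  qed
  fix z assume "z : carrier FF"
  then obtain b where b: "b : rees" "z = cl b" by (rule FF_rep)
  have "fam (%m. conv b (fr f m))" unfolding fam_def using conv_rees[OF b(1) fr1] by blast
  hence "\<Psi> (z \<odot>\<^bsub>G\<^esub> f) = mc (%m. conv b (fr f m))"
  proof (rule Psi_eq[OF G.smult_closed[OF \<open>z : carrier FF\<close> f]])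
   fix m assume m: "m : B"
   have "(z \<odot>\<^bsub>G\<^esub> f) m = z \<otimes>\<^bsub>FF\<^esub> f m" by (simp add: G_def)
   also have "... = cl b \<otimes>\<^bsub>FF\<^esub> cl (fr f m)"
    using b(2) bspec[OF conjunct2[OF ff] m] by (rule arg_cong2)
   also have "... = cl (conv b (fr f m))" by (rule cl_mult[OF b(1) fr1])
   finally show "(z \<odot>\<^bsub>G\<^esub> f) m = cl (conv b (fr f m))" .
  qed
  thus "\<Psi> (z \<odot>\<^bsub>G\<^esub> f) = z \<odot>\<^bsub>FM\<^esub> \<Psi> f" using mc_smult[OF b(1), of "fr f"] ff b(2) unfolding \<Psi>_def by simp
 qed
 show "\<Psi> ` carrier G = carrier FM"
 proof
  show "\<Psi> ` carrier G <= carrier FM" using Psi_c by blast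
  show "carrier FM <= \<Psi> ` carrier G"
  proof
   fix u assume "u : carrier FM"
   then obtain a where a: "fam a" "u = mc a" unfolding mc_carrier by blast
   define f where "f m = (if m : B then cl (a m) else \<zero>\<^bsub>FF\<^esub>)" for m
   have ar: "a m : rees" for m using a(1) by (simp add: fam_def)
   have "{m. f m ~= \<zero>\<^bsub>FF\<^esub>} <= B" unfolding f_def by auto
   moreover have "ALL m. f m : carrier FF" unfolding f_def using cl_closed[OF ar] F.zero_closed by simp
   ultimately have f: "f : carrier G" unfolding G_def F.free_carrier using fB(1) finite_subset by blast
   have "\<Psi> f = mc a" by (rule Psi_eq[OF f a(1)]) (simp add: f_def)
   hence "u = \<Psi> f" using a(2) by simp
   thus "u : \<Psi> ` carrier G" using f by (rule image_eqI)
  qed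
 qed
 have "fam (%m n. \<zero>)" unfolding fam_def using zero_rees by blast
 hence "\<Psi> \<zero>\<^bsub>G\<^esub> = mc (%m n. \<zero>)" by (rule Psi_eq[OF G.M.zero_closed]) (simp add: G_def cl_zero)
 also have "... = \<zero>\<^bsub>FM\<^esub>" unfolding FM_simps mc_def using lin_zero[OF fB(2)] qcos_zero[OF KLs] by simp
 finally show "\<Psi> \<zero>\<^bsub>G\<^esub> = \<zero>\<^bsub>FM\<^esub>" .
qed

text \<open>The fiber module is given by explicit operations only; its module axioms are transported
  from the free module \<open>G\<close> along \<open>\<Psi>\<close>.\<close>

lemma FM_mod: "module FF FM"
proof -
 note mi = module.module_image[OF G_mod, of \<Psi> FM]
 show ?thesis by (rule mi[OF Psi_im Psi_zero]) (rule mhomD(2,3)[OF Psi_hom]; assumption)+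
qed

text \<open>\<open>free_module\<close> asks for a basis inside the carrier, so the index set
  \<open>B\<close> is replaced by its image under \<open>nu\<close>, which is injective;
  \<open>pull\<close> undoes this renaming.\<close>

theorem fiber_module_free: "free_module FF FM"
proof -
 define nu where "nu m = \<Psi> (free_gen FF m)" for m
 interpret FMi: module FF FM by (rule FM_mod)
 have gG: "free_gen FF m : carrier G" if "m : B" for m unfolding G_def by (rule F.free_gen_carrier[OF that])
 have nuc: "nu m : carrier FM" if "m : B" for m unfolding nu_def by (rule mhomD(1)[OF Psi_hom gG[OF that]])
 have one: "\<one>\<^bsub>FF\<^esub> ~= \<zero>\<^bsub>FF\<^esub>" using hm_zero[of \<one> 0] mm_one unfolding cl_one by (simp add: hm_def KK_0)
 have nui: "inj_on nu B"
 proof (rule inj_onI)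
  fix m k assume mk: "m : B" "k : B" "nu m = nu k"
  have "free_gen FF m = free_gen FF k" using Psi_inj[OF gG[OF mk(1)] gG[OF mk(2)]] mk(3) unfolding nu_def by blast
  from fun_cong[OF this, of m] show "m = k" using one unfolding free_gen_def by (auto split: if_splits)
 qed
 define pull where "pull g m = (if m : B then g (nu m) else \<zero>\<^bsub>FF\<^esub>)" for g :: "(nat => 'c set) => nat => 'a set" and m
 let ?X = "carrier (free_on FF (nu ` B))"
 have pullG: "pull g : carrier G" if g: "g : ?X" for g
 proof -
  have "{m. pull g m ~= \<zero>\<^bsub>FF\<^esub>} <= B" unfolding pull_def by auto
  thus ?thesis unfolding G_def F.free_carrier using fB(1) finite_subset g F.free_carr[OF g] F.zero_closed by (auto simp: pull_def)
 qed
 have lc: "lincomb FF FM g = \<Psi> (pull g)" if g: "g : ?X" for g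
 proof -
  have gc: "g x : carrier FF" for x by (rule F.free_carr[OF g])
  have "lincomb FF FM g = (\<Oplus>\<^bsub>FM\<^esub>x\<in>nu ` B. g x \<odot>\<^bsub>FM\<^esub> x)"
   unfolding lincomb_lift
   by (rule F.lift_superset[OF FM_mod _ g]) (use nuc fB(1) g in \<open>auto simp: F.free_carrier\<close>)
  also have "... = (\<Oplus>\<^bsub>FM\<^esub>m\<in>B. g (nu m) \<odot>\<^bsub>FM\<^esub> nu m)"
   by (rule FMi.M.finsum_reindex[OF _ nui]) (use nuc gc in auto)
  also have "... = (\<Oplus>\<^bsub>FM\<^esub>m\<in>B. pull g m \<odot>\<^bsub>FM\<^esub> nu m)"
   by (rule FMi.M.finsum_cong') (use nuc gc in \<open>auto simp: pull_def\<close>)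
  also have "... = lift FF FM nu (pull g)"
   by (rule F.lift_superset[OF FM_mod nuc pullG[OF g, unfolded G_def] fB(1) _ subset_refl, symmetric]) (auto simp: pull_def)
  also have "... = \<Psi> (pull g)"
   unfolding nu_def by (rule F.mhom_free_expand[OF FM_mod Psi_hom[unfolded G_def] pullG[OF g, unfolded G_def], symmetric])
  finally show ?thesis .
 qed
 have "bij_betw (lincomb FF FM) ?X (carrier FM)"
  unfolding bij_betw_def
 proof
  show "inj_on (lincomb FF FM) ?X"
  proof (rule inj_onI)
   fix g h assume gh: "g : ?X" "h : ?X" "lincomb FF FM g = lincomb FF FM h"
   have p: "pull g = pull h" using Psi_inj[OF pullG[OF gh(1)] pullG[OF gh(2)]] gh(3) lc[OF gh(1)] lc[OF gh(2)] by simp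
   show "g = h"
   proof
    fix x show "g x = h x"
    proof (cases "x : nu ` B")
     case True
     then obtain m where m: "m : B" "x = nu m" by blast
     show ?thesis using fun_cong[OF p, of m] m by (simp add: pull_def)
    next
     case False
     hence "g x = \<zero>\<^bsub>FF\<^esub>" "h x = \<zero>\<^bsub>FF\<^esub>" using gh(1,2) unfolding F.free_carrier by auto
     thus ?thesis by simp
    qed
   qed
  qed
  show "lincomb FF FM ` ?X = carrier FM"
  proof
   show "lincomb FF FM ` ?X <= carrier FM" using lc pullG mhomD(1)[OF Psi_hom] by auto
   show "carrier FM <= lincomb FF FM ` ?X"
   proof
    fix u assume "u : carrier FM"
    then obtain f where f: "f : carrier G" "u = \<Psi> f" using Psi_im by blast
    define g where "g x = (if x : nu ` B then f (inv_into B nu x) else \<zero>\<^bsub>FF\<^esub>)" for x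
    have fc: "f m : carrier FF" for m using f(1) unfolding G_def by (rule F.free_carr)
    have "{x. g x ~= \<zero>\<^bsub>FF\<^esub>} <= nu ` B" unfolding g_def by auto
    moreover have "ALL x. g x : carrier FF" unfolding g_def using fc F.zero_closed by simp
    ultimately have g: "g : ?X" unfolding F.free_carrier using fB(1) finite_subset by blast
    have "pull g = f"
    proof
     fix m show "pull g m = f m"
     proof (cases "m : B")
      case True thus ?thesis using inv_into_f_f[OF nui True] by (simp add: pull_def g_def)
     next
      case False
      hence "f m = \<zero>\<^bsub>FF\<^esub>" using f(1) unfolding G_def F.free_carrier by auto
      thus ?thesis using False by (simp add: pull_def)
     qed
    qed
    hence "lincomb FF FM g = u" using lc[OF g] f(2) by simp
    thus "u : lincomb FF FM ` ?X" using g by blast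
   qed
  qed
 qed
 moreover have "nu ` B <= carrier FM" using nuc by blast
 ultimately show ?thesis unfolding free_module_def using FM_mod by blast
qed

end

section \<open>Counting monomials against the degree of the Tor polynomial\<close>

lemma Mon_iff: "mu : Mon s n \<longleftrightarrow> set_mset mu <= {..<s} & size mu = n"
 unfolding Mon_def by auto

text \<open>The exponents of the variables other than \<open>0\<close> can be chosen freely up to
  \<open>q\<close>, and the variable \<open>0\<close> fills up the degree.\<close>

lemma card_Mon_ge: "s * q <= r ==> Suc q ^ s <= card (Mon (Suc s) r)"
proof (induction s arbitrary: r)
 case 0
 have "replicate_mset r 0 : Mon (Suc 0) r" unfolding Mon_iff by auto
 hence "card (Mon (Suc 0) r) ~= 0" using finite_Mon by auto
 thus ?case by simp
next
 case (Suc s)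
 let ?S = "Sigma {..q} (%j. Mon (Suc s) (r - j))"
 let ?g = "%(j, mu). replicate_mset j (Suc s) + mu"
 have inj: "inj_on ?g ?S"
 proof (rule inj_onI)
  fix u v assume uv: "u : ?S" "v : ?S" "?g u = ?g v"
  obtain j mu where u: "u = (j, mu)" by (cases u)
  obtain k nu where v: "v = (k, nu)" by (cases v)
  have "count mu (Suc s) = 0" "count nu (Suc s) = 0" using uv u v unfolding not_in_iff[symmetric] by (auto simp: Mon_iff)
  moreover have "count (?g u) (Suc s) = count (?g v) (Suc s)" using uv(3) by simp
  ultimately have "j = k" unfolding u v by simp
  thus "u = v" using uv(3) unfolding u v by simp
 qed
 have im: "?g ` ?S <= Mon (Suc (Suc s)) r" using Suc.prems
  by (auto simp: Mon_iff subset_iff less_SucI split: if_splits)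
 have "Suc q ^ Suc s = (\<Sum>j\<in>{..q}. Suc q ^ s)" by simp
 also have "... <= (\<Sum>j\<in>{..q}. card (Mon (Suc s) (r - j)))" by (rule sum_mono) (use Suc in auto)
 also have "... = card ?S" by (simp add: card_SigmaI finite_Mon)
 also have "... <= card (Mon (Suc (Suc s)) r)" by (rule card_inj_on_le[OF inj im finite_Mon])
 finally show ?case .
qed

lemma poly_le:
 fixes t :: "rat poly"
 shows "EX C>=0. ALL n>=1. poly t (of_nat n) <= C * of_nat n ^ degree t"
proof (intro exI[of _ "\<Sum>i\<le>degree t. \<bar>Polynomial.coeff t i\<bar>"] conjI allI impI)
 fix n :: nat assume n: "n >= 1"
 have "poly t (of_nat n) = (\<Sum>i\<le>degree t. Polynomial.coeff t i * of_nat n ^ i)" by (rule poly_altdef)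
 also have "... <= (\<Sum>i\<le>degree t. \<bar>Polynomial.coeff t i\<bar> * of_nat n ^ degree t)"
 proof (rule sum_mono)
  fix i assume "i : {..degree t}"
  hence "(of_nat n :: rat) ^ i <= of_nat n ^ degree t" using n by (intro power_increasing) auto
  thus "Polynomial.coeff t i * of_nat n ^ i <= \<bar>Polynomial.coeff t i\<bar> * of_nat n ^ degree t"
   by (intro mult_mono) auto
 qed
 finally show "poly t (of_nat n) <= (\<Sum>i\<le>degree t. \<bar>Polynomial.coeff t i\<bar>) * of_nat n ^ degree t" by (simp add: sum_distrib_right)
qed (simp add: sum_nonneg)

text \<open>For \<open>s = d - 1\<close> there are at least \<open>(q + 1)^s\<close> monomials of
  degree \<open>s q\<close>, whereas a polynomial of degree \<open>e < s\<close> is at most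
  \<open>C (d q)^e\<close> at the argument in question; for large \<open>q\<close> this is a
  contradiction.\<close>

lemma tor_polynomial_degree:
 assumes t: "is_tor_polynomial R I M t" and d: "d >= 1"
  and len: "!!r. enat (card (Mon d r)) <= module_length R (Tor1 R M (quot_module (ring_as_module R) (ideal_pow R I (r + n'))))"
 shows "t ~= 0 & ~ degree t < d - 1"
proof -
 obtain N where N: "ALL n>=N. EX k. module_length R (Tor1 R M (quot_module (ring_as_module R) (ideal_pow R I (n + 1)))) = enat k &
   poly t (of_nat n) = of_nat k" using t unfolding is_tor_polynomial_def by blast
 obtain s where s: "d = Suc s" using d by (cases d) auto
 \<comment> \<open>The Tor polynomial at \<open>n\<close> belongs to the power \<open>n + 1\<close>,
   hence the argument \<open>r + n' - 1\<close>; \<open>r >= 1\<close> keeps the natural subtraction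
   exact.\<close>
 have key: "of_nat (card (Mon d r)) <= poly t (of_nat (r + n' - 1))" if r: "r + n' - 1 >= N" "r >= 1" for r
 proof -
  obtain k where k: "module_length R (Tor1 R M (quot_module (ring_as_module R) (ideal_pow R I (r + n' - 1 + 1)))) = enat k"
   "poly t (of_nat (r + n' - 1)) = of_nat k" using N r(1) by blast
  have "r + n' - 1 + 1 = r + n'" using r(2) by simp
  hence "card (Mon d r) <= k" using len[of r] k(1) by (metis enat_ord_simps(1))
  thus ?thesis unfolding k(2) by simp
 qed
 have t0: "t ~= 0"
 proof
  assume "t = 0"
  hence "card (Mon d (Suc N)) = 0" using key[of "Suc N"] by simp
  thus False using card_Mon_ge[of s 0 "Suc N"] unfolding s by simp
 qed
 moreover have "~ degree t < d - 1"
 proof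
  assume e: "degree t < d - 1"
  let ?e = "degree t"
  obtain C where C: "C >= 0" "ALL n>=1. poly t (of_nat n) <= C * of_nat n ^ ?e" using poly_le[of t] by blast
  obtain q0 where q0: "C * of_nat d ^ ?e < of_nat q0" using reals_Archimedean2 by blast
  \<comment> \<open>Large enough to pass the threshold \<open>N\<close>, to give
    \<open>?n <= d * q\<close> and, through \<open>q0\<close>, to exceed the constant
    \<open>C d^e\<close>.\<close>
  define q where "q = q0 + n' + N + 2"
  have es: "Suc ?e <= s" "1 <= s" using e unfolding s by auto
  let ?n = "s * q + n' - 1"
  have sq: "q <= s * q" using es(2) by simp
  have n: "?n >= N" "?n >= 1" "s * q >= 1" "?n <= d * q" using sq unfolding q_def s by auto
  have "(of_nat q + 1) * of_nat q ^ ?e <= ((of_nat q + 1) ^ Suc ?e :: rat)"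
   by (simp add: mult_left_mono power_mono)
  also have "... <= (of_nat q + 1) ^ s" by (rule power_increasing[OF es(1)]) simp
  also have "... = of_nat (Suc q ^ s)" by (simp add: add.commute)
  also have "... <= of_nat (card (Mon d (s * q)))" unfolding s by (simp only: of_nat_le_iff card_Mon_ge[OF order_refl])
  also have "... <= poly t (of_nat ?n)" by (rule key[OF n(1,3)])
  also have "... <= C * of_nat ?n ^ ?e" using C(2) n(2) by blast
  also have "... <= C * of_nat (d * q) ^ ?e" by (intro mult_left_mono power_mono C(1)) (use n(4) in \<open>simp_all only: of_nat_le_iff of_nat_0_le_iff\<close>)
  also have "... = (C * of_nat d ^ ?e) * of_nat q ^ ?e" by (simp add: power_mult_distrib)
  finally have "(of_nat q + 1 :: rat) <= C * of_nat d ^ ?e" by (simp add: q_def)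
  moreover have "(of_nat q0 :: rat) <= of_nat q + 1" by (simp add: q_def)
  ultimately show False using q0 by linarith
 qed
 ultimately show ?thesis by blast
qed

theorem theorem1p1:
  fixes A :: "('a, 'r) ring_scheme" and \<mm> I :: "'a set"
    and M :: "('a, 'b, 's) module_scheme"
    and d :: nat and t :: "rat poly"
  assumes "cohen_macaulay_local_ring A \<mm>"
    and "krull_dim A = enat d" and "d \<ge> 1"
    and "infinite (carrier (A Quot \<mm>))"
    and "maximal_cohen_macaulay_module A \<mm> M"
    and "ideal I A"
    and "locally_complete_intersection A I"
    and "reduction_number A I \<le> 1"
    and "ideal_height A I = enat (d - 1)"
    and "ideal_height_on A M I = enat (d - 1)"
    and "analytic_spread A \<mm> I = enat d"
    and "is_tor_polynomial A I M t"
    and "t = 0 \<or> degree t < d - 1"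
  shows "free_module (fiber_cone A \<mm> I) (fiber_module A \<mm> I M)"
proof -
 have CM: "cring A" "noetherian_ring A" "maximalideal \<mm> A" "!!\<nn>. maximalideal \<nn> A ==> \<nn> = \<mm>"
  "cohen_macaulay_module A \<mm> (ring_as_module A)"
  using assms(1) unfolding cohen_macaulay_local_ring_def noetherian_local_ring_def by simp_all
 have noeth: "noeth A" by (intro noeth.intro noeth_axioms.intro CM)
 have ln: "local_noeth A \<mm>" by (intro local_noeth.intro local_noeth_axioms.intro noeth CM)
 have li: "local_inf A \<mm>" by (intro local_inf.intro local_inf_axioms.intro ln assms(4))
 have fi: "fiber A \<mm> I" by (intro fiber.intro fiber_axioms.intro ln assms(6))
 interpret fiber_inf A \<mm> I by (rule fiber_inf.intro[OF fi li])
 have fg: "finitely_generated_module A M"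
  using assms(5) unfolding maximal_cohen_macaulay_module_def cohen_macaulay_module_def by blast
 then interpret MM: module A M unfolding finitely_generated_module_def by blast
 interpret LM: loc_mod A \<mm> M by unfold_locales
 have dep: "dep {\<zero>\<^bsub>A\<^esub>} d" by (rule cohen_macaulay_dep[OF CM(5) assms(2)])
 obtain J where J: "minimal_reduction A I J" "reduction_number_wrt A I J <= 1"
 proof -
  \<comment> \<open>If all minimal reductions had reduction number at least two, so would the
    infimum; hence one of them has at most one.\<close>
  have "~ 2 <= reduction_number A I"
  proof
   assume "2 <= reduction_number A I"
   from order_trans[OF this assms(8)] show False by (simp add: numeral_eq_enat one_enat_def)
  qed
  hence "EX J. minimal_reduction A I J & ~ 2 <= enat (reduction_number_wrt A I J)"
   unfolding reduction_number_def le_Inf_iff by blast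
  thus ?thesis using that by (auto simp: numeral_eq_enat)
 qed
 have Jr: "ideal J A" "J \<subseteq> I" using J(1) unfolding minimal_reduction_def reduction_def by blast+
 have red: "J \<cdot>\<^bsub>A\<^esub> ipow I n = ipow I (Suc n)" if n: "n >= 1" for n
 proof -
  have "EX m. ALL n>=m. J \<cdot>\<^bsub>A\<^esub> ideal_pow A I n = ideal_pow A I (n + 1)"
   using J(1) unfolding minimal_reduction_def reduction_def by blast
  from LeastI_ex[OF this] have "ALL n>=reduction_number_wrt A I J. J \<cdot>\<^bsub>A\<^esub> ideal_pow A I n = ideal_pow A I (n + 1)"
   unfolding reduction_number_wrt_def .
  thus ?thesis using J(2) n by (simp add: ipow_def)
 qed
 have min: "K = J" if K: "ideal K A" "K \<subseteq> J" "EX N. ALL n>=N. K \<cdot>\<^bsub>A\<^esub> ipow I n = ipow I (Suc n)" for K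
 proof -
  have "reduction A I K" using K Jr(2) unfolding reduction_def ipow_def by auto
  thus ?thesis using J(1) K(2) unfolding minimal_reduction_def by blast
 qed
 have spread: "krull_dim FF = enat d" using assms(11) unfolding analytic_spread_def FF_def .
 obtain x where x: "point x" "!!i. i < d ==> x i : I"
  "!!n u k f. u : ipow I n ==> u ~: \<mm> \<cdot>\<^bsub>A\<^esub> ipow I n ==> form (carrier A) d k f ==> ~ form \<mm> d k f ==>
   ev x d k f \<otimes>\<^bsub>A\<^esub> u ~: \<mm> \<cdot>\<^bsub>A\<^esub> ipow I (k + n)"
  using generators_torsion_free[OF assms(2,3) dep assms(9,7) Jr red min spread] by blast
 obtain B where B: "LM.gens B" "!!c m. LM.scalars c ==> LM.lin B c = \<zero>\<^bsub>M\<^esub> ==> m : B ==> c m : \<mm>"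
  using LM.minimal_gens[OF fg] by blast
 \<comment> \<open>A relation that violates this feeds \<open>tor_setup\<close> for every
   \<open>r\<close>, with the degree of its coefficients fixed as \<open>n\<close>; the resulting
   lower bounds on the length of Tor contradict the degree of \<open>t\<close>.\<close>
 have star: "ALL m:B. c m : KK n" if c: "ALL m. c m : ipow I n" "LM.lin B c = \<zero>\<^bsub>M\<^esub>" for c n
 proof (rule ccontr)
  assume "~ ?thesis"
  then obtain m0 where m0: "m0 : B" "c m0 ~: \<mm> \<cdot>\<^bsub>A\<^esub> ipow I n" unfolding KK_def by blast
  have sc: "LM.scalars c" using c(1) id_carr[OF Pi] unfolding LM.scalars_def by blast
  have "enat (card (Mon d r)) <= module_length A (Tor1 A M (quot_module (ring_as_module A) (ideal_pow A I (r + n))))" for r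
  proof -
   interpret ts: tor_setup A \<mm> M I x d B c m0 n r "r + n"
    by unfold_locales (use x B c sc m0 in auto)
   show ?thesis using ts.tor_length by (simp add: ipow_def)
  qed
  from tor_polynomial_degree[OF assms(12,3) this] show False using assms(13) by blast
 qed
 interpret fm: fib_mod A \<mm> M I B
  by unfold_locales (use B(1) star in auto)
 show ?thesis using fm.fiber_module_free unfolding FF_def fm.FM_def .
qed

end
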